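(* Let $D_1,D_2$ be semilocal Prüfer domains, and suppose that there is an order isomorphism $\nu:\mathrm{Spec_{hi}}(D_1)\to\mathrm{Spec_{hi}}(D_2)$ such that, for every $P\in\mathrm{Spec_{hi}}(D_1)$, there is an order isomorphism $\nu_P:\mathrm{FStar}(Z(P))\to\mathrm{FStar}(Z(\nu(P)))$. Let $\overline{\nu}:\mathrm{SkOver}(D_1)\to\mathrm{SkOver}(D_2)$ be the order isomorphism induced by $\nu$ (see context). Then there are order isomorphisms $$\boldsymbol{\nu}:\mathrm{SStar}(D_1)\to\mathrm{SStar}(D_2)\quad\text{and}\quad \boldsymbol{\nu}_F:\mathrm{FStar}(D_1)\to\mathrm{FStar}(D_2)$$ such that, for every $\Delta\subseteq\mathrm{SkOver}(D_1)$, $$\boldsymbol{\nu}(\mathrm{SStar}^{\Delta}(D_1))=\mathrm{SStar}^{\overline{\nu}(\Delta)}(D_2).$$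
   Context: Let $D$ be an integral domain with quotient field $K$. $\mathbf{F}(D)$ is the set of $D$-submodules of $K$; $\mathcal{F}(D)$ is the set of fractional ideals of $D$, i.e. of those $I\in\mathbf{F}(D)$ with $xI\subseteq D$ for some nonzero $x\in K$. A closure operation on a partially ordered set is an extensive, order-preserving, idempotent self-map. Property $(\mathbf S)$ for a closure operation $\ast$ on $\mathbf{F}(D)$ or $\mathcal{F}(D)$: $x\cdot I^\ast=(xI)^\ast$ for every $x\in K$ and every $I$ where $\ast$ is defined. A semistar operation on $D$ is a closure operation on $\mathbf{F}(D)$ with $(\mathbf S)$; a fractional star operation on $D$ is a closure operation on $\mathcal{F}(D)$ with $(\mathbf S)$. Their sets are $\mathrm{SStar}(D)$ and $\mathrm{FStar}(D)$, ordered by $\ast_1\le\ast_2$ iff $I^{\ast_1}\subseteq I^{\ast_2}$ for all $I$. A Prüfer domain is semilocal if it has finitely many maximal ideals. Standard decomposition of a semilocal Prüfer domain $D$: two maximal ideals are dependent if some nonzero prime ideal is contained in both; this is an equivalence relation on $\mathrm{Max}(D)$ (for $D\neq K$), and the standard decomposition $\Theta$ is the set of the rings $\bigcap\{D_M\mid M\in\Delta_\lambda\}$, one for each equivalence class $\Delta_\lambda$; if $D=K$, $\Theta=\emptyset$. $\mathrm{SkOver}(D)$ is the set of all intersections of elements of $\Theta$ (the empty intersection being $K$), ordered by inclusion. The support of $\ast\in\mathrm{SStar}(D)$ is $\mathrm{supp}(\ast):=\{A\in\mathrm{SkOver}(D)\mid A^\ast\in\mathcal{F}(A)\}$, and $\mathrm{SStar}^{\Delta}(D)$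 is the set of semistar operations on $D$ with support $\Delta$. For a semilocal Prüfer domain $D$, $\mathrm{Spec_{hi}}(D)$ is the (finite) subset of $\mathrm{Spec}(D)$, ordered by inclusion, consisting of $(0)$, the maximal ideals of $D$, and all prime ideals $P$ that are the infimum in $\mathrm{Spec}(D)$ of a family of pairwise incomparable prime ideals not containing $P$ as a member. For $(0)\neq P\in\mathrm{Spec_{hi}}(D)$, let $Q$ be the element of $\mathrm{Spec_{hi}}(D)$ directly below $P$, and put $Z(P):=D_P/QD_P$ (a valuation domain); $Z((0)):=K$. The elements of $\Theta$ are exactly the rings $T_P:=\bigcap\{D_M\mid M\in\mathrm{Max}(D), P\subseteq M\}$, for $P$ a minimal element of $\mathrm{Spec_{hi}}(D)\setminus\{(0)\}$. Given $\nu$ as in the claim, with $\Theta_1,\Theta_2$ the standard decompositions of $D_1,D_2$, $\overline{\nu}$ maps $T_P\in\Theta_1$ to $T_{\nu(P)}=\bigcap\{(D_2)_N\mid N\in\mathrm{Max}(D_2),\nu(P)\subseteq N\}\in\Theta_2$, and is extended by $\overline{\nu}(T_1\cap\cdots\cap T_n)=\overline{\nu}(T_1)\cap\cdots\cap\overline{\nu}(T_n)$ (and $K_1\mapsto K_2$ for the quotient fields); it is an order isomorphism $\mathrm{SkOver}(D_1)\to\mathrm{SkOver}(D_2)$. *)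

theory Defs
  imports "HOL-Algebra.Subrings" "HOL-Algebra.Ideal_Product" "HOL-Algebra.Module"
begin

text \<open>
  A domain is given together with its quotient field \<open>K\<close>, as a subset \<open>D\<close> of \<open>carrier K\<close>.
\<close>

definition quotient_field_of :: "('a, 'm) ring_scheme \<Rightarrow> 'a set \<Rightarrow> bool" where
  "quotient_field_of K D \<longleftrightarrow> field K \<and> subring D K \<and>
     (\<forall>x\<in>carrier K. \<exists>a\<in>D. \<exists>b\<in>D - {\<zero>\<^bsub>K\<^esub>}. x = a \<otimes>\<^bsub>K\<^esub> inv\<^bsub>K\<^esub> b)"

abbreviation subrg :: "('a, 'm) ring_scheme \<Rightarrow> 'a set \<Rightarrow> ('a, 'm) ring_scheme" where
  "subrg K D \<equiv> K\<lparr>carrier := D\<rparr>"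

definition self_module :: "('a, 'm) ring_scheme \<Rightarrow> ('a, 'a) module" where
  "self_module K = \<lparr>carrier = carrier K, mult = mult K, one = \<one>\<^bsub>K\<^esub>,
     zero = \<zero>\<^bsub>K\<^esub>, add = add K, smult = mult K\<rparr>"

definition submods :: "('a, 'm) ring_scheme \<Rightarrow> 'a set \<Rightarrow> 'a set set" where
  "submods K D = {I. submodule I (subrg K D) (self_module K)}"

definition frac_ideals :: "('a, 'm) ring_scheme \<Rightarrow> 'a set \<Rightarrow> 'a set set" where
  "frac_ideals K D =
     {I \<in> submods K D. \<exists>x\<in>carrier K - {\<zero>\<^bsub>K\<^esub>}. x <#\<^bsub>K\<^esub> I \<subseteq> D}"

text \<open>
  Self-maps of \<open>X\<close> are extensional functions (constantly \<open>undefined\<close> outside \<open>X\<close>), so that two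
  operations which agree on \<open>X\<close> are equal.
\<close>

definition closure_ops :: "'a set set \<Rightarrow> ('a set \<Rightarrow> 'a set) set" where
  "closure_ops X = {c \<in> X \<rightarrow>\<^sub>E X.
     (\<forall>I\<in>X. I \<subseteq> c I) \<and>
     (\<forall>I\<in>X. \<forall>J\<in>X. I \<subseteq> J \<longrightarrow> c I \<subseteq> c J) \<and>
     (\<forall>I\<in>X. c (c I) = c I)}"

definition prop_S :: "('a, 'm) ring_scheme \<Rightarrow> 'a set set \<Rightarrow> ('a set \<Rightarrow> 'a set) \<Rightarrow> bool" where
  "prop_S K X c \<longleftrightarrow> (\<forall>x\<in>carrier K. \<forall>I\<in>X. x <#\<^bsub>K\<^esub> c I = c (x <#\<^bsub>K\<^esub> I))"

definition SStar :: "('a, 'm) ring_scheme \<Rightarrow> 'a set \<Rightarrow> ('a set \<Rightarrow> 'a set) set" where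
  "SStar K D = {c \<in> closure_ops (submods K D). prop_S K (submods K D) c}"

definition FStar :: "('a, 'm) ring_scheme \<Rightarrow> 'a set \<Rightarrow> ('a set \<Rightarrow> 'a set) set" where
  "FStar K D = {c \<in> closure_ops (frac_ideals K D). prop_S K (frac_ideals K D) c}"

definition SStar_le ::
  "('a, 'm) ring_scheme \<Rightarrow> 'a set \<Rightarrow> ('a set \<Rightarrow> 'a set) \<Rightarrow> ('a set \<Rightarrow> 'a set) \<Rightarrow> bool" where
  "SStar_le K D c d \<longleftrightarrow> (\<forall>I\<in>submods K D. c I \<subseteq> d I)"

definition FStar_le ::
  "('a, 'm) ring_scheme \<Rightarrow> 'a set \<Rightarrow> ('a set \<Rightarrow> 'a set) \<Rightarrow> ('a set \<Rightarrow> 'a set) \<Rightarrow> bool" where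
  "FStar_le K D c d \<longleftrightarrow> (\<forall>I\<in>frac_ideals K D. c I \<subseteq> d I)"

definition order_iso ::
  "'a set \<Rightarrow> ('a \<Rightarrow> 'a \<Rightarrow> bool) \<Rightarrow> 'b set \<Rightarrow> ('b \<Rightarrow> 'b \<Rightarrow> bool) \<Rightarrow> ('a \<Rightarrow> 'b) \<Rightarrow> bool" where
  "order_iso A leA B leB f \<longleftrightarrow>
     bij_betw f A B \<and> (\<forall>x\<in>A. \<forall>y\<in>A. leA x y \<longleftrightarrow> leB (f x) (f y))"

text \<open>
  The ring \<open>Z(P)\<close> is a quotient ring, which does not come inside a field; its quotient field is
  constructed as the set of classes of pairs \<open>(a, b)\<close> with \<open>b \<noteq> 0\<close>.
\<close>

definition fraction_rel :: "('a, 'm) ring_scheme \<Rightarrow> (('a \<times> 'a) \<times> ('a \<times> 'a)) set" where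
  "fraction_rel R = {((a, b), (c, d)).
     a \<in> carrier R \<and> b \<in> carrier R - {\<zero>\<^bsub>R\<^esub>} \<and>
     c \<in> carrier R \<and> d \<in> carrier R - {\<zero>\<^bsub>R\<^esub>} \<and> a \<otimes>\<^bsub>R\<^esub> d = c \<otimes>\<^bsub>R\<^esub> b}"

definition fraction :: "('a, 'm) ring_scheme \<Rightarrow> 'a \<Rightarrow> 'a \<Rightarrow> ('a \<times> 'a) set" where
  "fraction R a b = fraction_rel R `` {(a, b)}"

definition fraction_field :: "('a, 'm) ring_scheme \<Rightarrow> ('a \<times> 'a) set ring" where
  "fraction_field R =
     \<lparr>carrier = {fraction R a b | a b. a \<in> carrier R \<and> b \<in> carrier R - {\<zero>\<^bsub>R\<^esub>}},
      mult = (\<lambda>X Y. \<Union>(a, b)\<in>X. \<Union>(c, d)\<in>Y. fraction R (a \<otimes>\<^bsub>R\<^esub> c) (b \<otimes>\<^bsub>R\<^esub> d)),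
      one = fraction R \<one>\<^bsub>R\<^esub> \<one>\<^bsub>R\<^esub>,
      zero = fraction R \<zero>\<^bsub>R\<^esub> \<one>\<^bsub>R\<^esub>,
      add = (\<lambda>X Y. \<Union>(a, b)\<in>X. \<Union>(c, d)\<in>Y.
               fraction R (a \<otimes>\<^bsub>R\<^esub> d \<oplus>\<^bsub>R\<^esub> c \<otimes>\<^bsub>R\<^esub> b) (b \<otimes>\<^bsub>R\<^esub> d))\<rparr>"

definition in_fraction_field :: "('a, 'm) ring_scheme \<Rightarrow> ('a \<times> 'a) set set" where
  "in_fraction_field R = (\<lambda>a. fraction R a \<one>\<^bsub>R\<^esub>) ` carrier R"

definition spec :: "('a, 'm) ring_scheme \<Rightarrow> 'a set \<Rightarrow> 'a set set" where
  "spec K D = {P. primeideal P (subrg K D)}"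

definition maxspec :: "('a, 'm) ring_scheme \<Rightarrow> 'a set \<Rightarrow> 'a set set" where
  "maxspec K D = {M. maximalideal M (subrg K D)}"

definition loc :: "('a, 'm) ring_scheme \<Rightarrow> 'a set \<Rightarrow> 'a set \<Rightarrow> 'a set" where
  "loc K D P = {a \<otimes>\<^bsub>K\<^esub> inv\<^bsub>K\<^esub> s | a s. a \<in> D \<and> s \<in> D - P}"

text \<open>Every nonzero finitely generated ideal is invertible.\<close>

definition pruefer :: "('a, 'm) ring_scheme \<Rightarrow> 'a set \<Rightarrow> bool" where
  "pruefer K D \<longleftrightarrow> quotient_field_of K D \<and>
     (\<forall>S. finite S \<and> S \<subseteq> D \<and> genideal (subrg K D) S \<noteq> {\<zero>\<^bsub>K\<^esub>} \<longrightarrow>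
        (\<exists>J\<in>submods K D. ideal_prod K (genideal (subrg K D) S) J = D))"

definition semilocal_pruefer :: "('a, 'm) ring_scheme \<Rightarrow> 'a set \<Rightarrow> bool" where
  "semilocal_pruefer K D \<longleftrightarrow> pruefer K D \<and> finite (maxspec K D)"

definition dep_rel :: "('a, 'm) ring_scheme \<Rightarrow> 'a set \<Rightarrow> ('a set \<times> 'a set) set" where
  "dep_rel K D = {(M, N). M \<in> maxspec K D \<and> N \<in> maxspec K D \<and>
     (\<exists>P\<in>spec K D. P \<noteq> {\<zero>\<^bsub>K\<^esub>} \<and> P \<subseteq> M \<and> P \<subseteq> N)}"

definition std_decomp :: "('a, 'm) ring_scheme \<Rightarrow> 'a set \<Rightarrow> 'a set set" where
  "std_decomp K D = (if D = carrier K then {}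
     else {\<Inter>M\<in>\<Delta>. loc K D M | \<Delta>. \<Delta> \<in> maxspec K D // dep_rel K D})"

definition SkOver :: "('a, 'm) ring_scheme \<Rightarrow> 'a set \<Rightarrow> 'a set set" where
  "SkOver K D = {carrier K \<inter> \<Inter>S | S. S \<subseteq> std_decomp K D}"

definition support :: "('a, 'm) ring_scheme \<Rightarrow> 'a set \<Rightarrow> ('a set \<Rightarrow> 'a set) \<Rightarrow> 'a set set" where
  "support K D c = {A \<in> SkOver K D. c A \<in> frac_ideals K A}"

definition SStar_supp ::
  "('a, 'm) ring_scheme \<Rightarrow> 'a set \<Rightarrow> 'a set set \<Rightarrow> ('a set \<Rightarrow> 'a set) set" where
  "SStar_supp K D \<Delta> = {c \<in> SStar K D. support K D c = \<Delta>}"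

definition spec_order :: "('a, 'm) ring_scheme \<Rightarrow> 'a set \<Rightarrow> 'a set gorder" where
  "spec_order K D = \<lparr>carrier = spec K D, eq = (=), le = (\<subseteq>)\<rparr>"

definition spec_hi :: "('a, 'm) ring_scheme \<Rightarrow> 'a set \<Rightarrow> 'a set set" where
  "spec_hi K D = {{\<zero>\<^bsub>K\<^esub>}} \<union> maxspec K D \<union>
     {P \<in> spec K D. \<exists>F \<subseteq> spec K D.
        (\<forall>Q\<in>F. \<forall>Q'\<in>F. Q \<noteq> Q' \<longrightarrow> \<not> Q \<subseteq> Q') \<and> P \<notin> F \<and> is_glb (spec_order K D) P F}"

definition hi_below :: "('a, 'm) ring_scheme \<Rightarrow> 'a set \<Rightarrow> 'a set \<Rightarrow> 'a set" where
  "hi_below K D P = (THE Q. Q \<in> spec_hi K D \<and> Q \<subset> P \<and>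
     \<not> (\<exists>Q'\<in>spec_hi K D. Q \<subset> Q' \<and> Q' \<subset> P))"

text \<open>
  \<open>Z(P) = D_P / Q D_P\<close> for nonzero \<open>P\<close> in \<open>spec_hi K D\<close>.  For \<open>P = (0)\<close> the convention is
  \<open>Z(P) = K\<close>, whose elements have another type than these cosets; its fractional star
  operations are \<open>FStar K (carrier K)\<close>.
\<close>

definition Zring :: "('a, 'm) ring_scheme \<Rightarrow> 'a set \<Rightarrow> 'a set \<Rightarrow> 'a set ring" where
  "Zring K D P = subrg K (loc K D P) Quot genideal (subrg K (loc K D P)) (hi_below K D P)"

definition FStar_ring ::
  "('a, 'm) ring_scheme \<Rightarrow> (('a \<times> 'a) set set \<Rightarrow> ('a \<times> 'a) set set) set" where
  "FStar_ring R = FStar (fraction_field R) (in_fraction_field R)"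

definition FStar_ring_le :: "('a, 'm) ring_scheme \<Rightarrow>
    (('a \<times> 'a) set set \<Rightarrow> ('a \<times> 'a) set set) \<Rightarrow> (('a \<times> 'a) set set \<Rightarrow> ('a \<times> 'a) set set) \<Rightarrow> bool" where
  "FStar_ring_le R = FStar_le (fraction_field R) (in_fraction_field R)"

definition hi_minimal :: "('a, 'm) ring_scheme \<Rightarrow> 'a set \<Rightarrow> 'a set set" where
  "hi_minimal K D = {P \<in> spec_hi K D - {{\<zero>\<^bsub>K\<^esub>}}.
     \<not> (\<exists>Q\<in>spec_hi K D - {{\<zero>\<^bsub>K\<^esub>}}. Q \<subset> P)}"

definition T_ring :: "('a, 'm) ring_scheme \<Rightarrow> 'a set \<Rightarrow> 'a set \<Rightarrow> 'a set" where
  "T_ring K D P = (\<Inter>M\<in>{M \<in> maxspec K D. P \<subseteq> M}. loc K D M)"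

text \<open>
  Sends \<open>T_P \<inter> \<dots> \<inter> T_P'\<close> to \<open>T_\<nu>(P) \<inter> \<dots> \<inter> T_\<nu>(P')\<close>, and \<open>K1\<close> (the empty intersection) to \<open>K2\<close>.
\<close>

definition induced_sk :: "('a, 'm) ring_scheme \<Rightarrow> 'a set \<Rightarrow> ('b, 'n) ring_scheme \<Rightarrow> 'b set \<Rightarrow>
    ('a set \<Rightarrow> 'b set) \<Rightarrow> 'a set \<Rightarrow> 'b set" where
  "induced_sk K1 D1 K2 D2 \<nu> A = (THE B. \<exists>S \<subseteq> hi_minimal K1 D1.
     A = carrier K1 \<inter> (\<Inter>P\<in>S. T_ring K1 D1 P) \<and>
     B = carrier K2 \<inter> (\<Inter>P\<in>S. T_ring K2 D2 (\<nu> P)))"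

end

theory Submission
  imports Defs
begin

text \<open>
  Multiplication by 0 forces the zero module to be closed, so a semistar operation on \<open>D\<close> is a closure
  operation on the nonzero \<open>D\<close>-submodules of \<open>K\<close> that commutes with multiplication by nonzero
  elements. The proof describes the ordered set of these operations in terms of the finite tree of
  branching primes and of the ordered sets attached to the valuation domains \<open>Z(P)\<close> only. An
  isomorphism of the trees together with isomorphisms at the nodes then transports everything.

  The description is recursive. In order not to leave the field \<open>K\<close> when passing to residue rings, the
  recursion runs over the following relative notion: for a valuation ring \<open>V\<close> of \<open>K\<close> with maximal
  ideal \<open>m\<close> and a ring \<open>B\<close> between \<open>m\<close> and \<open>V\<close>, the set \<open>Clos K B V\<close> consists of the closure
  operations on the \<open>B\<close>-modules \<open>I\<close> with \<open>m \<subset> I \<subseteq> V\<close> that commute with the units of \<open>V\<close>. These are the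
  semistar operations on \<open>B/m\<close> if \<open>V/m\<close> is its quotient field. For a prime \<open>P\<close> of the tree let \<open>V_P\<close>
  be the localization at \<open>P\<close> and \<open>T_P\<close> the intersection of the localizations at the maximal ideals
  above \<open>P\<close>. Then \<open>Clos K T_P V_P\<close> is built from the children \<open>C\<close> of \<open>P\<close> in two steps.

  Branching (\<open>fork_product.order_iso_component\<close>, \<open>order_iso_fam\<close>). A module over \<open>T_P\<close> is a tuple of
  modules over the rings \<open>T_C\<close>, by a partition of unity. Some units of \<open>T_C\<close> are as divisible as
  desired in the other rings \<open>T_C'\<close>; hence multiplication can move all other coordinates without
  changing the one at \<open>C\<close>, and the \<open>C\<close>-coordinate of a closure depends on the \<open>C\<close>-coordinate of the
  module and on the set \<open>S\<close> of coordinates different from \<open>V_P\<close> alone. A closure operation is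
  therefore a family of operations \<open>a (S, C)\<close> in \<open>Clos K T_C V_P\<close>, antitone in \<open>S\<close> and compatible with
  removing from \<open>S\<close> the \<open>C\<close> at which \<open>a (S, C)\<close> is the largest operation.

  Trunk (\<open>trunk.order_iso_split_op\<close>). As \<open>T_C\<close> contains the maximal ideal of \<open>V_C\<close>, every \<open>T_C\<close>-module
  is a module over \<open>V_C\<close> or a multiple of a module between \<open>V_C\<close> and its maximal ideal. An operation
  either fixes all \<open>V_C\<close>-modules or gives the modules of the second kind the same closure as \<open>V_C\<close>, so
  that \<open>Clos K T_C V_P\<close> is the ordinal sum of \<open>Clos K T_C V_C\<close> without its largest element and of
  \<open>Clos K V_C V_P\<close>. The latter, without its largest element, is the set of fractional star operations
  on \<open>Z(C)\<close> (\<open>order_iso_quotient\<close>).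

  At the root \<open>P = (0)\<close> the families indexed by all sets \<open>S\<close> are the semistar operations, and those
  indexed by the full set of children alone are the fractional star operations, because the nonzero
  fractional ideals are the tuples without a coordinate equal to \<open>K\<close>. The ring obtained by
  intersecting the \<open>T_C\<close> with \<open>C\<close> in \<open>S\<close> lies in the support exactly when no \<open>a (S, C)\<close> with \<open>C \<in> S\<close>
  is the largest operation. Order isomorphisms preserve largest elements, hence supports.
\<close>

section \<open>Order isomorphisms\<close>

lemma order_isoI:
  assumes "\<And>x. x \<in> A \<Longrightarrow> f x \<in> B"
    and le: "\<And>x y. x \<in> A \<Longrightarrow> y \<in> A \<Longrightarrow> leA x y \<longleftrightarrow> leB (f x) (f y)"
    and surj: "\<And>y. y \<in> B \<Longrightarrow> \<exists>x\<in>A. f x = y"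
    and refl: "\<And>y. y \<in> B \<Longrightarrow> leB y y"
    and antisym: "\<And>x y. x \<in> A \<Longrightarrow> y \<in> A \<Longrightarrow> leA x y \<Longrightarrow> leA y x \<Longrightarrow> x = y"
  shows "order_iso A leA B leB f"
proof -
  have "inj_on f A"
    using assms by (intro inj_onI) metis
  moreover have "f ` A = B"
    using assms(1) surj by blast
  ultimately show ?thesis
    unfolding order_iso_def bij_betw_def using le by blast
qed

lemma order_isoD:
  assumes "order_iso A leA B leB f"
  shows order_iso_closed: "x \<in> A \<Longrightarrow> f x \<in> B"
    and order_iso_le: "x \<in> A \<Longrightarrow> y \<in> A \<Longrightarrow> leB (f x) (f y) \<longleftrightarrow> leA x y"
    and order_iso_inj: "x \<in> A \<Longrightarrow> y \<in> A \<Longrightarrow> f x = f y \<longleftrightarrow> x = y"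
    and order_iso_surj: "z \<in> B \<Longrightarrow> \<exists>x\<in>A. f x = z"
  using assms unfolding order_iso_def bij_betw_def inj_on_def by (blast+)

lemma order_iso_trans:
  assumes "order_iso A leA B leB f" "order_iso B leB C leC g"
  shows "order_iso A leA C leC (g \<circ> f)"
proof -
  have "bij_betw (g \<circ> f) A C"
    using assms bij_betw_trans unfolding order_iso_def by blast
  then show ?thesis
    using order_iso_closed[OF assms(1)] order_iso_le[OF assms(1)] order_iso_le[OF assms(2)]
    unfolding order_iso_def by simp
qed

lemma order_iso_sym:
  assumes "order_iso A leA B leB f"
  shows "order_iso B leB A leA (inv_into A f)"
proof -
  have b: "bij_betw f A B" using assms unfolding order_iso_def by blast
  show ?thesis
    unfolding order_iso_def
  proof (intro conjI ballI)
    show "bij_betw (inv_into A f) B A" using b by (rule bij_betw_inv_into)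
    fix x y assume "x \<in> B" "y \<in> B"
    then have "inv_into A f x \<in> A" "f (inv_into A f x) = x" "inv_into A f y \<in> A" "f (inv_into A f y) = y"
      using b by (auto simp: bij_betw_def inv_into_into f_inv_into_f)
    then show "leB x y \<longleftrightarrow> leA (inv_into A f x) (inv_into A f y)"
      using order_iso_le[OF assms, of "inv_into A f x" "inv_into A f y"] by simp
  qed
qed

text \<open>
  The relation is an arbitrary one, so uniqueness of the top is part of the definition.
\<close>

definition is_top :: "'a set \<Rightarrow> ('a \<Rightarrow> 'a \<Rightarrow> bool) \<Rightarrow> 'a \<Rightarrow> bool" where
  "is_top A leA t \<longleftrightarrow> t \<in> A \<and> (\<forall>x\<in>A. leA x t) \<and> (\<forall>x\<in>A. leA t x \<longrightarrow> x = t)"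

lemma order_iso_top:
  assumes f: "order_iso A leA B leB f" and s: "is_top A leA s" and t: "is_top B leB t"
  shows "f s = t"
proof -
  obtain x where x: "x \<in> A" "f x = t"
    using order_iso_surj[OF f] t unfolding is_top_def by blast
  then have "leA x s"
    using s unfolding is_top_def by blast
  then have "leB t (f s)"
    using order_iso_le[OF f, of x s] x s unfolding is_top_def by blast
  then show ?thesis
    using t order_iso_closed[OF f, of s] s unfolding is_top_def by blast
qed

lemma order_iso_remove_top:
  assumes f: "order_iso A leA B leB f" and "is_top A leA s" "is_top B leB t"
  shows "order_iso (A - {s}) leA (B - {t}) leB f"
proof -
  have "f s = t" "s \<in> A"
    using order_iso_top[OF assms] assms(2) unfolding is_top_def by auto
  then have "bij_betw f (A - {s}) (B - {t})"
    using f unfolding order_iso_def by (auto simp: bij_betw_def inj_on_def)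
  then show ?thesis
    using f unfolding order_iso_def by auto
qed

lemma order_iso_add_top:
  assumes f: "order_iso (A - {s}) leA (B - {t}) leB f"
    and s: "is_top A leA s" and t: "is_top B leB t"
  shows "\<exists>g. order_iso A leA B leB g"
proof -
  let ?g = "\<lambda>x. if x = s then t else f x"
  have b: "bij_betw f (A - {s}) (B - {t})" using f unfolding order_iso_def by blast
  have st: "s \<in> A" "t \<in> B" using s t unfolding is_top_def by auto
  have f': "\<And>x. x \<in> A \<Longrightarrow> x \<noteq> s \<Longrightarrow> f x \<in> B \<and> f x \<noteq> t"
    using b by (auto simp: bij_betw_def)
  have "bij_betw ?g A B"
    unfolding bij_betw_def
  proof
    show "inj_on ?g A"
      using b f' unfolding bij_betw_def inj_on_def by (auto split: if_splits)
    have "?g ` (A - {s}) = B - {t}"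
      using b by (auto simp: bij_betw_def image_def)
    moreover have "?g ` A = insert (?g s) (?g ` (A - {s}))"
      using st(1) by (auto simp: image_iff)
    ultimately show "?g ` A = B" using st(2) by auto
  qed
  moreover have "leA x y \<longleftrightarrow> leB (?g x) (?g y)" if "x \<in> A" "y \<in> A" for x y
    using that f f'[of x] f'[of y] s t unfolding order_iso_def is_top_def
    by (auto split: if_splits)
  ultimately show ?thesis unfolding order_iso_def by blast
qed

text \<open>
  The ordinal sum of two posets, the first lying entirely below the second.
\<close>

definition ord_sum_le :: "('a \<Rightarrow> 'a \<Rightarrow> bool) \<Rightarrow> ('b \<Rightarrow> 'b \<Rightarrow> bool) \<Rightarrow> 'a + 'b \<Rightarrow> 'a + 'b \<Rightarrow> bool" where
  "ord_sum_le leA leB x y = (case x of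
     Inl a \<Rightarrow> (case y of Inl a' \<Rightarrow> leA a a' | Inr b \<Rightarrow> True)
   | Inr b \<Rightarrow> (case y of Inl a \<Rightarrow> False | Inr b' \<Rightarrow> leB b b'))"

lemma order_iso_ord_sum:
  assumes "order_iso A leA A' leA' f" "order_iso B leB B' leB' g"
  shows "order_iso (Inl ` A \<union> Inr ` B) (ord_sum_le leA leB) (Inl ` A' \<union> Inr ` B') (ord_sum_le leA' leB') (map_sum f g)"
proof -
  have ball: "(\<forall>x\<in>(Inl ` A \<union> Inr ` B). Q x) \<longleftrightarrow> (\<forall>a\<in>A. Q (Inl a)) \<and> (\<forall>b\<in>B. Q (Inr b))" for Q
    by auto
  have f: "inj_on f A" "f ` A = A'" and g: "inj_on g B" "g ` B = B'"
    using assms unfolding order_iso_def bij_betw_def by auto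
  have "inj_on (map_sum f g) (Inl ` A \<union> Inr ` B)"
    using f(1) g(1) unfolding inj_on_def ball by auto
  moreover have "map_sum f g ` (Inl ` A \<union> Inr ` B) = Inl ` A' \<union> Inr ` B'"
    unfolding f(2)[symmetric] g(2)[symmetric] by (simp add: image_Un image_image)
  ultimately show ?thesis
    using assms unfolding order_iso_def bij_betw_def ball ord_sum_le_def by simp
qed


section \<open>Closure operations that commute with a group action\<close>

text \<open>
  With \<open>act\<close> the multiplication of a submodule by a field element, equivariance is property (S) for
  the factors in \<open>U\<close>.
\<close>

definition eq_clos :: "('g \<Rightarrow> 'a set \<Rightarrow> 'a set) \<Rightarrow> 'g set \<Rightarrow> 'a set set \<Rightarrow> ('a set \<Rightarrow> 'a set) set" where
  "eq_clos act U X = {c \<in> closure_ops X. \<forall>u\<in>U. \<forall>I\<in>X. act u (c I) = c (act u I)}"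

definition cl_le :: "'a set set \<Rightarrow> ('a set \<Rightarrow> 'a set) \<Rightarrow> ('a set \<Rightarrow> 'a set) \<Rightarrow> bool" where
  "cl_le X c d \<longleftrightarrow> (\<forall>I\<in>X. c I \<subseteq> d I)"

definition const_on :: "'a set set \<Rightarrow> 'a set \<Rightarrow> 'a set \<Rightarrow> 'a set" where
  "const_on X V = (\<lambda>I\<in>X. V)"

lemma eq_closI:
  assumes "c \<in> extensional X" "\<And>I. I \<in> X \<Longrightarrow> c I \<in> X" "\<And>I. I \<in> X \<Longrightarrow> I \<subseteq> c I"
    "\<And>I J. I \<in> X \<Longrightarrow> J \<in> X \<Longrightarrow> I \<subseteq> J \<Longrightarrow> c I \<subseteq> c J"
    "\<And>I. I \<in> X \<Longrightarrow> c (c I) \<subseteq> c I"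
    "\<And>u I. u \<in> U \<Longrightarrow> I \<in> X \<Longrightarrow> act u (c I) = c (act u I)"
  shows "c \<in> eq_clos act U X"
proof -
  have "c (c I) = c I" if "I \<in> X" for I
    using assms(2,3,5) that by blast
  then show ?thesis
    using assms(1,2,3,4,6) unfolding eq_clos_def closure_ops_def PiE_def by simp
qed

lemma eq_closD:
  assumes "c \<in> eq_clos act U X"
  shows eq_clos_ext: "c \<in> extensional X"
    and eq_clos_closed: "I \<in> X \<Longrightarrow> c I \<in> X"
    and eq_clos_extensive: "I \<in> X \<Longrightarrow> I \<subseteq> c I"
    and eq_clos_mono: "I \<in> X \<Longrightarrow> J \<in> X \<Longrightarrow> I \<subseteq> J \<Longrightarrow> c I \<subseteq> c J"
    and eq_clos_idem: "I \<in> X \<Longrightarrow> c (c I) = c I"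
    and eq_clos_act: "u \<in> U \<Longrightarrow> I \<in> X \<Longrightarrow> act u (c I) = c (act u I)"
  using assms unfolding eq_clos_def closure_ops_def PiE_def by auto

lemma cl_le_antisym:
  assumes "c \<in> eq_clos act U X" "d \<in> eq_clos act U X" "cl_le X c d" "cl_le X d c"
  shows "c = d"
  using assms eq_clos_ext[OF assms(1)] eq_clos_ext[OF assms(2)]
  unfolding cl_le_def by (intro extensionalityI[of c X d]) blast+

lemma cl_le_refl: "cl_le X c c"
  unfolding cl_le_def by simp

lemma const_on_in_eq_clos:
  assumes "V \<in> X" "\<And>I. I \<in> X \<Longrightarrow> I \<subseteq> V" "\<And>u. u \<in> U \<Longrightarrow> act u V = V"
    "\<And>u I. u \<in> U \<Longrightarrow> I \<in> X \<Longrightarrow> act u I \<in> X"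
  shows "const_on X V \<in> eq_clos act U X"
  using assms unfolding const_on_def by (intro eq_closI) auto

lemma is_top_const_on:
  assumes "V \<in> X" "\<And>I. I \<in> X \<Longrightarrow> I \<subseteq> V" "\<And>u. u \<in> U \<Longrightarrow> act u V = V"
    "\<And>u I. u \<in> U \<Longrightarrow> I \<in> X \<Longrightarrow> act u I \<in> X"
  shows "is_top (eq_clos act U X) (cl_le X) (const_on X V)"
proof -
  have *: "cl_le X c (const_on X V)" if "c \<in> eq_clos act U X" for c
    using eq_clos_closed[OF that] assms(2) unfolding cl_le_def const_on_def by simp
  show ?thesis
    unfolding is_top_def
  proof (intro conjI ballI impI)
    show top: "const_on X V \<in> eq_clos act U X" by (rule const_on_in_eq_clos) (use assms in auto)
    fix c assume c: "c \<in> eq_clos act U X"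
    show "cl_le X c (const_on X V)" using *[OF c] .
    show "c = const_on X V" if "cl_le X (const_on X V) c"
      using cl_le_antisym[OF c top *[OF c] that] .
  qed
qed

text \<open>
  When any two members of \<open>X\<close> below the top \<open>V\<close> are comparable up to the action, one proper member
  whose closure is \<open>V\<close> forces every closure to be \<open>V\<close>.
\<close>

lemma eq_clos_top_dichotomy:
  assumes c: "c \<in> eq_clos act U X" and VX: "\<And>I. I \<in> X \<Longrightarrow> I \<subseteq> V" "V \<in> X"
    and V: "\<And>u. u \<in> U \<Longrightarrow> act u V = V"
    and X: "\<And>u I. u \<in> U \<Longrightarrow> I \<in> X \<Longrightarrow> act u I \<in> X"
    and bdd: "\<And>I J. I \<in> X \<Longrightarrow> I \<noteq> V \<Longrightarrow> J \<in> X \<Longrightarrow> \<exists>u\<in>U. act u I \<subseteq> J"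
    and I: "I \<in> X" "I \<noteq> V" "c I = V"
  shows "c = const_on X V"
proof (rule extensionalityI[of _ X])
  show "c \<in> extensional X" using eq_clos_ext[OF c] .
  show "const_on X V \<in> extensional X" unfolding const_on_def by simp
  fix J assume J: "J \<in> X"
  obtain u where u: "u \<in> U" "act u I \<subseteq> J" using bdd[OF I(1,2) J] by blast
  have "V = c (act u I)"
    using eq_clos_act[OF c u(1) I(1)] I(3) V[OF u(1)] by simp
  also have "\<dots> \<subseteq> c J"
    using eq_clos_mono[OF c X[OF u(1) I(1)] J u(2)] .
  finally show "c J = const_on X V J"
    using VX(1)[OF eq_clos_closed[OF c J]] J unfolding const_on_def by auto
qed

text \<open>
  Deleting the largest module from the domain amounts to deleting the largest operation: by the
  dichotomy every other operation keeps proper members proper, so it restricts, and it is recovered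
  from the restriction by closing \<open>V\<close>.
\<close>

lemma order_iso_restrict_below_top:
  assumes VX: "\<And>I. I \<in> X \<Longrightarrow> I \<subseteq> V" "V \<in> X"
    and V: "\<And>u. u \<in> U \<Longrightarrow> act u V = V"
    and X: "\<And>u I. u \<in> U \<Longrightarrow> I \<in> X \<Longrightarrow> act u I \<in> X"
    and X': "\<And>u I. u \<in> U \<Longrightarrow> I \<in> X \<Longrightarrow> act u I = V \<Longrightarrow> I = V"
    and bdd: "\<And>I J. I \<in> X \<Longrightarrow> I \<noteq> V \<Longrightarrow> J \<in> X \<Longrightarrow> \<exists>u\<in>U. act u I \<subseteq> J"
    and ne: "\<exists>I\<in>X. I \<noteq> V"
  shows "order_iso (eq_clos act U X - {const_on X V}) (cl_le X)
    (eq_clos act U (X - {V})) (cl_le (X - {V})) (\<lambda>c. restrict c (X - {V}))"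
proof (rule order_isoI)
  have cV: "c V = V" if "c \<in> eq_clos act U X" for c
    using eq_clos_extensive[OF that VX(2)] VX(1)[OF eq_clos_closed[OF that VX(2)]] by blast
  have below: "c I \<noteq> V" if "c \<in> eq_clos act U X - {const_on X V}" "I \<in> X" "I \<noteq> V" for c I
  proof
    assume "c I = V"
    with that have "c = const_on X V"
      using VX V X bdd by (intro eq_clos_top_dichotomy[of c act U X V I]) auto
    with that(1) show False by blast
  qed
  fix c assume c: "c \<in> eq_clos act U X - {const_on X V}"
  then have c': "c \<in> eq_clos act U X" by blast
  show "restrict c (X - {V}) \<in> eq_clos act U (X - {V})"
  proof (rule eq_closI)
    fix I assume I: "I \<in> X - {V}"
    have cI: "c I \<in> X - {V}" using eq_clos_closed[OF c'] below[OF c] I by blast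
    then show "restrict c (X - {V}) I \<in> X - {V}" using I by simp
    show "I \<subseteq> restrict c (X - {V}) I" using I eq_clos_extensive[OF c', of I] by simp
    show "restrict c (X - {V}) (restrict c (X - {V}) I) \<subseteq> restrict c (X - {V}) I"
      using I cI eq_clos_idem[OF c', of I] by simp
    show "restrict c (X - {V}) I \<subseteq> restrict c (X - {V}) J" if "J \<in> X - {V}" "I \<subseteq> J" for J
      using I that eq_clos_mono[OF c', of I J] by simp
    show "act u (restrict c (X - {V}) I) = restrict c (X - {V}) (act u I)" if "u \<in> U" for u
    proof -
      have "act u I \<in> X - {V}" using X[OF that, of I] X'[OF that, of I] I by blast
      then show ?thesis using I eq_clos_act[OF c' that, of I] by simp
    qed
  qed simp
  fix d assume d: "d \<in> eq_clos act U X - {const_on X V}"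
  then have d': "d \<in> eq_clos act U X" by blast
  show "cl_le X c d \<longleftrightarrow> cl_le (X - {V}) (restrict c (X - {V})) (restrict d (X - {V}))"
    using cV[OF c'] cV[OF d'] unfolding cl_le_def by (auto simp: restrict_apply)
  show "cl_le X c d \<Longrightarrow> cl_le X d c \<Longrightarrow> c = d"
    using cl_le_antisym[OF c' d'] .
next
  fix e assume e: "e \<in> eq_clos act U (X - {V})"
  define c where "c = (\<lambda>I\<in>X. if I = V then V else e I)"
  have eX: "e I \<in> X" "e I \<noteq> V" if "I \<in> X" "I \<noteq> V" for I
    using eq_clos_closed[OF e, of I] that by auto
  have c: "c \<in> eq_clos act U X"
  proof (rule eq_closI)
    show "c \<in> extensional X" unfolding c_def by simp
    show "c I \<in> X" if "I \<in> X" for I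
      using that eX VX unfolding c_def by simp
    show "I \<subseteq> c I" if "I \<in> X" for I
      using that eq_clos_extensive[OF e, of I] unfolding c_def by simp
    show "c I \<subseteq> c J" if "I \<in> X" "J \<in> X" "I \<subseteq> J" for I J
      using that eq_clos_mono[OF e, of I J] VX(1)[of J] VX(1)[OF eX(1)] unfolding c_def by auto
    show "c (c I) \<subseteq> c I" if "I \<in> X" for I
      using that eq_clos_idem[OF e, of I] eX[of I] VX unfolding c_def by auto
    show "act u (c I) = c (act u I)" if "u \<in> U" "I \<in> X" for u I
      using that eq_clos_act[OF e, of u I] X[of u I] X'[of u I] V[of u] unfolding c_def by auto
  qed
  moreover have "c \<noteq> const_on X V"
  proof
    assume c: "c = const_on X V"
    obtain I where I: "I \<in> X" "I \<noteq> V" using ne by blast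
    have "c I = e I" using I unfolding c_def by simp
    then show False using eX(2)[OF I] I(1) unfolding c const_on_def by simp
  qed
  moreover have "restrict c (X - {V}) = e"
    using eq_clos_ext[OF e] unfolding c_def
    by (intro extensionalityI[of _ "X - {V}"]) auto
  ultimately show "\<exists>c\<in>eq_clos act U X - {const_on X V}. restrict c (X - {V}) = e" by blast
next
  fix e show "cl_le (X - {V}) e e" by (rule cl_le_refl)
qed

section \<open>Closure operations on a product of lattices\<close>

text \<open>
  A combinatorial model of the equivariant closure operations on a product. An index set \<open>S\<close> is the
  set of coordinates at which a tuple is proper, and \<open>a (S, i)\<close> is the operation induced on the \<open>i\<close>-th
  coordinate of such tuples; \<open>t i\<close> is the operation after which the \<open>i\<close>-th coordinate is no longer
  proper. Monotonicity of the closure makes \<open>a\<close> antitone in \<open>S\<close>, and idempotence becomes the last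
  condition: the closed tuple is proper exactly at the \<open>i\<close> with \<open>a (S, i) \<noteq> t i\<close>, and closing it once
  more must not change it.
\<close>

definition fam :: "'i set set \<Rightarrow> ('i \<Rightarrow> 'p set) \<Rightarrow> ('i \<Rightarrow> 'p \<Rightarrow> 'p \<Rightarrow> bool) \<Rightarrow> ('i \<Rightarrow> 'p) \<Rightarrow>
    ('i set \<times> 'i \<Rightarrow> 'p) set" where
  "fam SS A leA t = {a \<in> (\<Pi>\<^sub>E p\<in>(SIGMA S:SS. S). A (snd p)).
     (\<forall>S\<in>SS. \<forall>S'\<in>SS. S \<subseteq> S' \<longrightarrow> (\<forall>i\<in>S. leA i (a (S', i)) (a (S, i)))) \<and>
     (\<forall>S\<in>SS. {i \<in> S. a (S, i) \<noteq> t i} \<in> SS \<and>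
        (\<forall>i\<in>S. a (S, i) \<noteq> t i \<longrightarrow> a ({i \<in> S. a (S, i) \<noteq> t i}, i) = a (S, i)))}"

definition fam_le :: "'i set set \<Rightarrow> ('i \<Rightarrow> 'p \<Rightarrow> 'p \<Rightarrow> bool) \<Rightarrow>
    ('i set \<times> 'i \<Rightarrow> 'p) \<Rightarrow> ('i set \<times> 'i \<Rightarrow> 'p) \<Rightarrow> bool" where
  "fam_le SS leA a b \<longleftrightarrow> (\<forall>S\<in>SS. \<forall>i\<in>S. leA i (a (S, i)) (b (S, i)))"

lemma famD:
  assumes "a \<in> fam SS A leA t"
  shows fam_closed: "S \<in> SS \<Longrightarrow> i \<in> S \<Longrightarrow> a (S, i) \<in> A i"
    and fam_ext: "a \<in> extensional (SIGMA S:SS. S)"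
    and fam_antimono: "S \<in> SS \<Longrightarrow> S' \<in> SS \<Longrightarrow> S \<subseteq> S' \<Longrightarrow> i \<in> S \<Longrightarrow> leA i (a (S', i)) (a (S, i))"
    and fam_shrink: "S \<in> SS \<Longrightarrow> {i \<in> S. a (S, i) \<noteq> t i} \<in> SS"
    and fam_stable: "S \<in> SS \<Longrightarrow> i \<in> S \<Longrightarrow> a (S, i) \<noteq> t i \<Longrightarrow>
      a ({i \<in> S. a (S, i) \<noteq> t i}, i) = a (S, i)"
proof -
  have a: "a \<in> (\<Pi>\<^sub>E p\<in>(SIGMA S:SS. S). A (snd p))" using assms unfolding fam_def by simp
  show "a (S, i) \<in> A i" if "S \<in> SS" "i \<in> S"
    using PiE_mem[OF a, of "(S, i)"] that by simp
  show "a \<in> extensional (SIGMA S:SS. S)" using a by (simp add: PiE_def)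
qed (use assms in \<open>simp_all add: fam_def\<close>)

lemma famI:
  assumes "\<And>S i. S \<in> SS \<Longrightarrow> i \<in> S \<Longrightarrow> a (S, i) \<in> A i"
    and "a \<in> extensional (SIGMA S:SS. S)"
    and "\<And>S S' i. S \<in> SS \<Longrightarrow> S' \<in> SS \<Longrightarrow> S \<subseteq> S' \<Longrightarrow> i \<in> S \<Longrightarrow> leA i (a (S', i)) (a (S, i))"
    and "\<And>S. S \<in> SS \<Longrightarrow> {i \<in> S. a (S, i) \<noteq> t i} \<in> SS"
    and "\<And>S i. S \<in> SS \<Longrightarrow> i \<in> S \<Longrightarrow> a (S, i) \<noteq> t i \<Longrightarrow>
      a ({i \<in> S. a (S, i) \<noteq> t i}, i) = a (S, i)"
  shows "a \<in> fam SS A leA t"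
  unfolding fam_def
proof (intro CollectI conjI ballI impI)
  show "a \<in> (\<Pi>\<^sub>E p\<in>(SIGMA S:SS. S). A (snd p))"
  proof (rule PiE_I)
    show "a p \<in> A (snd p)" if "p \<in> (SIGMA S:SS. S)" for p
      using that assms(1) by auto
    show "a p = undefined" if "p \<notin> (SIGMA S:SS. S)" for p
      using assms(2) that by (rule extensional_arb)
  qed
qed (use assms(3-5) in blast)+

text \<open>
  The model refers to the factors only through their orders and their top elements, and order
  isomorphisms respect both.
\<close>

lemma order_iso_fam:
  fixes \<mu> :: "'i \<Rightarrow> 'j"
  assumes mu: "bij_betw \<mu> N N'" and SS: "SS \<subseteq> Pow N"
    and g: "\<And>i. i \<in> N \<Longrightarrow> order_iso (A i) (leA i) (A' (\<mu> i)) (leA' (\<mu> i)) (g i)"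
    and t: "\<And>i. i \<in> N \<Longrightarrow> is_top (A i) (leA i) (t i)"
    and t': "\<And>i. i \<in> N \<Longrightarrow> is_top (A' (\<mu> i)) (leA' (\<mu> i)) (t' (\<mu> i))"
    and refl: "\<And>i x. i \<in> N \<Longrightarrow> x \<in> A i \<Longrightarrow> leA i x x"
    and antisym: "\<And>i x y. i \<in> N \<Longrightarrow> x \<in> A i \<Longrightarrow> y \<in> A i \<Longrightarrow> leA i x y \<Longrightarrow> leA i y x \<Longrightarrow> x = y"
  shows "\<exists>h. order_iso (fam SS A leA t) (fam_le SS leA)
      (fam ((`) \<mu> ` SS) A' leA' t') (fam_le ((`) \<mu> ` SS) leA') h \<and>
    (\<forall>a\<in>fam SS A leA t. \<forall>S\<in>SS. \<forall>i\<in>S. h a (\<mu> ` S, \<mu> i) = t' (\<mu> i) \<longleftrightarrow> a (S, i) = t i)"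
proof -
  define \<rho> where "\<rho> = inv_into N \<mu>"
  have inj: "inj_on \<mu> N" using mu unfolding bij_betw_def by blast
  have \<rho>: "\<rho> (\<mu> i) = i" if "i \<in> N" for i
    using inv_into_f_f[OF inj that] unfolding \<rho>_def .
  have \<rho>S: "\<rho> ` (\<mu> ` S) = S" if "S \<in> SS" for S
    using that SS \<rho> by (force simp: image_image)
  let ?SS' = "(`) \<mu> ` SS"
  let ?Q = "SIGMA S:SS. S" and ?Q' = "SIGMA S:?SS'. S"
  define h where "h a = (\<lambda>p\<in>?Q'. g (\<rho> (snd p)) (a (\<rho> ` fst p, \<rho> (snd p))))" for a
  define k where "k b = (\<lambda>p\<in>?Q. inv_into (A (snd p)) (g (snd p)) (b (\<mu> ` fst p, \<mu> (snd p))))" for b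
  have N: "i \<in> N" if "S \<in> SS" "i \<in> S" for S i using that SS by blast
  have h: "h a (\<mu> ` S, \<mu> i) = g i (a (S, i))" if "S \<in> SS" "i \<in> S" for a S i
    using that \<rho>S[OF that(1)] \<rho>[OF N[OF that]] unfolding h_def by auto
  have k: "k b (S, i) = inv_into (A i) (g i) (b (\<mu> ` S, \<mu> i))" if "S \<in> SS" "i \<in> S" for b S i
    using that unfolding k_def by simp
  have gA: "g i x \<in> A' (\<mu> i)" if "i \<in> N" "x \<in> A i" for i x
    using order_iso_closed[OF g[OF that(1)] that(2)] .
  have gt: "g i x = t' (\<mu> i) \<longleftrightarrow> x = t i" if "i \<in> N" "x \<in> A i" for i x
  proof -
    have "t i \<in> A i" using t[OF that(1)] unfolding is_top_def by blast
    then show ?thesis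
      using order_iso_top[OF g t t', OF that(1) that(1) that(1)]
        order_iso_inj[OF g[OF that(1)] that(2)] by metis
  qed
  have kA: "inv_into (A i) (g i) y \<in> A i" "g i (inv_into (A i) (g i) y) = y"
    if "i \<in> N" "y \<in> A' (\<mu> i)" for i y
    using that g[OF that(1)] unfolding order_iso_def bij_betw_def
    by (auto intro: inv_into_into f_inv_into_f)
  have muE: "\<exists>i\<in>S. j = \<mu> i" if "j \<in> \<mu> ` S" for j S using that by blast
  have mu_sub: "\<mu> ` S \<subseteq> \<mu> ` S' \<longleftrightarrow> S \<subseteq> S'" if "S \<in> SS" "S' \<in> SS" for S S'
    using image_mono[of "\<mu> ` S" "\<mu> ` S'" \<rho>] image_mono[of S S' \<mu>] \<rho>S[OF that(1)] \<rho>S[OF that(2)] by auto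
  have hfam: "h a \<in> fam ?SS' A' leA' t'" if a: "a \<in> fam SS A leA t" for a
  proof (rule famI)
    have sh: "{j \<in> \<mu> ` S. h a (\<mu> ` S, j) \<noteq> t' j} = \<mu> ` {i \<in> S. a (S, i) \<noteq> t i}" if "S \<in> SS" for S
      using h[OF that, of _ a] gt[OF N[OF that] fam_closed[OF a that]] by auto
    fix T assume "T \<in> ?SS'"
    then obtain S where S: "S \<in> SS" "T = \<mu> ` S" by blast
    show "{j \<in> T. h a (T, j) \<noteq> t' j} \<in> ?SS'"
      unfolding S(2) sh[OF S(1)] using fam_shrink[OF a S(1)] by blast
    fix j assume "j \<in> T"
    then obtain i where i: "i \<in> S" "j = \<mu> i" using S by blast
    show "h a (T, j) \<in> A' j"
      unfolding S(2) i(2) h[OF S(1) i(1)] using gA[OF N[OF S(1) i(1)] fam_closed[OF a S(1) i(1)]] .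
    show "h a ({j \<in> T. h a (T, j) \<noteq> t' j}, j) = h a (T, j)" if "h a (T, j) \<noteq> t' j"
    proof -
      have ne: "a (S, i) \<noteq> t i"
        using that gt[OF N[OF S(1) i(1)] fam_closed[OF a S(1) i(1)]]
        unfolding S(2) i(2) h[OF S(1) i(1)] by blast
      have "h a (\<mu> ` {i \<in> S. a (S, i) \<noteq> t i}, \<mu> i) = g i (a ({i \<in> S. a (S, i) \<noteq> t i}, i))"
        using fam_shrink[OF a S(1)] i ne by (intro h) auto
      then show ?thesis
        unfolding S(2) sh[OF S(1)] i(2) h[OF S(1) i(1)] fam_stable[OF a S(1) i(1) ne] .
    qed
  next
    fix T T' j assume "T \<in> ?SS'" "T' \<in> ?SS'" and T: "T \<subseteq> T'" and "j \<in> T"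
    then obtain S S' i where S: "S \<in> SS" "S' \<in> SS" "T = \<mu> ` S" "T' = \<mu> ` S'" "i \<in> S" "j = \<mu> i"
      by blast
    have sub: "S \<subseteq> S'" using T mu_sub S by blast
    then have i': "i \<in> S'" using S by blast
    show "leA' j (h a (T', j)) (h a (T, j))"
      using fam_antimono[OF a S(1,2) sub S(5)] order_iso_le[OF g[OF N[OF S(1,5)]]]
        fam_closed[OF a S(1,5)] fam_closed[OF a S(2) i']
      unfolding S(3,4,6) h[OF S(1,5)] h[OF S(2) i'] by blast
  next
    show "h a \<in> extensional ?Q'" unfolding h_def by simp
  qed
  have kfam: "k b \<in> fam SS A leA t \<and> h (k b) = b" if b: "b \<in> fam ?SS' A' leA' t'" for b
  proof -
    have bA: "b (\<mu> ` S, \<mu> i) \<in> A' (\<mu> i)" if "S \<in> SS" "i \<in> S" for S i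
      using fam_closed[OF b, of "\<mu> ` S" "\<mu> i"] that by blast
    have kA': "k b (S, i) \<in> A i" and gk: "g i (k b (S, i)) = b (\<mu> ` S, \<mu> i)"
      if "S \<in> SS" "i \<in> S" for S i
      using kA[OF N[OF that] bA[OF that]] k[OF that] by simp_all
    have kt: "k b (S, i) = t i \<longleftrightarrow> b (\<mu> ` S, \<mu> i) = t' (\<mu> i)" if "S \<in> SS" "i \<in> S" for S i
      using gt[OF N[OF that] kA'[OF that]] gk[OF that] by simp
    have sh: "{j \<in> \<mu> ` S. b (\<mu> ` S, j) \<noteq> t' j} = \<mu> ` {i \<in> S. k b (S, i) \<noteq> t i}" if "S \<in> SS" for S
      using kt[OF that] by auto
    have shS: "{i \<in> S. k b (S, i) \<noteq> t i} \<in> SS" if S: "S \<in> SS" for S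
    proof -
      obtain S0 where S0: "S0 \<in> SS" "\<mu> ` {i \<in> S. k b (S, i) \<noteq> t i} = \<mu> ` S0"
        using fam_shrink[OF b, of "\<mu> ` S"] S unfolding sh[OF S] by blast
      then have "{i \<in> S. k b (S, i) \<noteq> t i} = S0"
        using inj_on_image_eq_iff[OF inj, of "{i \<in> S. k b (S, i) \<noteq> t i}" S0] S SS by blast
      then show ?thesis using S0(1) by simp
    qed
    have 1: "k b \<in> fam SS A leA t"
    proof (rule famI)
      fix S i assume S: "S \<in> SS" "i \<in> S"
      show "k b (S, i) \<in> A i" using kA'[OF S] .
      show "k b ({i \<in> S. k b (S, i) \<noteq> t i}, i) = k b (S, i)" if ne: "k b (S, i) \<noteq> t i"
      proof -
        have i: "i \<in> {i \<in> S. k b (S, i) \<noteq> t i}" using S ne by blast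
        have "b (\<mu> ` {i \<in> S. k b (S, i) \<noteq> t i}, \<mu> i) = b (\<mu> ` S, \<mu> i)"
          using fam_stable[OF b, of "\<mu> ` S" "\<mu> i"] S kt[OF S] ne unfolding sh[OF S(1)] by blast
        then show ?thesis
          using k[OF S] k[OF shS[OF S(1)] i] by simp
      qed
    next
      fix S S' i assume S: "S \<in> SS" "S' \<in> SS" "S \<subseteq> S'" "i \<in> S"
      then have i': "i \<in> S'" by blast
      have "leA' (\<mu> i) (b (\<mu> ` S', \<mu> i)) (b (\<mu> ` S, \<mu> i))"
        using fam_antimono[OF b, of "\<mu> ` S" "\<mu> ` S'" "\<mu> i"] S by blast
      then show "leA i (k b (S', i)) (k b (S, i))"
        using order_iso_le[OF g[OF N[OF S(1,4)]] kA'[OF S(2) i'] kA'[OF S(1,4)]]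
        unfolding gk[OF S(2) i'] gk[OF S(1,4)] by blast
    next
      show "k b \<in> extensional ?Q" unfolding k_def by simp
    qed (rule shS)
    moreover have "h (k b) = b"
    proof (rule extensionalityI[of _ ?Q'])
      show "h (k b) \<in> extensional ?Q'" unfolding h_def by simp
      show "b \<in> extensional ?Q'" using fam_ext[OF b] .
      fix p assume "p \<in> ?Q'"
      then obtain S i where S: "S \<in> SS" "i \<in> S" "p = (\<mu> ` S, \<mu> i)" by auto
      show "h (k b) p = b p" unfolding S(3) h[OF S(1,2)] gk[OF S(1,2)] ..
    qed
    ultimately show ?thesis by blast
  qed
  have "order_iso (fam SS A leA t) (fam_le SS leA) (fam ?SS' A' leA' t') (fam_le ?SS' leA') h"
  proof (rule order_isoI)
    fix a b assume a: "a \<in> fam SS A leA t" and b: "b \<in> fam SS A leA t"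
    have "leA' (\<mu> i) (h a (\<mu> ` S, \<mu> i)) (h b (\<mu> ` S, \<mu> i)) \<longleftrightarrow> leA i (a (S, i)) (b (S, i))"
      if "S \<in> SS" "i \<in> S" for S i
      unfolding h[OF that]
      using order_iso_le[OF g[OF N[OF that]] fam_closed[OF a that] fam_closed[OF b that]] .
    then show "fam_le SS leA a b \<longleftrightarrow> fam_le ?SS' leA' (h a) (h b)"
      unfolding fam_le_def by (simp add: ball_simps)
    show "a = b" if "fam_le SS leA a b" "fam_le SS leA b a"
    proof (rule extensionalityI[OF fam_ext[OF a] fam_ext[OF b]])
      fix p assume "p \<in> ?Q"
      then obtain S i where S: "S \<in> SS" "i \<in> S" "p = (S, i)" by auto
      show "a p = b p"
        unfolding S(3) using that S(1,2) unfolding fam_le_def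
        by (intro antisym[OF N[OF S(1,2)] fam_closed[OF a S(1,2)] fam_closed[OF b S(1,2)]]) auto
    qed
  next
    fix b assume b: "b \<in> fam ?SS' A' leA' t'"
    show "\<exists>a\<in>fam SS A leA t. h a = b" using kfam[OF b] by blast
    show "fam_le ?SS' leA' b b"
      unfolding fam_le_def
    proof (intro ballI)
      fix T j assume "T \<in> ?SS'" "j \<in> T"
      then obtain S i where S: "S \<in> SS" "i \<in> S" "T = \<mu> ` S" "j = \<mu> i" by blast
      have "k b (S, i) \<in> A i" using fam_closed[of "k b"] kfam[OF b] S by blast
      then have "leA' (\<mu> i) (g i (k b (S, i))) (g i (k b (S, i)))"
        using refl[OF N[OF S(1,2)]] order_iso_le[OF g[OF N[OF S(1,2)]]] by blast
      then show "leA' j (b (T, j)) (b (T, j))"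
        unfolding S(3,4) h[OF S(1,2), symmetric] using kfam[OF b] by simp
    qed
  qed (rule hfam)
  moreover have "h a (\<mu> ` S, \<mu> i) = t' (\<mu> i) \<longleftrightarrow> a (S, i) = t i"
    if "a \<in> fam SS A leA t" "S \<in> SS" "i \<in> S" for a S i
    unfolding h[OF that(2,3)] using gt[OF N[OF that(2,3)] fam_closed[OF that]] .
  ultimately show ?thesis by blast
qed

text \<open>
  An ordered set \<open>Y\<close> of sets that is the product of the \<open>X i\<close>: the coordinates of \<open>I\<close> are \<open>E i I\<close>, and
  a tuple is glued by intersection. All factors share the top \<open>V\<close>. The assumption \<open>independent\<close> says
  that the group can push all coordinates but the \<open>i\<close>-th below given ones while acting trivially on \<open>X
  i\<close>; this is what decouples the coordinates. The \<open>T i\<close> are arbitrary proper members, used to fill up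
  tuples.
\<close>

locale fork_product =
  fixes act :: "'g \<Rightarrow> 'a set \<Rightarrow> 'a set" and U :: "'g set" and V :: "'a set" and N :: "'i set"
    and X :: "'i \<Rightarrow> 'a set set" and Y :: "'a set set" and E :: "'i \<Rightarrow> 'a set \<Rightarrow> 'a set"
    and T :: "'i \<Rightarrow> 'a set"
  assumes E_in: "i \<in> N \<Longrightarrow> I \<in> Y \<Longrightarrow> E i I \<in> X i"
    and E_mono: "i \<in> N \<Longrightarrow> I \<in> Y \<Longrightarrow> J \<in> Y \<Longrightarrow> I \<subseteq> J \<Longrightarrow> E i I \<subseteq> E i J"
    and E_act: "i \<in> N \<Longrightarrow> u \<in> U \<Longrightarrow> I \<in> Y \<Longrightarrow> E i (act u I) = act u (E i I)"
    and glue_E: "I \<in> Y \<Longrightarrow> V \<inter> (\<Inter>i\<in>N. E i I) = I"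
    and glue_in: "(\<And>i. i \<in> N \<Longrightarrow> F i \<in> X i) \<Longrightarrow> V \<inter> (\<Inter>i\<in>N. F i) \<in> Y"
    and E_glue: "(\<And>i. i \<in> N \<Longrightarrow> F i \<in> X i) \<Longrightarrow> i \<in> N \<Longrightarrow> E i (V \<inter> (\<Inter>i\<in>N. F i)) = F i"
    and V_in: "i \<in> N \<Longrightarrow> V \<in> X i"
    and X_le: "i \<in> N \<Longrightarrow> J \<in> X i \<Longrightarrow> J \<subseteq> V"
    and act_X: "i \<in> N \<Longrightarrow> u \<in> U \<Longrightarrow> J \<in> X i \<Longrightarrow> act u J \<in> X i"
    and act_Y: "u \<in> U \<Longrightarrow> I \<in> Y \<Longrightarrow> act u I \<in> Y"
    and act_V: "u \<in> U \<Longrightarrow> act u V = V"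
    and act_eq_V: "i \<in> N \<Longrightarrow> u \<in> U \<Longrightarrow> J \<in> X i \<Longrightarrow> act u J = V \<Longrightarrow> J = V"
    and T_in: "i \<in> N \<Longrightarrow> T i \<in> X i" and T_ne: "i \<in> N \<Longrightarrow> T i \<noteq> V"
    and bounded: "i \<in> N \<Longrightarrow> I \<in> X i \<Longrightarrow> I \<noteq> V \<Longrightarrow> J \<in> X i \<Longrightarrow> \<exists>u\<in>U. act u I \<subseteq> J"
    and independent: "i \<in> N \<Longrightarrow> I \<in> Y \<Longrightarrow> I' \<in> Y \<Longrightarrow> (\<And>j. j \<in> N \<Longrightarrow> E j I = V \<Longrightarrow> E j I' = V) \<Longrightarrow>
      \<exists>u\<in>U. (\<forall>J\<in>X i. act u J = J) \<and> (\<forall>j\<in>N - {i}. act u (E j I) \<subseteq> E j I')"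
begin

text \<open>
  A coordinate equal to \<open>V\<close> remains \<open>V\<close> under every closure, so only the other ones carry information.
\<close>

definition dom :: "'a set \<Rightarrow> 'i set" where
  "dom I = {i \<in> N. E i I \<noteq> V}"

text \<open>
  For \<open>SS = Pow N\<close> this is all of \<open>Y\<close>, which leads to semistar operations; for \<open>SS = {N}\<close> it consists
  of the tuples that are proper everywhere, which leads to operations on fractional ideals. Both cases
  are treated at once.
\<close>

definition with_dom :: "'i set set \<Rightarrow> 'a set set" where
  "with_dom SS = {I \<in> Y. dom I \<in> SS}"

definition tuple :: "'i set \<Rightarrow> 'i \<Rightarrow> 'a set \<Rightarrow> 'a set" where
  "tuple S i J = V \<inter> (\<Inter>k\<in>N. if k = i then J else if k \<in> S then T k else V)"

text \<open>
  The value at \<open>V\<close> is prescribed, because a tuple with \<open>i\<close>-th coordinate \<open>V\<close> has domain \<open>S - {i}\<close>,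
  which need not lie in \<open>SS\<close>.
\<close>

definition component :: "'i set set \<Rightarrow> ('a set \<Rightarrow> 'a set) \<Rightarrow> 'i set \<times> 'i \<Rightarrow> 'a set \<Rightarrow> 'a set" where
  "component SS c = (\<lambda>(S, i)\<in>(SIGMA S:SS. S). \<lambda>J\<in>X i. if J = V then V else E i (c (tuple S i J)))"

lemma le_by_E:
  assumes "I \<in> Y" "I' \<in> Y" "\<And>i. i \<in> N \<Longrightarrow> E i I \<subseteq> E i I'"
  shows "I \<subseteq> I'"
  using glue_E[OF assms(1)] glue_E[OF assms(2)] assms(3) by blast

lemma eq_by_E:
  assumes "I \<in> Y" "I' \<in> Y" "\<And>i. i \<in> N \<Longrightarrow> E i I = E i I'"
  shows "I = I'"
  using le_by_E[of I I'] le_by_E[of I' I] assms by simp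

lemma dom_sub: "dom I \<subseteq> N"
  unfolding dom_def by blast

lemma dom_act: "u \<in> U \<Longrightarrow> I \<in> Y \<Longrightarrow> dom (act u I) = dom I"
  unfolding dom_def using E_act act_eq_V[OF _ _ E_in] act_V by (metis (no_types, lifting))

lemma with_domD: "I \<in> with_dom SS \<Longrightarrow> I \<in> Y" "I \<in> with_dom SS \<Longrightarrow> dom I \<in> SS"
  unfolding with_dom_def by auto

lemma with_dom_act: "u \<in> U \<Longrightarrow> I \<in> with_dom SS \<Longrightarrow> act u I \<in> with_dom SS"
  using act_Y dom_act unfolding with_dom_def by simp

lemma dom_antimono: "I \<in> Y \<Longrightarrow> I' \<in> Y \<Longrightarrow> I \<subseteq> I' \<Longrightarrow> dom I' \<subseteq> dom I"
  unfolding dom_def using E_mono[of _ I I'] X_le[OF _ E_in[of _ I']] by blast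

lemma tuple:
  assumes "S \<subseteq> N" "i \<in> S" "J \<in> X i"
  shows tuple_in: "tuple S i J \<in> Y" and E_tuple: "E i (tuple S i J) = J"
    and dom_tuple: "J \<noteq> V \<Longrightarrow> dom (tuple S i J) = S"
proof -
  let ?F = "\<lambda>k. if k = i then J else if k \<in> S then T k else V"
  have F: "\<And>k. k \<in> N \<Longrightarrow> ?F k \<in> X k" using assms T_in V_in by auto
  show "tuple S i J \<in> Y" unfolding tuple_def using glue_in[of ?F, OF F] by simp
  have E: "E k (tuple S i J) = ?F k" if "k \<in> N" for k
    unfolding tuple_def using E_glue[of ?F, OF F that] by simp
  show "E i (tuple S i J) = J" using E[of i] assms by auto
  assume "J \<noteq> V"
  then show "dom (tuple S i J) = S"
    unfolding dom_def using E T_ne assms by (auto split: if_splits)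
qed

lemma tuple_mono: "J \<subseteq> J' \<Longrightarrow> tuple S i J \<subseteq> tuple S i J'"
  unfolding tuple_def by (auto split: if_splits)

context
  fixes SS :: "'i set set"
  assumes SS: "SS \<subseteq> Pow N"
begin

abbreviation "A i \<equiv> eq_clos act U (X i)"
abbreviation "top_op i \<equiv> const_on (X i) V"

lemma top_iff:
  assumes "i \<in> N" "c \<in> A i" "J \<in> X i" "J \<noteq> V"
  shows "c = top_op i \<longleftrightarrow> c J = V"
proof
  assume "c J = V"
  then show "c = top_op i"
    using assms X_le act_V act_X bounded V_in by (intro eq_clos_top_dichotomy[of c act U "X i" V J]) auto
qed (use assms in \<open>simp add: const_on_def\<close>)

lemma index_in: "S \<in> SS \<Longrightarrow> i \<in> S \<Longrightarrow> i \<in> N"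
  using SS by blast

lemma S_sub: "S \<in> SS \<Longrightarrow> S \<subseteq> N"
  using SS by blast

lemma tuple_with_dom:
  assumes "S \<in> SS" "i \<in> S" "J \<in> X i" "J \<noteq> V"
  shows "tuple S i J \<in> with_dom SS"
  using tuple_in[OF S_sub] dom_tuple[OF S_sub] assms unfolding with_dom_def by simp

text \<open>
  The coordinates of a closure depend on the corresponding coordinate and on the domain alone. By independence
  some \<open>u\<close> fixes the \<open>i\<close>-th coordinate and moves all others below those of \<open>I'\<close>; then \<open>act u I \<subseteq> I'\<close>, and
  the closures are compared in the \<open>i\<close>-th coordinate, where \<open>u\<close> is invisible.
\<close>

lemma component_le:
  assumes c: "c \<in> eq_clos act U (with_dom SS)" and I: "I \<in> with_dom SS" and I': "I' \<in> with_dom SS"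
    and i: "i \<in> N" "E i I \<subseteq> E i I'" and d: "dom I' \<subseteq> dom I"
  shows "E i (c I) \<subseteq> E i (c I')"
proof -
  note IY = with_domD(1)[OF I] with_domD(1)[OF I']
  have "\<exists>u\<in>U. (\<forall>J\<in>X i. act u J = J) \<and> (\<forall>j\<in>N - {i}. act u (E j I) \<subseteq> E j I')"
    using d unfolding dom_def by (intro independent[OF i(1) IY]) blast
  then obtain u where u0: "u \<in> U"
    "(\<forall>J\<in>X i. act u J = J) \<and> (\<forall>j\<in>N - {i}. act u (E j I) \<subseteq> E j I')" by (rule bexE)
  then have u: "u \<in> U" "\<And>J. J \<in> X i \<Longrightarrow> act u J = J"
    "\<And>j. j \<in> N - {i} \<Longrightarrow> act u (E j I) \<subseteq> E j I'" by simp_all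
  have "act u I \<subseteq> I'"
  proof (rule le_by_E[OF act_Y[OF u(1) IY(1)] IY(2)])
    fix j assume "j \<in> N"
    then show "E j (act u I) \<subseteq> E j I'"
      using E_act[OF _ u(1) IY(1), of j] u(2)[OF E_in[OF i(1) IY(1)]] u(3)[of j] i(2)
      by (cases "j = i") auto
  qed
  then have "c (act u I) \<subseteq> c I'"
    using eq_clos_mono[OF c with_dom_act[OF u(1) I] I'] by blast
  then have "act u (c I) \<subseteq> c I'"
    using eq_clos_act[OF c u(1) I] by simp
  moreover have cY: "c I \<in> Y" "c I' \<in> Y"
    using eq_clos_closed[OF c] I I' with_domD(1) by blast+
  ultimately have "E i (act u (c I)) \<subseteq> E i (c I')"
    using E_mono[OF i(1) act_Y[OF u(1)]] by blast
  then show ?thesis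
    using E_act[OF i(1) u(1) cY(1)] u(2)[OF E_in[OF i(1) cY(1)]] by simp
qed

lemma component_cong:
  assumes c: "c \<in> eq_clos act U (with_dom SS)" and "I \<in> with_dom SS" "I' \<in> with_dom SS"
    and "i \<in> N" "E i I = E i I'" "dom I' = dom I"
  shows "E i (c I) = E i (c I')"
  using component_le[OF c, of I I' i] component_le[OF c, of I' I i] assms by simp

lemma component_apply:
  assumes "S \<in> SS" "i \<in> S" "J \<in> X i"
  shows "component SS c (S, i) J = (if J = V then V else E i (c (tuple S i J)))"
  using assms unfolding component_def by simp

lemma E_closure:
  assumes c: "c \<in> eq_clos act U (with_dom SS)" and I: "I \<in> with_dom SS" and i: "i \<in> dom I"
  shows "E i (c I) = component SS c (dom I, i) (E i I)"
proof -
  have dS: "dom I \<in> SS" using with_domD(2)[OF I] .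
  have iN: "i \<in> N" using i dom_sub by blast
  have EX: "E i I \<in> X i" "E i I \<noteq> V"
    using E_in[OF iN with_domD(1)[OF I]] i unfolding dom_def by auto
  have "E i (c I) = E i (c (tuple (dom I) i (E i I)))"
    using E_tuple[OF dom_sub i EX(1)] dom_tuple[OF dom_sub i EX] tuple_with_dom[OF dS i EX] I iN
    by (intro component_cong[OF c]) auto
  then show ?thesis
    unfolding component_apply[OF dS i EX(1)] using EX(2) by simp
qed

lemma E_closure_outside:
  assumes c: "c \<in> eq_clos act U (with_dom SS)" and I: "I \<in> with_dom SS" and i: "i \<in> N" "i \<notin> dom I"
  shows "E i (c I) = V"
proof -
  have cI: "c I \<in> Y" using eq_clos_closed[OF c I] by (rule with_domD)
  have "E i I = V" using i unfolding dom_def by blast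
  then show ?thesis
    using E_mono[OF i(1) with_domD(1)[OF I] cI eq_clos_extensive[OF c I]] X_le[OF i(1) E_in[OF i(1) cI]]
    by blast
qed

text \<open>
  For idempotence, the closure of a tuple is compared with the tuple that has the same \<open>i\<close>-th
  coordinate and the original domain.
\<close>

lemma component_in:
  assumes c: "c \<in> eq_clos act U (with_dom SS)" and S: "S \<in> SS" "i \<in> S"
  shows "component SS c (S, i) \<in> A i"
proof (rule eq_closI)
  note iN = index_in[OF S] and ap = component_apply[OF S] and wd = tuple_with_dom[OF S]
  note Et = E_tuple[OF S_sub[OF S(1)] S(2)] and dt = dom_tuple[OF S_sub[OF S(1)] S(2)]
  note cY = with_domD(1)[OF eq_clos_closed[OF c wd]]
  show "component SS c (S, i) \<in> extensional (X i)"
    using S unfolding component_def by simp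
  fix J assume J: "J \<in> X i"
  show clX: "component SS c (S, i) J \<in> X i"
    using ap[OF J] E_in[OF iN cY] V_in[OF iN] J by simp
  show "J \<subseteq> component SS c (S, i) J"
  proof (cases "J = V")
    case False
    then have "E i (tuple S i J) \<subseteq> E i (c (tuple S i J))"
      using E_mono[OF iN with_domD(1)[OF wd] cY] eq_clos_extensive[OF c wd] J by blast
    then show ?thesis unfolding ap[OF J] using False Et[OF J] by simp
  qed (use ap[OF J] in simp)
  show "component SS c (S, i) J \<subseteq> component SS c (S, i) J'" if J': "J' \<in> X i" "J \<subseteq> J'" for J'
  proof (cases "J' = V")
    case True
    then show ?thesis using X_le[OF iN clX] ap[OF J'(1)] by simp
  next
    case False
    then have nV: "J \<noteq> V" using J' X_le[OF iN] by blast
    have "E i (c (tuple S i J)) \<subseteq> E i (c (tuple S i J'))"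
      using E_mono[OF iN cY cY] eq_clos_mono[OF c wd wd tuple_mono] J J' nV False by blast
    then show ?thesis using ap[OF J] ap[OF J'(1)] nV False by simp
  qed
  show "component SS c (S, i) (component SS c (S, i) J) \<subseteq> component SS c (S, i) J"
  proof (cases "component SS c (S, i) J = V")
    case True
    then show ?thesis using ap[OF V_in[OF iN]] by simp
  next
    case False
    then have nV: "J \<noteq> V" using ap[OF J] by auto
    define I where "I = tuple S i J"
    have I: "I \<in> with_dom SS" unfolding I_def using wd[OF J nV] .
    have J1: "component SS c (S, i) J = E i (c I)" unfolding ap[OF J] I_def using nV by simp
    define I' where "I' = tuple S i (E i (c I))"
    have J1X: "E i (c I) \<in> X i" "E i (c I) \<noteq> V" using clX False J1 by auto
    have "E i (c I') \<subseteq> E i (c (c I))"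
    proof (rule component_le[OF c])
      show "I' \<in> with_dom SS" unfolding I'_def using wd[OF J1X] .
      show "c I \<in> with_dom SS" using eq_clos_closed[OF c I] .
      \<comment> \<open>the closure of a tuple has at most the domain of the tuple\<close>
      show "dom (c I) \<subseteq> dom I'"
        unfolding I'_def dt[OF J1X]
        using dom_antimono[OF with_domD(1)[OF I] _ eq_clos_extensive[OF c I]]
          with_domD(1)[OF eq_clos_closed[OF c I]] dt[OF J nV] unfolding I_def by blast
    qed (use iN Et[OF J1X(1)] I'_def in auto)
    then show ?thesis
      unfolding J1 ap[OF J1X(1)] using J1X(2) eq_clos_idem[OF c I] unfolding I'_def by simp
  qed
  show "act u (component SS c (S, i) J) = component SS c (S, i) (act u J)" if u: "u \<in> U" for u
  proof (cases "J = V")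
    case True
    then show ?thesis using act_V[OF u] ap[OF V_in[OF iN]] by simp
  next
    case False
    have uJ: "act u J \<in> X i" "act u J \<noteq> V"
      using act_X[OF iN u J] act_eq_V[OF iN u J] False by auto
    have "E i (c (act u (tuple S i J))) = E i (c (tuple S i (act u J)))"
    proof (rule component_cong[OF c])
      show "E i (act u (tuple S i J)) = E i (tuple S i (act u J))"
        using E_act[OF iN u with_domD(1)[OF wd[OF J False]]] Et[OF J] Et[OF uJ(1)] by simp
      show "dom (tuple S i (act u J)) = dom (act u (tuple S i J))"
        using dom_act[OF u with_domD(1)[OF wd[OF J False]]] dt[OF J False] dt[OF uJ] by simp
    qed (use with_dom_act[OF u wd[OF J False]] wd[OF uJ] iN in auto)
    then show ?thesis
      unfolding ap[OF J] ap[OF uJ(1)]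
      using False uJ(2) eq_clos_act[OF c u wd[OF J False]] E_act[OF iN u cY[OF J False]] by simp
  qed
qed

lemma component_top_iff:
  assumes c: "c \<in> eq_clos act U (with_dom SS)" and I: "I \<in> with_dom SS" and i: "i \<in> dom I"
  shows "component SS c (dom I, i) = top_op i \<longleftrightarrow> E i (c I) = V"
proof -
  have iN: "i \<in> N" using i dom_sub by blast
  show ?thesis
    unfolding E_closure[OF assms]
    using i E_in[OF iN with_domD(1)[OF I]]
    by (intro top_iff[OF iN component_in[OF c with_domD(2)[OF I] i]]) (auto simp: dom_def)
qed

lemma ex_with_dom:
  assumes "S \<in> SS" "S \<noteq> {}"
  shows "\<exists>I\<in>with_dom SS. dom I = S"
proof -
  obtain i where "i \<in> S" using assms by blast
  then show ?thesis
    using tuple_with_dom[of S i "T i"] dom_tuple[OF S_sub, of S i "T i"] assms(1) T_in T_ne index_in by blast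
qed

text \<open>
  A closure can only shrink the domain, and by boundedness of \<open>X i\<close> whether the index \<open>i\<close> is lost
  depends on the induced operation and not on the coordinate it is applied to.
\<close>

lemma dom_closure:
  assumes c: "c \<in> eq_clos act U (with_dom SS)" and I: "I \<in> with_dom SS"
  shows "dom (c I) = {i \<in> dom I. component SS c (dom I, i) \<noteq> top_op i}"
proof -
  have "dom (c I) \<subseteq> dom I"
    using dom_antimono[OF with_domD(1)[OF I] with_domD(1)[OF eq_clos_closed[OF c I]]
        eq_clos_extensive[OF c I]] .
  moreover have "i \<in> dom (c I) \<longleftrightarrow> component SS c (dom I, i) \<noteq> top_op i" if "i \<in> dom I" for i
    using component_top_iff[OF c I that] that dom_sub unfolding dom_def by blast
  ultimately show ?thesis by blast
qed

lemma component_in_fam: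
  assumes c: "c \<in> eq_clos act U (with_dom SS)"
  shows "component SS c \<in> fam SS A (\<lambda>i. cl_le (X i)) top_op"
proof (rule famI)
  show "component SS c \<in> extensional (SIGMA S:SS. S)" unfolding component_def by simp
  have anti: "cl_le (X i) (component SS c (S', i)) (component SS c (S, i))"
    if S: "S \<in> SS" "S' \<in> SS" "S \<subseteq> S'" "i \<in> S" for S S' i
    unfolding cl_le_def
  proof
    fix J assume J: "J \<in> X i"
    have i': "i \<in> S'" using S by blast
    show "component SS c (S', i) J \<subseteq> component SS c (S, i) J"
    proof (cases "J = V")
      case False
      have "E i (c (tuple S' i J)) \<subseteq> E i (c (tuple S i J))"
        using tuple_with_dom[OF S(2) i' J False] tuple_with_dom[OF S(1,4) J False]
          index_in[OF S(1,4)] E_tuple[OF S_sub[OF S(1)] S(4) J] E_tuple[OF S_sub[OF S(2)] i' J]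
          dom_tuple[OF S_sub[OF S(1)] S(4) J False] dom_tuple[OF S_sub[OF S(2)] i' J False] S(3)
        by (intro component_le[OF c]) auto
      then show ?thesis
        unfolding component_apply[OF S(2) i' J] component_apply[OF S(1,4) J] using False by simp
    qed (use component_apply[OF S(2) i' J, of c] component_apply[OF S(1,4) J, of c] in simp)
  qed
  then show "\<And>S S' i. S \<in> SS \<Longrightarrow> S' \<in> SS \<Longrightarrow> S \<subseteq> S' \<Longrightarrow> i \<in> S \<Longrightarrow>
    cl_le (X i) (component SS c (S', i)) (component SS c (S, i))" .
  fix S assume S: "S \<in> SS"
  show sh: "{i \<in> S. component SS c (S, i) \<noteq> top_op i} \<in> SS"
  proof (cases "S = {}")
    case False
    then obtain I where "I \<in> with_dom SS" "dom I = S" using ex_with_dom[OF S] by blast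
    then show ?thesis
      using dom_closure[OF c, of I] with_domD(2)[OF eq_clos_closed[OF c, of I]] by simp
  qed (use S in simp)
  fix i assume i: "i \<in> S"
  show "component SS c (S, i) \<in> A i" using component_in[OF c S i] .
  let ?S0 = "{i \<in> S. component SS c (S, i) \<noteq> top_op i}"
  assume ne: "component SS c (S, i) \<noteq> top_op i"
  then have i0: "i \<in> ?S0" using i by blast
  show "component SS c (?S0, i) = component SS c (S, i)"
  proof (rule cl_le_antisym[OF component_in[OF c sh i0] component_in[OF c S i]])
    show "cl_le (X i) (component SS c (S, i)) (component SS c (?S0, i))"
      using anti[OF sh S _ i0] by blast
    show "cl_le (X i) (component SS c (?S0, i)) (component SS c (S, i))"
      unfolding cl_le_def
    proof
      fix J assume J: "J \<in> X i"
      show "component SS c (?S0, i) J \<subseteq> component SS c (S, i) J"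
      proof (cases "J = V")
        case False
        define I where "I = tuple S i J"
        have I: "I \<in> with_dom SS" "dom I = S" "E i I = J"
          unfolding I_def using tuple_with_dom[OF S i J False] dom_tuple[OF S_sub[OF S] i J False]
            E_tuple[OF S_sub[OF S] i J] by auto
        have d: "dom (c I) = ?S0" using dom_closure[OF c I(1)] I(2) by simp
        have J1: "component SS c (S, i) J = E i (c I)"
          using E_closure[OF c I(1), of i] i I by simp
        have "component SS c (?S0, i) (E i (c I)) = E i (c (c I))"
          using E_closure[OF c eq_clos_closed[OF c I(1)], of i] i0 unfolding d by simp
        then have "component SS c (?S0, i) (component SS c (S, i) J) = component SS c (S, i) J"
          unfolding J1 eq_clos_idem[OF c I(1)] .
        then show ?thesis
          using eq_clos_mono[OF component_in[OF c sh i0] J eq_clos_closed[OF component_in[OF c S i] J]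
              eq_clos_extensive[OF component_in[OF c S i] J]] by simp
      qed (use component_apply[OF sh i0 J] component_apply[OF S i J] in simp)
    qed
  qed
qed

definition assemble :: "('i set \<times> 'i \<Rightarrow> 'a set \<Rightarrow> 'a set) \<Rightarrow> 'a set \<Rightarrow> 'a set" where
  "assemble a = (\<lambda>I\<in>with_dom SS. V \<inter> (\<Inter>i\<in>N. if i \<in> dom I then a (dom I, i) (E i I) else V))"

lemma assemble:
  assumes a: "a \<in> fam SS A (\<lambda>i. cl_le (X i)) top_op"
  shows assemble_in: "assemble a \<in> eq_clos act U (with_dom SS)"
    and component_assemble: "component SS (assemble a) = a"
proof -
  let ?F = "\<lambda>I i. if i \<in> dom I then a (dom I, i) (E i I) else V"
  have aA: "a (dom I, i) \<in> A i" if "I \<in> with_dom SS" "i \<in> dom I" for I i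
    using fam_closed[OF a with_domD(2)[OF that(1)] that(2)] .
  have EX: "E i I \<in> X i" if "I \<in> with_dom SS" "i \<in> N" for I i
    using E_in[OF that(2) with_domD(1)[OF that(1)]] .
  have F: "?F I i \<in> X i" if "I \<in> with_dom SS" "i \<in> N" for I i
    using eq_clos_closed[OF aA[OF that(1)] EX[OF that]] V_in[OF that(2)] by auto
  have asY: "assemble a I \<in> Y" if "I \<in> with_dom SS" for I
    unfolding assemble_def using that glue_in[of "?F I", OF F[OF that]] by simp
  have asE: "E i (assemble a I) = ?F I i" if "I \<in> with_dom SS" "i \<in> N" for I i
    unfolding assemble_def using that E_glue[of "?F I" i, OF F[OF that(1)]] by simp
  have asd: "dom (assemble a I) = {i \<in> dom I. a (dom I, i) \<noteq> top_op i}" if I: "I \<in> with_dom SS" for I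
  proof -
    have "E i (assemble a I) \<noteq> V \<longleftrightarrow> i \<in> dom I \<and> a (dom I, i) \<noteq> top_op i" if i: "i \<in> N" for i
    proof (cases "i \<in> dom I")
      case True
      then have "E i I \<noteq> V" unfolding dom_def by blast
      then show ?thesis
        using top_iff[OF i aA[OF I True] EX[OF I i]] True asE[OF I i] by simp
    qed (use asE[OF I i] in simp)
    then show ?thesis using dom_sub unfolding dom_def[of "assemble a I"] by blast
  qed
  have asw: "assemble a I \<in> with_dom SS" if I: "I \<in> with_dom SS" for I
    using asY[OF I] asd[OF I] fam_shrink[OF a with_domD(2)[OF I]] unfolding with_dom_def by simp
  show in_c: "assemble a \<in> eq_clos act U (with_dom SS)"
  proof (rule eq_closI)
    show "assemble a \<in> extensional (with_dom SS)" unfolding assemble_def by simp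
    fix I assume I: "I \<in> with_dom SS"
    note IY = with_domD(1)[OF I]
    show "assemble a I \<in> with_dom SS" using asw[OF I] .
    show "I \<subseteq> assemble a I"
    proof (rule le_by_E[OF IY asY[OF I]])
      fix i assume i: "i \<in> N"
      show "E i I \<subseteq> E i (assemble a I)"
        using asE[OF I i] eq_clos_extensive[OF aA[OF I] EX[OF I i]] X_le[OF i EX[OF I i]] by simp
    qed
    show "assemble a I \<subseteq> assemble a I'" if I': "I' \<in> with_dom SS" "I \<subseteq> I'" for I'
    proof (rule le_by_E[OF asY[OF I] asY[OF I'(1)]])
      fix i assume i: "i \<in> N"
      have d: "dom I' \<subseteq> dom I" using dom_antimono[OF IY with_domD(1)[OF I'(1)] I'(2)] .
      show "E i (assemble a I) \<subseteq> E i (assemble a I')"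
      proof (cases "i \<in> dom I'")
        case True
        then have iI: "i \<in> dom I" using d by blast
        have "a (dom I, i) (E i I) \<subseteq> a (dom I', i) (E i I)"
          using fam_antimono[OF a with_domD(2)[OF I'(1)] with_domD(2)[OF I] d True] EX[OF I i]
          unfolding cl_le_def by blast
        also have "\<dots> \<subseteq> a (dom I', i) (E i I')"
          using eq_clos_mono[OF aA[OF I'(1) True] EX[OF I i] EX[OF I'(1) i]]
            E_mono[OF i IY with_domD(1)[OF I'(1)] I'(2)] by blast
        finally show ?thesis using asE[OF I i] asE[OF I'(1) i] True iI by simp
      next
        case False
        then show ?thesis using asE[OF I'(1) i] X_le[OF i F[OF I i]] asE[OF I i] by simp
      qed
    qed
    show "assemble a (assemble a I) \<subseteq> assemble a I"
    proof (rule le_by_E[OF asY[OF asw[OF I]] asY[OF I]])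
      fix i assume i: "i \<in> N"
      let ?S0 = "{i \<in> dom I. a (dom I, i) \<noteq> top_op i}"
      show "E i (assemble a (assemble a I)) \<subseteq> E i (assemble a I)"
      proof (cases "i \<in> ?S0")
        case True
        then have "a (?S0, i) = a (dom I, i)"
          using fam_stable[OF a with_domD(2)[OF I]] by blast
        then show ?thesis
          using asE[OF asw[OF I] i] asE[OF I i] True eq_clos_idem[OF aA[OF I] EX[OF I i]]
          unfolding asd[OF I] by simp
      next
        case False
        then have "E i (assemble a I) = V"
          using i unfolding asd[OF I, symmetric] dom_def[of "assemble a I"] by blast
        then show ?thesis using X_le[OF i EX[OF asw[OF asw[OF I]] i]] by (simp only:)
      qed
    qed
    show "act u (assemble a I) = assemble a (act u I)" if u: "u \<in> U" for u
    proof (rule eq_by_E[OF act_Y[OF u asY[OF I]] asY[OF with_dom_act[OF u I]]])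
      fix i assume i: "i \<in> N"
      show "E i (act u (assemble a I)) = E i (assemble a (act u I))"
        unfolding E_act[OF i u asY[OF I]] asE[OF I i] asE[OF with_dom_act[OF u I] i]
          dom_act[OF u IY] E_act[OF i u IY]
        using eq_clos_act[OF aA[OF I] u EX[OF I i]] act_V[OF u] by simp
    qed
  qed
  show "component SS (assemble a) = a"
  proof (rule extensionalityI[OF _ fam_ext[OF a]])
    show "component SS (assemble a) \<in> extensional (SIGMA S:SS. S)" unfolding component_def by simp
    fix p assume "p \<in> (SIGMA S:SS. S)"
    then obtain S i where S: "S \<in> SS" "i \<in> S" and p: "p = (S, i)" by auto
    have aS: "a (S, i) \<in> A i" using fam_closed[OF a S] .
    show "component SS (assemble a) p = a p"
      unfolding p
    proof (rule extensionalityI[OF eq_clos_ext[OF component_in[OF in_c S]] eq_clos_ext[OF aS]])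
      fix J assume J: "J \<in> X i"
      show "component SS (assemble a) (S, i) J = a (S, i) J"
      proof (cases "J = V")
        case True
        then show ?thesis
          using component_apply[OF S J] eq_clos_extensive[OF aS J]
            X_le[OF index_in[OF S] eq_clos_closed[OF aS J]] by auto
      next
        case False
        then show ?thesis
          using component_apply[OF S J] asE[OF tuple_with_dom[OF S J False] index_in[OF S]]
            dom_tuple[OF S_sub[OF S(1)] S(2) J False] E_tuple[OF S_sub[OF S(1)] S(2) J] S(2) by simp
      qed
    qed
  qed
qed

text \<open>
  The family of induced operations determines the operation, because a member of \<open>Y\<close> is glued from its
  coordinates, and \<open>assemble\<close> is the inverse construction.
\<close>

theorem order_iso_component:
  "order_iso (eq_clos act U (with_dom SS)) (cl_le (with_dom SS))
     (fam SS A (\<lambda>i. cl_le (X i)) top_op) (fam_le SS (\<lambda>i. cl_le (X i))) (component SS)"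
proof (rule order_isoI)
  fix c d assume c: "c \<in> eq_clos act U (with_dom SS)" and d: "d \<in> eq_clos act U (with_dom SS)"
  show "component SS c \<in> fam SS A (\<lambda>i. cl_le (X i)) top_op" using component_in_fam[OF c] .
  show "cl_le (with_dom SS) c d \<longleftrightarrow> fam_le SS (\<lambda>i. cl_le (X i)) (component SS c) (component SS d)"
  proof
    assume le: "cl_le (with_dom SS) c d"
    have "component SS c (S, i) J \<subseteq> component SS d (S, i) J" if S: "S \<in> SS" "i \<in> S" "J \<in> X i" for S i J
    proof (cases "J = V")
      case False
      note w = tuple_with_dom[OF S False]
      have "c (tuple S i J) \<subseteq> d (tuple S i J)" using le w unfolding cl_le_def by blast
      then have "E i (c (tuple S i J)) \<subseteq> E i (d (tuple S i J))"
        using E_mono[OF index_in[OF S(1,2)]] with_domD(1)[OF eq_clos_closed[OF c w]]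
          with_domD(1)[OF eq_clos_closed[OF d w]] by blast
      then show ?thesis unfolding component_apply[OF S] using False by simp
    qed (use component_apply[OF S] in simp)
    then show "fam_le SS (\<lambda>i. cl_le (X i)) (component SS c) (component SS d)"
      unfolding fam_le_def cl_le_def by blast
  next
    assume le: "fam_le SS (\<lambda>i. cl_le (X i)) (component SS c) (component SS d)"
    show "cl_le (with_dom SS) c d"
      unfolding cl_le_def
    proof
      fix I assume I: "I \<in> with_dom SS"
      show "c I \<subseteq> d I"
      proof (rule le_by_E)
        show "c I \<in> Y" "d I \<in> Y"
          using eq_clos_closed[OF c I] eq_clos_closed[OF d I] by (auto dest: with_domD)
        fix i assume i: "i \<in> N"
        show "E i (c I) \<subseteq> E i (d I)"
        proof (cases "i \<in> dom I")
          case True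
          then show ?thesis
            using le with_domD(2)[OF I] E_in[OF i with_domD(1)[OF I]]
            unfolding E_closure[OF c I True] E_closure[OF d I True] fam_le_def cl_le_def by blast
        next
          case False
          then show ?thesis
            using E_closure_outside[OF c I i] E_closure_outside[OF d I i] by simp
        qed
      qed
    qed
  qed
  show "c = d" if "cl_le (with_dom SS) c d" "cl_le (with_dom SS) d c"
    using cl_le_antisym[OF c d that] .
next
  fix a assume a: "a \<in> fam SS A (\<lambda>i. cl_le (X i)) top_op"
  then show "\<exists>c\<in>eq_clos act U (with_dom SS). component SS c = a"
    using assemble_in component_assemble by blast
  show "fam_le SS (\<lambda>i. cl_le (X i)) a a" unfolding fam_le_def cl_le_def by blast
qed

end

end

section \<open>Submodules of a field and valuation rings\<close>

text \<open>
  The submodules of \<open>K\<close> over a subring \<open>B\<close>; closure under negatives follows from \<open>-1 \<in> B\<close>.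
\<close>

definition rmod :: "('a, 'm) ring_scheme \<Rightarrow> 'a set \<Rightarrow> 'a set \<Rightarrow> bool" where
  "rmod K B I \<longleftrightarrow> I \<subseteq> carrier K \<and> \<zero>\<^bsub>K\<^esub> \<in> I \<and> (\<forall>x\<in>I. \<forall>y\<in>I. x \<oplus>\<^bsub>K\<^esub> y \<in> I) \<and>
     (\<forall>r\<in>B. \<forall>x\<in>I. r \<otimes>\<^bsub>K\<^esub> x \<in> I)"

definition valuation_ring :: "('a, 'm) ring_scheme \<Rightarrow> 'a set \<Rightarrow> bool" where
  "valuation_ring K V \<longleftrightarrow> subring V K \<and> (\<forall>x\<in>carrier K - V. inv\<^bsub>K\<^esub> x \<in> V)"

definition runits :: "('a, 'm) ring_scheme \<Rightarrow> 'a set \<Rightarrow> 'a set" where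
  "runits K V = {x \<in> V. x \<noteq> \<zero>\<^bsub>K\<^esub> \<and> inv\<^bsub>K\<^esub> x \<in> V}"

definition nonunits :: "('a, 'm) ring_scheme \<Rightarrow> 'a set \<Rightarrow> 'a set" where
  "nonunits K V = V - runits K V"

text \<open>
  When \<open>V\<close> is a valuation ring with maximal ideal \<open>m\<close> and \<open>B\<close> is a subring with \<open>m \<subseteq> B \<subseteq> V\<close>, these are
  the nonzero \<open>B/m\<close>-submodules of the residue field \<open>V/m\<close>. If \<open>V/m\<close> is the quotient field of \<open>B/m\<close>,
  then \<open>Clos K B V\<close> below consists of the semistar operations on \<open>B/m\<close>. Working between \<open>m\<close> and \<open>V\<close>
  keeps the whole recursion inside one field.
\<close>

definition mods :: "('a, 'm) ring_scheme \<Rightarrow> 'a set \<Rightarrow> 'a set \<Rightarrow> 'a set set" where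
  "mods K B V = {I. rmod K B I \<and> nonunits K V \<subset> I \<and> I \<subseteq> V}"

definition Clos :: "('a, 'm) ring_scheme \<Rightarrow> 'a set \<Rightarrow> 'a set \<Rightarrow> ('a set \<Rightarrow> 'a set) set" where
  "Clos K B V = eq_clos (l_coset K) (runits K V) (mods K B V)"

context field
begin

lemma nz_inv:
  assumes "x \<in> carrier R" "x \<noteq> \<zero>"
  shows "inv x \<in> carrier R" "inv x \<noteq> \<zero>" "x \<otimes> inv x = \<one>" "inv x \<otimes> x = \<one>" "inv (inv x) = x"
proof -
  have u: "x \<in> Units R" using assms field_Units by blast
  then show "inv x \<in> carrier R" "x \<otimes> inv x = \<one>" "inv x \<otimes> x = \<one>" "inv (inv x) = x"
    using assms by auto
  show "inv x \<noteq> \<zero>" using u field_Units by blast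
qed

lemma nz_cancel:
  assumes "x \<in> carrier R" "x \<noteq> \<zero>" "y \<in> carrier R"
  shows "x \<otimes> (inv x \<otimes> y) = y" "inv x \<otimes> (x \<otimes> y) = y" "(y \<otimes> x) \<otimes> inv x = y" "(y \<otimes> inv x) \<otimes> x = y"
    "x \<otimes> (y \<otimes> inv x) = y" "inv x \<otimes> (y \<otimes> x) = y"
proof -
  note x = nz_inv[OF assms(1,2)]
  show "x \<otimes> (inv x \<otimes> y) = y" "inv x \<otimes> (x \<otimes> y) = y"
    using x assms by (simp_all add: m_assoc[symmetric])
  show "(y \<otimes> x) \<otimes> inv x = y" "(y \<otimes> inv x) \<otimes> x = y"
    using x assms by (simp_all add: m_assoc)
  show "x \<otimes> (y \<otimes> inv x) = y" "inv x \<otimes> (y \<otimes> x) = y"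
    using x assms m_lcomm[of x y "inv x"] m_lcomm[of "inv x" y x] by simp_all
qed

lemma nz_inv_mult:
  assumes "x \<in> carrier R" "x \<noteq> \<zero>" "y \<in> carrier R" "y \<noteq> \<zero>"
  shows "inv (x \<otimes> y) = inv x \<otimes> inv y" "x \<otimes> y \<noteq> \<zero>"
proof -
  note x = nz_inv[OF assms(1,2)] and y = nz_inv[OF assms(3,4)]
  have "(x \<otimes> y) \<otimes> (inv x \<otimes> inv y) = (x \<otimes> inv x) \<otimes> (y \<otimes> inv y)"
    using assms x(1) y(1) by (simp add: m_ac)
  then have "(x \<otimes> y) \<otimes> (inv x \<otimes> inv y) = \<one>" using x y by simp
  then show "inv (x \<otimes> y) = inv x \<otimes> inv y"
    using comm_inv_char[of "x \<otimes> y" "inv x \<otimes> inv y"] assms x(1) y(1) by simp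
  show "x \<otimes> y \<noteq> \<zero>" using integral_iff assms by simp
qed

lemma l_coset_mem_iff:
  assumes "u \<in> carrier R" "u \<noteq> \<zero>" "I \<subseteq> carrier R"
  shows "y \<in> u <# I \<longleftrightarrow> y \<in> carrier R \<and> inv u \<otimes> y \<in> I"
proof
  assume "y \<in> u <# I"
  then obtain i where i: "i \<in> I" "y = u \<otimes> i" unfolding l_coset_def by blast
  then show "y \<in> carrier R \<and> inv u \<otimes> y \<in> I"
    using assms nz_cancel(2)[OF assms(1,2), of i] by auto
next
  assume y: "y \<in> carrier R \<and> inv u \<otimes> y \<in> I"
  then have "y = u \<otimes> (inv u \<otimes> y)" using nz_cancel(1)[OF assms(1,2)] by simp
  then show "y \<in> u <# I" using y unfolding l_coset_def by blast
qed

lemma l_coset_image: "u <# I = (\<lambda>i. u \<otimes> i) ` I"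
  unfolding l_coset_def by blast

lemma l_coset_memI: "i \<in> I \<Longrightarrow> u \<otimes> i \<in> u <# I"
  unfolding l_coset_def by blast

lemma l_coset_mono: "I \<subseteq> J \<Longrightarrow> u <# I \<subseteq> u <# J"
  unfolding l_coset_def by blast

lemma l_coset_carrier: "u \<in> carrier R \<Longrightarrow> I \<subseteq> carrier R \<Longrightarrow> u <# I \<subseteq> carrier R"
  unfolding l_coset_def by blast

lemma l_coset_assoc: "u \<in> carrier R \<Longrightarrow> v \<in> carrier R \<Longrightarrow> I \<subseteq> carrier R \<Longrightarrow> u <# (v <# I) = (u \<otimes> v) <# I"
  unfolding l_coset_image image_image by (intro image_cong) (auto simp: m_assoc)

lemma l_coset_one: "I \<subseteq> carrier R \<Longrightarrow> \<one> <# I = I"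
  unfolding l_coset_image by (auto simp: subset_iff image_iff)

lemma l_coset_inv:
  assumes "u \<in> carrier R" "u \<noteq> \<zero>" "I \<subseteq> carrier R"
  shows "u <# (inv u <# I) = I" "inv u <# (u <# I) = I"
  using assms nz_inv[OF assms(1,2)] by (simp_all add: l_coset_assoc l_coset_one)

lemma l_coset_le_iff:
  assumes "u \<in> carrier R" "u \<noteq> \<zero>" "I \<subseteq> carrier R" "J \<subseteq> carrier R"
  shows "u <# I \<subseteq> J \<longleftrightarrow> I \<subseteq> inv u <# J" "u <# I \<subseteq> u <# J \<longleftrightarrow> I \<subseteq> J"
proof -
  note inv = nz_inv[OF assms(1,2)] and li = l_coset_inv[OF assms(1,2)]
  show "u <# I \<subseteq> J \<longleftrightarrow> I \<subseteq> inv u <# J"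
    using l_coset_mono[of "u <# I" J "inv u"] l_coset_mono[of I "inv u <# J" u] li assms by auto
  show "u <# I \<subseteq> u <# J \<longleftrightarrow> I \<subseteq> J"
    using l_coset_mono[of "u <# I" "u <# J" "inv u"] l_coset_mono[of I J u] li assms by auto
qed

lemma rmodD:
  assumes "rmod R B I"
  shows rmod_carrier: "I \<subseteq> carrier R" and rmod_zero: "\<zero> \<in> I"
    and rmod_add: "x \<in> I \<Longrightarrow> y \<in> I \<Longrightarrow> x \<oplus> y \<in> I"
    and rmod_smult: "r \<in> B \<Longrightarrow> x \<in> I \<Longrightarrow> r \<otimes> x \<in> I"
  using assms unfolding rmod_def by auto

lemma rmod_subring:
  assumes "subring B R"
  shows "rmod R B B"
  unfolding rmod_def using subringE(1,2,6,7)[OF assms] by blast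

lemma rmod_minus:
  assumes B: "subring B R" and I: "rmod R B I" and x: "x \<in> I"
  shows "\<ominus> x \<in> I"
proof -
  have "\<ominus> \<one> \<otimes> x \<in> I" using rmod_smult[OF I subringE(5)[OF B subringE(3)[OF B]] x] .
  then show ?thesis using x rmod_carrier[OF I] l_minus[of \<one> x] by auto
qed

lemma rmod_scale:
  assumes "rmod R B I" "B \<subseteq> carrier R" "u \<in> carrier R"
  shows "rmod R B (u <# I)"
  unfolding rmod_def
proof (intro conjI ballI)
  note I = rmodD[OF assms(1)]
  show "u <# I \<subseteq> carrier R" using l_coset_carrier[OF assms(3) I(1)] .
  have "u \<otimes> \<zero> \<in> u <# I" using l_coset_memI[OF I(2)] .
  then show "\<zero> \<in> u <# I" using assms(3) by simp
  fix x assume "x \<in> u <# I"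
  then obtain i where i: "i \<in> I" "x = u \<otimes> i" unfolding l_coset_def by blast
  show "x \<oplus> y \<in> u <# I" if y: "y \<in> u <# I" for y
  proof -
    obtain j where j: "j \<in> I" "y = u \<otimes> j" using y unfolding l_coset_def by blast
    have "x \<oplus> y = u \<otimes> (i \<oplus> j)" using i j I(1) assms(3) by (simp add: r_distr subset_iff)
    then show ?thesis using l_coset_memI[OF I(3)[OF i(1) j(1)]] by simp
  qed
  show "r \<otimes> x \<in> u <# I" if r: "r \<in> B" for r
  proof -
    have "r \<in> carrier R" "i \<in> carrier R" using r assms(2) i I(1) by auto
    then have "r \<otimes> x = u \<otimes> (r \<otimes> i)" using i assms(3) by (simp add: m_lcomm)
    then show ?thesis using l_coset_memI[OF I(4)[OF r i(1)]] by simp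
  qed
qed

lemma rmod_le: "rmod R B I \<Longrightarrow> B' \<subseteq> B \<Longrightarrow> rmod R B' I"
  unfolding rmod_def by blast

lemma rmod_Inter:
  assumes "\<And>I. I \<in> F \<Longrightarrow> rmod R B I" "F \<noteq> {}"
  shows "rmod R B (\<Inter>F)"
  using assms unfolding rmod_def by blast

lemma runits_mem:
  assumes "subring V R" "u \<in> runits R V"
  shows "u \<in> V" "inv u \<in> V" "u \<in> carrier R" "u \<noteq> \<zero>" "inv u \<in> carrier R" "inv u \<noteq> \<zero>"
  using assms subringE(1)[OF assms(1)] nz_inv[of u] unfolding runits_def by auto

lemma runits_closed:
  assumes "subring V R"
  shows runits_inv: "u \<in> runits R V \<Longrightarrow> inv u \<in> runits R V"
    and runits_mult: "u \<in> runits R V \<Longrightarrow> v \<in> runits R V \<Longrightarrow> u \<otimes> v \<in> runits R V"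
    and runits_one: "\<one> \<in> runits R V"
proof -
  show "inv u \<in> runits R V" if "u \<in> runits R V"
    using runits_mem[OF assms that] nz_inv(5)[of u] unfolding runits_def by simp
  show "u \<otimes> v \<in> runits R V" if "u \<in> runits R V" "v \<in> runits R V"
    using runits_mem[OF assms that(1)] runits_mem[OF assms that(2)] subringE(6)[OF assms]
      nz_inv_mult[of u v] unfolding runits_def by simp
  have "inv \<one> = \<one>" by simp
  then show "\<one> \<in> runits R V" unfolding runits_def using subringE(3)[OF assms] by simp
qed

lemma runits_scale:
  assumes "rmod R B I" "u \<in> B" "inv u \<in> B" "u \<in> carrier R" "u \<noteq> \<zero>"
  shows "u <# I = I"
proof
  show "u <# I \<subseteq> I" using rmod_smult[OF assms(1,2)] unfolding l_coset_def by blast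
  show "I \<subseteq> u <# I"
    using l_coset_mem_iff[OF assms(4,5) rmod_carrier[OF assms(1)]] rmod_smult[OF assms(1,3)]
      rmod_carrier[OF assms(1)] by blast
qed

lemma valuation_subring: "valuation_ring R V \<Longrightarrow> subring V R"
  unfolding valuation_ring_def by blast

lemma valuation_carrier: "valuation_ring R V \<Longrightarrow> V \<subseteq> carrier R"
  using subringE(1)[OF valuation_subring] .

lemma valuation_inv: "valuation_ring R V \<Longrightarrow> x \<in> carrier R \<Longrightarrow> x \<notin> V \<Longrightarrow> inv x \<in> nonunits R V"
proof -
  assume V: "valuation_ring R V" and x: "x \<in> carrier R" "x \<notin> V"
  have "x \<noteq> \<zero>" using x subringE(2)[OF valuation_subring[OF V]] by blast
  then show ?thesis using V x nz_inv[OF x(1)] unfolding valuation_ring_def nonunits_def runits_def by auto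
qed

lemma nonunits_iff:
  assumes "valuation_ring R V"
  shows "x \<in> nonunits R V \<longleftrightarrow> x \<in> carrier R \<and> (x = \<zero> \<or> inv x \<notin> V)"
proof
  assume "x \<in> nonunits R V"
  then show "x \<in> carrier R \<and> (x = \<zero> \<or> inv x \<notin> V)"
    using valuation_carrier[OF assms] unfolding nonunits_def runits_def by auto
next
  assume x: "x \<in> carrier R \<and> (x = \<zero> \<or> inv x \<notin> V)"
  show "x \<in> nonunits R V"
  proof (cases "x = \<zero>")
    case True
    then show ?thesis
      using subringE(2)[OF valuation_subring[OF assms]] unfolding nonunits_def runits_def by simp
  next
    case False
    then show ?thesis
      using valuation_inv[OF assms, of "inv x"] nz_inv[of x] x by simp
  qed
qed

lemma nonunits_le: "nonunits R V \<subseteq> V"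
  unfolding nonunits_def by blast

lemma nonunits_rmod:
  assumes V: "valuation_ring R V"
  shows "rmod R V (nonunits R V)"
proof -
  note VR = valuation_subring[OF V] and Vc = valuation_carrier[OF V]
  have mult: "r \<otimes> x \<in> nonunits R V" if r: "r \<in> V" and x: "x \<in> nonunits R V" for r x
  proof (rule ccontr)
    assume n: "r \<otimes> x \<notin> nonunits R V"
    have c: "r \<in> carrier R" "x \<in> carrier R" using r Vc x nonunits_iff[OF V] by auto
    then have n': "r \<otimes> x \<noteq> \<zero>" "inv (r \<otimes> x) \<in> V" using n nonunits_iff[OF V] by auto
    then have nz: "r \<noteq> \<zero>" "x \<noteq> \<zero>" using integral_iff c by auto
    have "r \<otimes> inv (r \<otimes> x) = inv x"
      using nz_inv_mult(1)[OF c(1) nz(1) c(2) nz(2)] nz_cancel(1)[OF c(1) nz(1)] nz_inv[OF c(2) nz(2)] by simp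
    then have "inv x \<in> V" using subringE(6)[OF VR r n'(2)] by simp
    then show False using x nz(2) nonunits_iff[OF V] by blast
  qed
  have add: "x \<oplus> y \<in> nonunits R V"
    if xy: "x \<in> nonunits R V" "y \<in> nonunits R V" "y \<noteq> \<zero>" "x \<otimes> inv y \<in> V" for x y
  proof -
    have c: "x \<in> carrier R" "y \<in> carrier R" using xy nonunits_iff[OF V] by auto
    have "\<one> \<oplus> x \<otimes> inv y \<in> V" using subringE(3,7)[OF VR] xy(4) by blast
    then have "(\<one> \<oplus> x \<otimes> inv y) \<otimes> y \<in> nonunits R V" using mult xy(2) by blast
    moreover have "(\<one> \<oplus> x \<otimes> inv y) \<otimes> y = x \<oplus> y"
      using c xy(3) nz_inv[OF c(2) xy(3)] nz_cancel(4)[OF c(2) xy(3) c(1)]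
      by (simp add: l_distr a_comm)
    ultimately show ?thesis by simp
  qed
  have z: "\<zero> \<in> nonunits R V" using nonunits_iff[OF V] by simp
  have "x \<oplus> y \<in> nonunits R V" if xy: "x \<in> nonunits R V" "y \<in> nonunits R V" for x y
  proof -
    have c: "x \<in> carrier R" "y \<in> carrier R" using xy nonunits_iff[OF V] by auto
    show ?thesis
    proof (cases "x = \<zero> \<or> y = \<zero>")
      case False
      then have nz: "x \<noteq> \<zero>" "y \<noteq> \<zero>" by auto
      have "inv (x \<otimes> inv y) = y \<otimes> inv x"
        using nz_inv_mult[OF c(1) nz(1), of "inv y"] nz_inv[OF c(2) nz(2)] nz_inv[OF c(1) nz(1)] c
        by (simp add: m_comm)
      then have "x \<otimes> inv y \<in> V \<or> y \<otimes> inv x \<in> V"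
        using valuation_inv[OF V, of "x \<otimes> inv y"] nonunits_le[of V] nz_inv(1)[OF c(2) nz(2)] c(1) by auto
      then show ?thesis using add[OF xy nz(2)] add[OF xy(2,1) nz(1)] a_comm[OF c] by auto
    qed (use xy c in auto)
  qed
  then show ?thesis unfolding rmod_def using mult z Vc nonunits_le by blast
qed

lemma runits_iff: "x \<in> runits R V \<longleftrightarrow> x \<in> V \<and> x \<notin> nonunits R V"
  unfolding nonunits_def runits_def by blast

lemma nonunits_antimono:
  assumes "valuation_ring R V" "valuation_ring R W" "W \<subseteq> V"
  shows "nonunits R V \<subseteq> nonunits R W"
  using nonunits_iff[OF assms(1)] nonunits_iff[OF assms(2)] assms(3) by blast

lemma runits_mono: "W \<subseteq> V \<Longrightarrow> runits R W \<subseteq> runits R V"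
  unfolding runits_def by blast

lemma nonunits_strict:
  assumes V: "valuation_ring R V" and W: "valuation_ring R W" and "W \<subset> V"
  shows "\<exists>p. p \<in> nonunits R W \<and> p \<in> runits R V"
proof -
  obtain x where x: "x \<in> V" "x \<notin> W" using assms(3) by blast
  have xc: "x \<in> carrier R" "x \<noteq> \<zero>"
    using x valuation_carrier[OF V] subringE(2)[OF valuation_subring[OF W]] by auto
  have p: "inv x \<in> nonunits R W" using valuation_inv[OF W xc(1) x(2)] .
  moreover have "inv x \<in> runits R V"
    using p nonunits_le[of W] assms(3) nz_inv[OF xc] x unfolding runits_def by auto
  ultimately show ?thesis by blast
qed

text \<open>A module over a valuation ring is comparable with every principal one.\<close>

lemma valuation_module_le:
  assumes W: "valuation_ring R W" and I: "rmod R W I" and y: "y \<in> carrier R" "y \<notin> I"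
  shows "I \<subseteq> y <# nonunits R W"
proof
  fix i assume i: "i \<in> I"
  have c: "i \<in> carrier R" using rmod_carrier[OF I] i by blast
  have y0: "y \<noteq> \<zero>" using y rmod_zero[OF I] by blast
  have "inv y \<otimes> i \<in> nonunits R W"
  proof (cases "i = \<zero>")
    case True
    then show ?thesis using rmod_zero[OF nonunits_rmod[OF W]] nz_inv[OF y(1) y0] by simp
  next
    case False
    have "inv (inv y \<otimes> i) = y \<otimes> inv i"
      using nz_inv_mult[OF _ _ c False, of "inv y"] nz_inv[OF y(1) y0] by simp
    moreover have "y \<otimes> inv i \<notin> W"
    proof
      assume "y \<otimes> inv i \<in> W"
      then have "(y \<otimes> inv i) \<otimes> i \<in> I" using rmod_smult[OF I _ i] by blast
      then show False using nz_cancel(4)[OF c False y(1)] y(2) by simp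
    qed
    ultimately show ?thesis
      using nonunits_iff[OF W] nz_inv[OF y(1) y0] c by simp
  qed
  then show "i \<in> y <# nonunits R W"
    using l_coset_mem_iff[OF y(1) y0] rmod_carrier[OF nonunits_rmod[OF W]] c by blast
qed

lemma modsD:
  assumes "I \<in> mods R B V"
  shows mods_rmod: "rmod R B I" and mods_nonunits: "nonunits R V \<subseteq> I" and mods_le: "I \<subseteq> V"
    and mods_unit: "\<exists>u. u \<in> I \<and> u \<in> runits R V"
  using assms unfolding mods_def nonunits_def by auto

lemma modsI:
  assumes "rmod R B I" "nonunits R V \<subseteq> I" "I \<subseteq> V" "u \<in> I" "u \<in> runits R V"
  shows "I \<in> mods R B V"
  using assms unfolding mods_def nonunits_def by blast

lemma mods_carrier: "I \<in> mods R B V \<Longrightarrow> I \<subseteq> carrier R"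
  using rmod_carrier[OF mods_rmod] .

lemma mods_V:
  assumes "valuation_ring R V" "subring B R" "B \<subseteq> V"
  shows "V \<in> mods R B V"
  using modsI[OF rmod_le[OF rmod_subring[OF valuation_subring[OF assms(1)]] assms(3)] nonunits_le,
      of \<one>] runits_one[OF valuation_subring[OF assms(1)]]
    subringE(3)[OF valuation_subring[OF assms(1)]] by blast

lemma mods_self:
  assumes "valuation_ring R V" "subring B R" "nonunits R V \<subseteq> B" "B \<subseteq> V"
  shows "B \<in> mods R B V"
  using modsI[OF rmod_subring[OF assms(2)] assms(3,4) subringE(3)[OF assms(2)]]
    runits_one[OF valuation_subring[OF assms(1)]] by blast

lemma runits_scale_mods:
  assumes V: "valuation_ring R V" and B: "B \<subseteq> V" and u: "u \<in> runits R V" and I: "I \<in> mods R B V"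
  shows "u <# I \<in> mods R B V"
proof -
  note uc = runits_mem[OF valuation_subring[OF V] u]
  obtain v where v: "v \<in> I" "v \<in> runits R V" using mods_unit[OF I] by blast
  have N: "u <# nonunits R V = nonunits R V" "u <# V = V"
    using runits_scale[OF nonunits_rmod[OF V] uc(1-4)]
      runits_scale[OF rmod_subring[OF valuation_subring[OF V]] uc(1-4)] by auto
  show ?thesis
  proof (rule modsI)
    show "rmod R B (u <# I)"
      using rmod_scale[OF mods_rmod[OF I]] B valuation_carrier[OF V] uc by blast
    show "nonunits R V \<subseteq> u <# I" using l_coset_mono[OF mods_nonunits[OF I], of u] N by simp
    show "u <# I \<subseteq> V" using l_coset_mono[OF mods_le[OF I], of u] N by simp
    show "u \<otimes> v \<in> u <# I" using l_coset_memI[OF v(1)] .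
    show "u \<otimes> v \<in> runits R V" using runits_mult[OF valuation_subring[OF V] u v(2)] .
  qed
qed

lemma runits_scale_V: "valuation_ring R V \<Longrightarrow> u \<in> runits R V \<Longrightarrow> u <# V = V"
  using runits_scale[OF rmod_subring[OF valuation_subring]] runits_mem[OF valuation_subring] by blast

lemma runits_scale_eq_V:
  assumes "valuation_ring R V" "u \<in> runits R V" "I \<subseteq> carrier R" "u <# I = V"
  shows "I = V"
proof -
  note u = runits_mem[OF valuation_subring[OF assms(1)] assms(2)]
  have "inv u <# (u <# I) = inv u <# V" using assms(4) by simp
  then show ?thesis
    using l_coset_inv(2)[OF u(3,4) assms(3)]
      runits_scale_V[OF assms(1) runits_inv[OF valuation_subring[OF assms(1)] assms(2)]] by simp
qed

end

section \<open>Cutting along a branch\<close>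

text \<open>
  The situation above a node of the tree: \<open>W\<close> is a valuation ring strictly below \<open>V\<close>, and \<open>B\<close> is
  squeezed between \<open>W\<close> and its maximal ideal. In other words, \<open>B\<close> is the preimage in \<open>W\<close> of a subring
  of the residue field of \<open>W\<close>.
\<close>

locale trunk = field R for R (structure) +
  fixes V W B
  assumes V: "valuation_ring R V" and W: "valuation_ring R W" and WV: "W \<subset> V"
    and B: "subring B R" and NB: "nonunits R W \<subseteq> B" and BW: "B \<subseteq> W"
begin

lemmas Vs = valuation_subring[OF V] and Ws = valuation_subring[OF W]
lemmas Vc = valuation_carrier[OF V] and Wc = valuation_carrier[OF W]

abbreviation "X \<equiv> mods R B V"
abbreviation "XW \<equiv> mods R W V"
abbreviation "XM \<equiv> mods R B W"

lemma WleV: "W \<subseteq> V" using WV by blast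
lemma BleV: "B \<subseteq> V" using WV BW by blast

lemmas act_X = runits_scale_mods[OF V BleV]
lemmas act_XW = runits_scale_mods[OF V WleV]
lemmas act_XM = runits_scale_mods[OF W BW]
lemmas U_mem = runits_mem[OF Vs]

lemma U_W: "u \<in> runits R W \<Longrightarrow> u \<in> runits R V"
  using runits_mono[OF WleV] by blast

lemma nonunits_VW: "nonunits R V \<subseteq> nonunits R W"
  using nonunits_antimono[OF V W WleV] .

lemma XW_sub: "I \<in> XW \<Longrightarrow> I \<in> X"
  using rmod_le[OF _ BW] unfolding mods_def by blast

lemma XM_sub: "J \<in> XM \<Longrightarrow> J \<in> X"
  using nonunits_VW WleV unfolding mods_def by blast

lemma W_in: "W \<in> XM" "W \<in> XW"
  using mods_V[OF W B BW] mods_self[OF V Ws _ WleV] nonunits_VW nonunits_le[of W] by auto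

text \<open>
  Different scalings of modules living inside \<open>W\<close> do not interfere: an element that is not a unit of
  \<open>W\<close> moves such a module either into the maximal ideal of \<open>W\<close> or above \<open>W\<close>.
\<close>

lemma le_trunk_cases:
  assumes J: "J \<in> XM" and J': "J' \<in> XM" and u: "u \<in> runits R V" and le: "J \<subseteq> u <# J'"
  shows "u \<in> runits R W \<or> W \<subseteq> u <# J'"
proof (rule disjCI)
  assume n: "\<not> W \<subseteq> u <# J'"
  note um = U_mem[OF u]
  show "u \<in> runits R W"
  proof (rule ccontr)
    assume nu: "u \<notin> runits R W"
    consider "u \<in> nonunits R W" | "u \<notin> W" using nu runits_iff by blast
    then show False
    proof cases
      case 1
      have "u <# J' \<subseteq> nonunits R W"
      proof
        fix x assume "x \<in> u <# J'"
        then obtain j where j: "j \<in> J'" "x = u \<otimes> j" unfolding l_coset_def by blast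
        have "j \<in> W" using j mods_le[OF J'] by blast
        then show "x \<in> nonunits R W"
          using rmod_smult[OF nonunits_rmod[OF W] _ 1, of j] um Wc j m_comm by auto
      qed
      then show False using le mods_unit[OF J] runits_iff by blast
    next
      case 2
      have iu: "inv u \<in> nonunits R W" using valuation_inv[OF W um(3) 2] .
      have "W \<subseteq> u <# J'"
      proof
        fix w assume w: "w \<in> W"
        have "w \<otimes> inv u \<in> nonunits R W" using rmod_smult[OF nonunits_rmod[OF W] w iu] .
        moreover have "w \<otimes> inv u = inv u \<otimes> w" using m_comm w Wc um by blast
        ultimately have "inv u \<otimes> w \<in> J'" using mods_nonunits[OF J'] by auto
        then show "w \<in> u <# J'" using l_coset_mem_iff[OF um(3,4) mods_carrier[OF J']] w Wc by blast
      qed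
      then show False using n by blast
    qed
  qed
qed

lemma scaled_W_le:
  assumes J: "J \<in> XM" and I: "rmod R W I" and u: "u \<in> carrier R" and le: "u <# J \<subseteq> I"
  shows "u <# W \<subseteq> I"
proof
  fix x assume "x \<in> u <# W"
  then obtain w where w: "w \<in> W" "x = u \<otimes> w" unfolding l_coset_def by blast
  obtain v where v: "v \<in> J" "v \<in> runits R W" using mods_unit[OF J] by blast
  note vm = runits_mem[OF Ws v(2)]
  have "u \<otimes> v \<in> I" using le l_coset_memI[OF v(1)] by blast
  then have "(w \<otimes> inv v) \<otimes> (u \<otimes> v) \<in> I"
    using rmod_smult[OF I] subringE(6)[OF Ws w(1) vm(2)] by blast
  moreover have "(w \<otimes> inv v) \<otimes> (u \<otimes> v) = u \<otimes> w"
    using w Wc u vm nz_cancel(2)[OF vm(3,4), of "w \<otimes> u"] by (simp add: m_ac subset_iff)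
  ultimately show "x \<in> I" using w by simp
qed

lemma W_le:
  assumes "J \<in> XM" "rmod R W I" "J \<subseteq> I"
  shows "W \<subseteq> I"
  using scaled_W_le[of J I \<one>] assms l_coset_one[OF Wc] l_coset_one[OF mods_carrier[OF assms(1)]] by simp

text \<open>
  If \<open>w \<otimes> i \<notin> I\<close> with \<open>w \<in> W\<close> and \<open>i \<in> I\<close>, then \<open>I \<subseteq> i <# W\<close>: for \<open>j \<in> I\<close> outside \<open>i <# W\<close> the
  quotient of \<open>i\<close> by \<open>j\<close> would be a nonunit of \<open>W\<close>, and \<open>w \<otimes> i\<close> would be a multiple of \<open>j\<close> by an
  element of \<open>B\<close>. Hence a module that is not a \<open>W\<close>-module lies, after division by \<open>i\<close>, between the
  maximal ideal of \<open>W\<close> and \<open>W\<close>.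
\<close>

lemma not_XW_form:
  assumes I: "I \<in> X" "I \<notin> XW"
  shows "\<exists>u\<in>runits R V. \<exists>J\<in>XM. J \<noteq> W \<and> I = u <# J"
proof -
  note Im = rmodD[OF mods_rmod[OF I(1)]]
  have "\<not> rmod R W I" using I unfolding mods_def by blast
  then obtain w i where wi: "w \<in> W" "i \<in> I" "w \<otimes> i \<notin> I"
    using Im unfolding rmod_def by blast
  have iV: "i \<in> V" using mods_le[OF I(1)] wi by blast
  have c: "w \<in> carrier R" "i \<in> carrier R" using wi Wc iV Vc by auto
  have "i \<notin> nonunits R V"
    using rmod_smult[OF nonunits_rmod[OF V], of w i] wi WleV mods_nonunits[OF I(1)] by blast
  then have u: "i \<in> runits R V" using runits_iff iV by blast
  note um = U_mem[OF u]
  define J where "J = inv i <# I"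
  have Jmem: "j \<in> J \<longleftrightarrow> j \<in> carrier R \<and> i \<otimes> j \<in> I" for j
    unfolding J_def using l_coset_mem_iff[OF um(5,6) Im(1), of j] nz_inv(5)[OF um(3,4)] by simp
  have JW: "j \<in> W" if j: "j \<in> J" for j
  proof (rule ccontr)
    assume "j \<notin> W"
    moreover have jc: "j \<in> carrier R" using j Jmem by blast
    ultimately have ij: "inv j \<in> nonunits R W" using valuation_inv[OF W] by blast
    have j0: "j \<noteq> \<zero>" using \<open>j \<notin> W\<close> subringE(2)[OF Ws] by blast
    note jm = nz_inv[OF jc j0]
    have "w \<otimes> inv j \<in> B" using rmod_smult[OF nonunits_rmod[OF W] wi(1) ij] NB by blast
    then have "(w \<otimes> inv j) \<otimes> (i \<otimes> j) \<in> I" using Im(4) j Jmem by blast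
    moreover have "(w \<otimes> inv j) \<otimes> (i \<otimes> j) = w \<otimes> i"
      using nz_cancel(2)[OF jc j0, of "w \<otimes> i"] c jc jm by (simp add: m_ac)
    ultimately show False using wi by simp
  qed
  have J: "J \<in> XM"
  proof (rule modsI)
    show "rmod R B J" unfolding J_def using rmod_scale[OF mods_rmod[OF I(1)]] um BW Wc by blast
    show "nonunits R W \<subseteq> J"
    proof
      fix m assume m: "m \<in> nonunits R W"
      then have "m \<in> carrier R" using nonunits_iff[OF W] by blast
      then show "m \<in> J" using Jmem Im(4)[of m i] m NB wi m_comm c by auto
    qed
    show "J \<subseteq> W" using JW by blast
    show "\<one> \<in> J" using Jmem wi c by simp
    show "\<one> \<in> runits R W" using runits_one[OF Ws] .
  qed
  moreover have "w \<notin> J" using Jmem wi c m_comm by auto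
  then have "J \<noteq> W" using wi by blast
  moreover have "I = i <# J" unfolding J_def using l_coset_inv(1)[OF um(3,4) Im(1)] by simp
  ultimately show ?thesis using u by blast
qed

lemma scaled_XM_notin:
  assumes "J \<in> XM" "J \<noteq> W" "u \<in> runits R V"
  shows "u <# J \<notin> XW"
proof
  assume "u <# J \<in> XW"
  then have "u <# W \<subseteq> u <# J"
    using scaled_W_le[OF assms(1) mods_rmod] U_mem[OF assms(3)] by blast
  then have "W \<subseteq> J"
    using l_coset_le_iff(2) U_mem[OF assms(3)] Wc mods_carrier[OF assms(1)] by blast
  then show False using assms mods_le by blast
qed

text \<open>
  A proper module misses some unit \<open>y\<close> of \<open>V\<close>, so it is contained in \<open>y <# W\<close>. The factor \<open>p\<close>, a
  nonunit of \<open>W\<close> that is invertible in \<open>V\<close>, brings \<open>W\<close> into \<open>B\<close>.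
\<close>

lemma bounded:
  assumes I: "I \<in> X" "I \<noteq> V" and J: "J \<in> X"
  shows "\<exists>u\<in>runits R V. u <# I \<subseteq> J"
proof -
  obtain y where y: "y \<in> V" "y \<notin> I" using I mods_le by blast
  then have "y \<notin> nonunits R V" using mods_nonunits[OF I(1)] by blast
  then have yu: "y \<in> runits R V" using runits_iff y by blast
  obtain z where z: "z \<in> J" "z \<in> runits R V" using mods_unit[OF J] by blast
  obtain p where p: "p \<in> nonunits R W" "p \<in> runits R V" using nonunits_strict[OF V W WV] by blast
  note ym = U_mem[OF yu] and zm = U_mem[OF z(2)] and pm = U_mem[OF p(2)]
  \<comment> \<open>division by \<open>y\<close> leads into \<open>W\<close>, the factor \<open>p\<close> into \<open>B\<close>, and \<open>z\<close> into \<open>J\<close>\<close>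
  let ?u = "z \<otimes> p \<otimes> inv y"
  have "?u \<in> runits R V"
    using runits_mult[OF Vs runits_mult[OF Vs z(2) p(2)] runits_inv[OF Vs yu]] .
  moreover have "?u <# I \<subseteq> J"
  proof
    fix x assume "x \<in> ?u <# I"
    then obtain i where i: "i \<in> I" "x = ?u \<otimes> i" unfolding l_coset_def by blast
    have ic: "i \<in> carrier R" using i mods_carrier[OF I(1)] by blast
    have "inv y \<otimes> i \<in> W"
    proof (rule ccontr)
      assume n: "inv y \<otimes> i \<notin> W"
      then have "inv (inv y \<otimes> i) \<in> B" using valuation_inv[OF W _ n] NB ic ym by blast
      moreover have i0: "i \<noteq> \<zero>" using n subringE(2)[OF Ws] ym by auto
      ultimately have "(y \<otimes> inv i) \<otimes> i \<in> I"
        using rmod_smult[OF mods_rmod[OF I(1)] _ i(1)] nz_inv_mult(1)[OF ym(5,6) ic i0] nz_inv(5)[OF ym(3,4)]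
        by simp
      then show False using y nz_cancel(4)[OF ic i0 ym(3)] by simp
    qed
    then have "(inv y \<otimes> i) \<otimes> p \<in> B" using rmod_smult[OF nonunits_rmod[OF W] _ p(1)] NB by blast
    then have "((inv y \<otimes> i) \<otimes> p) \<otimes> z \<in> J" using rmod_smult[OF mods_rmod[OF J] _ z(1)] by blast
    moreover have "((inv y \<otimes> i) \<otimes> p) \<otimes> z = x"
      using i(2) ic ym zm pm by (simp add: m_ac)
    ultimately show "x \<in> J" by simp
  qed
  ultimately show ?thesis by blast
qed

text \<open>
  Multiplication by \<open>w \<in> W\<close> is an equivariance if \<open>w\<close> is a unit of \<open>V\<close>, and otherwise it sends \<open>V\<close>
  into the maximal ideal of \<open>V\<close>, which every module contains.
\<close>

lemma closure_XW:
  assumes c: "c \<in> Clos R B V" and I: "I \<in> XW"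
  shows "c I \<in> XW"
proof -
  note c' = c[unfolded Clos_def]
  have cX: "c I \<in> X" using eq_clos_closed[OF c' XW_sub[OF I]] .
  have "w \<otimes> x \<in> c I" if w: "w \<in> W" and x: "x \<in> c I" for w x
  proof (cases "w \<in> nonunits R V")
    case True
    have "x \<in> V" using x mods_le[OF cX] by blast
    then have "x \<otimes> w \<in> nonunits R V" using rmod_smult[OF nonunits_rmod[OF V] _ True] by blast
    then show ?thesis
      using mods_nonunits[OF cX] m_comm[OF subsetD[OF Vc \<open>x \<in> V\<close>] subsetD[OF Wc w]] by auto
  next
    case False
    then have u: "w \<in> runits R V" using runits_iff w WleV by blast
    have "w <# I \<subseteq> I" using rmod_smult[OF mods_rmod[OF I] w] unfolding l_coset_def by blast
    then have "c (w <# I) \<subseteq> c I"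
      using eq_clos_mono[OF c' act_X[OF u XW_sub[OF I]] XW_sub[OF I]] by blast
    then have "w <# c I \<subseteq> c I" using eq_clos_act[OF c' u XW_sub[OF I]] by simp
    then show ?thesis using l_coset_memI[OF x] by blast
  qed
  then have "rmod R W (c I)" using rmodD[OF mods_rmod[OF cX]] unfolding rmod_def by blast
  then show ?thesis using cX unfolding mods_def by blast
qed

text \<open>Such an operation does not distinguish the modules between \<open>W\<close> and its maximal ideal: all of them have the
  same closure as \<open>W\<close>.\<close>

definition coarse :: "('a set \<Rightarrow> 'a set) \<Rightarrow> bool" where
  "coarse c \<longleftrightarrow> (\<forall>J\<in>XM. W \<subseteq> c J)"

text \<open>
  If the closure of a \<open>W\<close>-module \<open>I\<close> contained a new element \<open>u\<close>, then \<open>I \<subseteq> u <# nonunits R W\<close> while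
  \<open>u <# W\<close> is contained in the closure of \<open>I\<close>; dividing by \<open>u\<close>, the closure of every module between
  the maximal ideal and \<open>W\<close> would contain \<open>W\<close>.
\<close>

lemma fine_XW:
  assumes c: "c \<in> Clos R B V" and n: "\<not> coarse c" and I: "I \<in> XW"
  shows "c I = I"
proof (rule ccontr)
  note c' = c[unfolded Clos_def]
  assume "c I \<noteq> I"
  then obtain u where u: "u \<in> c I" "u \<notin> I" using eq_clos_extensive[OF c' XW_sub[OF I]] by blast
  have cI: "c I \<in> XW" using closure_XW[OF c I] .
  have uV: "u \<in> V" using u mods_le[OF cI] by blast
  have "u \<notin> nonunits R V" using u mods_nonunits[OF I] by blast
  then have uu: "u \<in> runits R V" using uV runits_iff by blast
  note um = U_mem[OF uu]
  obtain J where J: "J \<in> XM" "\<not> W \<subseteq> c J" using n unfolding coarse_def by blast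
  have "I \<subseteq> u <# nonunits R W" using valuation_module_le[OF W mods_rmod[OF I] um(3) u(2)] .
  also have "\<dots> \<subseteq> u <# J" using l_coset_mono[OF mods_nonunits[OF J(1)]] .
  finally have "c I \<subseteq> c (u <# J)"
    using eq_clos_mono[OF c' XW_sub[OF I] act_X[OF uu XM_sub[OF J(1)]]] by blast
  moreover have "u <# W \<subseteq> c I"
  proof
    fix x assume "x \<in> u <# W"
    then obtain w where w: "w \<in> W" "x = u \<otimes> w" unfolding l_coset_def by blast
    then show "x \<in> c I" using rmod_smult[OF mods_rmod[OF cI] w(1) u(1)] m_comm[of u w] um Wc by auto
  qed
  ultimately have "u <# W \<subseteq> u <# c J" using eq_clos_act[OF c' uu XM_sub[OF J(1)]] by simp
  then have "W \<subseteq> c J"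
    using l_coset_le_iff(2)[OF um(3,4) Wc mods_carrier[OF eq_clos_closed[OF c' XM_sub[OF J(1)]]]] by blast
  then show False using J by blast
qed

lemma fine_XM:
  assumes c: "c \<in> Clos R B V" and n: "\<not> coarse c" and J: "J \<in> XM"
  shows "c J \<in> XM"
proof -
  note c' = c[unfolded Clos_def]
  have "c J \<subseteq> W"
    using eq_clos_mono[OF c' XM_sub[OF J] XM_sub[OF W_in(1)] mods_le[OF J]] fine_XW[OF c n W_in(2)] by simp
  moreover have "J \<subseteq> c J" using eq_clos_extensive[OF c' XM_sub[OF J]] .
  moreover have "rmod R B (c J)" using mods_rmod[OF eq_clos_closed[OF c' XM_sub[OF J]]] .
  ultimately show ?thesis using J unfolding mods_def by blast
qed

lemma coarse_eq:
  assumes c: "c \<in> Clos R B V" and co: "coarse c" and J: "J \<in> XM" and u: "u \<in> runits R V"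
  shows "c (u <# J) = c (u <# W)"
proof
  note c' = c[unfolded Clos_def] and uJ = act_X[OF u XM_sub[OF J]] and uW = act_X[OF u XM_sub[OF W_in(1)]]
  show "c (u <# J) \<subseteq> c (u <# W)" using eq_clos_mono[OF c' uJ uW l_coset_mono[OF mods_le[OF J]]] .
  have "u <# W \<subseteq> u <# c J" using l_coset_mono co J unfolding coarse_def by blast
  then have "u <# W \<subseteq> c (u <# J)" using eq_clos_act[OF c' u XM_sub[OF J]] by simp
  then have "c (u <# W) \<subseteq> c (c (u <# J))" using eq_clos_mono[OF c' uW eq_clos_closed[OF c' uJ]] by blast
  then show "c (u <# W) \<subseteq> c (u <# J)" using eq_clos_idem[OF c' uJ] by simp
qed

text \<open>
  A coarse operation is determined by the modules over \<open>W\<close>, all others by the modules between \<open>W\<close> and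
  its maximal ideal.
\<close>

definition split_op :: "('a set \<Rightarrow> 'a set) \<Rightarrow> ('a set \<Rightarrow> 'a set) + ('a set \<Rightarrow> 'a set)" where
  "split_op c = (if coarse c then Inr (restrict c XW) else Inl (restrict c XM))"

text \<open>
  All sets in the intersection are equal; taking the intersection avoids choosing one of the
  representations \<open>I = u <# J\<close>.
\<close>

definition extend_fine :: "('a set \<Rightarrow> 'a set) \<Rightarrow> 'a set \<Rightarrow> 'a set" where
  "extend_fine e = (\<lambda>I\<in>X. if I \<in> XW then I
     else \<Inter>{u <# e J | u J. u \<in> runits R V \<and> J \<in> XM \<and> I = u <# J})"

lemma extend_fine_XW: "I \<in> XW \<Longrightarrow> extend_fine e I = I"
  using XW_sub unfolding extend_fine_def by simp

lemma extend_fine_scaled: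
  assumes e: "e \<in> Clos R B W" and u: "u \<in> runits R V" and J: "J \<in> XM"
  shows "extend_fine e (u <# J) = u <# e J"
proof (cases "J = W")
  case True
  have "e W = W"
    using eq_clos_extensive[OF e[unfolded Clos_def] W_in(1)]
      mods_le[OF eq_clos_closed[OF e[unfolded Clos_def] W_in(1)]] by blast
  then show ?thesis using extend_fine_XW[OF act_XW[OF u W_in(2)]] True by simp
next
  case False
  have "u' <# e J' = u <# e J" if u': "u' \<in> runits R V" and J': "J' \<in> XM" and eq: "u <# J = u' <# J'" for u' J'
  proof -
    note um = U_mem[OF u] and um' = U_mem[OF u'] and Jc = mods_carrier[OF J] and Jc' = mods_carrier[OF J']
    have v: "inv u \<otimes> u' \<in> runits R V" using runits_mult[OF Vs runits_inv[OF Vs u] u'] .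
    have "J = inv u <# (u' <# J')" using l_coset_inv(2)[OF um(3,4) Jc] eq by simp
    then have Jv: "J = (inv u \<otimes> u') <# J'" using l_coset_assoc[OF um(5) um'(3) Jc'] by simp
    then have vW: "inv u \<otimes> u' \<in> runits R W"
      using le_trunk_cases[OF J J' v] False mods_le[OF J] by blast
    have eJ': "e J' \<subseteq> carrier R" using mods_carrier eq_clos_closed[OF e[unfolded Clos_def] J'] by blast
    have "e J = (inv u \<otimes> u') <# e J'"
      using eq_clos_act[OF e[unfolded Clos_def] vW J'] Jv by simp
    then have "u <# e J = (u \<otimes> (inv u \<otimes> u')) <# e J'"
      using l_coset_assoc[OF um(3) _ eJ', of "inv u \<otimes> u'"] um um' by simp
    then show ?thesis using nz_cancel(1)[OF um(3,4) um'(3)] by simp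
  qed
  then have "{u' <# e J' | u' J'. u' \<in> runits R V \<and> J' \<in> XM \<and> u <# J = u' <# J'} = {u <# e J}"
    using u J by blast
  then show ?thesis
    unfolding extend_fine_def using act_X[OF u XM_sub[OF J]] scaled_XM_notin[OF J False u] by simp
qed

lemma X_cases [consumes 1, case_names XW scaled]:
  assumes "I \<in> X"
  obtains "I \<in> XW" | u J where "u \<in> runits R V" "J \<in> XM" "J \<noteq> W" "I = u <# J" "I \<notin> XW"
  using not_XW_form[OF assms] by blast

lemma extend_fine_in:
  assumes e: "e \<in> Clos R B W"
  shows "extend_fine e \<in> Clos R B V"
  unfolding Clos_def
proof (rule eq_closI)
  note e' = e[unfolded Clos_def] and sc = extend_fine_scaled[OF e] and xw = extend_fine_XW[of _ e]
  note eX = eq_clos_closed[OF e']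
  show "extend_fine e \<in> extensional X" unfolding extend_fine_def by simp
  fix I assume I: "I \<in> X"
  show "extend_fine e I \<in> X"
    using I
  proof (cases rule: X_cases)
    case (scaled u J)
    then show ?thesis using sc[OF scaled(1,2)] act_X[OF scaled(1) XM_sub[OF eX[OF scaled(2)]]] by simp
  qed (simp add: xw XW_sub)
  show "I \<subseteq> extend_fine e I"
    using I
  proof (cases rule: X_cases)
    case (scaled u J)
    then show ?thesis using sc[OF scaled(1,2)] l_coset_mono[OF eq_clos_extensive[OF e' scaled(2)]] by simp
  qed (simp add: xw)
  show "extend_fine e (extend_fine e I) \<subseteq> extend_fine e I"
    using I
  proof (cases rule: X_cases)
    case (scaled u J)
    then show ?thesis
      using sc[OF scaled(1,2)] sc[OF scaled(1) eX[OF scaled(2)]] eq_clos_idem[OF e' scaled(2)] by simp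
  qed (simp add: xw)
  show "v <# extend_fine e I = extend_fine e (v <# I)" if v: "v \<in> runits R V" for v
    using I
  proof (cases rule: X_cases)
    case XW
    then show ?thesis using xw act_XW[OF v XW] by simp
  next
    case (scaled u J)
    have "v <# I = (v \<otimes> u) <# J"
      using scaled l_coset_assoc[OF U_mem(3)[OF v] U_mem(3)[OF scaled(1)] mods_carrier[OF scaled(2)]] by simp
    moreover have "v <# (u <# e J) = (v \<otimes> u) <# e J"
      using l_coset_assoc[OF U_mem(3)[OF v] U_mem(3)[OF scaled(1)] mods_carrier[OF eX[OF scaled(2)]]] .
    ultimately show ?thesis
      using sc[OF scaled(1,2)] sc[OF runits_mult[OF Vs v scaled(1)] scaled(2)] scaled(4) by simp
  qed
  show "extend_fine e I \<subseteq> extend_fine e I'" if I': "I' \<in> X" "I \<subseteq> I'" for I'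
    using I
  proof (cases rule: X_cases)
    case XW
    have "I' \<subseteq> extend_fine e I'"
      using I'(1)
    proof (cases rule: X_cases)
      case (scaled u J)
      then show ?thesis using sc[OF scaled(1,2)] l_coset_mono[OF eq_clos_extensive[OF e' scaled(2)]] by simp
    qed (simp add: xw)
    then show ?thesis using xw[OF XW] I'(2) by simp
  next
    case (scaled u J)
    have uW: "u <# e J \<subseteq> u <# W" using l_coset_mono[OF mods_le[OF eX[OF scaled(2)]]] .
    show ?thesis
      using I'(1)
    proof (cases rule: X_cases)
      case XW
      then show ?thesis
        using xw[OF XW] sc[OF scaled(1,2)] scaled(4) uW
          scaled_W_le[OF scaled(2) mods_rmod[OF XW] U_mem(3)[OF scaled(1)]] I'(2) by auto
    next
      case s': (scaled u' J')
      note um = U_mem[OF scaled(1)] and um' = U_mem[OF s'(1)]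
      let ?v = "inv u \<otimes> u'"
      have v: "?v \<in> runits R V" using runits_mult[OF Vs runits_inv[OF Vs scaled(1)] s'(1)] .
      note vm = U_mem[OF v]
      have uv: "u \<otimes> ?v = u'" using nz_cancel(1)[OF um(3,4) um'(3)] .
      have u'J: "u' <# Z = u <# (?v <# Z)" if "Z \<subseteq> carrier R" for Z
        using l_coset_assoc[OF um(3) vm(3) that] uv by simp
      have "u <# J \<subseteq> u <# (?v <# J')"
        using I'(2) scaled(4) s'(4) u'J[OF mods_carrier[OF s'(2)]] by simp
      then have le: "J \<subseteq> ?v <# J'"
        using l_coset_le_iff(2)[OF um(3,4) mods_carrier[OF scaled(2)] l_coset_carrier[OF vm(3) mods_carrier[OF s'(2)]]]
        by blast
      have "e J \<subseteq> ?v <# e J'"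
      proof (cases "?v \<in> runits R W")
        case True
        have "e J \<subseteq> e (?v <# J')" using eq_clos_mono[OF e' scaled(2) act_XM[OF True s'(2)] le] .
        then show ?thesis using eq_clos_act[OF e' True s'(2)] by simp
      next
        case False
        then have "W \<subseteq> ?v <# J'" using le_trunk_cases[OF scaled(2) s'(2) v le] by blast
        then show ?thesis
          using mods_le[OF eX[OF scaled(2)]] l_coset_mono[OF eq_clos_extensive[OF e' s'(2)], of ?v] by blast
      qed
      then have "u <# e J \<subseteq> u' <# e J'"
        using l_coset_mono[of "e J" "?v <# e J'" u] u'J[OF mods_carrier[OF eX[OF s'(2)]]] by simp
      then show ?thesis
        unfolding scaled(4) s'(4) sc[OF scaled(1,2)] sc[OF s'(1,2)] .
    qed
  qed
qed

definition W_hull :: "'a set \<Rightarrow> 'a set" where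
  "W_hull I = \<Inter>{I' \<in> XW. I \<subseteq> I'}"

lemma W_hull_in: "I \<in> X \<Longrightarrow> W_hull I \<in> XW"
proof -
  assume I: "I \<in> X"
  have V_in: "V \<in> XW" using mods_V[OF V Ws WleV] .
  obtain u where u: "u \<in> I" "u \<in> runits R V" using mods_unit[OF I] by blast
  show ?thesis
  proof (rule modsI)
    show "rmod R W (W_hull I)"
      unfolding W_hull_def using V_in mods_le[OF I] mods_rmod by (intro rmod_Inter) auto
    show "nonunits R V \<subseteq> W_hull I" unfolding W_hull_def using mods_nonunits by blast
    show "W_hull I \<subseteq> V" unfolding W_hull_def using V_in mods_le[OF I] by blast
    show "u \<in> W_hull I" unfolding W_hull_def using u by blast
  qed (rule u)
qed

lemma W_hull_ge: "I \<subseteq> W_hull I"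
  unfolding W_hull_def by blast

lemma W_hull_le: "I' \<in> XW \<Longrightarrow> I \<subseteq> I' \<Longrightarrow> W_hull I \<subseteq> I'"
  unfolding W_hull_def by blast

lemma W_hull_XW: "I \<in> XW \<Longrightarrow> W_hull I = I"
  using W_hull_ge W_hull_le by blast

lemma W_hull_act:
  assumes u: "u \<in> runits R V" and I: "I \<in> X"
  shows "W_hull (u <# I) = u <# W_hull I"
proof
  have le: "W_hull (u <# I) \<subseteq> u <# W_hull I" if "u \<in> runits R V" "I \<in> X" for u I
    using W_hull_le[OF act_XW[OF that(1) W_hull_in[OF that(2)]] l_coset_mono[OF W_hull_ge]] .
  show "W_hull (u <# I) \<subseteq> u <# W_hull I" using le[OF u I] .
  note um = U_mem[OF u]
  have "W_hull (inv u <# (u <# I)) \<subseteq> inv u <# W_hull (u <# I)"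
    using le[OF runits_inv[OF Vs u] act_X[OF u I]] .
  then have "W_hull I \<subseteq> inv u <# W_hull (u <# I)" using l_coset_inv(2)[OF um(3,4) mods_carrier[OF I]] by simp
  then show "u <# W_hull I \<subseteq> W_hull (u <# I)"
    using l_coset_le_iff(1)[OF um(3,4) mods_carrier[OF W_hull_in[OF I]] mods_carrier[OF W_hull_in[OF act_X[OF u I]]]]
    by blast
qed

lemma extend_coarse_in:
  assumes e: "e \<in> Clos R W V"
  shows "(\<lambda>I\<in>X. e (W_hull I)) \<in> Clos R B V"
  unfolding Clos_def
proof (rule eq_closI)
  note e' = e[unfolded Clos_def] note eX = eq_clos_closed[OF e' W_hull_in]
  fix I assume I: "I \<in> X"
  note eI = XW_sub[OF eX[OF I]]
  show "(\<lambda>I\<in>X. e (W_hull I)) I \<in> X" using eI I by simp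
  show "I \<subseteq> (\<lambda>I\<in>X. e (W_hull I)) I" using W_hull_ge eq_clos_extensive[OF e' W_hull_in[OF I]] I by fastforce
  show "(\<lambda>I\<in>X. e (W_hull I)) ((\<lambda>I\<in>X. e (W_hull I)) I) \<subseteq> (\<lambda>I\<in>X. e (W_hull I)) I"
    using I eI W_hull_XW[OF eX[OF I]] eq_clos_idem[OF e' W_hull_in[OF I]] by simp
  show "(\<lambda>I\<in>X. e (W_hull I)) I \<subseteq> (\<lambda>I\<in>X. e (W_hull I)) I'" if I': "I' \<in> X" "I \<subseteq> I'" for I'
    using I I' eq_clos_mono[OF e' W_hull_in[OF I] W_hull_in[OF I'(1)]]
      W_hull_le[OF W_hull_in[OF I'(1)], of I] W_hull_ge[of I'] by auto
  show "u <# (\<lambda>I\<in>X. e (W_hull I)) I = (\<lambda>I\<in>X. e (W_hull I)) (u <# I)" if u: "u \<in> runits R V" for u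
    using I act_X[OF u I] W_hull_act[OF u I] eq_clos_act[OF e' u W_hull_in[OF I]] by simp
qed simp

text \<open>
  The operations on \<open>B\<close>-modules inside \<open>V\<close> form an ordinal sum. An operation that is not coarse fixes
  all \<open>W\<close>-modules, so it lies below every coarse one. The constant operation is removed from the lower
  summand because an operation that collapses all modules inside \<open>W\<close> is coarse.
\<close>

theorem order_iso_split_op:
  "order_iso (Clos R B V) (cl_le X)
     (Inl ` (Clos R B W - {const_on XM W}) \<union> Inr ` Clos R W V) (ord_sum_le (cl_le XM) (cl_le XW)) split_op"
proof (rule order_isoI)
  fix c assume c: "c \<in> Clos R B V"
  note c' = c[unfolded Clos_def]
  show "split_op c \<in> Inl ` (Clos R B W - {const_on XM W}) \<union> Inr ` Clos R W V"
  proof (cases "coarse c")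
    case True
    have "restrict c XW \<in> Clos R W V"
      unfolding Clos_def
      using closure_XW[OF c] eq_clos_extensive[OF c' XW_sub] eq_clos_mono[OF c' XW_sub XW_sub]
        eq_clos_idem[OF c' XW_sub] eq_clos_act[OF c' _ XW_sub] act_XW
      by (intro eq_closI) simp_all
    then show ?thesis unfolding split_op_def using True by simp
  next
    case False
    have "restrict c XM \<in> Clos R B W"
      unfolding Clos_def
      using fine_XM[OF c False] eq_clos_extensive[OF c' XM_sub] eq_clos_mono[OF c' XM_sub XM_sub]
        eq_clos_idem[OF c' XM_sub] eq_clos_act[OF c' U_W XM_sub] act_XM
      by (intro eq_closI) simp_all
    moreover have "restrict c XM \<noteq> const_on XM W"
    proof
      assume eq: "restrict c XM = const_on XM W"
      have "c J = W" if "J \<in> XM" for J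
        using fun_cong[OF eq, of J] that unfolding const_on_def by simp
      then show False using False unfolding coarse_def by blast
    qed
    ultimately show ?thesis unfolding split_op_def using False by simp
  qed
  fix d assume d: "d \<in> Clos R B V"
  note d' = d[unfolded Clos_def]
  show "cl_le X c d \<longleftrightarrow> ord_sum_le (cl_le XM) (cl_le XW) (split_op c) (split_op d)"
  proof (cases "coarse c")
    case cc: True
    show ?thesis
    proof (cases "coarse d")
      case cd: True
      have "c I \<subseteq> d I" if le: "\<And>I. I \<in> XW \<Longrightarrow> c I \<subseteq> d I" and I: "I \<in> X" for I
        using I
      proof (cases rule: X_cases)
        case (scaled u J)
        then show ?thesis
          using coarse_eq[OF c cc scaled(2,1)] coarse_eq[OF d cd scaled(2,1)] le[OF act_XW[OF scaled(1) W_in(2)]]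
          by simp
      qed (rule le)
      then show ?thesis
        unfolding split_op_def ord_sum_le_def cl_le_def using cc cd XW_sub by auto
    next
      case False
      then obtain J where J: "J \<in> XM" "\<not> W \<subseteq> d J" unfolding coarse_def by blast
      then have "\<not> c J \<subseteq> d J" using cc unfolding coarse_def by blast
      then have "\<not> cl_le X c d" using XM_sub[OF J(1)] unfolding cl_le_def by blast
      then show ?thesis unfolding split_op_def ord_sum_le_def using cc False by simp
    qed
  next
    case cc: False
    show ?thesis
    proof (cases "coarse d")
      case cd: True
      have "c I \<subseteq> d I" if I: "I \<in> X" for I
        using I
      proof (cases rule: X_cases)
        case XW
        then show ?thesis using fine_XW[OF c cc XW] eq_clos_extensive[OF d' I] by simp
      next
        case (scaled u J)
        have "u <# c J \<subseteq> u <# d J"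
          using l_coset_mono mods_le[OF fine_XM[OF c cc scaled(2)]] cd scaled(2) unfolding coarse_def by blast
        then show ?thesis
          using scaled(4) eq_clos_act[OF c' scaled(1) XM_sub[OF scaled(2)]]
            eq_clos_act[OF d' scaled(1) XM_sub[OF scaled(2)]] by simp
      qed
      then show ?thesis unfolding split_op_def ord_sum_le_def cl_le_def using cc cd by simp
    next
      case cd: False
      have "c I \<subseteq> d I" if le: "\<And>J. J \<in> XM \<Longrightarrow> c J \<subseteq> d J" and I: "I \<in> X" for I
        using I
      proof (cases rule: X_cases)
        case XW
        then show ?thesis using fine_XW[OF c cc XW] fine_XW[OF d cd XW] by simp
      next
        case (scaled u J)
        then show ?thesis
          using l_coset_mono[OF le[OF scaled(2)], of u] eq_clos_act[OF c' scaled(1) XM_sub[OF scaled(2)]]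
            eq_clos_act[OF d' scaled(1) XM_sub[OF scaled(2)]] by simp
      qed
      then show ?thesis
        unfolding split_op_def ord_sum_le_def cl_le_def using cc cd XM_sub by auto
    qed
  qed
  show "c = d" if "cl_le X c d" "cl_le X d c" using cl_le_antisym[OF c' d' that] .
next
  fix y assume y: "y \<in> Inl ` (Clos R B W - {const_on XM W}) \<union> Inr ` Clos R W V"
  show "ord_sum_le (cl_le XM) (cl_le XW) y y"
    unfolding ord_sum_le_def by (simp add: cl_le_refl split: sum.split)
  from y consider e where "e \<in> Clos R B W" "e \<noteq> const_on XM W" "y = Inl e" | e where "e \<in> Clos R W V" "y = Inr e"
    by blast
  then show "\<exists>c\<in>Clos R B V. split_op c = y"
  proof cases
    case (1 e)
    note e' = 1(1)[unfolded Clos_def]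
    have eq: "extend_fine e J = e J" if "J \<in> XM" for J
      using extend_fine_scaled[OF 1(1) runits_one[OF Vs] that] l_coset_one[OF mods_carrier[OF that]]
        l_coset_one[OF mods_carrier[OF eq_clos_closed[OF e' that]]] by simp
    have "\<not> coarse (extend_fine e)"
    proof
      assume "coarse (extend_fine e)"
      then have "e J = W" if "J \<in> XM" for J
        using eq[OF that] mods_le[OF eq_clos_closed[OF e' that]] that unfolding coarse_def by blast
      then have "e = const_on XM W"
        unfolding const_on_def by (intro extensionalityI[OF eq_clos_ext[OF e']]) auto
      then show False using 1(2) by blast
    qed
    moreover have "restrict (extend_fine e) XM = e"
      using eq by (intro extensionalityI[OF _ eq_clos_ext[OF e']]) auto
    ultimately have "split_op (extend_fine e) = y" unfolding split_op_def 1(3) by simp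
    then show ?thesis using extend_fine_in[OF 1(1)] by blast
  next
    case (2 e)
    note e' = 2(1)[unfolded Clos_def]
    let ?c = "\<lambda>I\<in>X. e (W_hull I)"
    have "W \<subseteq> ?c J" if J: "J \<in> XM" for J
    proof -
      have "W \<subseteq> W_hull J" using W_le[OF J mods_rmod[OF W_hull_in[OF XM_sub[OF J]]] W_hull_ge] .
      then show ?thesis using eq_clos_extensive[OF e' W_hull_in[OF XM_sub[OF J]]] XM_sub[OF J] by auto
    qed
    then have "coarse ?c" unfolding coarse_def by blast
    moreover have "restrict ?c XW = e"
      using XW_sub W_hull_XW by (intro extensionalityI[OF _ eq_clos_ext[OF e']]) auto
    ultimately have "split_op ?c = y" unfolding split_op_def 2(2) by simp
    then show ?thesis using extend_coarse_in[OF 2(1)] by blast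
  qed
qed

end

section \<open>Branching\<close>

context trunk
begin

text \<open>
  The maximal ideal of \<open>W\<close> is contained in the Jacobson radical of \<open>B\<close>: indeed \<open>inv (a \<oplus> m)\<close> differs
  from \<open>inv a\<close> by a multiple of \<open>m\<close> over \<open>W\<close>.
\<close>

lemma unit_add_nonunit:
  assumes a: "a \<in> runits R B" and m: "m \<in> nonunits R W"
  shows "a \<oplus> m \<in> runits R B"
proof -
  note am = runits_mem[OF B a]
  have aW: "a \<in> runits R W" using runits_mono[OF BW] a by blast
  have mc: "m \<in> carrier R" using m nonunits_iff[OF W] by blast
  have sW: "a \<oplus> m \<in> W" using subringE(7)[OF Ws] aW m nonunits_le[of W] runits_iff by blast
  note neg = rmod_minus[OF Ws nonunits_rmod[OF W]]
  have "a \<oplus> m \<notin> nonunits R W"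
  proof
    assume "a \<oplus> m \<in> nonunits R W"
    then have "(a \<oplus> m) \<oplus> \<ominus> m \<in> nonunits R W"
      using rmod_add[OF nonunits_rmod[OF W]] neg[OF m] by blast
    then have "a \<in> nonunits R W" using am mc by (simp add: a_assoc r_neg)
    then show False using aW runits_iff by blast
  qed
  then have su: "a \<oplus> m \<in> runits R W" using sW runits_iff by blast
  note sm = runits_mem[OF Ws su]
  have "inv a \<otimes> inv (a \<oplus> m) \<in> W"
    using subringE(6)[OF Ws] sm(2) am(2) BW by blast
  then have mm: "\<ominus> ((inv a \<otimes> inv (a \<oplus> m)) \<otimes> m) \<in> B"
    using neg rmod_smult[OF nonunits_rmod[OF W] _ m] NB by blast
  have "inv a = inv a \<otimes> (inv (a \<oplus> m) \<otimes> (a \<oplus> m))"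
    using nz_inv[OF sm(3,4)] am by simp
  also have "\<dots> = inv a \<otimes> inv (a \<oplus> m) \<otimes> a \<oplus> inv a \<otimes> inv (a \<oplus> m) \<otimes> m"
    using sm am mc by (simp add: r_distr m_assoc)
  also have "inv a \<otimes> inv (a \<oplus> m) \<otimes> a = inv (a \<oplus> m)"
    using nz_cancel(6)[OF am(3,4) sm(5)] sm am by (simp add: m_assoc)
  finally have "inv a \<oplus> \<ominus> ((inv a \<otimes> inv (a \<oplus> m)) \<otimes> m)
      = (inv (a \<oplus> m) \<oplus> (inv a \<otimes> inv (a \<oplus> m)) \<otimes> m) \<oplus> \<ominus> ((inv a \<otimes> inv (a \<oplus> m)) \<otimes> m)"
    by (rule arg_cong)
  then have "inv a \<oplus> \<ominus> ((inv a \<otimes> inv (a \<oplus> m)) \<otimes> m) = inv (a \<oplus> m)"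
    using sm am mc by (simp add: a_assoc r_neg)
  then have "inv (a \<oplus> m) \<in> B" using subringE(7)[OF B am(2) mm] by simp
  moreover have "a \<oplus> m \<in> B" using subringE(7)[OF B am(1)] m NB by blast
  ultimately show ?thesis using sm(4) unfolding runits_def by blast
qed

end

text \<open>
  Finitely many rings \<open>T i\<close> inside \<open>V\<close>, each squeezed between a valuation ring \<open>W i\<close> and its maximal
  ideal. The assumption \<open>approx\<close> is a weak form of the approximation theorem: a unit of \<open>T i\<close> can be
  chosen as divisible as desired in the other \<open>T j\<close>.
\<close>

locale fork_rings = field R for R (structure) +
  fixes V :: "'a set" and N :: "'i set" and W T :: "'i \<Rightarrow> 'a set"
  assumes V: "valuation_ring R V" and fin: "finite N"
    and branch: "i \<in> N \<Longrightarrow> trunk R V (W i) (T i)"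
    and approx: "i \<in> N \<Longrightarrow> (\<And>j. j \<in> N \<Longrightarrow> u j \<in> runits R V) \<Longrightarrow>
      \<exists>s\<in>runits R (T i). \<forall>j\<in>N - {i}. s \<in> T j \<and> inv (u j) \<otimes> s \<in> T j"
begin

definition TT :: "'a set" where
  "TT = V \<inter> (\<Inter>i\<in>N. T i)"

text \<open>
  The localization of \<open>I\<close> at those elements of \<open>TT\<close> that become invertible in \<open>T i\<close>. By \<open>approx\<close> this
  is the \<open>T i\<close>-module generated by \<open>I\<close>.
\<close>

definition EE :: "'i \<Rightarrow> 'a set \<Rightarrow> 'a set" where
  "EE i I = {y \<in> carrier R. \<exists>s \<in> TT \<inter> runits R (T i). s \<otimes> y \<in> I}"

lemmas VS = valuation_subring[OF V] and VC = valuation_carrier[OF V]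

lemma T_sub: "i \<in> N \<Longrightarrow> subring (T i) R"
  using trunk.B[OF branch] .

lemma T_le: "i \<in> N \<Longrightarrow> T i \<subseteq> V"
  using trunk.BleV[OF branch] .

lemma nonunits_T: "i \<in> N \<Longrightarrow> nonunits R V \<subseteq> T i"
  using trunk.nonunits_VW[OF branch] trunk.NB[OF branch] by blast

lemma nonunits_TT: "nonunits R V \<subseteq> TT"
  using nonunits_T nonunits_le[of V] unfolding TT_def by blast

lemma TT_le: "TT \<subseteq> V" "i \<in> N \<Longrightarrow> TT \<subseteq> T i"
  unfolding TT_def by auto

lemma TT_sub: "subring TT R"
proof -
  have "subring (\<Inter>(insert V (T ` N))) R"
    using VS T_sub by (intro subring_Inter) auto
  then show ?thesis unfolding TT_def by simp
qed

lemma runits_TV: "i \<in> N \<Longrightarrow> s \<in> runits R (T i) \<Longrightarrow> s \<in> runits R V"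
  using runits_mono[OF T_le] by blast

lemma approx_TT:
  assumes "i \<in> N" "\<And>j. j \<in> N \<Longrightarrow> u j \<in> runits R V"
  obtains s where "s \<in> TT" "s \<in> runits R (T i)" "\<And>j. j \<in> N \<Longrightarrow> j \<noteq> i \<Longrightarrow> inv (u j) \<otimes> s \<in> T j"
proof -
  obtain s where s: "s \<in> runits R (T i)" "\<forall>j\<in>N - {i}. s \<in> T j \<and> inv (u j) \<otimes> s \<in> T j"
    using approx[of i u] assms by blast
  have "s \<in> T j" if "j \<in> N" for j
    using s that unfolding runits_def by (cases "j = i") auto
  moreover have "s \<in> V" using runits_TV[OF assms(1) s(1)] unfolding runits_def by blast
  ultimately have "s \<in> TT" unfolding TT_def by blast
  then show ?thesis using s that by blast
qed

lemma EE_ge: "I \<subseteq> carrier R \<Longrightarrow> i \<in> N \<Longrightarrow> I \<subseteq> EE i I"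
  using subringE(3)[OF TT_sub] runits_one[OF T_sub] unfolding EE_def by force

lemma EE_T_mod:
  assumes "i \<in> N" "rmod R (T i) J"
  shows "EE i J = J"
proof
  show "EE i J \<subseteq> J"
  proof
    fix y assume "y \<in> EE i J"
    then obtain s where s: "y \<in> carrier R" "s \<in> runits R (T i)" "s \<otimes> y \<in> J" unfolding EE_def by blast
    note sm = runits_mem[OF T_sub[OF assms(1)] s(2)]
    have "inv s \<otimes> (s \<otimes> y) \<in> J" using rmod_smult[OF assms(2) sm(2) s(3)] .
    then show "y \<in> J" using nz_cancel(2)[OF sm(3,4) s(1)] by simp
  qed
  show "J \<subseteq> EE i J" using EE_ge[OF rmod_carrier[OF assms(2)] assms(1)] .
qed

lemma EE_mono: "I \<subseteq> J \<Longrightarrow> EE i I \<subseteq> EE i J"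
  unfolding EE_def by blast

text \<open>
  Approximation with respect to \<open>inv t\<close> produces the denominator. Hence \<open>T i\<close> is a localization of
  \<open>TT\<close>.
\<close>

lemma denominator:
  assumes i: "i \<in> N" and t: "t \<in> T i"
  shows "\<exists>s \<in> TT \<inter> runits R (T i). s \<otimes> t \<in> TT"
proof (cases "t \<in> nonunits R V")
  case True
  have "\<one> \<otimes> t \<in> TT" using nonunits_TT True l_one[OF subsetD[OF subringE(1)[OF T_sub[OF i]] t]] by auto
  then show ?thesis using subringE(3)[OF TT_sub] runits_one[OF T_sub[OF i]] by blast
next
  case False
  then have tu: "t \<in> runits R V" using t T_le[OF i] runits_iff by blast
  note tm = runits_mem[OF VS tu]
  obtain s where s: "s \<in> TT" "s \<in> runits R (T i)" "\<And>j. j \<in> N \<Longrightarrow> j \<noteq> i \<Longrightarrow> inv (inv t) \<otimes> s \<in> T j"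
    using approx_TT[OF i, of "\<lambda>j. inv t"] runits_inv[OF VS tu] by blast
  have sc: "s \<in> carrier R" using s(1) TT_le(1) VC by blast
  have "s \<otimes> t \<in> T j" if "j \<in> N" for j
  proof (cases "j = i")
    case True
    then show ?thesis using subringE(6)[OF T_sub[OF i]] s(1) TT_le(2)[OF i] t by blast
  next
    case False
    then show ?thesis using s(3)[OF that] nz_inv(5)[OF tm(3,4)] m_comm[OF sc tm(3)] by simp
  qed
  moreover have "s \<otimes> t \<in> V" using subringE(6)[OF VS] s(1) TT_le(1) tm(1) by blast
  ultimately show ?thesis using s unfolding TT_def by blast
qed

lemma EE_in:
  assumes i: "i \<in> N" and I: "I \<in> mods R TT V"
  shows "EE i I \<in> mods R (T i) V"
proof -
  note Im = rmodD[OF mods_rmod[OF I]]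
  obtain v where v: "v \<in> I" "v \<in> runits R V" using mods_unit[OF I] by blast
  have EI: "I \<subseteq> EE i I" using EE_ge[OF Im(1) i] .
  have Tc: "T i \<subseteq> carrier R" using subringE(1)[OF T_sub[OF i]] .
  show ?thesis
  proof (rule modsI)
    show "nonunits R V \<subseteq> EE i I" using mods_nonunits[OF I] EI by blast
    show "v \<in> EE i I" using v EI by blast
    show "v \<in> runits R V" using v by blast
    show "EE i I \<subseteq> V"
    proof
      fix y assume "y \<in> EE i I"
      then obtain s where s: "y \<in> carrier R" "s \<in> runits R (T i)" "s \<otimes> y \<in> I" unfolding EE_def by blast
      note sm = runits_mem[OF T_sub[OF i] s(2)]
      have "inv s \<otimes> (s \<otimes> y) \<in> V"
        using subringE(6)[OF VS] sm(2) T_le[OF i] s(3) mods_le[OF I] by blast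
      then show "y \<in> V" using nz_cancel(2)[OF sm(3,4) s(1)] by simp
    qed
    show "rmod R (T i) (EE i I)"
      unfolding rmod_def
    proof (intro conjI ballI)
      show "EE i I \<subseteq> carrier R" unfolding EE_def by blast
      show "\<zero> \<in> EE i I" using EI Im(2) by blast
      fix x assume "x \<in> EE i I"
      then obtain s where s: "x \<in> carrier R" "s \<in> TT" "s \<in> runits R (T i)" "s \<otimes> x \<in> I"
        unfolding EE_def by blast
      have sc: "s \<in> carrier R" using s(2) TT_le(1) VC by blast
      show "x \<oplus> y \<in> EE i I" if y: "y \<in> EE i I" for y
      proof -
        obtain s' where s': "y \<in> carrier R" "s' \<in> TT" "s' \<in> runits R (T i)" "s' \<otimes> y \<in> I"
          using y unfolding EE_def by blast
        have sc': "s' \<in> carrier R" using s'(2) TT_le(1) VC by blast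
        have "s' \<otimes> (s \<otimes> x) \<oplus> s \<otimes> (s' \<otimes> y) \<in> I" using Im(3,4) s s' by blast
        moreover have "s' \<otimes> (s \<otimes> x) \<oplus> s \<otimes> (s' \<otimes> y) = (s \<otimes> s') \<otimes> (x \<oplus> y)"
          using sc sc' s(1) s'(1) by (simp add: r_distr m_ac)
        moreover have "s \<otimes> s' \<in> TT \<inter> runits R (T i)"
          using subringE(6)[OF TT_sub s(2) s'(2)] runits_mult[OF T_sub[OF i] s(3) s'(3)] by blast
        ultimately have "x \<oplus> y \<in> carrier R" "\<exists>r\<in>TT \<inter> runits R (T i). r \<otimes> (x \<oplus> y) \<in> I"
          using s(1) s'(1) by (auto intro: bexI[of _ "s \<otimes> s'"])
        then show ?thesis unfolding EE_def by blast
      qed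
      show "t \<otimes> x \<in> EE i I" if t: "t \<in> T i" for t
      proof -
        obtain s' where s': "s' \<in> TT \<inter> runits R (T i)" "s' \<otimes> t \<in> TT" using denominator[OF i t] by blast
        have c: "s' \<in> carrier R" "t \<in> carrier R" using s' t Tc TT_le(1) VC by auto
        have "(s' \<otimes> t) \<otimes> (s \<otimes> x) \<in> I" using Im(4) s' s by blast
        moreover have "(s' \<otimes> t) \<otimes> (s \<otimes> x) = (s \<otimes> s') \<otimes> (t \<otimes> x)"
          using c sc s(1) by (simp add: m_ac)
        moreover have "s \<otimes> s' \<in> TT \<inter> runits R (T i)"
          using subringE(6)[OF TT_sub s(2)] runits_mult[OF T_sub[OF i] s(3)] s' by blast
        ultimately have "t \<otimes> x \<in> carrier R" "\<exists>r\<in>TT \<inter> runits R (T i). r \<otimes> (t \<otimes> x) \<in> I"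
          using s(1) c by (auto intro: bexI[of _ "s \<otimes> s'"])
        then show ?thesis unfolding EE_def by blast
      qed
    qed
  qed
qed

lemma EE_act:
  assumes u: "u \<in> runits R V" and I: "I \<subseteq> carrier R"
  shows "EE i (u <# I) = u <# EE i I"
proof -
  note um = runits_mem[OF VS u]
  have "EE i I \<subseteq> carrier R" unfolding EE_def by blast
  then have "y \<in> u <# EE i I \<longleftrightarrow> y \<in> carrier R \<and> (\<exists>s \<in> TT \<inter> runits R (T i). s \<otimes> (inv u \<otimes> y) \<in> I)" for y
    using l_coset_mem_iff[OF um(3,4)] um(5) unfolding EE_def by auto
  moreover have "s \<otimes> y \<in> u <# I \<longleftrightarrow> s \<otimes> (inv u \<otimes> y) \<in> I"
    if "y \<in> carrier R" "s \<in> TT \<inter> runits R (T i)" for y s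
  proof -
    have "s \<in> carrier R" using that TT_le(1) VC by blast
    then show ?thesis
      using l_coset_mem_iff[OF um(3,4) I, of "s \<otimes> y"] m_lcomm[of s "inv u" y] that um by simp
  qed
  ultimately show ?thesis unfolding EE_def by blast
qed

text \<open>
  Multiplying \<open>y\<close> by a unit of \<open>T i\<close> that is divisible by \<open>z j \<otimes> inv y\<close> in \<open>T j\<close>, where \<open>z j\<close> is a
  unit of \<open>V\<close> in \<open>F j\<close>, moves it into every \<open>F j\<close>.
\<close>

lemma common_element:
  assumes i: "i \<in> N" and F: "\<And>j. j \<in> N \<Longrightarrow> F j \<in> mods R (T j) V" and y: "y \<in> F i" "y \<in> runits R V"
  shows "\<exists>s \<in> TT \<inter> runits R (T i). s \<otimes> y \<in> V \<inter> (\<Inter>j\<in>N. F j)"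
proof -
  have "\<forall>j\<in>N. \<exists>z. z \<in> F j \<and> z \<in> runits R V" using mods_unit[OF F] by blast
  then obtain z where z: "\<And>j. j \<in> N \<Longrightarrow> z j \<in> F j \<and> z j \<in> runits R V" by metis
  note ym = runits_mem[OF VS y(2)]
  obtain s where s: "s \<in> TT" "s \<in> runits R (T i)"
    "\<And>j. j \<in> N \<Longrightarrow> j \<noteq> i \<Longrightarrow> inv (z j \<otimes> inv y) \<otimes> s \<in> T j"
    using approx_TT[OF i, of "\<lambda>j. z j \<otimes> inv y"] runits_mult[OF VS] runits_inv[OF VS y(2)] z by blast
  have sc: "s \<in> carrier R" using s(1) TT_le(1) VC by blast
  have "s \<otimes> y \<in> F j" if j: "j \<in> N" for j
  proof (cases "j = i")
    case True
    then show ?thesis using rmod_smult[OF mods_rmod[OF F[OF j]]] s(1) TT_le(2)[OF i] y by blast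
  next
    case False
    note zm = runits_mem[OF VS conjunct2[OF z[OF j]]]
    have "inv (z j \<otimes> inv y) \<otimes> s \<otimes> z j \<in> F j"
      using rmod_smult[OF mods_rmod[OF F[OF j]] s(3)[OF j False]] z[OF j] by blast
    moreover have "inv (z j \<otimes> inv y) \<otimes> s \<otimes> z j = s \<otimes> y"
      using nz_inv_mult(1)[OF zm(3,4) ym(5,6)] nz_inv(5)[OF ym(3,4)] nz_cancel(6)[OF zm(3,4), of "y \<otimes> s"]
        zm ym sc by (simp add: m_ac)
    ultimately show ?thesis by simp
  qed
  moreover have "s \<otimes> y \<in> V" using subringE(6)[OF VS] s(1) TT_le(1) ym(1) by blast
  ultimately show ?thesis using s by blast
qed

lemma glue_mods:
  assumes F: "\<And>j. j \<in> N \<Longrightarrow> F j \<in> mods R (T j) V"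
  shows "V \<inter> (\<Inter>j\<in>N. F j) \<in> mods R TT V"
proof -
  have rm: "rmod R TT (\<Inter>(insert V (F ` N)))"
    using rmod_le[OF rmod_subring[OF VS] TT_le(1)] rmod_le[OF mods_rmod[OF F] TT_le(2)]
    by (intro rmod_Inter) auto
  have "\<exists>x. x \<in> V \<inter> (\<Inter>j\<in>N. F j) \<and> x \<in> runits R V"
  proof (cases "N = {}")
    case True
    then show ?thesis using runits_one[OF VS] subringE(3)[OF VS] by auto
  next
    case False
    then obtain i where i: "i \<in> N" by blast
    obtain y where y: "y \<in> F i" "y \<in> runits R V" using mods_unit[OF F[OF i]] by blast
    obtain s where "s \<in> TT \<inter> runits R (T i)" "s \<otimes> y \<in> V \<inter> (\<Inter>j\<in>N. F j)"
      using common_element[OF i F y] by blast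
    then show ?thesis using runits_mult[OF VS runits_TV[OF i] y(2)] by blast
  qed
  then obtain x where x: "x \<in> V \<inter> (\<Inter>j\<in>N. F j)" "x \<in> runits R V" by blast
  show ?thesis
    using rm mods_nonunits[OF F] nonunits_le[of V] by (intro modsI[OF _ _ _ x]) auto
qed

lemma EE_glue:
  assumes F: "\<And>j. j \<in> N \<Longrightarrow> F j \<in> mods R (T j) V" and i: "i \<in> N"
  shows "EE i (V \<inter> (\<Inter>j\<in>N. F j)) = F i"
proof
  have "EE i (V \<inter> (\<Inter>j\<in>N. F j)) \<subseteq> EE i (F i)" using i by (intro EE_mono) blast
  then show "EE i (V \<inter> (\<Inter>j\<in>N. F j)) \<subseteq> F i" using EE_T_mod[OF i mods_rmod[OF F[OF i]]] by simp
  show "F i \<subseteq> EE i (V \<inter> (\<Inter>j\<in>N. F j))"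
  proof
    fix y assume y: "y \<in> F i"
    show "y \<in> EE i (V \<inter> (\<Inter>j\<in>N. F j))"
    proof (cases "y \<in> nonunits R V")
      case True
      then show ?thesis
        using EE_ge[OF mods_carrier[OF glue_mods[OF F]] i] mods_nonunits[OF glue_mods[OF F]] by blast
    next
      case False
      then have "y \<in> runits R V" using y mods_le[OF F[OF i]] runits_iff by blast
      then show ?thesis
        using common_element[OF i F y] y mods_carrier[OF F[OF i]] unfolding EE_def by blast
    qed
  qed
qed

text \<open>
  A module is the intersection of its localizations. An element \<open>y\<close> of the intersection satisfies \<open>f i
  \<otimes> y \<in> I\<close> with \<open>f i\<close> a unit of \<open>T i\<close>, and by approximation \<open>f i\<close> can be taken in the maximal ideals
  of all other \<open>W j\<close>. The sum of the \<open>f i\<close> is then a unit in every \<open>T j\<close>, hence in \<open>TT\<close>. The induction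
  adds the \<open>f i\<close> one at a time.
\<close>

lemma glue_EE:
  assumes I: "I \<in> mods R TT V"
  shows "V \<inter> (\<Inter>i\<in>N. EE i I) = I"
proof
  note Im = rmodD[OF mods_rmod[OF I]]
  show "I \<subseteq> V \<inter> (\<Inter>i\<in>N. EE i I)" using EE_ge[OF Im(1)] mods_le[OF I] by blast
  show "V \<inter> (\<Inter>i\<in>N. EE i I) \<subseteq> I"
  proof
    fix y assume y: "y \<in> V \<inter> (\<Inter>i\<in>N. EE i I)"
    have yc: "y \<in> carrier R" using y VC by blast
    have "\<forall>j\<in>N. \<exists>p. p \<in> nonunits R (W j) \<and> p \<in> runits R V"
      using nonunits_strict[OF V trunk.W[OF branch] trunk.WV[OF branch]] by blast
    then obtain w where w: "\<And>j. j \<in> N \<Longrightarrow> w j \<in> nonunits R (W j) \<and> w j \<in> runits R V" by metis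
    have NW: "rmod R (W j) (nonunits R (W j))" "TT \<subseteq> W j" if "j \<in> N" for j
      using nonunits_rmod[OF trunk.W[OF branch[OF that]]] TT_le(2)[OF that] trunk.BW[OF branch[OF that]]
      by auto
    have local_elt: "\<exists>f\<in>TT. f \<otimes> y \<in> I \<and> f \<in> runits R (T i) \<and> (\<forall>j\<in>N - {i}. f \<in> nonunits R (W j))"
      if i: "i \<in> N" for i
    proof -
      obtain s where s: "s \<in> TT" "s \<in> runits R (T i)" "s \<otimes> y \<in> I" using y i unfolding EE_def by blast
      have su: "s \<in> runits R V" using runits_TV[OF i s(2)] .
      note sm = runits_mem[OF VS su]
      obtain f where f: "f \<in> TT" "f \<in> runits R (T i)"
        "\<And>j. j \<in> N \<Longrightarrow> j \<noteq> i \<Longrightarrow> inv (w j \<otimes> s) \<otimes> f \<in> T j"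
        using approx_TT[OF i, of "\<lambda>j. w j \<otimes> s"] runits_mult[OF VS] su w by blast
      have fc: "f \<in> carrier R" using f(1) TT_le(1) VC by blast
      \<comment> \<open>approximation with \<open>w j \<otimes> s\<close> makes \<open>f\<close> a multiple \<open>s \<otimes> g\<close> with \<open>g\<close> in the maximal ideals of the
            other branches\<close>
      define g where "g = inv s \<otimes> f"
      have fg: "s \<otimes> g = f" unfolding g_def using nz_cancel(1)[OF sm(3,4) fc] .
      have gc: "g \<in> carrier R" unfolding g_def using sm fc by simp
      have gN: "g \<in> nonunits R (W j)" if j: "j \<in> N" "j \<noteq> i" for j
      proof -
        note wm = runits_mem[OF VS conjunct2[OF w[OF j(1)]]]
        have "inv (w j \<otimes> s) \<otimes> f \<otimes> w j \<in> nonunits R (W j)"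
          using rmod_smult[OF NW(1)[OF j(1)]] f(3)[OF j] trunk.BW[OF branch[OF j(1)]] w[OF j(1)] by blast
        moreover have "inv (w j \<otimes> s) \<otimes> f \<otimes> w j = g"
          unfolding g_def
          using nz_inv_mult(1)[OF wm(3,4) sm(3,4)] nz_cancel(6)[OF wm(3,4), of "inv s \<otimes> f"] wm sm fc
          by (simp add: m_ac)
        ultimately show ?thesis by simp
      qed
      have "g \<in> T j" if j: "j \<in> N" for j
      proof (cases "j = i")
        case True
        then show ?thesis
          unfolding g_def using subringE(6)[OF T_sub[OF i]] runits_mem(2)[OF T_sub[OF i] s(2)] f(1) TT_le(2)[OF i]
          by blast
      next
        case False
        then show ?thesis using gN[OF j] trunk.NB[OF branch[OF j]] by blast
      qed
      moreover have "g \<in> V"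
        unfolding g_def using subringE(6)[OF VS sm(2)] f(1) TT_le(1) by blast
      ultimately have gT: "g \<in> TT" unfolding TT_def by blast
      have "g \<otimes> (s \<otimes> y) \<in> I" using Im(4)[OF gT s(3)] .
      moreover have "g \<otimes> (s \<otimes> y) = f \<otimes> y" using fg gc sm yc by (simp add: m_ac flip: fg)
      moreover have "f \<in> nonunits R (W j)" if j: "j \<in> N - {i}" for j
      proof -
        have "s \<in> W j" using s(1) NW(2) j by blast
        then show ?thesis using rmod_smult[OF NW(1)[of j] \<open>s \<in> W j\<close> gN[of j]] j fg by simp
      qed
      ultimately show ?thesis using f by auto
    qed
    have "\<exists>f\<in>TT. f \<otimes> y \<in> I \<and> (\<forall>j\<in>S. f \<in> runits R (T j)) \<and> (\<forall>j\<in>N - S. f \<in> nonunits R (W j))"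
      if "finite S" "S \<subseteq> N" for S
      using that
    proof (induction S)
      case empty
      have "\<zero> \<in> TT" "\<zero> \<otimes> y \<in> I" using subringE(2)[OF TT_sub] Im(2) yc by simp_all
      moreover have "\<forall>j\<in>N. \<zero> \<in> nonunits R (W j)" using rmod_zero[OF NW(1)] by blast
      ultimately show ?case by blast
    next
      case (insert i S)
      then obtain f where f: "f \<in> TT" "f \<otimes> y \<in> I" "\<forall>j\<in>S. f \<in> runits R (T j)"
        "\<forall>j\<in>N - S. f \<in> nonunits R (W j)" by auto
      have i: "i \<in> N" using insert by blast
      obtain g where g: "g \<in> TT" "g \<otimes> y \<in> I" "g \<in> runits R (T i)" "\<forall>j\<in>N - {i}. g \<in> nonunits R (W j)"
        using local_elt[OF i] by blast
      have c: "f \<in> carrier R" "g \<in> carrier R" using f g TT_le(1) VC by auto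
      have "f \<oplus> g \<in> TT" using subringE(7)[OF TT_sub f(1) g(1)] .
      moreover have "(f \<oplus> g) \<otimes> y \<in> I" using Im(3)[OF f(2) g(2)] c yc by (simp add: l_distr)
      moreover have "f \<oplus> g \<in> runits R (T j)" if j: "j \<in> insert i S" for j
      proof (cases "j = i")
        case True
        then show ?thesis
          using trunk.unit_add_nonunit[OF branch[OF i] g(3), of f] f(4) insert i a_comm[OF c] by auto
      next
        case False
        then show ?thesis
          using trunk.unit_add_nonunit[OF branch, of j f g] f(3) g(4) insert j by auto
      qed
      moreover have "f \<oplus> g \<in> nonunits R (W j)" if j: "j \<in> N - insert i S" for j
        using rmod_add[OF NW(1)] f(4) g(4) j by blast
      ultimately show ?case by blast
    qed
    from this[OF fin subset_refl] obtain f where f: "f \<in> TT" "f \<otimes> y \<in> I" "\<forall>j\<in>N. f \<in> runits R (T j)" by blast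
    show "y \<in> I"
    proof (cases "N = {}")
      case True
      then have "TT = V" unfolding TT_def by simp
      obtain v where v: "v \<in> I" "v \<in> runits R V" using mods_unit[OF I] by blast
      note vm = runits_mem[OF VS v(2)]
      have "y \<otimes> inv v \<in> TT" using \<open>TT = V\<close> subringE(6)[OF VS] vm(2) y by blast
      then have "(y \<otimes> inv v) \<otimes> v \<in> I" using Im(4) v by blast
      then show ?thesis using nz_cancel(4)[OF vm(3,4) yc] by simp
    next
      case False
      then obtain i where i: "i \<in> N" by blast
      have fu: "f \<in> runits R V" using runits_TV[OF i] f i by blast
      note fm = runits_mem[OF VS fu]
      have "inv f \<in> TT" unfolding TT_def using fm(2) f(3) runits_mem(2)[OF T_sub] by blast
      then have "inv f \<otimes> (f \<otimes> y) \<in> I" using Im(4) f by blast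
      then show ?thesis using nz_cancel(2)[OF fm(3,4) yc] by simp
    qed
  qed
qed

sublocale fork: fork_product "(<#)" "runits R V" V N "\<lambda>i. mods R (T i) V" "mods R TT V" EE T
proof
  fix i assume i: "i \<in> N"
  interpret t: trunk R V "W i" "T i" using branch[OF i] .
  show "V \<in> mods R (T i) V" using mods_V[OF V T_sub[OF i] T_le[OF i]] .
  show "T i \<in> mods R (T i) V" using mods_self[OF V T_sub[OF i] nonunits_T[OF i] T_le[OF i]] .
  show "T i \<noteq> V" using t.BW t.WV by blast
  show "I \<in> mods R TT V \<Longrightarrow> EE i I \<in> mods R (T i) V" for I using EE_in[OF i] .
  show "EE i I \<subseteq> EE i J" if "I \<subseteq> J" for I J using EE_mono[OF that] .
  show "EE i (u <# I) = u <# EE i I" if "u \<in> runits R V" "I \<in> mods R TT V" for u I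
    using EE_act[OF that(1) mods_carrier[OF that(2)]] .
  show "J \<subseteq> V" if "J \<in> mods R (T i) V" for J using mods_le[OF that] .
  show "u <# J \<in> mods R (T i) V" if "u \<in> runits R V" "J \<in> mods R (T i) V" for u J
    using t.act_X[OF that] .
  show "J = V" if "u \<in> runits R V" "J \<in> mods R (T i) V" "u <# J = V" for u J
    using runits_scale_eq_V[OF V that(1) mods_carrier[OF that(2)] that(3)] .
  show "\<exists>u\<in>runits R V. u <# I \<subseteq> J" if "I \<in> mods R (T i) V" "I \<noteq> V" "J \<in> mods R (T i) V" for I J
    using t.bounded[OF that] .
  show "EE i (V \<inter> \<Inter> (F ` N)) = F i" if "\<And>j. j \<in> N \<Longrightarrow> F j \<in> mods R (T j) V" for F
    using EE_glue[OF that i] .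
  show "\<exists>u\<in>runits R V. (\<forall>J\<in>mods R (T i) V. u <# J = J) \<and> (\<forall>j\<in>N - {i}. u <# EE j I \<subseteq> EE j I')"
    if I: "I \<in> mods R TT V" "I' \<in> mods R TT V" and d: "\<And>j. j \<in> N \<Longrightarrow> EE j I = V \<Longrightarrow> EE j I' = V" for I I'
  proof -
    have "\<forall>j\<in>N. \<exists>u\<in>runits R V. u <# EE j I \<subseteq> EE j I'"
    proof
      fix j assume j: "j \<in> N"
      show "\<exists>u\<in>runits R V. u <# EE j I \<subseteq> EE j I'"
      proof (cases "EE j I = V")
        case True
        then show ?thesis using d[OF j] l_coset_one[OF VC] runits_one[OF VS] by (intro bexI[of _ \<one>]) auto
      next
        case False
        then show ?thesis using trunk.bounded[OF branch[OF j] EE_in[OF j I(1)] False EE_in[OF j I(2)]] by blast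
      qed
    qed
    then obtain u where u: "\<And>j. j \<in> N \<Longrightarrow> u j \<in> runits R V" "\<And>j. j \<in> N \<Longrightarrow> u j <# EE j I \<subseteq> EE j I'"
      by metis
    obtain s where s: "s \<in> TT" "s \<in> runits R (T i)" "\<And>j. j \<in> N \<Longrightarrow> j \<noteq> i \<Longrightarrow> inv (u j) \<otimes> s \<in> T j"
      using approx_TT[of i u] i u(1) by blast
    have sc: "s \<in> carrier R" using s(1) TT_le(1) VC by blast
    have "s <# EE j I \<subseteq> EE j I'" if j: "j \<in> N - {i}" for j
    proof -
      have jN: "j \<in> N" using j by blast
      note um = runits_mem[OF VS u(1)[OF jN]] and EI = mods_rmod[OF EE_in[OF jN I(1)]]
      let ?t = "inv (u j) \<otimes> s"
      have "?t <# EE j I \<subseteq> EE j I"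
        using rmod_smult[OF EI s(3)] j unfolding l_coset_def by blast
      then have "u j <# (?t <# EE j I) \<subseteq> EE j I'" using l_coset_mono u(2)[OF jN] by blast
      moreover have "u j \<otimes> ?t = s" using nz_cancel(1)[OF um(3,4) sc] .
      ultimately show ?thesis
        using l_coset_assoc[OF um(3) _ rmod_carrier[OF EI], of ?t] um sc by simp
    qed
    moreover have "s <# J = J" if "J \<in> mods R (T i) V" for J
      using runits_scale[OF mods_rmod[OF that]] runits_mem[OF T_sub[OF i] s(2)] by blast
    ultimately show ?thesis using runits_TV[OF i s(2)] by blast
  qed
next
  show "V \<inter> (\<Inter>i\<in>N. EE i I) = I" if "I \<in> mods R TT V" for I using glue_EE[OF that] .
  show "V \<inter> \<Inter> (F ` N) \<in> mods R TT V" if "\<And>j. j \<in> N \<Longrightarrow> F j \<in> mods R (T j) V" for F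
    using glue_mods[OF that] .
  show "u <# I \<in> mods R TT V" if "u \<in> runits R V" "I \<in> mods R TT V" for u I
    using runits_scale_mods[OF V TT_le(1) that] .
  show "u <# V = V" if "u \<in> runits R V" for u using runits_scale_V[OF V that] .
qed

end

section \<open>Transport to a residue field\<close>

lemma order_iso_transport:
  assumes X: "bij_betw \<phi> X X'" and le: "\<And>I J. I \<in> X \<Longrightarrow> J \<in> X \<Longrightarrow> \<phi> I \<subseteq> \<phi> J \<longleftrightarrow> I \<subseteq> J"
    and r: "r ` U = U'" and act: "\<And>u I. u \<in> U \<Longrightarrow> I \<in> X \<Longrightarrow> \<phi> (act u I) = act' (r u) (\<phi> I)"
    and act_X: "\<And>u I. u \<in> U \<Longrightarrow> I \<in> X \<Longrightarrow> act u I \<in> X"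
  shows "\<exists>h. order_iso (eq_clos act U X) (cl_le X) (eq_clos act' U' X') (cl_le X') h"
proof -
  define \<psi> where "\<psi> = inv_into X \<phi>"
  have \<phi>: "\<phi> I \<in> X'" "\<psi> (\<phi> I) = I" if "I \<in> X" for I
    using X that unfolding \<psi>_def bij_betw_def by auto
  have \<psi>: "\<psi> J \<in> X" "\<phi> (\<psi> J) = J" if "J \<in> X'" for J
    using X that unfolding \<psi>_def bij_betw_def by (auto simp: inv_into_into f_inv_into_f)
  have \<psi>_le: "\<psi> I \<subseteq> \<psi> J \<longleftrightarrow> I \<subseteq> J" if "I \<in> X'" "J \<in> X'" for I J
    using le[OF \<psi>(1)[OF that(1)] \<psi>(1)[OF that(2)]] \<psi>(2) that by simp
  have act_\<psi>: "act' (r u) J = \<phi> (act u (\<psi> J))" if "u \<in> U" "J \<in> X'" for u J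
    using act[OF that(1) \<psi>(1)[OF that(2)]] \<psi>(2)[OF that(2)] by simp
  have act_X': "act' (r u) J \<in> X'" if "u \<in> U" "J \<in> X'" for u J
    using \<phi>(1)[OF act_X[OF that(1) \<psi>(1)[OF that(2)]]] act_\<psi>[OF that] by simp
  let ?h = "\<lambda>c. \<lambda>J\<in>X'. \<phi> (c (\<psi> J))"
  have "order_iso (eq_clos act U X) (cl_le X) (eq_clos act' U' X') (cl_le X') ?h"
  proof (rule order_isoI)
    fix c assume c: "c \<in> eq_clos act U X"
    note cX = eq_clos_closed[OF c \<psi>(1)]
    show "?h c \<in> eq_clos act' U' X'"
    proof (rule eq_closI)
      fix J assume J: "J \<in> X'"
      show "?h c J \<in> X'" using \<phi>(1)[OF cX[OF J]] J by simp
      have "\<phi> (\<psi> J) \<subseteq> \<phi> (c (\<psi> J))"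
        using le[OF \<psi>(1)[OF J] cX[OF J]] eq_clos_extensive[OF c \<psi>(1)[OF J]] by blast
      then show "J \<subseteq> ?h c J" using \<psi>(2)[OF J] J by simp
      show "?h c (?h c J) \<subseteq> ?h c J"
        using J \<phi>[OF cX[OF J]] eq_clos_idem[OF c \<psi>(1)[OF J]] by simp
      show "?h c J \<subseteq> ?h c J'" if J': "J' \<in> X'" "J \<subseteq> J'" for J'
        using J J' le[OF cX[OF J] cX[OF J'(1)]] eq_clos_mono[OF c \<psi>(1)[OF J] \<psi>(1)[OF J'(1)]]
          \<psi>_le[OF J J'(1)] by simp
      fix u' assume "u' \<in> U'"
      then obtain u where u: "u \<in> U" "u' = r u" using r by blast
      have "\<psi> (act' u' J) = act u (\<psi> J)"
        unfolding u(2) act_\<psi>[OF u(1) J] using \<phi>(2)[OF act_X[OF u(1) \<psi>(1)[OF J]]] .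
      then have "?h c (act' u' J) = \<phi> (act u (c (\<psi> J)))"
        using act_X'[OF u(1) J] u(2) eq_clos_act[OF c u(1) \<psi>(1)[OF J]] by simp
      then show "act' u' (?h c J) = ?h c (act' u' J)"
        using act[OF u(1) cX[OF J]] u(2) J by simp
    qed simp
    fix d assume d: "d \<in> eq_clos act U X"
    have "cl_le X c d \<longleftrightarrow> (\<forall>J\<in>X'. c (\<psi> J) \<subseteq> d (\<psi> J))"
      unfolding cl_le_def using \<phi> \<psi>(1) by metis
    also have "\<dots> \<longleftrightarrow> cl_le X' (?h c) (?h d)"
      unfolding cl_le_def using le[OF cX eq_clos_closed[OF d \<psi>(1)]] by simp
    finally show "cl_le X c d \<longleftrightarrow> cl_le X' (?h c) (?h d)" .
    show "cl_le X c d \<Longrightarrow> cl_le X d c \<Longrightarrow> c = d" using cl_le_antisym[OF c d] .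
  next
    fix e assume e: "e \<in> eq_clos act' U' X'"
    note eX = eq_clos_closed[OF e \<phi>(1)]
    let ?c = "\<lambda>I\<in>X. \<psi> (e (\<phi> I))"
    have "?c \<in> eq_clos act U X"
    proof (rule eq_closI)
      fix I assume I: "I \<in> X"
      show "?c I \<in> X" using \<psi>(1)[OF eX[OF I]] I by simp
      have "\<psi> (\<phi> I) \<subseteq> \<psi> (e (\<phi> I))"
        using \<psi>_le[OF \<phi>(1)[OF I] eX[OF I]] eq_clos_extensive[OF e \<phi>(1)[OF I]] by blast
      then show "I \<subseteq> ?c I" using \<phi>(2)[OF I] I by simp
      show "?c (?c I) \<subseteq> ?c I"
        using I \<psi>[OF eX[OF I]] eq_clos_idem[OF e \<phi>(1)[OF I]] by simp
      show "?c I \<subseteq> ?c J" if J: "J \<in> X" "I \<subseteq> J" for J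
        using I J \<psi>_le[OF eX[OF I] eX[OF J(1)]] eq_clos_mono[OF e \<phi>(1)[OF I] \<phi>(1)[OF J(1)]]
          le[OF I J(1)] by simp
      fix u assume u: "u \<in> U"
      have ru: "r u \<in> U'" using r u by blast
      have "\<phi> (act u (\<psi> (e (\<phi> I)))) = act' (r u) (e (\<phi> I))"
        using act[OF u \<psi>(1)[OF eX[OF I]]] \<psi>(2)[OF eX[OF I]] by simp
      also have "\<dots> = e (\<phi> (act u I))"
        using eq_clos_act[OF e ru \<phi>(1)[OF I]] act[OF u I] by simp
      finally have "\<psi> (\<phi> (act u (\<psi> (e (\<phi> I))))) = \<psi> (e (\<phi> (act u I)))" by simp
      then show "act u (?c I) = ?c (act u I)"
        using \<phi>(2)[OF act_X[OF u \<psi>(1)[OF eX[OF I]]]] I act_X[OF u I] by simp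
    qed simp
    moreover have "?h ?c = e"
    proof (rule extensionalityI[OF _ eq_clos_ext[OF e]])
      fix J assume J: "J \<in> X'"
      show "?h ?c J = e J" using J \<psi>[OF J] \<psi>(2)[OF eq_clos_closed[OF e J]] by simp
    qed simp
    ultimately show "\<exists>c\<in>eq_clos act U X. ?h c = e" by blast
  qed (rule cl_le_refl)
  then show ?thesis by blast
qed

context field
begin

lemma submods_eq:
  assumes D: "subring D R"
  shows "submods R D = {I. rmod R D I}"
proof -
  have "m_inv (add_monoid (self_module R)) = m_inv (add_monoid R)"
    unfolding m_inv_def self_module_def by simp
  then have addm: "subgroup I (add_monoid (self_module R)) \<longleftrightarrow> subgroup I (add_monoid R)" for I
    unfolding subgroup_def by (simp add: self_module_def)
  have "submodule I (subrg R D) (self_module R) \<longleftrightarrow> rmod R D I" for I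
  proof
    assume "submodule I (subrg R D) (self_module R)"
    then have "subgroup I (add_monoid R)" "\<And>a x. a \<in> D \<Longrightarrow> x \<in> I \<Longrightarrow> a \<otimes> x \<in> I"
      unfolding submodule_def submodule_axioms_def addm by (auto simp: self_module_def)
    then show "rmod R D I" unfolding rmod_def subgroup_def by auto
  next
    assume I: "rmod R D I"
    have "\<ominus> x \<in> I" if "x \<in> I" for x using rmod_minus[OF D I that] .
    then have "subgroup I (add_monoid R)"
      using rmodD[OF I] by (intro add.subgroupI) (auto simp: a_inv_def)
    then show "submodule I (subrg R D) (self_module R)"
      unfolding submodule_def submodule_axioms_def addm
      using rmod_smult[OF I] by (auto simp: self_module_def)
  qed
  then show ?thesis unfolding submods_def by blast
qed

lemma frac_ideals_eq:
  assumes D: "subring D R"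
  shows "frac_ideals R D = {I. rmod R D I \<and> (\<exists>x\<in>carrier R - {\<zero>}. x <# I \<subseteq> D)}"
  unfolding frac_ideals_def submods_eq[OF D] by blast

text \<open>
  Property (S) for the factor 0 forces the zero module to be closed, and it says nothing else.
\<close>

lemma order_iso_drop_zero:
  assumes zero: "{\<zero>} \<in> Y" and Y: "\<And>I. I \<in> Y \<Longrightarrow> \<zero> \<in> I \<and> I \<subseteq> carrier R"
    and act: "\<And>x I. x \<in> carrier R - {\<zero>} \<Longrightarrow> I \<in> Y \<Longrightarrow> x <# I \<in> Y"
  shows "order_iso {c \<in> closure_ops Y. prop_S R Y c} (cl_le Y)
    (eq_clos (<#) (carrier R - {\<zero>}) (Y - {{\<zero>}})) (cl_le (Y - {{\<zero>}})) (\<lambda>c. restrict c (Y - {{\<zero>}}))"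
proof (rule order_isoI)
  let ?Y = "Y - {{\<zero>}}"
  have zero_coset: "\<zero> <# I = {\<zero>}" if "I \<in> Y" for I
    using Y[OF that] unfolding l_coset_image by force
  have coset_zero: "x <# {\<zero>} = {\<zero>}" if "x \<in> carrier R" for x
    using that unfolding l_coset_image by simp
  have nz: "x <# I \<in> ?Y" if x: "x \<in> carrier R - {\<zero>}" and I: "I \<in> ?Y" for x I
  proof -
    obtain i where i: "i \<in> I" "i \<noteq> \<zero>" using I Y by blast
    have "x \<otimes> i \<in> x <# I" "x \<otimes> i \<noteq> \<zero>"
      using l_coset_memI[OF i(1)] integral_iff[of x i] x i I Y by auto
    then show ?thesis using act x I by blast
  qed
  have clY: "c \<in> eq_clos (<#) (carrier R - {\<zero>}) Y" "c {\<zero>} = {\<zero>}"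
    if c: "c \<in> {c \<in> closure_ops Y. prop_S R Y c}" for c
  proof -
    show cc: "c \<in> eq_clos (<#) (carrier R - {\<zero>}) Y"
      using c unfolding eq_clos_def prop_S_def by blast
    have "\<zero> <# c {\<zero>} = c (\<zero> <# {\<zero>})" using c zero unfolding prop_S_def by blast
    then show "c {\<zero>} = {\<zero>}" using zero_coset[OF eq_clos_closed[OF cc zero]] coset_zero by simp
  qed
  fix c assume c: "c \<in> {c \<in> closure_ops Y. prop_S R Y c}"
  note cc = clY[OF c]
  show "restrict c ?Y \<in> eq_clos (<#) (carrier R - {\<zero>}) ?Y"
  proof (rule eq_closI)
    fix I assume I: "I \<in> ?Y"
    then have IY: "I \<in> Y" by blast
    have "I \<subseteq> c I" using eq_clos_extensive[OF cc(1) IY] .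
    then have cI: "c I \<in> ?Y" using eq_clos_closed[OF cc(1) IY] I Y[OF IY] by blast
    then show "restrict c ?Y I \<in> ?Y" using I by simp
    show "I \<subseteq> restrict c ?Y I" using \<open>I \<subseteq> c I\<close> I by simp
    show "restrict c ?Y (restrict c ?Y I) \<subseteq> restrict c ?Y I"
      using I cI eq_clos_idem[OF cc(1) IY] by simp
    show "restrict c ?Y I \<subseteq> restrict c ?Y J" if J: "J \<in> ?Y" "I \<subseteq> J" for J
      using I J eq_clos_mono[OF cc(1), of I J] by simp
    show "x <# restrict c ?Y I = restrict c ?Y (x <# I)" if x: "x \<in> carrier R - {\<zero>}" for x
      using I nz[OF x I] eq_clos_act[OF cc(1) x IY] by simp
  qed simp
  fix d assume d: "d \<in> {c \<in> closure_ops Y. prop_S R Y c}"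
  note dd = clY[OF d]
  have "c I \<subseteq> d I \<longleftrightarrow> restrict c ?Y I \<subseteq> restrict d ?Y I" if "I \<in> ?Y" for I using that by simp
  then show "cl_le Y c d \<longleftrightarrow> cl_le ?Y (restrict c ?Y) (restrict d ?Y)"
    unfolding cl_le_def using cc(2) dd(2) by auto
  show "cl_le Y c d \<Longrightarrow> cl_le Y d c \<Longrightarrow> c = d" using cl_le_antisym[OF cc(1) dd(1)] .
next
  let ?Y = "Y - {{\<zero>}}"
  fix e assume e: "e \<in> eq_clos (<#) (carrier R - {\<zero>}) ?Y"
  let ?c = "\<lambda>I\<in>Y. if I = {\<zero>} then {\<zero>} else e I"
  have eY: "e I \<in> Y \<and> e I \<noteq> {\<zero>}" if "I \<in> Y" "I \<noteq> {\<zero>}" for I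
    using eq_clos_closed[OF e, of I] that by blast
  have coset_zero: "x <# {\<zero>} = {\<zero>}" if "x \<in> carrier R" for x
    using that unfolding l_coset_image by simp
  have zero_coset: "\<zero> <# I = {\<zero>}" if "I \<in> Y" for I
    using Y[OF that] unfolding l_coset_image by force
  have "?c \<in> eq_clos (<#) (carrier R) Y"
  proof (rule eq_closI)
    fix I assume I: "I \<in> Y"
    show "?c I \<in> Y" using eY[OF I] I by auto
    show "I \<subseteq> ?c I" using I eq_clos_extensive[OF e, of I] by auto
    show "?c (?c I) \<subseteq> ?c I" using I eY[OF I] zero eq_clos_idem[OF e, of I] by auto
    show "?c I \<subseteq> ?c J" if J: "J \<in> Y" "I \<subseteq> J" for J
    proof (cases "I = {\<zero>}")
      case True
      have "\<zero> \<in> ?c J" using eY[OF J(1)] Y J(1) by auto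
      then show ?thesis using True I by simp
    next
      case False
      then have "J \<noteq> {\<zero>}" using J Y[OF I] by blast
      then show ?thesis using I J False eq_clos_mono[OF e, of I J] by simp
    qed
    show "x <# ?c I = ?c (x <# I)" if x: "x \<in> carrier R" for x
    proof (cases "x = \<zero> \<or> I = {\<zero>}")
      case True
      then show ?thesis
        using I zero x zero_coset[OF I] coset_zero[OF x] zero_coset[of "e I"] eY[OF I] by auto
    next
      case False
      have "I = {\<zero>}" if "x <# I = {\<zero>}"
        using l_coset_inv(2)[of x I] that x False Y[OF I] coset_zero[of "inv x"] nz_inv[of x] by simp
      then show ?thesis
        using False I act[of x I] x eq_clos_act[OF e, of x I] by auto
    qed
  qed simp
  then have "?c \<in> {c \<in> closure_ops Y. prop_S R Y c}" unfolding eq_clos_def prop_S_def by blast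
  moreover have "restrict ?c ?Y = e"
    by (rule extensionalityI[OF _ eq_clos_ext[OF e]]) auto
  ultimately show "\<exists>c\<in>{c \<in> closure_ops Y. prop_S R Y c}. restrict c ?Y = e" by blast
qed (rule cl_le_refl)

lemma zero_rmod: "subring D R \<Longrightarrow> rmod R D {\<zero>}"
  using subringE(1) unfolding rmod_def by force

lemma order_iso_SStar:
  assumes D: "subring D R"
  shows "order_iso (SStar R D) (SStar_le R D)
    (eq_clos (<#) (carrier R - {\<zero>}) (submods R D - {{\<zero>}})) (cl_le (submods R D - {{\<zero>}}))
    (\<lambda>c. restrict c (submods R D - {{\<zero>}}))"
proof -
  have "SStar_le R D = cl_le (submods R D)" unfolding SStar_le_def cl_le_def by (intro ext) simp
  moreover have "\<zero> \<in> I \<and> I \<subseteq> carrier R" if "I \<in> submods R D" for I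
    using that rmod_zero rmod_carrier unfolding submods_eq[OF D] by blast
  moreover have "x <# I \<in> submods R D" if "x \<in> carrier R - {\<zero>}" "I \<in> submods R D" for x I
    using that rmod_scale[OF _ subringE(1)[OF D]] unfolding submods_eq[OF D] by blast
  ultimately show ?thesis
    unfolding SStar_def using order_iso_drop_zero[of "submods R D"] zero_rmod[OF D]
    by (simp add: submods_eq[OF D])
qed

lemma order_iso_FStar:
  assumes D: "subring D R"
  shows "order_iso (FStar R D) (FStar_le R D)
    (eq_clos (<#) (carrier R - {\<zero>}) (frac_ideals R D - {{\<zero>}})) (cl_le (frac_ideals R D - {{\<zero>}}))
    (\<lambda>c. restrict c (frac_ideals R D - {{\<zero>}}))"
proof -
  have "FStar_le R D = cl_le (frac_ideals R D)" unfolding FStar_le_def cl_le_def by (intro ext) simp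
  moreover have "\<zero> \<in> I \<and> I \<subseteq> carrier R" if "I \<in> frac_ideals R D" for I
    using that rmod_zero rmod_carrier unfolding frac_ideals_eq[OF D] by blast
  moreover have "{\<zero>} \<in> frac_ideals R D"
    using zero_rmod[OF D] subringE(2)[OF D] unfolding frac_ideals_eq[OF D]
    by (auto intro!: bexI[of _ \<one>] simp: l_coset_image)
  moreover have "x <# I \<in> frac_ideals R D" if x: "x \<in> carrier R - {\<zero>}" and I: "I \<in> frac_ideals R D" for x I
  proof -
    obtain y where y: "y \<in> carrier R - {\<zero>}" "y <# I \<subseteq> D" and Im: "rmod R D I"
      using I unfolding frac_ideals_eq[OF D] by blast
    have xc: "x \<in> carrier R" "x \<noteq> \<zero>" using x by auto
    note xi = nz_inv[OF xc]
    have "(y \<otimes> inv x) <# (x <# I) = y <# I"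
      using l_coset_assoc[of "y \<otimes> inv x" x I] nz_cancel(4)[OF xc, of y] xi x y rmod_carrier[OF Im] by simp
    moreover have "y \<otimes> inv x \<in> carrier R - {\<zero>}" using xi y integral_iff[of y "inv x"] by auto
    ultimately show ?thesis
      using y(2) rmod_scale[OF Im subringE(1)[OF D] xc(1)] unfolding frac_ideals_eq[OF D] by force
  qed
  ultimately show ?thesis
    unfolding FStar_def using order_iso_drop_zero[of "frac_ideals R D"] by simp
qed

end

text \<open>
  A surjective homomorphism from the valuation ring \<open>V\<close> to a ring \<open>F\<close> whose kernel is the maximal
  ideal of \<open>V\<close>, together with a valuation ring \<open>W\<close> strictly below \<open>V\<close>. Stating it for a map, rather
  than for the quotient of \<open>V\<close>, allows \<open>F\<close> to be a fraction field built from pairs.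
\<close>

locale residue_map = field R for R (structure) +
  fixes V W :: "'a set" and F :: "'c ring" and \<rho> :: "'a \<Rightarrow> 'c"
  assumes V: "valuation_ring R V" and W: "valuation_ring R W" and WV: "W \<subset> V"
    and \<rho>_surj: "\<rho> ` V = carrier F"
    and \<rho>_mult: "x \<in> V \<Longrightarrow> y \<in> V \<Longrightarrow> \<rho> (x \<otimes> y) = \<rho> x \<otimes>\<^bsub>F\<^esub> \<rho> y"
    and \<rho>_add: "x \<in> V \<Longrightarrow> y \<in> V \<Longrightarrow> \<rho> (x \<oplus> y) = \<rho> x \<oplus>\<^bsub>F\<^esub> \<rho> y"
    and \<rho>_one: "\<rho> \<one> = \<one>\<^bsub>F\<^esub>" and \<rho>_ker: "x \<in> V \<Longrightarrow> \<rho> x = \<zero>\<^bsub>F\<^esub> \<longleftrightarrow> x \<in> nonunits R V"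
begin

lemmas Vs = valuation_subring[OF V] and Ws = valuation_subring[OF W]

lemma WleV: "W \<subseteq> V" using WV by blast

lemma trunk: "trunk R V W W"
  using V W WV Ws nonunits_le[of W] by (intro trunk.intro trunk_axioms.intro field_axioms) auto

lemma \<rho>_zero: "\<rho> \<zero> = \<zero>\<^bsub>F\<^esub>"
  using \<rho>_ker[OF subringE(2)[OF Vs]] nonunits_iff[OF V] by simp

lemma \<rho>_hom: "\<rho> \<in> ring_hom (R\<lparr>carrier := V\<rparr>) F"
  using \<rho>_surj \<rho>_mult \<rho>_add \<rho>_one by (intro ring_hom_memI) auto

lemma F_field: "field F"
proof -
  interpret V: ring "R\<lparr>carrier := V\<rparr>" using subring_is_ring[OF Vs] .
  have "F\<lparr>carrier := \<rho> ` V, zero := \<rho> \<zero>\<rparr> = F" using \<rho>_surj \<rho>_zero by simp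
  then interpret F: ring F
    using V.ring_hom_imp_img_ring[OF \<rho>_hom] by simp
  have rep: "\<exists>x\<in>V. a = \<rho> x" if "a \<in> carrier F" for a using that \<rho>_surj by blast
  have comm: "a \<otimes>\<^bsub>F\<^esub> b = b \<otimes>\<^bsub>F\<^esub> a" if ab: "a \<in> carrier F" "b \<in> carrier F" for a b
  proof -
    obtain x y where xy: "x \<in> V" "a = \<rho> x" "y \<in> V" "b = \<rho> y" using rep ab by blast
    have "x \<otimes> y = y \<otimes> x" using m_comm xy valuation_carrier[OF V] by blast
    then show ?thesis using \<rho>_mult[of x y] \<rho>_mult[of y x] xy by simp
  qed
  interpret F: cring F
    using F.ring_axioms comm by (intro cring.intro F.is_monoid comm_monoid.intro comm_monoid_axioms.intro) auto
  show ?thesis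
  proof (rule F.cring_fieldI2)
    have "\<one> \<notin> nonunits R V" using runits_one[OF Vs] runits_iff by blast
    then show "\<zero>\<^bsub>F\<^esub> \<noteq> \<one>\<^bsub>F\<^esub>" using \<rho>_ker[OF subringE(3)[OF Vs]] \<rho>_one by auto
    fix a assume a: "a \<in> carrier F" "a \<noteq> \<zero>\<^bsub>F\<^esub>"
    then obtain x where x: "x \<in> V" "a = \<rho> x" using rep by blast
    then have "x \<in> runits R V" using a \<rho>_ker runits_iff by blast
    note xm = runits_mem[OF Vs this]
    have "a \<otimes>\<^bsub>F\<^esub> \<rho> (inv x) = \<one>\<^bsub>F\<^esub>"
      using \<rho>_mult[OF xm(1,2)] nz_inv(3)[OF xm(3,4)] x \<rho>_one by simp
    then show "\<exists>b\<in>carrier F. a \<otimes>\<^bsub>F\<^esub> b = \<one>\<^bsub>F\<^esub>" using \<rho>_surj xm(2) by blast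
  qed
qed

definition D where "D = \<rho> ` W"

lemma D_sub: "subring D F"
proof -
  interpret F: field F by (rule F_field)
  have hom: "\<rho> (\<ominus> x) = \<ominus>\<^bsub>F\<^esub> \<rho> x" if x: "x \<in> V" for x
  proof -
    have xc: "x \<in> carrier R" "\<ominus> x \<in> V" using x valuation_carrier[OF V] subringE(5)[OF Vs] by auto
    have "\<rho> x \<oplus>\<^bsub>F\<^esub> \<rho> (\<ominus> x) = \<zero>\<^bsub>F\<^esub>" using \<rho>_add[OF x xc(2)] r_neg[OF xc(1)] \<rho>_zero by simp
    moreover have "\<rho> x \<in> carrier F" "\<rho> (\<ominus> x) \<in> carrier F" using \<rho>_surj x xc by auto
    ultimately show ?thesis using F.minus_equality[of "\<rho> (\<ominus> x)" "\<rho> x"] F.a_comm by simp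
  qed
  show ?thesis
  proof (rule F.subringI)
    show "D \<subseteq> carrier F" unfolding D_def using \<rho>_surj WleV by blast
    show "\<one>\<^bsub>F\<^esub> \<in> D" unfolding D_def using imageI[OF subringE(3)[OF Ws], of \<rho>] \<rho>_one by simp
    show "\<ominus>\<^bsub>F\<^esub> h \<in> D" if h: "h \<in> D" for h
    proof -
      obtain x where x: "x \<in> W" "h = \<rho> x" using h unfolding D_def by blast
      have "\<ominus>\<^bsub>F\<^esub> h = \<rho> (\<ominus> x)" using hom[of x] x WleV by auto
      then show ?thesis using subringE(5)[OF Ws x(1)] unfolding D_def by simp
    qed
    fix h1 h2 assume "h1 \<in> D" "h2 \<in> D"
    then obtain x y where xy: "x \<in> W" "y \<in> W" "h1 = \<rho> x" "h2 = \<rho> y" unfolding D_def by blast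
    then have "h1 \<otimes>\<^bsub>F\<^esub> h2 = \<rho> (x \<otimes> y)" "h1 \<oplus>\<^bsub>F\<^esub> h2 = \<rho> (x \<oplus> y)"
      using \<rho>_mult[OF subsetD[OF WleV xy(1)] subsetD[OF WleV xy(2)]]
        \<rho>_add[OF subsetD[OF WleV xy(1)] subsetD[OF WleV xy(2)]] by simp_all
    then show "h1 \<otimes>\<^bsub>F\<^esub> h2 \<in> D" "h1 \<oplus>\<^bsub>F\<^esub> h2 \<in> D"
      using subringE(6,7)[OF Ws xy(1,2)] unfolding D_def by simp_all
  qed
qed

lemma \<rho>_reflects:
  assumes I: "rmod R W I" "nonunits R V \<subseteq> I" "I \<subseteq> V" and x: "x \<in> V" and mem: "\<rho> x \<in> \<rho> ` I"
  shows "x \<in> I"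
proof -
  obtain i where i: "i \<in> I" "\<rho> x = \<rho> i" using mem by blast
  have c: "i \<in> V" "\<ominus> i \<in> V" "x \<in> carrier R" "i \<in> carrier R"
    using i I x subringE(5)[OF Vs] valuation_carrier[OF V] by auto
  interpret F: field F by (rule F_field)
  have "\<rho> (x \<oplus> \<ominus> i) = \<rho> (i \<oplus> \<ominus> i)" using \<rho>_add x c i(2) by simp
  then have "\<rho> (x \<oplus> \<ominus> i) = \<zero>\<^bsub>F\<^esub>" using r_neg c \<rho>_zero by simp
  then have "x \<oplus> \<ominus> i \<in> I" using \<rho>_ker[OF subringE(7)[OF Vs x c(2)]] I(2) by blast
  then have "(x \<oplus> \<ominus> i) \<oplus> i \<in> I" using rmod_add[OF I(1)] i by blast
  then show "x \<in> I" using c by (simp add: a_assoc l_neg)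
qed

lemma image_frac_ideal:
  assumes I: "I \<in> mods R W V" "I \<noteq> V"
  shows "\<rho> ` I \<in> frac_ideals F D - {{\<zero>\<^bsub>F\<^esub>}}"
proof -
  interpret F: field F by (rule F_field)
  note IV = mods_le[OF I(1)] and Im = rmodD[OF mods_rmod[OF I(1)]]
  have rm: "rmod F D (\<rho> ` I)"
    unfolding rmod_def
  proof (intro conjI ballI)
    show "\<rho> ` I \<subseteq> carrier F" using IV \<rho>_surj by blast
    show "\<zero>\<^bsub>F\<^esub> \<in> \<rho> ` I" using imageI[OF Im(2), of \<rho>] \<rho>_zero by simp
    fix a assume "a \<in> \<rho> ` I"
    then obtain x where x: "x \<in> I" "a = \<rho> x" by blast
    show "a \<oplus>\<^bsub>F\<^esub> b \<in> \<rho> ` I" if b: "b \<in> \<rho> ` I" for b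
    proof -
      obtain y where y: "y \<in> I" "b = \<rho> y" using b by blast
      have "a \<oplus>\<^bsub>F\<^esub> b = \<rho> (x \<oplus> y)" using \<rho>_add[OF subsetD[OF IV x(1)] subsetD[OF IV y(1)]] x y by simp
      then show ?thesis using Im(3)[OF x(1) y(1)] by simp
    qed
    show "r \<otimes>\<^bsub>F\<^esub> a \<in> \<rho> ` I" if r: "r \<in> D" for r
    proof -
      obtain w where w: "w \<in> W" "r = \<rho> w" using r unfolding D_def by blast
      have "r \<otimes>\<^bsub>F\<^esub> a = \<rho> (w \<otimes> x)" using \<rho>_mult[OF subsetD[OF WleV w(1)] subsetD[OF IV x(1)]] x w by simp
      then show ?thesis using Im(4)[OF w(1) x(1)] by simp
    qed
  qed
  obtain v where v: "v \<in> I" "v \<in> runits R V" using mods_unit[OF I(1)] by blast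
  then have "\<rho> v \<noteq> \<zero>\<^bsub>F\<^esub>" using \<rho>_ker IV runits_iff by blast
  then have "\<rho> ` I \<noteq> {\<zero>\<^bsub>F\<^esub>}" using v by blast
  moreover have "\<exists>x\<in>carrier F - {\<zero>\<^bsub>F\<^esub>}. x <#\<^bsub>F\<^esub> \<rho> ` I \<subseteq> D"
  proof -
    obtain u where u: "u \<in> runits R V" "u <# I \<subseteq> W"
      using trunk.bounded[OF trunk I trunk.W_in(2)[OF trunk]] by blast
    have uV: "u \<in> V" "u \<notin> nonunits R V" using u runits_iff by auto
    have "\<rho> u <#\<^bsub>F\<^esub> \<rho> ` I \<subseteq> D"
    proof
      fix y assume "y \<in> \<rho> u <#\<^bsub>F\<^esub> \<rho> ` I"
      then obtain i where i: "i \<in> I" "y = \<rho> u \<otimes>\<^bsub>F\<^esub> \<rho> i" unfolding l_coset_def by blast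
      then have "y = \<rho> (u \<otimes> i)" using \<rho>_mult[OF uV(1) subsetD[OF IV i(1)]] by simp
      then show "y \<in> D" unfolding D_def using u(2) l_coset_memI[OF i(1)] by blast
    qed
    moreover have "\<rho> u \<in> carrier F - {\<zero>\<^bsub>F\<^esub>}" using uV \<rho>_ker \<rho>_surj by blast
    ultimately show ?thesis by blast
  qed
  ultimately show ?thesis unfolding field.frac_ideals_eq[OF F_field D_sub] using rm by blast
qed

text \<open>
  The preimage of a fractional ideal is proper. Otherwise that ideal would be all of \<open>F\<close> and the image
  of \<open>W\<close> would be \<open>F\<close> as well; since \<open>W\<close> contains the kernel, \<open>W\<close> would be \<open>V\<close>.
\<close>

lemma preimage_frac_ideal:
  assumes J: "J \<in> frac_ideals F D - {{\<zero>\<^bsub>F\<^esub>}}"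
  shows "{x \<in> V. \<rho> x \<in> J} \<in> mods R W V - {V}" "\<rho> ` {x \<in> V. \<rho> x \<in> J} = J"
proof -
  interpret F: field F by (rule F_field)
  let ?I = "{x \<in> V. \<rho> x \<in> J}"
  obtain y where rm: "rmod F D J" and y: "y \<in> carrier F - {\<zero>\<^bsub>F\<^esub>}" "y <#\<^bsub>F\<^esub> J \<subseteq> D"
    using J unfolding field.frac_ideals_eq[OF F_field D_sub] by blast
  note Jm = rmod_def[of F D J, THEN iffD1, OF rm]
  show im: "\<rho> ` ?I = J" using Jm \<rho>_surj by auto
  have "rmod R W ?I"
    unfolding rmod_def
  proof (intro conjI ballI)
    show "?I \<subseteq> carrier R" using valuation_carrier[OF V] by blast
    show "\<zero> \<in> ?I" using \<rho>_zero Jm subringE(2)[OF Vs] by simp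
    fix x assume x: "x \<in> ?I"
    show "x \<oplus> z \<in> ?I" if z: "z \<in> ?I" for z
      using x z \<rho>_add Jm subringE(7)[OF Vs] by simp
    show "w \<otimes> x \<in> ?I" if w: "w \<in> W" for w
      using x w \<rho>_mult WleV Jm subringE(6)[OF Vs] unfolding D_def by auto
  qed
  moreover have "nonunits R V \<subseteq> ?I" 
  proof
    fix x assume x: "x \<in> nonunits R V"
    then have xV: "x \<in> V" using nonunits_le by blast
    then have "\<rho> x \<in> J" using \<rho>_ker[OF xV] x Jm by simp
    then show "x \<in> ?I" using xV by blast
  qed
  moreover obtain j where j: "j \<in> J" "j \<noteq> \<zero>\<^bsub>F\<^esub>" using J Jm by blast
  have "j \<in> \<rho> ` ?I" using im j(1) by simp
  then obtain v where v: "v \<in> ?I" "j = \<rho> v" by (rule imageE)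
  then have "v \<in> ?I" "v \<in> runits R V" using j(2) \<rho>_ker[of v] runits_iff by auto
  ultimately have "?I \<in> mods R W V" by (intro modsI) auto
  moreover have "?I \<noteq> V"
  proof
    assume "?I = V"
    then have JF: "J = carrier F" using im \<rho>_surj by simp
    have "D = carrier F"
    proof
      show "D \<subseteq> carrier F" using subringE(1)[OF D_sub] .
      show "carrier F \<subseteq> D"
      proof
        fix a assume a: "a \<in> carrier F"
        have yc: "y \<in> carrier F" "y \<noteq> \<zero>\<^bsub>F\<^esub>" using y by auto
        have "y \<otimes>\<^bsub>F\<^esub> (inv\<^bsub>F\<^esub> y \<otimes>\<^bsub>F\<^esub> a) \<in> y <#\<^bsub>F\<^esub> J"
          using F.l_coset_memI JF a F.nz_inv(1)[OF yc] by simp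
        then show "a \<in> D" using y(2) F.nz_cancel(1)[OF yc a] by auto
      qed
    qed
    moreover obtain x where x: "x \<in> V" "x \<notin> W" using WV by blast
    ultimately have "\<rho> x \<in> \<rho> ` W" using \<rho>_surj unfolding D_def by blast
    then show False
      using \<rho>_reflects[OF rmod_subring[OF Ws] _ WleV x(1)] x(2)
        nonunits_antimono[OF V W WleV] nonunits_le[of W] by blast
  qed
  ultimately show "?I \<in> mods R W V - {V}" by blast
qed

text \<open>
  Images and preimages identify the proper \<open>W\<close>-modules above the kernel with the nonzero fractional
  ideals of the image of \<open>W\<close>, and the units of \<open>V\<close> map onto the nonzero elements of \<open>F\<close>.
\<close>

theorem order_iso_residue:
  "\<exists>h. order_iso (Clos R W V - {const_on (mods R W V) V}) (cl_le (mods R W V))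
     (FStar F D) (FStar_le F D) h"
proof -
  interpret F: field F by (rule F_field)
  let ?X = "mods R W V" and ?Y = "frac_ideals F D - {{\<zero>\<^bsub>F\<^esub>}}"
  let ?U = "runits R V" and ?U' = "carrier F - {\<zero>\<^bsub>F\<^esub>}"
  note act_X = runits_scale_mods[OF V WleV]
  have act_ne: "I = V" if "u \<in> ?U" "I \<in> ?X" "u <# I = V" for u I
    using runits_scale_eq_V[OF V that(1) mods_carrier[OF that(2)] that(3)] .
  have 1: "order_iso (Clos R W V - {const_on ?X V}) (cl_le ?X)
      (eq_clos (<#) ?U (?X - {V})) (cl_le (?X - {V})) (\<lambda>c. restrict c (?X - {V}))"
    unfolding Clos_def
  proof (rule order_iso_restrict_below_top)
    show "V \<in> ?X" using mods_V[OF V Ws WleV] .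
    show "\<exists>u\<in>?U. u <# I \<subseteq> J" if "I \<in> ?X" "I \<noteq> V" "J \<in> ?X" for I J using trunk.bounded[OF trunk that] .
    show "\<exists>I\<in>?X. I \<noteq> V" using trunk.W_in(2)[OF trunk] WV by blast
  qed (use mods_le runits_scale_V[OF V] act_X act_ne in auto)
  have "\<exists>h. order_iso (eq_clos (<#) ?U (?X - {V})) (cl_le (?X - {V}))
      (eq_clos (<#\<^bsub>F\<^esub>) ?U' ?Y) (cl_le ?Y) h"
  proof (rule order_iso_transport)
    have refl: "\<rho> ` I \<subseteq> \<rho> ` J \<longleftrightarrow> I \<subseteq> J" if "I \<in> ?X" "J \<in> ?X" for I J
      using \<rho>_reflects[OF mods_rmod[OF that(2)] mods_nonunits[OF that(2)] mods_le[OF that(2)]]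
        mods_le[OF that(1)] by blast
    then show "\<rho> ` I \<subseteq> \<rho> ` J \<longleftrightarrow> I \<subseteq> J" if "I \<in> ?X - {V}" "J \<in> ?X - {V}" for I J using that by blast
    show "bij_betw ((`) \<rho>) (?X - {V}) ?Y"
      unfolding bij_betw_def
    proof
      show "inj_on ((`) \<rho>) (?X - {V})"
      proof (rule inj_onI)
        fix I J assume IJ: "I \<in> ?X - {V}" "J \<in> ?X - {V}" "\<rho> ` I = \<rho> ` J"
        then have "I \<subseteq> J" "J \<subseteq> I" using refl[of I J] refl[of J I] by auto
        then show "I = J" by blast
      qed
      show "(`) \<rho> ` (?X - {V}) = ?Y"
      proof
        show "(`) \<rho> ` (?X - {V}) \<subseteq> ?Y" using image_frac_ideal by blast
        show "?Y \<subseteq> (`) \<rho> ` (?X - {V})"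
        proof
          fix J assume J: "J \<in> ?Y"
          show "J \<in> (`) \<rho> ` (?X - {V})"
            using preimage_frac_ideal[OF J] by (intro image_eqI[of _ _ "{x \<in> V. \<rho> x \<in> J}"]) auto
        qed
      qed
    qed
    show "\<rho> ` ?U = ?U'"
    proof
      show "\<rho> ` ?U \<subseteq> ?U'"
      proof
        fix a assume "a \<in> \<rho> ` ?U"
        then obtain x where x: "x \<in> ?U" "a = \<rho> x" by (rule imageE)
        then have "x \<in> V" "x \<notin> nonunits R V" using runits_iff by auto
        then show "a \<in> ?U'" using x(2) \<rho>_ker[of x] \<rho>_surj by auto
      qed
      show "?U' \<subseteq> \<rho> ` ?U"
      proof
        fix a assume a: "a \<in> ?U'"
        then have "a \<in> \<rho> ` V" using \<rho>_surj by simp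
        then obtain x where x: "x \<in> V" "a = \<rho> x" by auto
        then have "x \<in> ?U" using a \<rho>_ker[of x] runits_iff by auto
        then show "a \<in> \<rho> ` ?U" using x(2) by simp
      qed
    qed
    fix u I assume u: "u \<in> ?U" and I: "I \<in> ?X - {V}"
    show "u <# I \<in> ?X - {V}" using act_X[OF u, of I] act_ne[OF u, of I] I by blast
    have "\<rho> (u \<otimes> i) = \<rho> u \<otimes>\<^bsub>F\<^esub> \<rho> i" if "i \<in> I" for i
    proof -
      have "u \<in> V" using u runits_iff by blast
      moreover have "I \<in> ?X" using I by blast
      then have "i \<in> V" using mods_le that by blast
      ultimately have "u \<in> V" "i \<in> V" .
      then show ?thesis by (rule \<rho>_mult)
    qed
    then show "\<rho> ` (u <# I) = \<rho> u <#\<^bsub>F\<^esub> \<rho> ` I"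
      unfolding l_coset_image F.l_coset_image image_image by (intro image_cong) auto
  qed
  then obtain h where 2: "order_iso (eq_clos (<#) ?U (?X - {V})) (cl_le (?X - {V}))
      (eq_clos (<#\<^bsub>F\<^esub>) ?U' ?Y) (cl_le ?Y) h" by blast
  show ?thesis
    using order_iso_trans[OF order_iso_trans[OF 1 2] order_iso_sym[OF F.order_iso_FStar[OF D_sub]]] by blast
qed

end

section \<open>The fraction field of a domain\<close>

lemma UN_pairs_eq:
  assumes "(a, b) \<in> A" "(c, d) \<in> B" "\<And>a b c d. (a, b) \<in> A \<Longrightarrow> (c, d) \<in> B \<Longrightarrow> f a b c d = C"
  shows "(\<Union>(a, b)\<in>A. \<Union>(c, d)\<in>B. f a b c d) = C"
proof (rule UN_constant_eq[OF assms(1)], rule ballI)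
  fix p assume p: "p \<in> A"
  obtain a b where ab: "p = (a, b)" by (cases p)
  have "(\<Union>(c, d)\<in>B. f a b c d) = C"
  proof (rule UN_constant_eq[OF assms(2)], rule ballI)
    fix q assume "q \<in> B"
    then show "(case q of (c, d) \<Rightarrow> f a b c d) = C"
      using assms(3)[of a b "fst q" "snd q"] p unfolding ab by (cases q) simp
  qed
  then show "(case p of (a, b) \<Rightarrow> \<Union>(c, d)\<in>B. f a b c d) = C" unfolding ab by simp
qed

context domain
begin

lemma fraction_self: "a \<in> carrier R \<Longrightarrow> b \<in> carrier R - {\<zero>} \<Longrightarrow> (a, b) \<in> fraction R a b"
  unfolding fraction_def fraction_rel_def by simp

lemma fraction_mem: "(c, d) \<in> fraction R a b \<longleftrightarrow> a \<in> carrier R \<and> b \<in> carrier R - {\<zero>} \<and>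
    c \<in> carrier R \<and> d \<in> carrier R - {\<zero>} \<and> a \<otimes> d = c \<otimes> b"
  unfolding fraction_def fraction_rel_def by simp

lemma fraction_trans:
  assumes "a \<in> carrier R" "b \<in> carrier R" "c \<in> carrier R" "d \<in> carrier R - {\<zero>}" "e \<in> carrier R" "f \<in> carrier R"
    and "a \<otimes> d = c \<otimes> b" "c \<otimes> f = e \<otimes> d"
  shows "a \<otimes> f = e \<otimes> b"
proof -
  have "d \<otimes> (a \<otimes> f) = (a \<otimes> d) \<otimes> f" using assms(1-6) by (simp add: m_ac)
  also have "\<dots> = (c \<otimes> b) \<otimes> f" unfolding assms(7) ..
  also have "\<dots> = b \<otimes> (c \<otimes> f)" using assms(1-6) by (simp add: m_ac)
  also have "\<dots> = b \<otimes> (e \<otimes> d)" unfolding assms(8) ..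
  also have "\<dots> = d \<otimes> (e \<otimes> b)" using assms(1-6) by (simp add: m_ac)
  finally show ?thesis using m_lcancel[of d "a \<otimes> f" "e \<otimes> b"] assms(1-6) by simp
qed

lemma fraction_eq_iff:
  assumes "a \<in> carrier R" "b \<in> carrier R - {\<zero>}" "c \<in> carrier R" "d \<in> carrier R - {\<zero>}"
  shows "fraction R a b = fraction R c d \<longleftrightarrow> a \<otimes> d = c \<otimes> b"
proof
  assume "fraction R a b = fraction R c d"
  then have "(c, d) \<in> fraction R a b" using fraction_self assms by blast
  then show "a \<otimes> d = c \<otimes> b" using fraction_mem by blast
next
  assume eq: "a \<otimes> d = c \<otimes> b"
  have "(e, f) \<in> fraction R a b \<longleftrightarrow> (e, f) \<in> fraction R c d" for e f
    unfolding fraction_mem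
    using fraction_trans[of c d a b e f] fraction_trans[of a b c d e f] eq assms by auto
  then show "fraction R a b = fraction R c d" by auto
qed

lemma frac_nz: "b \<in> carrier R - {\<zero>} \<Longrightarrow> d \<in> carrier R - {\<zero>} \<Longrightarrow> b \<otimes> d \<in> carrier R - {\<zero>}"
  using integral_iff by auto

lemma fraction_mult:
  assumes "a \<in> carrier R" "b \<in> carrier R - {\<zero>}" "c \<in> carrier R" "d \<in> carrier R - {\<zero>}"
  shows "fraction R a b \<otimes>\<^bsub>fraction_field R\<^esub> fraction R c d = fraction R (a \<otimes> c) (b \<otimes> d)"
proof -
  have eq: "fraction R (a' \<otimes> c') (b' \<otimes> d') = fraction R (a \<otimes> c) (b \<otimes> d)"
    if "(a', b') \<in> fraction R a b" "(c', d') \<in> fraction R c d" for a' b' c' d'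
  proof -
    have h: "a' \<in> carrier R" "b' \<in> carrier R - {\<zero>}" "a \<otimes> b' = a' \<otimes> b"
      "c' \<in> carrier R" "d' \<in> carrier R - {\<zero>}" "c \<otimes> d' = c' \<otimes> d"
      using that unfolding fraction_mem by auto
    have "(a' \<otimes> c') \<otimes> (b \<otimes> d) = (a' \<otimes> b) \<otimes> (c' \<otimes> d)" using h(1,4) assms by (simp add: m_ac)
    also have "\<dots> = (a \<otimes> b') \<otimes> (c \<otimes> d')" using h(3,6) by simp
    also have "\<dots> = (a \<otimes> c) \<otimes> (b' \<otimes> d')" using h(2,5) assms by (simp add: m_ac)
    finally show ?thesis
      using h assms frac_nz by (intro fraction_eq_iff[THEN iffD2]) auto
  qed
  have ab: "(a, b) \<in> fraction R a b" "(c, d) \<in> fraction R c d" using fraction_self assms by auto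
  have "fraction R a b \<otimes>\<^bsub>fraction_field R\<^esub> fraction R c d =
      (\<Union>(a', b')\<in>fraction R a b. \<Union>(c', d')\<in>fraction R c d. fraction R (a' \<otimes> c') (b' \<otimes> d'))"
    unfolding fraction_field_def by simp
  also have "\<dots> = fraction R (a \<otimes> c) (b \<otimes> d)"
    using ab eq by (rule UN_pairs_eq)
  finally show ?thesis .
qed

lemma fraction_add:
  assumes "a \<in> carrier R" "b \<in> carrier R - {\<zero>}" "c \<in> carrier R" "d \<in> carrier R - {\<zero>}"
  shows "fraction R a b \<oplus>\<^bsub>fraction_field R\<^esub> fraction R c d = fraction R (a \<otimes> d \<oplus> c \<otimes> b) (b \<otimes> d)"
proof -
  have eq: "fraction R (a' \<otimes> d' \<oplus> c' \<otimes> b') (b' \<otimes> d') = fraction R (a \<otimes> d \<oplus> c \<otimes> b) (b \<otimes> d)"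
    if "(a', b') \<in> fraction R a b" "(c', d') \<in> fraction R c d" for a' b' c' d'
  proof -
    have h: "a' \<in> carrier R" "b' \<in> carrier R - {\<zero>}" "a \<otimes> b' = a' \<otimes> b"
      "c' \<in> carrier R" "d' \<in> carrier R - {\<zero>}" "c \<otimes> d' = c' \<otimes> d"
      using that unfolding fraction_mem by auto
    have "(a' \<otimes> d' \<oplus> c' \<otimes> b') \<otimes> (b \<otimes> d) = (a' \<otimes> b) \<otimes> (d \<otimes> d') \<oplus> (c' \<otimes> d) \<otimes> (b \<otimes> b')"
      using h(1,2,4,5) assms by (simp add: l_distr r_distr m_ac)
    also have "\<dots> = (a \<otimes> b') \<otimes> (d \<otimes> d') \<oplus> (c \<otimes> d') \<otimes> (b \<otimes> b')" using h(3,6) by simp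
    also have "\<dots> = (a \<otimes> d \<oplus> c \<otimes> b) \<otimes> (b' \<otimes> d')" using h(2,5) assms by (simp add: l_distr r_distr m_ac)
    finally show ?thesis
      using h assms frac_nz by (intro fraction_eq_iff[THEN iffD2]) auto
  qed
  have ab: "(a, b) \<in> fraction R a b" "(c, d) \<in> fraction R c d" using fraction_self assms by auto
  have "fraction R a b \<oplus>\<^bsub>fraction_field R\<^esub> fraction R c d =
      (\<Union>(a', b')\<in>fraction R a b. \<Union>(c', d')\<in>fraction R c d. fraction R (a' \<otimes> d' \<oplus> c' \<otimes> b') (b' \<otimes> d'))"
    unfolding fraction_field_def by simp
  also have "\<dots> = fraction R (a \<otimes> d \<oplus> c \<otimes> b) (b \<otimes> d)"
    using ab eq by (rule UN_pairs_eq)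
  finally show ?thesis .
qed

end

section \<open>Localizations of Pruefer domains\<close>

locale domain_in_field = field R for R (structure) +
  fixes D :: "'a set"
  assumes D: "subring D R" and quot: "x \<in> carrier R \<Longrightarrow> \<exists>a\<in>D. \<exists>b\<in>D - {\<zero>}. x = a \<otimes> inv b"
begin

lemma Dc: "D \<subseteq> carrier R"
  using subringE(1)[OF D] .

lemma D_dom: "domain (subrg R D)"
  using subring_is_domain[OF D] .

lemma D_minus: "x \<in> D \<Longrightarrow> \<ominus>\<^bsub>subrg R D\<^esub> x = \<ominus> x"
proof -
  interpret Dd: domain "subrg R D" by (rule D_dom)
  assume x: "x \<in> D"
  show ?thesis
  proof (rule Dd.minus_equality)
    show "\<ominus> x \<oplus>\<^bsub>subrg R D\<^esub> x = \<zero>\<^bsub>subrg R D\<^esub>" using x Dc by (simp add: l_neg subset_iff)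
    show "x \<in> carrier (subrg R D)" "\<ominus> x \<in> carrier (subrg R D)" using x subringE(5)[OF D] by auto
  qed
qed

lemma ideal_iff: "ideal I (subrg R D) \<longleftrightarrow> I \<subseteq> D \<and> rmod R D I"
proof -
  interpret Dd: domain "subrg R D" by (rule D_dom)
  show ?thesis
  proof
    assume "ideal I (subrg R D)"
    then interpret I: ideal I "subrg R D" .
    show "I \<subseteq> D \<and> rmod R D I"
      unfolding rmod_def
      using I.a_subset I.zero_closed I.a_closed I.I_l_closed Dc by auto
  next
    assume I: "I \<subseteq> D \<and> rmod R D I"
    note Im = rmodD[OF conjunct2[OF I]]
    show "ideal I (subrg R D)"
    proof (rule idealI[OF Dd.ring_axioms])
      have "\<ominus>\<^bsub>subrg R D\<^esub> a \<in> I" if "a \<in> I" for a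
        using D_minus[of a] rmod_minus[OF D conjunct2[OF I] that] I that by auto
      then show "subgroup I (add_monoid (subrg R D))"
        using I Im by (intro Dd.add.subgroupI) (auto simp: a_inv_def)
      fix a x assume a: "a \<in> I" and x: "x \<in> carrier (subrg R D)"
      show "x \<otimes>\<^bsub>subrg R D\<^esub> a \<in> I" using Im(4) a x by simp
      then show "a \<otimes>\<^bsub>subrg R D\<^esub> x \<in> I" using m_comm[OF subsetD[OF Im(1) a], of x] x Dc by auto
    qed
  qed
qed

lemma spec_iff: "P \<in> spec R D \<longleftrightarrow> P \<subseteq> D \<and> rmod R D P \<and> \<one> \<notin> P \<and>
    (\<forall>a\<in>D. \<forall>b\<in>D. a \<otimes> b \<in> P \<longrightarrow> a \<in> P \<or> b \<in> P)"
proof -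
  interpret Dd: domain "subrg R D" by (rule D_dom)
  have one: "\<one> \<notin> I \<longleftrightarrow> D \<noteq> I" if I: "I \<subseteq> D" "rmod R D I" for I
  proof
    assume "D \<noteq> I"
    then obtain x where x: "x \<in> D" "x \<notin> I" using I by blast
    show "\<one> \<notin> I"
    proof
      assume "\<one> \<in> I"
      then have "x \<otimes> \<one> \<in> I" using rmod_smult[OF I(2) x(1)] by blast
      then show False using x Dc by auto
    qed
  qed (use subringE(3)[OF D] in blast)
  show ?thesis
  proof
    assume "P \<in> spec R D"
    then have "primeideal P (subrg R D)" unfolding spec_def by blast
    then interpret P: primeideal P "subrg R D" .
    have 1: "P \<subseteq> D" "rmod R D P" using P.is_ideal ideal_iff by auto
    moreover have "\<one> \<notin> P" using one[OF 1] P.I_notcarr by simp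
    ultimately show "P \<subseteq> D \<and> rmod R D P \<and> \<one> \<notin> P \<and> (\<forall>a\<in>D. \<forall>b\<in>D. a \<otimes> b \<in> P \<longrightarrow> a \<in> P \<or> b \<in> P)"
      using P.I_prime by auto
  next
    assume P: "P \<subseteq> D \<and> rmod R D P \<and> \<one> \<notin> P \<and> (\<forall>a\<in>D. \<forall>b\<in>D. a \<otimes> b \<in> P \<longrightarrow> a \<in> P \<or> b \<in> P)"
    have "primeideal P (subrg R D)"
    proof (rule primeidealI[OF _ Dd.is_cring])
      show "ideal P (subrg R D)" using P ideal_iff by blast
      show "carrier (subrg R D) \<noteq> P" using P one by auto
      show "a \<in> P \<or> b \<in> P" if "a \<in> carrier (subrg R D)" "b \<in> carrier (subrg R D)"
        "a \<otimes>\<^bsub>subrg R D\<^esub> b \<in> P" for a b using P that by auto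
    qed
    then show "P \<in> spec R D" unfolding spec_def by blast
  qed
qed

lemma specD:
  assumes "P \<in> spec R D"
  shows spec_le: "P \<subseteq> D" and spec_rmod: "rmod R D P" and spec_one: "\<one> \<notin> P"
    and spec_prime: "a \<in> D \<Longrightarrow> b \<in> D \<Longrightarrow> a \<otimes> b \<in> P \<Longrightarrow> a \<in> P \<or> b \<in> P"
  using assms spec_iff by blast+

lemma maxspec_spec: "M \<in> maxspec R D \<Longrightarrow> M \<in> spec R D"
proof -
  interpret Dd: domain "subrg R D" by (rule D_dom)
  show "M \<in> maxspec R D \<Longrightarrow> M \<in> spec R D"
    unfolding maxspec_def spec_def using Dd.maximalideal_prime by blast
qed

lemma maxspec_maximal:
  assumes "M \<in> maxspec R D" "M \<subseteq> J" "J \<subseteq> D" "rmod R D J"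
  shows "J = M \<or> J = D"
proof -
  interpret M: maximalideal M "subrg R D" using assms(1) unfolding maxspec_def by blast
  show ?thesis using M.I_maximal[of J] assms ideal_iff by simp
qed

lemma maxspec_incomparable: "M \<in> maxspec R D \<Longrightarrow> P \<in> spec R D \<Longrightarrow> M \<subseteq> P \<Longrightarrow> M = P"
  using maxspec_maximal[of M P] specD[of P] subringE(3)[OF D] by blast

text \<open>
  Zorn's lemma for the ideals that avoid 1.
\<close>

lemma ex_maxspec:
  assumes I: "I \<subseteq> D" "rmod R D I" "\<one> \<notin> I"
  shows "\<exists>M\<in>maxspec R D. I \<subseteq> M"
proof -
  define A where "A = {J. I \<subseteq> J \<and> J \<subseteq> D \<and> rmod R D J \<and> \<one> \<notin> J}"
  have "\<exists>M\<in>A. \<forall>X\<in>A. M \<subseteq> X \<longrightarrow> X = M"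
  proof (rule subset_Zorn)
    fix C assume C: "subset.chain A C"
    show "\<exists>U\<in>A. \<forall>X\<in>C. X \<subseteq> U"
    proof (cases "C = {}")
      case True
      then show ?thesis using I unfolding A_def by blast
    next
      case False
      have CA: "C \<subseteq> A" and ch: "\<And>X Y. X \<in> C \<Longrightarrow> Y \<in> C \<Longrightarrow> X \<subseteq> Y \<or> Y \<subseteq> X"
        using C unfolding subset_chain_def by auto
      obtain X0 where X0: "X0 \<in> C" using False by blast
      have "rmod R D (\<Union>C)"
        unfolding rmod_def
      proof (intro conjI ballI)
        show "\<Union>C \<subseteq> carrier R" using CA Dc unfolding A_def by blast
        show "\<zero> \<in> \<Union>C" using X0 CA rmod_zero unfolding A_def by blast
        fix x assume "x \<in> \<Union>C"
        then obtain X where X: "x \<in> X" "X \<in> C" by blast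
        show "x \<oplus> y \<in> \<Union>C" if y: "y \<in> \<Union>C" for y
        proof -
          obtain Y where Y: "y \<in> Y" "Y \<in> C" using y by blast
          obtain Z where Z: "Z \<in> C" "x \<in> Z" "y \<in> Z" using ch[OF X(2) Y(2)] X Y by blast
          have "rmod R D Z" using Z CA unfolding A_def by blast
          then show ?thesis using rmod_add[OF _ Z(2,3)] Z(1) by blast
        qed
        show "r \<otimes> x \<in> \<Union>C" if r: "r \<in> D" for r
        proof -
          have "rmod R D X" using X CA unfolding A_def by blast
          then show ?thesis using rmod_smult[OF _ r X(1)] X(2) by blast
        qed
      qed
      then have "\<Union>C \<in> A" using CA X0 unfolding A_def by blast
      then show ?thesis by blast
    qed
  qed
  then obtain M where M: "M \<in> A" "\<And>X. X \<in> A \<Longrightarrow> M \<subseteq> X \<Longrightarrow> X = M" by blast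
  have "maximalideal M (subrg R D)"
  proof (rule maximalidealI)
    show "ideal M (subrg R D)" using M(1) ideal_iff unfolding A_def by blast
    show "carrier (subrg R D) \<noteq> M" using M(1) subringE(3)[OF D] unfolding A_def by auto
    fix J assume J: "ideal J (subrg R D)" "M \<subseteq> J" "J \<subseteq> carrier (subrg R D)"
    then have Jm: "J \<subseteq> D" "rmod R D J" using ideal_iff by auto
    show "J = M \<or> J = carrier (subrg R D)"
    proof (cases "\<one> \<in> J")
      case True
      have "x \<in> J" if x: "x \<in> D" for x
      proof -
        have "x \<otimes> \<one> \<in> J" using rmod_smult[OF Jm(2) x True] .
        then show ?thesis using x Dc by auto
      qed
      then show ?thesis using Jm by auto
    next
      case False
      then have "J \<in> A" using Jm J(2) M(1) unfolding A_def by blast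
      then show ?thesis using M(2) J(2) by blast
    qed
  qed
  then show ?thesis using M(1) unfolding maxspec_def A_def by blast
qed

lemma ex_maxspec_above: "P \<in> spec R D \<Longrightarrow> \<exists>M\<in>maxspec R D. P \<subseteq> M"
  using ex_maxspec[of P] specD[of P] by blast

lemma zero_spec: "{\<zero>} \<in> spec R D"
proof -
  have "a = \<zero> \<or> b = \<zero>" if "a \<in> D" "b \<in> D" "a \<otimes> b = \<zero>" for a b
    using that Dc integral[of a b] by auto
  then show ?thesis
    unfolding spec_iff using subringE(2)[OF D] zero_rmod[OF D] one_not_zero by auto
qed

lemma zero_least: "P \<in> spec R D \<Longrightarrow> {\<zero>} \<subseteq> P"
  using rmod_zero[OF spec_rmod] by blast

abbreviation L :: "'a set \<Rightarrow> 'a set" where "L P \<equiv> loc R D P"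

lemma den:
  assumes "P \<in> spec R D" "s \<in> D - P"
  shows "s \<in> carrier R" "s \<noteq> \<zero>" "inv s \<in> carrier R" "inv s \<noteq> \<zero>"
proof -
  show s: "s \<in> carrier R" "s \<noteq> \<zero>" using assms Dc zero_least[OF assms(1)] by auto
  show "inv s \<in> carrier R" "inv s \<noteq> \<zero>" using nz_inv[OF s] by auto
qed

lemma den_mult: "P \<in> spec R D \<Longrightarrow> s \<in> D - P \<Longrightarrow> t \<in> D - P \<Longrightarrow> s \<otimes> t \<in> D - P"
  using spec_prime[of P s t] subringE(6)[OF D, of s t] by blast

lemma locI: "a \<in> D \<Longrightarrow> s \<in> D - P \<Longrightarrow> a \<otimes> inv s \<in> L P"
  unfolding loc_def by blast

lemma locE:
  assumes "x \<in> L P"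
  obtains a s where "a \<in> D" "s \<in> D - P" "x = a \<otimes> inv s"
  using assms unfolding loc_def by blast

lemma D_le_loc: "P \<in> spec R D \<Longrightarrow> D \<subseteq> L P"
proof
  fix x assume P: "P \<in> spec R D" and x: "x \<in> D"
  have "x \<otimes> inv \<one> \<in> L P" using locI[OF x, of \<one> P] subringE(3)[OF D] spec_one[OF P] by blast
  then show "x \<in> L P" using x Dc by auto
qed

lemma inv_in_loc: "P \<in> spec R D \<Longrightarrow> s \<in> D - P \<Longrightarrow> inv s \<in> L P"
  using locI[OF subringE(3)[OF D], of s P] den(3) by simp

lemma loc_carrier: "P \<in> spec R D \<Longrightarrow> L P \<subseteq> carrier R"
  using Dc den(3) unfolding loc_def by blast

lemma loc_subring:
  assumes P: "P \<in> spec R D"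
  shows "subring (L P) R"
proof (rule subringI)
  show "L P \<subseteq> carrier R" using loc_carrier[OF P] .
  show "\<one> \<in> L P" using D_le_loc[OF P] subringE(3)[OF D] by blast
  fix x assume "x \<in> L P"
  then obtain a s where x: "a \<in> D" "s \<in> D - P" "x = a \<otimes> inv s" by (rule locE)
  note s = den[OF P x(2)]
  have ac: "a \<in> carrier R" using x Dc by blast
  have "\<ominus> x = \<ominus> a \<otimes> inv s" unfolding x(3) using l_minus ac s by simp
  then show "\<ominus> x \<in> L P" using locI[OF subringE(5)[OF D x(1)] x(2)] by simp
  fix y assume "y \<in> L P"
  then obtain b t where y: "b \<in> D" "t \<in> D - P" "y = b \<otimes> inv t" by (rule locE)
  note t = den[OF P y(2)]
  have bc: "b \<in> carrier R" using y Dc by blast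
  have st: "inv (s \<otimes> t) = inv s \<otimes> inv t" using nz_inv_mult(1)[OF s(1,2) t(1,2)] .
  have "x \<otimes> y = (a \<otimes> b) \<otimes> inv (s \<otimes> t)" unfolding x(3) y(3) st using ac bc s t by (simp add: m_ac)
  then show "x \<otimes> y \<in> L P" using locI[OF subringE(6)[OF D x(1) y(1)] den_mult[OF P x(2) y(2)]] by simp
  have "a \<otimes> t \<otimes> (inv s \<otimes> inv t) = a \<otimes> inv s \<otimes> (t \<otimes> inv t)"
    "b \<otimes> s \<otimes> (inv s \<otimes> inv t) = b \<otimes> inv t \<otimes> (s \<otimes> inv s)"
    using ac bc s t by (simp_all add: m_ac)
  then have "x \<oplus> y = (a \<otimes> t \<oplus> b \<otimes> s) \<otimes> inv (s \<otimes> t)"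
    unfolding x(3) y(3) st using ac bc s t nz_inv(3)[OF s(1,2)] nz_inv(3)[OF t(1,2)] by (simp add: l_distr)
  moreover have "a \<otimes> t \<oplus> b \<otimes> s \<in> D" using subringE(6,7)[OF D] x y by blast
  ultimately show "x \<oplus> y \<in> L P" using locI[OF _ den_mult[OF P x(2) y(2)]] by simp
qed

lemma prime_not_unit:
  assumes P: "P \<in> spec R D" and p: "p \<in> P" "p \<noteq> \<zero>"
  shows "inv p \<notin> L P"
proof
  assume "inv p \<in> L P"
  then obtain a s where a: "a \<in> D" "s \<in> D - P" "inv p = a \<otimes> inv s" by (rule locE)
  note s = den[OF P a(2)]
  have c: "p \<in> carrier R" "a \<in> carrier R" using p spec_le[OF P] Dc a by auto
  have "p \<otimes> (inv p \<otimes> s) = s" using nz_cancel(1)[OF c(1) p(2) s(1)] .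
  moreover have "inv p \<otimes> s = a" unfolding a(3) using nz_cancel(4)[OF s(1,2) c(2)] .
  ultimately have "s = a \<otimes> p" using m_comm c by simp
  then have "s \<in> P" using rmod_smult[OF spec_rmod[OF P] a(1) p(1)] by simp
  then show False using a(2) by blast
qed

lemma loc_antimono: "P \<subseteq> Q \<Longrightarrow> L Q \<subseteq> L P"
  unfolding loc_def by blast

lemma loc_strict:
  assumes P: "P \<in> spec R D" and Q: "Q \<in> spec R D" and PQ: "P \<subset> Q"
  shows "L Q \<subset> L P"
proof -
  obtain x where x: "x \<in> Q" "x \<notin> P" using PQ by blast
  have xd: "x \<in> D - P" using x spec_le[OF Q] by blast
  have "inv x \<notin> L Q" using prime_not_unit[OF Q x(1)] den(2)[OF P xd] by blast
  then show ?thesis using inv_in_loc[OF P xd] loc_antimono[of P Q] PQ by blast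
qed

lemma loc_zero: "L {\<zero>} = carrier R"
  using loc_carrier[OF zero_spec] quot unfolding loc_def by blast

text \<open>
  The denominators of an element form an ideal that is contained in no maximal ideal.
\<close>

lemma D_eq_Inter_loc: "D = carrier R \<inter> (\<Inter>M\<in>maxspec R D. L M)"
proof
  show "D \<subseteq> carrier R \<inter> (\<Inter>M\<in>maxspec R D. L M)" using Dc D_le_loc[OF maxspec_spec] by blast
  show "carrier R \<inter> (\<Inter>M\<in>maxspec R D. L M) \<subseteq> D"
  proof
    fix x assume x: "x \<in> carrier R \<inter> (\<Inter>M\<in>maxspec R D. L M)"
    then have xc: "x \<in> carrier R" by blast
    define I where "I = {d \<in> D. d \<otimes> x \<in> D}"
    have "rmod R D I"
      unfolding rmod_def
    proof (intro conjI ballI)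
      show "I \<subseteq> carrier R" unfolding I_def using Dc by blast
      show "\<zero> \<in> I" unfolding I_def using subringE(2)[OF D] xc by simp
      fix d assume d: "d \<in> I"
      have dc: "d \<in> carrier R" using d Dc unfolding I_def by blast
      show "d \<oplus> e \<in> I" if e: "e \<in> I" for e
      proof -
        have "e \<in> carrier R" using e Dc unfolding I_def by blast
        then show ?thesis using d e subringE(7)[OF D] xc dc unfolding I_def by (simp add: l_distr)
      qed
      show "r \<otimes> d \<in> I" if r: "r \<in> D" for r
      proof -
        have "r \<in> carrier R" using r Dc by blast
        then show ?thesis using d r subringE(6)[OF D] xc dc unfolding I_def by (simp add: m_assoc)
      qed
    qed
    have "\<one> \<in> I"
    proof (rule ccontr)
      assume "\<one> \<notin> I"
      then obtain M where M: "M \<in> maxspec R D" "I \<subseteq> M"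
        using ex_maxspec[of I] \<open>rmod R D I\<close> unfolding I_def by blast
      then have "x \<in> L M" using x by blast
      then obtain a s where a: "a \<in> D" "s \<in> D - M" "x = a \<otimes> inv s" by (rule locE)
      note s = den[OF maxspec_spec[OF M(1)] a(2)]
      have "s \<otimes> x = a" unfolding a(3) using nz_cancel(5)[OF s(1,2)] a(1) Dc by blast
      then have "s \<in> I" unfolding I_def using a by simp
      then show False using M(2) a(2) by blast
    qed
    then show "x \<in> D" unfolding I_def using xc by simp
  qed
qed

text \<open>
  The localization at a prime \<open>P\<close> is a valuation ring. If \<open>I = (a, b)\<close> and \<open>I J = D\<close>, some product \<open>u
  = i \<otimes> j\<close> with \<open>i \<in> I\<close>, \<open>j \<in> J\<close> lies outside \<open>P\<close>. Writing \<open>i\<close> as a combination of \<open>a\<close> and \<open>b\<close> shows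
  that \<open>a \<otimes> j\<close> or \<open>b \<otimes> j\<close> lies outside \<open>P\<close> too, and then \<open>(b \<otimes> j) / (a \<otimes> j)\<close> or its inverse is in the
  localization.
\<close>

lemma pruefer_loc_valuation:
  assumes pr: "pruefer R D" and P: "P \<in> spec R D"
  shows "valuation_ring R (L P)"
proof -
  interpret Dd: domain "subrg R D" by (rule D_dom)
  have main: "b \<otimes> inv a \<in> L P \<or> a \<otimes> inv b \<in> L P"
    if ab: "a \<in> D" "b \<in> D" "a \<noteq> \<zero>" "b \<noteq> \<zero>" for a b
  proof -
    let ?I = "genideal (subrg R D) {a, b}"
    have abc: "a \<in> carrier R" "b \<in> carrier R" using ab Dc by auto
    have Iid: "ideal ?I (subrg R D)" using ab by (intro Dd.genideal_ideal) auto
    have abI: "a \<in> ?I" "b \<in> ?I" using Dd.genideal_self[of "{a, b}"] ab by auto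
    let ?G = "{\<alpha> \<otimes> a \<oplus> \<beta> \<otimes> b | \<alpha> \<beta>. \<alpha> \<in> D \<and> \<beta> \<in> D}"
    have "ideal ?G (subrg R D)"
      unfolding ideal_iff
    proof
      show "?G \<subseteq> D" using subringE(6,7)[OF D] ab by blast
      then have Gc: "?G \<subseteq> carrier R" using Dc by blast
      show "rmod R D ?G"
        unfolding rmod_def
      proof (intro conjI ballI Gc)
        have "\<zero> = \<zero> \<otimes> a \<oplus> \<zero> \<otimes> b" using abc by simp
        then show "\<zero> \<in> ?G" using subringE(2)[OF D] by blast
        fix x assume "x \<in> ?G"
        then obtain \<alpha> \<beta> where x: "\<alpha> \<in> D" "\<beta> \<in> D" "x = \<alpha> \<otimes> a \<oplus> \<beta> \<otimes> b" by blast
        have xc: "\<alpha> \<in> carrier R" "\<beta> \<in> carrier R" using x Dc by auto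
        show "x \<oplus> y \<in> ?G" if y: "y \<in> ?G" for y
        proof -
          obtain \<gamma> \<delta> where y: "\<gamma> \<in> D" "\<delta> \<in> D" "y = \<gamma> \<otimes> a \<oplus> \<delta> \<otimes> b" using y by blast
          have yc: "\<gamma> \<in> carrier R" "\<delta> \<in> carrier R" using y Dc by auto
          have "x \<oplus> y = (\<alpha> \<oplus> \<gamma>) \<otimes> a \<oplus> (\<beta> \<oplus> \<delta>) \<otimes> b"
            unfolding x(3) y(3) using xc yc abc by (simp add: l_distr a_ac)
          then show ?thesis using subringE(7)[OF D] x y by blast
        qed
        show "r \<otimes> x \<in> ?G" if r: "r \<in> D" for r
        proof -
          have "r \<otimes> x = (r \<otimes> \<alpha>) \<otimes> a \<oplus> (r \<otimes> \<beta>) \<otimes> b"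
            unfolding x(3) using xc abc subsetD[OF Dc r] by (simp add: r_distr m_assoc)
          then show ?thesis using subringE(6)[OF D r] x by blast
        qed
      qed
    qed
    moreover have "{a, b} \<subseteq> ?G"
    proof -
      have "a = \<one> \<otimes> a \<oplus> \<zero> \<otimes> b" "b = \<zero> \<otimes> a \<oplus> \<one> \<otimes> b" using abc by simp_all
      then show ?thesis using subringE(2,3)[OF D] by blast
    qed
    ultimately have IG: "?I \<subseteq> ?G" by (intro Dd.genideal_minimal)
    have "finite {a, b}" "{a, b} \<subseteq> D" "?I \<noteq> {\<zero>}" using ab abI by auto
    then obtain J where J: "J \<in> submods R D" "ideal_prod R ?I J = D"
      using pr unfolding pruefer_def by blast
    have "\<exists>i\<in>?I. \<exists>j\<in>J. i \<otimes> j \<notin> P"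
    proof (rule ccontr)
      assume "\<not> ?thesis"
      then have all: "i \<otimes> j \<in> P" if "i \<in> ?I" "j \<in> J" for i j using that by blast
      have "x \<in> P" if "x \<in> ideal_prod R ?I J" for x
        using that
      proof (induction rule: ideal_prod.induct)
        case (prod i j)
        then show ?case by (rule all)
      next
        case (sum x y)
        then show ?case using rmod_add[OF spec_rmod[OF P]] by blast
      qed
      then show False using J(2) subringE(3)[OF D] spec_one[OF P] by blast
    qed
    then obtain i j where ij: "i \<in> ?I" "j \<in> J" "i \<otimes> j \<notin> P" by blast
    have IJ: "y \<otimes> j \<in> D" if "y \<in> ?I" for y
      using ideal_prod.prod[OF that ij(2), of R] J(2) by simp
    define u where "u = i \<otimes> j"
    have u: "u \<in> D - P" using IJ[OF ij(1)] ij(3) unfolding u_def by blast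
    note um = den[OF P u]
    have jc: "j \<in> carrier R" using J(1) ij(2) rmod_carrier unfolding submods_eq[OF D] by blast
    have ID: "?I \<subseteq> D" using Iid ideal_iff by blast
    have ic: "i \<in> carrier R" using ij(1) ID Dc by blast
    have i0: "i \<noteq> \<zero>" using um(2) jc unfolding u_def by auto
    have fac: "y = i \<otimes> ((y \<otimes> j) \<otimes> inv u)" if y: "y \<in> ?I" for y
    proof -
      have yc: "y \<in> carrier R" using y ID Dc by blast
      have "i \<otimes> ((y \<otimes> j) \<otimes> inv u) = u \<otimes> (y \<otimes> inv u)"
        unfolding u_def[symmetric] using yc ic jc um by (simp add: u_def m_ac)
      then show ?thesis using nz_cancel(5)[OF um(1,2) yc] by simp
    qed
    define r s where "r = a \<otimes> j" and "s = b \<otimes> j"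
    have rs: "r \<in> D" "s \<in> D" unfolding r_def s_def using IJ abI by auto
    have rsc: "r \<in> carrier R" "s \<in> carrier R" using rs Dc by auto
    obtain \<alpha> \<beta> where i: "\<alpha> \<in> D" "\<beta> \<in> D" "i = \<alpha> \<otimes> a \<oplus> \<beta> \<otimes> b" using ij(1) IG by blast
    have ab': "\<alpha> \<in> carrier R" "\<beta> \<in> carrier R" using i Dc by auto
    have "u = \<alpha> \<otimes> r \<oplus> \<beta> \<otimes> s"
      unfolding u_def i(3) r_def s_def using ab' abc jc by (simp add: l_distr m_assoc)
    then have rsP: "r \<notin> P \<or> s \<notin> P"
      using rmod_add[OF spec_rmod[OF P]] rmod_smult[OF spec_rmod[OF P]] i(1,2) u by blast
    have ratio: "y \<otimes> inv x \<in> L P"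
      if x: "x \<in> ?I" "x \<noteq> \<zero>" "x \<otimes> j \<notin> P" and y: "y \<in> ?I" for x y
    proof -
      have xc: "x \<in> carrier R" "y \<in> carrier R" using x y ID Dc by auto
      have xj: "x \<otimes> j \<in> D - P" using IJ[OF x(1)] x(3) by blast
      note xjm = den[OF P xj]
      have j0: "j \<noteq> \<zero>" using xjm(2) xc by auto
      have "(y \<otimes> j) \<otimes> inv (x \<otimes> j) = y \<otimes> inv x"
        using nz_inv_mult(1)[OF xc(1) x(2) jc j0] nz_cancel(1)[OF jc j0, of "y \<otimes> inv x"]
          nz_inv[OF xc(1) x(2)] nz_inv[OF jc j0] xc jc by (simp add: m_ac)
      then show ?thesis using locI[OF IJ[OF y] xj] by simp
    qed
    show ?thesis using rsP ratio[of a b] ratio[of b a] abI ab unfolding r_def s_def by blast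
  qed
  show ?thesis
    unfolding valuation_ring_def
  proof (intro conjI ballI)
    show "subring (L P) R" using loc_subring[OF P] .
    fix x assume x: "x \<in> carrier R - L P"
    obtain a b where ab: "a \<in> D" "b \<in> D - {\<zero>}" "x = a \<otimes> inv b" using quot x by blast
    have c: "a \<in> carrier R" "b \<in> carrier R" "b \<noteq> \<zero>" using ab Dc by auto
    have "a \<noteq> \<zero>"
    proof
      assume "a = \<zero>"
      then have "x = \<zero>" using ab(3) nz_inv[OF c(2,3)] by simp
      then show False using x subringE(2)[OF loc_subring[OF P]] by blast
    qed
    moreover have "inv x = b \<otimes> inv a"
      using nz_inv_mult(1)[OF c(1) \<open>a \<noteq> \<zero>\<close>, of "inv b"] nz_inv[OF c(2,3)] ab(3) nz_inv[OF c(1) \<open>a \<noteq> \<zero>\<close>] c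
      by (simp add: m_comm)
    ultimately show "inv x \<in> L P" using main[of a b] ab x by auto
  qed
qed

end

locale pruefer_domain = domain_in_field +
  assumes loc_valuation: "P \<in> spec R D \<Longrightarrow> valuation_ring R (loc R D P)"
    and finite_max: "finite (maxspec R D)"

lemma semilocal_pruefer_imp_locale:
  assumes "semilocal_pruefer K D"
  shows "pruefer_domain K D"
proof -
  have pr: "pruefer K D" and fin: "finite (maxspec K D)"
    using assms unfolding semilocal_pruefer_def by auto
  then have q: "field K" "subring D K" "\<And>x. x \<in> carrier K \<Longrightarrow> \<exists>a\<in>D. \<exists>b\<in>D - {\<zero>\<^bsub>K\<^esub>}. x = a \<otimes>\<^bsub>K\<^esub> inv\<^bsub>K\<^esub> b"
    unfolding pruefer_def quotient_field_of_def by auto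
  interpret field K by (rule q(1))
  interpret domain_in_field K D
    using q by (intro domain_in_field.intro domain_in_field_axioms.intro) auto
  show ?thesis using pruefer_loc_valuation[OF pr] fin by unfold_locales auto
qed

text \<open>
  If \<open>W\<close> is a valuation ring properly contained in the valuation ring \<open>V\<close>, the residue field of \<open>V\<close> is the
  fraction field of \<open>W\<close> modulo the maximal ideal of \<open>V\<close>.
\<close>

lemma (in field) order_iso_quotient:
  assumes V: "valuation_ring R V" and W: "valuation_ring R W" and WV: "W \<subset> V"
  defines "Z \<equiv> subrg R W Quot nonunits R V"
  shows "\<exists>h. order_iso (Clos R W V - {const_on (mods R W V) V}) (cl_le (mods R W V))
     (FStar_ring Z) (FStar_ring_le Z) h"
proof -
  note Vs = valuation_subring[OF V] and Ws = valuation_subring[OF W] and Vc = valuation_carrier[OF V]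
  have WleV: "W \<subseteq> V" using WV by blast
  let ?P = "nonunits R V"
  have PW: "?P \<subseteq> W" using nonunits_antimono[OF V W WleV] nonunits_le[of W] by blast
  have Pm: "rmod R V ?P" using nonunits_rmod[OF V] .
  interpret WD: domain_in_field R W
  proof (intro domain_in_field.intro domain_in_field_axioms.intro field_axioms Ws)
    fix x assume x: "x \<in> carrier R"
    show "\<exists>a\<in>W. \<exists>b\<in>W - {\<zero>}. x = a \<otimes> inv b"
    proof (cases "x \<in> W")
      case True
      have "x = x \<otimes> inv \<one>" using x by simp
      then show ?thesis using True subringE(3)[OF Ws] one_not_zero by blast
    next
      case False
      then have "x \<noteq> \<zero>" using subringE(2)[OF Ws] by blast
      note ix = nz_inv[OF x this]
      have "x = \<one> \<otimes> inv (inv x)" using ix(5) x by simp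
      then show ?thesis
        using ix(2) valuation_inv[OF W x False] nonunits_le[of W] subringE(3)[OF Ws] by blast
    qed
  qed
  interpret W: domain "subrg R W" by (rule WD.D_dom)
  have "?P \<in> spec R W"
    unfolding WD.spec_iff
  proof (intro conjI ballI impI PW)
    show "rmod R W ?P" using rmod_le[OF Pm WleV] .
    show "\<one> \<notin> ?P" using runits_one[OF Vs] runits_iff by blast
    fix a b assume "a \<in> W" "b \<in> W" and ab: "a \<otimes> b \<in> ?P"
    then have "a \<in> V" "b \<in> V" using WleV by auto
    then show "a \<in> ?P \<or> b \<in> ?P" using runits_mult[OF Vs, of a b] ab runits_iff by auto
  qed
  then have prime: "primeideal ?P (subrg R W)" unfolding spec_def by simp
  interpret P: primeideal ?P "subrg R W" by (rule prime)
  interpret Z: domain Z unfolding Z_def by (rule P.quotient_is_domain)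
  define q where "q = (+>\<^bsub>subrg R W\<^esub>) ?P"
  have q_hom: "q \<in> ring_hom (subrg R W) Z" unfolding q_def Z_def by (rule P.rcos_ring_hom)
  have qc: "q a \<in> carrier Z" if "a \<in> W" for a using ring_hom_closed[OF q_hom] that by simp
  have q_mult: "q (a \<otimes> b) = q a \<otimes>\<^bsub>Z\<^esub> q b" if "a \<in> W" "b \<in> W" for a b
    using ring_hom_mult[OF q_hom] that by simp
  have q_add: "q (a \<oplus> b) = q a \<oplus>\<^bsub>Z\<^esub> q b" if "a \<in> W" "b \<in> W" for a b
    using ring_hom_add[OF q_hom] that by simp
  have q_one: "q \<one> = \<one>\<^bsub>Z\<^esub>" using ring_hom_one[OF q_hom] by simp
  have Z0: "\<zero>\<^bsub>Z\<^esub> = ?P" unfolding Z_def FactRing_def by simp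
  have q_ker: "q a = \<zero>\<^bsub>Z\<^esub> \<longleftrightarrow> a \<in> ?P" if "a \<in> W" for a
    unfolding Z0 q_def using P.rcos_const_imp_mem[of a] W.a_rcos_zero[OF P.is_ideal, of a] that by auto
  have q_zero: "q \<zero> = \<zero>\<^bsub>Z\<^esub>" using q_ker[OF subringE(2)[OF Ws]] rmod_zero[OF Pm] by simp
  have q_surj: "\<exists>a\<in>W. z = q a" if "z \<in> carrier Z" for z
    using that unfolding Z_def q_def FactRing_def A_RCOSETS_def' by auto
  have q_nz: "q b \<in> carrier Z - {\<zero>\<^bsub>Z\<^esub>}" if "b \<in> W - ?P" for b using q_ker qc that by blast
  \<comment> \<open>a quotient \<open>a / b\<close> with \<open>b \<notin> ?P\<close> goes to the class of \<open>(q a, q b)\<close>; every \<open>x \<in> V\<close> has numerator or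
        denominator 1\<close>
  define \<rho> where "\<rho> x = (if x \<in> W then fraction Z (q x) \<one>\<^bsub>Z\<^esub> else fraction Z \<one>\<^bsub>Z\<^esub> (q (inv x)))" for x
  have one_nz: "\<one>\<^bsub>Z\<^esub> \<in> carrier Z - {\<zero>\<^bsub>Z\<^esub>}" by simp
  have rep: "\<exists>a\<in>W. \<exists>b\<in>W - ?P. x = a \<otimes> inv b" if x: "x \<in> V" for x
  proof (cases "x \<in> W")
    case True
    have "x = x \<otimes> inv \<one>" using x Vc by auto
    moreover have "\<one> \<in> W - ?P" using subringE(3)[OF Ws] runits_one[OF Vs] runits_iff by blast
    ultimately show ?thesis using True by blast
  next
    case False
    have xc: "x \<in> carrier R" "x \<noteq> \<zero>" using x Vc False subringE(2)[OF Ws] by auto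
    have "inv x \<in> W" using valuation_inv[OF W xc(1) False] nonunits_le[of W] by blast
    moreover have "inv x \<notin> ?P" using nonunits_iff[OF V] nz_inv[OF xc] x by auto
    moreover have "x = \<one> \<otimes> inv (inv x)" using nz_inv[OF xc] xc by simp
    ultimately show ?thesis using subringE(3)[OF Ws] by blast
  qed
  have WP: "b \<in> carrier R \<and> b \<noteq> \<zero> \<and> inv b \<in> V \<and> inv b \<in> carrier R \<and> inv b \<noteq> \<zero>" if "b \<in> W - ?P" for b
    using runits_mem[OF Vs, of b] that WleV runits_iff by blast
  have \<rho>_frac: "\<rho> (a \<otimes> inv b) = fraction Z (q a) (q b)" if a: "a \<in> W" and b: "b \<in> W - ?P" for a b
  proof (cases "a \<otimes> inv b \<in> W")
    case True
    have ac: "a \<in> carrier R" using a WleV Vc by blast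
    have "q (a \<otimes> inv b) \<otimes>\<^bsub>Z\<^esub> q b = q a"
      using q_mult[OF True, of b] b WP[OF b] nz_cancel(4)[of b a] ac by simp
    then show ?thesis
      unfolding \<rho>_def using True qc[OF True] qc[OF a] q_nz[OF b] one_nz
      by (simp add: Z.fraction_eq_iff)
  next
    case False
    have ac: "a \<in> carrier R" using a WleV Vc by blast
    have a0: "a \<noteq> \<zero>" using False WP[OF b] subringE(2)[OF Ws] by auto
    have "a \<otimes> inv b \<in> V" using a WP[OF b] WleV subringE(6)[OF Vs] by blast
    moreover have xc: "a \<otimes> inv b \<in> carrier R" "a \<otimes> inv b \<noteq> \<zero>"
      using ac WP[OF b] nz_inv_mult(2)[OF ac a0, of "inv b"] by auto
    ultimately have ix: "inv (a \<otimes> inv b) \<in> W - ?P"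
      using valuation_inv[OF W xc(1) False] nonunits_le[of W] nonunits_iff[OF V] nz_inv[OF xc] by auto
    have "inv (a \<otimes> inv b) = inv a \<otimes> b"
      using nz_inv_mult(1)[OF ac a0, of "inv b"] WP[OF b] nz_inv(5)[of b] by simp
    then have "a \<otimes> inv (a \<otimes> inv b) = b" using nz_cancel(1)[OF ac a0, of b] WP[OF b] by simp
    then have "q a \<otimes>\<^bsub>Z\<^esub> q (inv (a \<otimes> inv b)) = q b" using q_mult[of a "inv (a \<otimes> inv b)"] a ix by simp
    then show ?thesis
      unfolding \<rho>_def using False qc[OF a] q_nz[OF b] q_nz[OF ix] by (simp add: Z.fraction_eq_iff)
  qed
  have prodP: "b \<otimes> d \<in> W - ?P" if "b \<in> W - ?P" "d \<in> W - ?P" for b d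
    using that subringE(6)[OF Ws, of b d] P.I_prime[of b d] by auto
  have fc: "fraction Z (q a) (q b) \<in> carrier (fraction_field Z)" if "a \<in> W" "b \<in> W - ?P" for a b
    using qc[OF that(1)] q_nz[OF that(2)] unfolding fraction_field_def by auto
  interpret residue_map R V W "fraction_field Z" \<rho>
  proof
    show "valuation_ring R V" "valuation_ring R W" "W \<subset> V" by fact+
    show "\<rho> ` V = carrier (fraction_field Z)"
    proof
      show "\<rho> ` V \<subseteq> carrier (fraction_field Z)"
      proof
        fix y assume "y \<in> \<rho> ` V"
        then obtain x where x: "x \<in> V" "y = \<rho> x" by blast
        obtain a b where ab: "a \<in> W" "b \<in> W - ?P" "x = a \<otimes> inv b" using rep[OF x(1)] by blast
        show "y \<in> carrier (fraction_field Z)" using fc[OF ab(1,2)] \<rho>_frac[OF ab(1,2)] ab(3) x(2) by simp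
      qed
      show "carrier (fraction_field Z) \<subseteq> \<rho> ` V"
      proof
        fix y assume "y \<in> carrier (fraction_field Z)"
        then obtain s t where st: "y = fraction Z s t" "s \<in> carrier Z" "t \<in> carrier Z - {\<zero>\<^bsub>Z\<^esub>}"
          unfolding fraction_field_def by auto
        obtain a b where ab: "a \<in> W" "s = q a" "b \<in> W" "t = q b" using q_surj st by blast
        then have b: "b \<in> W - ?P" using q_ker st by blast
        have "a \<otimes> inv b \<in> V" using ab WP[OF b] WleV subringE(6)[OF Vs] by blast
        then show "y \<in> \<rho> ` V" using imageI[of "a \<otimes> inv b" V \<rho>] \<rho>_frac[OF ab(1) b] st(1) ab(2,4) by simp
      qed
    qed
    show "\<rho> \<one> = \<one>\<^bsub>fraction_field Z\<^esub>"
      unfolding \<rho>_def using subringE(3)[OF Ws] q_one by (simp add: fraction_field_def)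
    fix x assume x: "x \<in> V"
    obtain a b where ab: "a \<in> W" "b \<in> W - ?P" "x = a \<otimes> inv b" using rep[OF x] by blast
    have c: "a \<in> carrier R" "b \<in> carrier R" "b \<noteq> \<zero>" "inv b \<in> carrier R" using ab WP[OF ab(2)] WleV Vc by auto
    have "fraction Z (q a) (q b) = \<zero>\<^bsub>fraction_field Z\<^esub> \<longleftrightarrow> q a = \<zero>\<^bsub>Z\<^esub>"
      using qc[OF ab(1)] q_nz[OF ab(2)] by (simp add: fraction_field_def Z.fraction_eq_iff)
    also have "\<dots> \<longleftrightarrow> a \<in> ?P" using q_ker[OF ab(1)] .
    also have "\<dots> \<longleftrightarrow> x \<in> ?P"
    proof
      assume "a \<in> ?P"
      then have "inv b \<otimes> a \<in> ?P" using rmod_smult[OF Pm] WP[OF ab(2)] by blast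
      then show "x \<in> ?P" using ab(3) m_comm c by simp
    next
      assume "x \<in> ?P"
      then have "b \<otimes> x \<in> ?P" using rmod_smult[OF Pm] ab(2) WleV by blast
      then show "a \<in> ?P" using ab(3) nz_cancel(5)[OF c(2,3,1)] by simp
    qed
    finally show "\<rho> x = \<zero>\<^bsub>fraction_field Z\<^esub> \<longleftrightarrow> x \<in> ?P" using \<rho>_frac[OF ab(1,2)] ab(3) by simp
    fix y assume y: "y \<in> V"
    obtain a' b' where ab': "a' \<in> W" "b' \<in> W - ?P" "y = a' \<otimes> inv b'" using rep[OF y] by blast
    have c': "a' \<in> carrier R" "b' \<in> carrier R" "b' \<noteq> \<zero>" "inv b' \<in> carrier R"
      using ab' WP[OF ab'(2)] WleV Vc by auto
    have bb: "b \<otimes> b' \<in> W - ?P" using prodP[OF ab(2) ab'(2)] .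
    have ibb: "inv (b \<otimes> b') = inv b \<otimes> inv b'" using nz_inv_mult(1)[OF c(2,3) c'(2,3)] .
    have "x \<otimes> y = (a \<otimes> a') \<otimes> inv (b \<otimes> b')" unfolding ab(3) ab'(3) ibb using c c' by (simp add: m_ac)
    then show "\<rho> (x \<otimes> y) = \<rho> x \<otimes>\<^bsub>fraction_field Z\<^esub> \<rho> y"
      using \<rho>_frac[OF subringE(6)[OF Ws ab(1) ab'(1)] bb] \<rho>_frac[OF ab(1,2)] \<rho>_frac[OF ab'(1,2)]
        ab(3) ab'(3) q_mult ab ab' Z.fraction_mult[OF qc[OF ab(1)] q_nz[OF ab(2)] qc[OF ab'(1)] q_nz[OF ab'(2)]]
      by simp
    have n: "a \<otimes> b' \<oplus> a' \<otimes> b \<in> W" using subringE(6,7)[OF Ws] ab ab' by blast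
    have "a \<otimes> b' \<otimes> (inv b \<otimes> inv b') = a \<otimes> inv b \<otimes> (b' \<otimes> inv b')"
      "a' \<otimes> b \<otimes> (inv b \<otimes> inv b') = a' \<otimes> inv b' \<otimes> (b \<otimes> inv b)"
      using c c' by (simp_all add: m_ac)
    then have "x \<oplus> y = (a \<otimes> b' \<oplus> a' \<otimes> b) \<otimes> inv (b \<otimes> b')"
      unfolding ab(3) ab'(3) ibb using c c' nz_inv(3)[OF c(2,3)] nz_inv(3)[OF c'(2,3)] by (simp add: l_distr)
    then show "\<rho> (x \<oplus> y) = \<rho> x \<oplus>\<^bsub>fraction_field Z\<^esub> \<rho> y"
      using \<rho>_frac[OF n bb] \<rho>_frac[OF ab(1,2)] \<rho>_frac[OF ab'(1,2)]
        ab(3) ab'(3) q_mult q_add subringE(6)[OF Ws] ab ab'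
        Z.fraction_add[OF qc[OF ab(1)] q_nz[OF ab(2)] qc[OF ab'(1)] q_nz[OF ab'(2)]]
      by simp
  qed
  have "D = in_fraction_field Z"
  proof -
    have "D = (\<lambda>a. fraction Z (q a) \<one>\<^bsub>Z\<^esub>) ` W" unfolding D_def \<rho>_def by (intro image_cong) auto
    also have "\<dots> = in_fraction_field Z" unfolding in_fraction_field_def using qc q_surj by (auto simp: image_iff)
    finally show ?thesis .
  qed
  then show ?thesis using order_iso_residue unfolding FStar_ring_def FStar_ring_le_def by simp
qed

section \<open>The tree of branching primes\<close>

context pruefer_domain
begin

lemma nonunits_loc:
  assumes "P \<in> spec R D" "x \<in> D"
  shows "x \<in> nonunits R (L P) \<longleftrightarrow> x \<in> P"
proof
  assume "x \<in> P"
  then show "x \<in> nonunits R (L P)"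
    using nonunits_iff[OF loc_valuation[OF assms(1)]] prime_not_unit[OF assms(1)] assms(2) Dc by blast
next
  assume x: "x \<in> nonunits R (L P)"
  show "x \<in> P"
  proof (rule ccontr)
    assume "x \<notin> P"
    then show False
      using inv_in_loc[OF assms(1), of x] den(2)[OF assms(1), of x] x assms(2)
        nonunits_iff[OF loc_valuation[OF assms(1)]] by blast
  qed
qed

text \<open>The primes below a given prime form a chain, because they are contracted from a valuation ring.\<close>

lemma spec_chain:
  assumes M: "M \<in> spec R D" and P: "P \<in> spec R D" "P \<subseteq> M" and Q: "Q \<in> spec R D" "Q \<subseteq> M"
  shows "P \<subseteq> Q \<or> Q \<subseteq> P"
proof (rule ccontr)
  assume "\<not> ?thesis"
  then obtain x y where x: "x \<in> P" "x \<notin> Q" and y: "y \<in> Q" "y \<notin> P" by blast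
  have no: False
    if P: "P \<in> spec R D" "P \<subseteq> M" and Q: "Q \<in> spec R D" "Q \<subseteq> M" and x: "x \<in> P" "x \<notin> Q" and y: "y \<in> Q" "y \<notin> P"
      and m: "x \<otimes> inv y \<in> L M" for P Q x y
  proof -
    obtain a s where a: "a \<in> D" "s \<in> D - M" "x \<otimes> inv y = a \<otimes> inv s" using m by (rule locE)
    have yd: "y \<in> D - P" using y spec_le[OF Q(1)] by blast
    note ym = den[OF P(1) yd] and sm = den[OF M a(2)]
    have xc: "x \<in> carrier R" "x \<in> D" and ac: "a \<in> carrier R" using x spec_le[OF P(1)] Dc a by auto
    have "s \<otimes> x = s \<otimes> ((x \<otimes> inv y) \<otimes> y)" using nz_cancel(4)[OF ym(1,2) xc(1)] by simp
    also have "\<dots> = (s \<otimes> (a \<otimes> inv s)) \<otimes> y" unfolding a(3) using sm ac ym by (simp add: m_assoc)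
    also have "\<dots> = a \<otimes> y" using nz_cancel(5)[OF sm(1,2) ac] by simp
    finally have "s \<otimes> x \<in> Q" using rmod_smult[OF spec_rmod[OF Q(1)] a(1) y(1)] by simp
    then have "s \<in> Q" using spec_prime[OF Q(1)] a(2) xc(2) x(2) by blast
    then show False using Q(2) a(2) by blast
  qed
  have c: "x \<in> D" "y \<in> D" "x \<noteq> \<zero>" "y \<noteq> \<zero>"
    using x y spec_le[OF P(1)] spec_le[OF Q(1)] zero_least[OF P(1)] zero_least[OF Q(1)] by auto
  then have cc: "x \<in> carrier R" "y \<in> carrier R" using Dc by auto
  have "inv (x \<otimes> inv y) = y \<otimes> inv x"
    using nz_inv_mult(1)[OF cc(1) c(3), of "inv y"] nz_inv[OF cc(1) c(3)] nz_inv[OF cc(2) c(4)] cc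
    by (simp add: m_comm)
  then have "x \<otimes> inv y \<in> L M \<or> y \<otimes> inv x \<in> L M"
    using valuation_inv[OF loc_valuation[OF M], of "x \<otimes> inv y"] nonunits_le[of "L M"]
      nz_inv(1)[OF cc(2) c(4)] cc by auto
  then show False using no[OF P Q x y] no[OF Q P y x] by blast
qed

text \<open>
  The largest prime contained in both \<open>M\<close> and \<open>N\<close>. It is prime because the primes below \<open>M\<close> form a
  chain.
\<close>

definition prime_meet :: "'a set \<Rightarrow> 'a set \<Rightarrow> 'a set" where
  "prime_meet M N = \<Union>{P \<in> spec R D. P \<subseteq> M \<and> P \<subseteq> N}"

lemma meet_ge: "P \<in> spec R D \<Longrightarrow> P \<subseteq> M \<Longrightarrow> P \<subseteq> N \<Longrightarrow> P \<subseteq> prime_meet M N"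
  unfolding prime_meet_def by blast

lemma meet_le: "prime_meet M N \<subseteq> M" "prime_meet M N \<subseteq> N"
  unfolding prime_meet_def by auto

lemma meet_spec:
  assumes M: "M \<in> spec R D" and N: "N \<in> spec R D"
  shows "prime_meet M N \<in> spec R D"
proof -
  let ?F = "{P \<in> spec R D. P \<subseteq> M \<and> P \<subseteq> N}"
  have ch: "P \<subseteq> Q \<or> Q \<subseteq> P" if "P \<in> ?F" "Q \<in> ?F" for P Q using spec_chain[OF M, of P Q] that by blast
  have z: "{\<zero>} \<in> ?F" using zero_spec zero_least[OF M] zero_least[OF N] by blast
  show ?thesis
    unfolding spec_iff
  proof (intro conjI ballI impI)
    show MD: "prime_meet M N \<subseteq> D" using meet_le spec_le[OF M] by blast
    show "\<one> \<notin> prime_meet M N" using meet_le(1) spec_one[OF M] by blast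
    show "rmod R D (prime_meet M N)"
      unfolding rmod_def
    proof (intro conjI ballI)
      show "prime_meet M N \<subseteq> carrier R" using MD Dc by blast
      show "\<zero> \<in> prime_meet M N" using z unfolding prime_meet_def by blast
      fix x assume "x \<in> prime_meet M N"
      then obtain P where P: "P \<in> ?F" "x \<in> P" unfolding prime_meet_def by blast
      show "r \<otimes> x \<in> prime_meet M N" if r: "r \<in> D" for r
        using rmod_smult[OF spec_rmod r P(2)] P(1) unfolding prime_meet_def by blast
      show "x \<oplus> y \<in> prime_meet M N" if y: "y \<in> prime_meet M N" for y
      proof -
        obtain Q where Q: "Q \<in> ?F" "y \<in> Q" using y unfolding prime_meet_def by blast
        obtain Q' where Q': "Q' \<in> ?F" "x \<in> Q'" "y \<in> Q'" using ch[OF P(1) Q(1)] P Q by blast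
        have "x \<oplus> y \<in> Q'" using rmod_add[OF spec_rmod] Q' by blast
        then show ?thesis using Q' unfolding prime_meet_def by blast
      qed
    qed
    fix a b assume ab: "a \<in> D" "b \<in> D" and "a \<otimes> b \<in> prime_meet M N"
    then obtain P where P: "P \<in> ?F" "a \<otimes> b \<in> P" unfolding prime_meet_def by blast
    then have "a \<in> P \<or> b \<in> P" using spec_prime[OF _ ab] by blast
    then show "a \<in> prime_meet M N \<or> b \<in> prime_meet M N" using P unfolding prime_meet_def by blast
  qed
qed

abbreviation "H \<equiv> spec_hi R D"

lemma glb_iff: "is_glb (spec_order R D) P F \<longleftrightarrow> P \<in> spec R D \<and> (\<forall>Q\<in>F \<inter> spec R D. P \<subseteq> Q) \<and>
    (\<forall>P'\<in>spec R D. (\<forall>Q\<in>F \<inter> spec R D. P' \<subseteq> Q) \<longrightarrow> P' \<subseteq> P)"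
proof -
  have [simp]: "carrier (spec_order R D) = spec R D" "le (spec_order R D) = (\<subseteq>)"
    unfolding spec_order_def by simp_all
  have lower: "Lower (spec_order R D) F = {P' \<in> spec R D. \<forall>Q\<in>F \<inter> spec R D. P' \<subseteq> Q}"
    unfolding Lower_def by (simp add: Ball_def Int_def conj_commute)
  show ?thesis unfolding greatest_def lower by (simp add: Ball_def) blast
qed

lemma H_spec: "P \<in> H \<Longrightarrow> P \<in> spec R D"
  unfolding spec_hi_def using zero_spec maxspec_spec by blast

lemma zero_H: "{\<zero>} \<in> H"
  unfolding spec_hi_def by blast

lemma max_H: "M \<in> maxspec R D \<Longrightarrow> M \<in> H"
  unfolding spec_hi_def by blast

lemma meet_H:
  assumes M: "M \<in> maxspec R D" and N: "N \<in> maxspec R D" and "M \<noteq> N"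
  shows "prime_meet M N \<in> H"
proof -
  note MN = maxspec_spec[OF M] maxspec_spec[OF N]
  have inc: "\<not> M \<subseteq> N" "\<not> N \<subseteq> M"
    using maxspec_incomparable[OF M MN(2)] maxspec_incomparable[OF N MN(1)] assms(3) by auto
  have "is_glb (spec_order R D) (prime_meet M N) {M, N}"
    unfolding glb_iff using meet_spec[OF MN] meet_le[of M N] meet_ge[of _ M N] MN by auto
  moreover have "prime_meet M N \<notin> {M, N}" using meet_le[of M N] inc by auto
  moreover have "\<forall>Q\<in>{M, N}. \<forall>Q'\<in>{M, N}. Q \<noteq> Q' \<longrightarrow> \<not> Q \<subseteq> Q'" using inc by blast
  moreover have "{M, N} \<subseteq> spec R D" using MN by blast
  ultimately show ?thesis unfolding spec_hi_def using meet_spec[OF MN] by blast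
qed

text \<open>
  This bound makes the tree finite: apart from \<open>(0)\<close> and the maximal ideals, every node is the meet of
  two maximal ideals. For a family \<open>F\<close> of incomparable primes fix \<open>Q1\<close> in it: the meets of \<open>Q1\<close> with
  the members of \<open>F\<close> form a finite chain below \<open>Q1\<close>, whose least element is the infimum. Replacing two
  incomparable primes by maximal ideals above them does not change their meet.
\<close>

lemma H_sub: "H \<subseteq> {{\<zero>}} \<union> maxspec R D \<union> (\<lambda>(M, N). prime_meet M N) ` (maxspec R D \<times> maxspec R D)"
proof
  fix P assume "P \<in> H"
  then consider "P = {\<zero>} \<or> P \<in> maxspec R D" | F where "P \<in> spec R D" "F \<subseteq> spec R D"
    "\<forall>Q\<in>F. \<forall>Q'\<in>F. Q \<noteq> Q' \<longrightarrow> \<not> Q \<subseteq> Q'" "P \<notin> F" "is_glb (spec_order R D) P F"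
    unfolding spec_hi_def by blast
  then show "P \<in> {{\<zero>}} \<union> maxspec R D \<union> (\<lambda>(M, N). prime_meet M N) ` (maxspec R D \<times> maxspec R D)"
  proof cases
    case (2 F)
    have lb: "\<And>Q. Q \<in> F \<Longrightarrow> P \<subseteq> Q" and gr: "\<And>P'. P' \<in> spec R D \<Longrightarrow> (\<And>Q. Q \<in> F \<Longrightarrow> P' \<subseteq> Q) \<Longrightarrow> P' \<subseteq> P"
      using 2(2,5) unfolding glb_iff by blast+
    show ?thesis
    proof (cases "F = {}")
      case True
      obtain M where M: "M \<in> maxspec R D" "P \<subseteq> M" using ex_maxspec_above[OF 2(1)] by blast
      have "M \<subseteq> P" using gr[OF maxspec_spec[OF M(1)]] True by blast
      then have "P = M" using M(2) by (rule subset_antisym[rotated])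
      then show ?thesis using M(1) by simp
    next
      case False
      have "\<forall>Q\<in>F. \<exists>M\<in>maxspec R D. Q \<subseteq> M" using ex_maxspec_above 2(2) by blast
      then obtain m where m: "\<And>Q. Q \<in> F \<Longrightarrow> m Q \<in> maxspec R D" "\<And>Q. Q \<in> F \<Longrightarrow> Q \<subseteq> m Q" by metis
      have FS: "\<And>Q. Q \<in> F \<Longrightarrow> Q \<in> spec R D" using 2(2) by blast
      have inj: "inj_on m F"
      proof (rule inj_onI, rule ccontr)
        fix Q Q' assume Q: "Q \<in> F" "Q' \<in> F" "m Q = m Q'" "Q \<noteq> Q'"
        then have "Q \<subseteq> Q' \<or> Q' \<subseteq> Q"
          using spec_chain[OF maxspec_spec[OF m(1)[OF Q(1)]] FS[OF Q(1)] m(2)[OF Q(1)] FS[OF Q(2)]]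
            m(2)[OF Q(2)] by simp
        then show False using 2(3) Q by blast
      qed
      have finF: "finite F" using inj finite_max m(1) by (meson finite_subset image_subsetI inj_on_finite)
      obtain Q1 where Q1: "Q1 \<in> F" using False by blast
      let ?A = "prime_meet Q1 ` F"
      have ch: "X \<subseteq> Y \<or> Y \<subseteq> X" if "X \<in> ?A" "Y \<in> ?A" for X Y
        using that spec_chain[OF FS[OF Q1], of X Y] meet_spec[OF FS[OF Q1] FS] meet_le(1) by blast
      have "finite ?A" "?A \<noteq> {}" using finF False by auto
      then obtain X where X: "X \<in> ?A" "\<forall>Y\<in>?A. Y \<subseteq> X \<longrightarrow> X = Y"
        using finite_has_minimal[of ?A] by blast
      then have X_le: "X \<subseteq> Y" if "Y \<in> ?A" for Y using ch[OF X(1) that] that by blast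
      obtain Q2 where Q2: "Q2 \<in> F" "X = prime_meet Q1 Q2" using X(1) by blast
      have "X \<subseteq> P"
      proof (rule gr)
        show "X \<in> spec R D" using meet_spec[OF FS[OF Q1] FS[OF Q2(1)]] Q2 by simp
        show "X \<subseteq> Q" if "Q \<in> F" for Q using X_le[of "prime_meet Q1 Q"] that meet_le(2)[of Q1 Q] by blast
      qed
      moreover have "P \<subseteq> X" unfolding Q2(2) using meet_ge[OF 2(1) lb[OF Q1] lb[OF Q2(1)]] .
      ultimately have PX: "P = prime_meet Q1 Q2" using Q2 by blast
      have "Q1 \<noteq> Q2"
      proof
        assume "Q1 = Q2"
        then have "P = Q1" using PX meet_le(1)[of Q1 Q2] meet_ge[OF FS[OF Q1], of Q1 Q2] by auto
        then show False using 2(4) Q1 by blast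
      qed
      then have inc: "\<not> Q1 \<subseteq> Q2" "\<not> Q2 \<subseteq> Q1" using 2(3) Q1 Q2(1) by auto
      have below: "L' \<subseteq> Q" if Q: "Q \<in> F" "Q' \<in> F" "\<not> Q \<subseteq> Q'" "\<not> Q' \<subseteq> Q"
        and L: "L' \<in> spec R D" "L' \<subseteq> m Q" "L' \<subseteq> m Q'" for L' Q Q'
      proof (rule ccontr)
        assume "\<not> L' \<subseteq> Q"
        then have "Q \<subseteq> L'"
          using spec_chain[OF maxspec_spec[OF m(1)[OF Q(1)]] L(1,2) FS[OF Q(1)] m(2)[OF Q(1)]] by blast
        then have "Q \<subseteq> m Q'" using L(3) by blast
        then show False
          using spec_chain[OF maxspec_spec[OF m(1)[OF Q(2)]] FS[OF Q(1)] _ FS[OF Q(2)] m(2)[OF Q(2)]] Q by blast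
      qed
      have "prime_meet (m Q1) (m Q2) = prime_meet Q1 Q2"
      proof
        show "prime_meet Q1 Q2 \<subseteq> prime_meet (m Q1) (m Q2)" unfolding prime_meet_def using m(2)[OF Q1] m(2)[OF Q2(1)] by blast
        show "prime_meet (m Q1) (m Q2) \<subseteq> prime_meet Q1 Q2"
          unfolding prime_meet_def using below[OF Q1 Q2(1) inc] below[OF Q2(1) Q1 inc(2,1)] by blast
      qed
      then have "P = (\<lambda>(M, N). prime_meet M N) (m Q1, m Q2)" using PX by simp
      moreover have "(m Q1, m Q2) \<in> maxspec R D \<times> maxspec R D" using m(1)[OF Q1] m(1)[OF Q2(1)] by simp
      ultimately show ?thesis by (intro UnI2 image_eqI)
    qed
  qed blast
qed

lemma finite_H: "finite H"
  using finite_subset[OF H_sub] finite_max by blast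

definition children :: "'a set \<Rightarrow> 'a set set" where
  "children P = {C \<in> H. P \<subset> C \<and> \<not> (\<exists>Q\<in>H. P \<subset> Q \<and> Q \<subset> C)}"

lemma childrenD:
  assumes "C \<in> children P"
  shows child_H: "C \<in> H" and child_above: "P \<subset> C" and child_spec: "C \<in> spec R D"
    and child_minimal: "Q \<in> H \<Longrightarrow> P \<subset> Q \<Longrightarrow> Q \<subset> C \<Longrightarrow> False"
  using assms H_spec unfolding children_def by blast+

lemma finite_children: "finite (children P)"
proof -
  have "children P \<subseteq> H" using child_H by blast
  then show ?thesis using finite_H by (rule finite_subset)
qed

lemma ex_child:
  assumes Q: "Q \<in> H" "P \<subset> Q"
  shows "\<exists>C\<in>children P. C \<subseteq> Q"
proof -
  let ?A = "{C \<in> H. P \<subset> C \<and> C \<subseteq> Q}"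
  have "?A \<subseteq> H" by blast
  then have "finite ?A" using finite_H by (rule finite_subset)
  moreover have "?A \<noteq> {}" using Q by blast
  ultimately obtain C where C: "C \<in> ?A" "\<forall>C'\<in>?A. C' \<subseteq> C \<longrightarrow> C = C'"
    using finite_has_minimal[of ?A] by auto
  then have "C \<in> children P" unfolding children_def by blast
  then show ?thesis using C by blast
qed

text \<open>
  A prime below two maximal ideals that lie over distinct children of \<open>P\<close> is contained in \<open>P\<close>: otherwise the
  meet of the two maximal ideals would be a branching prime strictly between \<open>P\<close> and a child.
\<close>

lemma distinct_children:
  assumes P: "P \<in> H" and C: "C \<in> children P" "C' \<in> children P" "C \<noteq> C'"
    and M: "M \<in> maxspec R D" "C \<subseteq> M" and M': "M' \<in> maxspec R D" "C' \<subseteq> M'"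
    and Q: "Q \<in> spec R D" "Q \<subseteq> M" "Q \<subseteq> M'"
  shows "Q \<subseteq> P"
proof -
  note Ms = maxspec_spec[OF M(1)] and Ms' = maxspec_spec[OF M'(1)]
  have nle: "\<not> C1 \<subseteq> C2" if "C1 \<in> children P" "C2 \<in> children P" "C1 \<noteq> C2" for C1 C2
    using child_minimal[OF that(2) child_H[OF that(1)] child_above[OF that(1)]] that by blast
  have CM': "\<not> C \<subseteq> M'"
    using spec_chain[OF Ms' child_spec[OF C(1)] _ child_spec[OF C(2)] M'(2)] nle C by blast
  then have "M \<noteq> M'" using M by blast
  then have mH: "prime_meet M M' \<in> H" using meet_H M(1) M'(1) by blast
  have PM: "P \<subseteq> M" "P \<subseteq> M'" using child_above[OF C(1)] child_above[OF C(2)] M(2) M'(2) by auto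
  have Pm: "P \<subseteq> prime_meet M M'" using meet_ge[OF H_spec[OF P] PM] .
  have "prime_meet M M' \<subseteq> C \<or> C \<subseteq> prime_meet M M'"
    using spec_chain[OF Ms meet_spec[OF Ms Ms'] meet_le(1) child_spec[OF C(1)] M(2)] .
  then have "prime_meet M M' \<subset> C" using CM' meet_le(2)[of M M'] by blast
  then have "prime_meet M M' = P" using child_minimal[OF C(1) mH] Pm by blast
  then show ?thesis using meet_ge[OF Q] by simp
qed

text \<open>
  The elements of the tree below \<open>C\<close> form a chain, so the description of \<open>hi_below\<close> has only one
  solution.
\<close>

lemma hi_below_child:
  assumes P: "P \<in> H" and C: "C \<in> children P"
  shows "hi_below R D C = P"
  unfolding hi_below_def
proof (rule the_equality)
  show "P \<in> H \<and> P \<subset> C \<and> \<not> (\<exists>Q'\<in>H. P \<subset> Q' \<and> Q' \<subset> C)" using P C unfolding children_def by blast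
  fix Q assume Q: "Q \<in> H \<and> Q \<subset> C \<and> \<not> (\<exists>Q'\<in>H. Q \<subset> Q' \<and> Q' \<subset> C)"
  have "P \<subseteq> Q \<or> Q \<subseteq> P"
    using spec_chain[OF child_spec[OF C] H_spec[OF P] _ H_spec, of Q] child_above[OF C] Q by blast
  then show "Q = P" using Q P child_above[OF C] child_minimal[OF C, of Q] by blast
qed

abbreviation "T P \<equiv> T_ring R D P"

lemma T_sub:
  assumes "P \<in> spec R D"
  shows "subring (T P) R"
proof -
  have "{M \<in> maxspec R D. P \<subseteq> M} \<noteq> {}" using ex_maxspec_above[OF assms] by blast
  then show ?thesis
    unfolding T_ring_def using loc_subring[OF maxspec_spec] by (intro subring_Inter) auto
qed

lemma T_le_loc:
  assumes "P \<in> spec R D"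
  shows "T P \<subseteq> L P"
proof -
  obtain M where "M \<in> maxspec R D" "P \<subseteq> M" using ex_maxspec_above[OF assms] by blast
  then show ?thesis unfolding T_ring_def using loc_antimono[of P M] by blast
qed

lemma D_le_T: "D \<subseteq> T P"
  unfolding T_ring_def using D_le_loc[OF maxspec_spec] by blast

text \<open>
  The maximal ideal of a valuation overring is contained in every smaller valuation ring.
\<close>

lemma nonunits_le_T:
  assumes P: "P \<in> spec R D"
  shows "nonunits R (L P) \<subseteq> T P"
  unfolding T_ring_def
proof
  fix x assume x: "x \<in> nonunits R (L P)"
  have "x \<in> L M" if M: "M \<in> maxspec R D" "P \<subseteq> M" for M
    using nonunits_antimono[OF loc_valuation[OF P] loc_valuation[OF maxspec_spec[OF M(1)]] loc_antimono[OF M(2)]]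
      x nonunits_le[of "L M"] by blast
  then show "x \<in> (\<Inter>M\<in>{M \<in> maxspec R D. P \<subseteq> M}. L M)" by blast
qed

lemma T_zero: "T {\<zero>} = D"
proof -
  have "{M \<in> maxspec R D. {\<zero>} \<subseteq> M} = maxspec R D" using zero_least[OF maxspec_spec] by blast
  then have T0: "T {\<zero>} = (\<Inter>M\<in>maxspec R D. L M)" unfolding T_ring_def by simp
  have "T {\<zero>} \<subseteq> carrier R" using T_le_loc[OF zero_spec] loc_carrier[OF zero_spec] by (rule subset_trans)
  then show ?thesis unfolding T0 using D_eq_Inter_loc by (simp add: Int_absorb1)
qed

lemma T_eq:
  assumes P: "P \<in> H"
  shows "T P = L P \<inter> (\<Inter>C\<in>children P. T C)"
proof
  have "T P \<subseteq> T C" if "C \<in> children P" for C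
    unfolding T_ring_def using child_above[OF that] by blast
  then show "T P \<subseteq> L P \<inter> (\<Inter>C\<in>children P. T C)" using T_le_loc[OF H_spec[OF P]] by blast
  show "L P \<inter> (\<Inter>C\<in>children P. T C) \<subseteq> T P"
  proof
    fix x assume x: "x \<in> L P \<inter> (\<Inter>C\<in>children P. T C)"
    have "x \<in> L M" if M: "M \<in> maxspec R D" "P \<subseteq> M" for M
    proof (cases "M = P")
      case False
      then obtain C where C: "C \<in> children P" "C \<subseteq> M" using ex_child[OF max_H[OF M(1)]] M(2) by blast
      then have "x \<in> T C" using x by blast
      then show ?thesis unfolding T_ring_def using C M by blast
    qed (use x in blast)
    then show "x \<in> T P" unfolding T_ring_def by blast
  qed
qed

lemma trunk_child:
  assumes P: "P \<in> H" and C: "C \<in> children P"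
  shows "trunk R (L P) (L C) (T C)"
  using loc_valuation[OF H_spec[OF P]] loc_valuation[OF child_spec[OF C]]
    loc_strict[OF H_spec[OF P] child_spec[OF C] child_above[OF C]] T_sub[OF child_spec[OF C]]
    nonunits_le_T[OF child_spec[OF C]] T_le_loc[OF child_spec[OF C]]
  by (intro trunk.intro trunk_axioms.intro field_axioms)

text \<open>
  The elements of \<open>D\<close> all of whose multiples avoid the products of an element outside \<open>M\<close> and one outside
  \<open>N\<close> form a prime ideal, the centre of the valuation ring generated by the two localizations.
\<close>

lemma coprime_denominators:
  assumes M: "M \<in> spec R D" and N: "N \<in> spec R D"
    and P: "\<And>Q. Q \<in> spec R D \<Longrightarrow> Q \<subseteq> M \<Longrightarrow> Q \<subseteq> N \<Longrightarrow> Q \<subseteq> P" and x: "x \<in> D" "x \<notin> P"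
  shows "\<exists>a\<in>D. \<exists>s\<in>D - N. \<exists>t\<in>D - M. s \<otimes> t = x \<otimes> a"
proof -
  \<comment> \<open>the elements of \<open>D\<close> whose inverse is no fraction \<open>a / (s \<otimes> t)\<close>\<close>
  define Q where "Q = {y \<in> D. \<not> (\<exists>a\<in>D. \<exists>s\<in>D - N. \<exists>t\<in>D - M. s \<otimes> t = y \<otimes> a)}"
  have one: "\<one> \<in> D - N" "\<one> \<in> D - M" using subringE(3)[OF D] spec_one[OF M] spec_one[OF N] by auto
  have QD: "Q \<subseteq> D" unfolding Q_def by blast
  have QI: "y \<notin> Q" if "y \<in> D" "a \<in> D" "s \<in> D - N" "t \<in> D - M" "s \<otimes> t = y \<otimes> a" for y a s t
    using that unfolding Q_def by blast
  have QE: "\<exists>a\<in>D. \<exists>s\<in>D - N. \<exists>t\<in>D - M. s \<otimes> t = y \<otimes> a" if "y \<in> D" "y \<notin> Q" for y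
    using that unfolding Q_def by blast
  have mult: "r \<otimes> y \<in> Q" if r: "r \<in> D" and y: "y \<in> Q" for r y
  proof (rule ccontr)
    assume n: "r \<otimes> y \<notin> Q"
    have yD: "y \<in> D" using y QD by blast
    obtain a s t where a: "a \<in> D" "s \<in> D - N" "t \<in> D - M" "s \<otimes> t = (r \<otimes> y) \<otimes> a"
      using QE[OF subringE(6)[OF D r yD] n] by blast
    have "(r \<otimes> y) \<otimes> a = y \<otimes> (r \<otimes> a)"
      using subsetD[OF Dc r] subsetD[OF Dc yD] subsetD[OF Dc a(1)] by (simp add: m_ac)
    then show False using QI[OF yD subringE(6)[OF D r a(1)] a(2,3)] a(4) y by simp
  qed
  have add: "y \<oplus> z \<in> Q" if y: "y \<in> Q" and z: "z \<in> Q" "z \<noteq> \<zero>" and m: "y \<otimes> inv z \<in> L N" for y z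
  proof (rule ccontr)
    assume n: "y \<oplus> z \<notin> Q"
    have yz: "y \<in> D" "z \<in> D" using y z QD by auto
    then have yzc: "y \<in> carrier R" "z \<in> carrier R" using Dc by auto
    obtain a s t where a: "a \<in> D" "s \<in> D - N" "t \<in> D - M" "s \<otimes> t = (y \<oplus> z) \<otimes> a"
      using QE[OF subringE(7)[OF D yz] n] by blast
    obtain c d where c: "c \<in> D" "d \<in> D - N" "y \<otimes> inv z = c \<otimes> inv d" using m by (rule locE)
    note dm = den[OF N c(2)] and sm = den[OF N a(2)] and tm = den[OF M a(3)]
    have cc: "c \<in> carrier R" "a \<in> carrier R" using c a Dc by auto
    have "d \<otimes> y = d \<otimes> ((y \<otimes> inv z) \<otimes> z)" using nz_cancel(4)[OF yzc(2) z(2) yzc(1)] by simp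
    also have "\<dots> = (d \<otimes> (c \<otimes> inv d)) \<otimes> z" unfolding c(3) using dm cc yzc by (simp add: m_assoc)
    also have "\<dots> = c \<otimes> z" using nz_cancel(5)[OF dm(1,2) cc(1)] by simp
    finally have dy: "d \<otimes> y = c \<otimes> z" .
    have "(d \<otimes> s) \<otimes> t = d \<otimes> ((y \<oplus> z) \<otimes> a)" using a(4) dm sm tm by (simp add: m_assoc)
    also have "\<dots> = (d \<otimes> y \<oplus> d \<otimes> z) \<otimes> a" using dm yzc cc by (simp add: r_distr l_distr m_assoc)
    also have "\<dots> = z \<otimes> ((c \<oplus> d) \<otimes> a)" unfolding dy using dm yzc cc by (simp add: r_distr l_distr m_ac)
    finally have "(d \<otimes> s) \<otimes> t = z \<otimes> ((c \<oplus> d) \<otimes> a)" .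
    moreover have "(c \<oplus> d) \<otimes> a \<in> D" using subringE(6,7)[OF D] c a by blast
    ultimately show False using QI[OF yz(2) _ den_mult[OF N c(2) a(2)] a(3)] z by blast
  qed
  have zero: "\<zero> \<in> Q"
  proof -
    have "s \<otimes> t \<noteq> \<zero>" if "s \<in> D - N" "t \<in> D - M" for s t
      using nz_inv_mult(2) den(1,2)[OF N that(1)] den(1,2)[OF M that(2)] by blast
    moreover have "\<zero> \<otimes> a = \<zero>" if "a \<in> D" for a using that Dc by auto
    ultimately show ?thesis unfolding Q_def using subringE(2)[OF D] by auto
  qed
  have add': "y \<oplus> z \<in> Q" if y: "y \<in> Q" and z: "z \<in> Q" for y z
  proof (cases "y = \<zero> \<or> z = \<zero>")
    case True
    then show ?thesis using y z subsetD[OF Dc subsetD[OF QD y]] subsetD[OF Dc subsetD[OF QD z]] by auto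
  next
    case False
    have c: "y \<in> carrier R" "z \<in> carrier R" using y z QD Dc by auto
    have "inv (y \<otimes> inv z) = z \<otimes> inv y"
      using nz_inv_mult(1)[OF c(1) _, of "inv z"] nz_inv[OF c(1)] nz_inv[OF c(2)] c False
      by (simp add: m_comm)
    then have "y \<otimes> inv z \<in> L N \<or> z \<otimes> inv y \<in> L N"
      using valuation_inv[OF loc_valuation[OF N], of "y \<otimes> inv z"] nonunits_le[of "L N"]
        nz_inv(1)[OF c(2)] c False by auto
    then show ?thesis using add[OF y z] add[OF z y] False a_comm[OF c] by auto
  qed
  have "Q \<in> spec R D"
    unfolding spec_iff
  proof (intro conjI ballI impI QD)
    show "rmod R D Q" unfolding rmod_def using QD Dc zero add' mult by blast
    show "\<one> \<notin> Q" using QI[of \<one> \<one> \<one> \<one>] one by blast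
    fix y z assume yz: "y \<in> D" "z \<in> D" "y \<otimes> z \<in> Q"
    show "y \<in> Q \<or> z \<in> Q"
    proof (rule ccontr)
      assume "\<not> ?thesis"
      then obtain a s t a' s' t' where a: "a \<in> D" "s \<in> D - N" "t \<in> D - M" "s \<otimes> t = y \<otimes> a"
        and a': "a' \<in> D" "s' \<in> D - N" "t' \<in> D - M" "s' \<otimes> t' = z \<otimes> a'" using QE yz by meson
      have c: "y \<in> carrier R" "z \<in> carrier R" "a \<in> carrier R" "a' \<in> carrier R" using yz a a' Dc by auto
      note m = den(1)[OF N a(2)] den(1)[OF N a'(2)] den(1)[OF M a(3)] den(1)[OF M a'(3)]
      have "(s \<otimes> s') \<otimes> (t \<otimes> t') = (s \<otimes> t) \<otimes> (s' \<otimes> t')" using m by (simp add: m_ac)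
      also have "\<dots> = (y \<otimes> z) \<otimes> (a \<otimes> a')" unfolding a(4) a'(4) using c by (simp add: m_ac)
      finally show False
        using QI[OF _ subringE(6)[OF D a(1) a'(1)] den_mult[OF N a(2) a'(2)] den_mult[OF M a(3) a'(3)]]
          subringE(6)[OF D yz(1,2)] yz(3) by blast
    qed
  qed
  moreover have "Q \<subseteq> N"
  proof
    fix y assume y: "y \<in> Q"
    show "y \<in> N"
    proof (rule ccontr)
      assume "y \<notin> N"
      then show False using QI[of y \<one> y \<one>] y QD one by blast
    qed
  qed
  moreover have "Q \<subseteq> M"
  proof
    fix y assume y: "y \<in> Q"
    show "y \<in> M"
    proof (rule ccontr)
      assume n: "y \<notin> M"
      have "\<one> \<otimes> y = y \<otimes> \<one>" using subsetD[OF Dc subsetD[OF QD y]] by simp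
      then show False using QI[of y \<one> \<one> y] y n QD one by blast
    qed
  qed
  ultimately have "Q \<subseteq> P" using P by blast
  then show ?thesis using QE[OF x(1)] x(2) by blast
qed

end

section \<open>Approximation at the children of a node\<close>

context pruefer_domain
begin

text \<open>
  The two localizations generate the localization at \<open>P\<close>, so a fraction with denominator outside \<open>P\<close>
  can be written with a denominator that is a product of an element outside \<open>M\<close> and one outside \<open>N\<close>.
\<close>

lemma local_approx:
  assumes P: "P \<in> H" and C: "C \<in> children P" "C' \<in> children P" "C \<noteq> C'"
    and M: "M \<in> maxspec R D" "C \<subseteq> M" and N: "N \<in> maxspec R D" "C' \<subseteq> N" and u: "u \<in> runits R (L P)"
  shows "\<exists>t\<in>D - M. inv u \<otimes> t \<in> L N"
proof -
  note Ms = maxspec_spec[OF M(1)] and Ns = maxspec_spec[OF N(1)]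
  note um = runits_mem[OF loc_subring[OF H_spec[OF P]] u]
  obtain a b where ab: "a \<in> D" "b \<in> D - P" "inv u = a \<otimes> inv b" using um(2) by (rule locE)
  have dc: "\<And>Q. Q \<in> spec R D \<Longrightarrow> Q \<subseteq> M \<Longrightarrow> Q \<subseteq> N \<Longrightarrow> Q \<subseteq> P"
    using distinct_children[OF P C M N] .
  have bP: "b \<in> D" "b \<notin> P" using ab(2) by auto
  obtain e s t where e: "e \<in> D" "s \<in> D - N" "t \<in> D - M" "s \<otimes> t = b \<otimes> e"
    using coprime_denominators[OF Ms Ns dc bP] by blast
  note sm = den[OF Ns e(2)] and tm = den[OF Ms e(3)] and bm = den[OF H_spec[OF P] ab(2)]
  have c: "a \<in> carrier R" "e \<in> carrier R" using ab e Dc by auto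
  have "t = inv s \<otimes> (b \<otimes> e)" unfolding e(4)[symmetric] using nz_cancel(2)[OF sm(1,2) tm(1)] by simp
  then have "inv u \<otimes> t = (inv b \<otimes> (b \<otimes> (a \<otimes> e))) \<otimes> inv s"
    unfolding ab(3) using c sm bm by (simp add: m_ac)
  then have "inv u \<otimes> t = (a \<otimes> e) \<otimes> inv s" using nz_cancel(2)[OF bm(1,2), of "a \<otimes> e"] c by simp
  then have "inv u \<otimes> t \<in> L N" using locI[OF subringE(6)[OF D ab(1) e(1)] e(2)] by simp
  then show ?thesis using e(3) by blast
qed

lemma maximal_separation:
  assumes "finite F" "F \<subseteq> maxspec R D" "M \<in> maxspec R D" "M \<notin> F" "rmod R D J" "J \<subseteq> D" "\<not> J \<subseteq> M"
  shows "\<exists>r\<in>J - M. \<forall>N\<in>F. r \<in> N"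
  using assms(1,2,4)
proof (induction F)
  case empty
  then show ?case using assms(7) by blast
next
  case (insert N F)
  then obtain r where r: "r \<in> J - M" "\<forall>N\<in>F. r \<in> N" by blast
  have Nmax: "N \<in> maxspec R D" "N \<noteq> M" using insert.prems by auto
  have "\<not> N \<subseteq> M" using maxspec_incomparable[OF Nmax(1) maxspec_spec[OF assms(3)]] Nmax(2) by blast
  then obtain n where n: "n \<in> N" "n \<notin> M" by blast
  have nD: "n \<in> D" using n spec_le[OF maxspec_spec[OF Nmax(1)]] by blast
  have rD: "r \<in> D" using r(1) assms(6) by blast
  have rJ: "n \<otimes> r \<in> J" using rmod_smult[OF assms(5) nD] r(1) by blast
  have rM: "n \<otimes> r \<notin> M" using spec_prime[OF maxspec_spec[OF assms(3)] nD rD] n r(1) by blast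
  have "n \<otimes> r \<in> N'" if "N' \<in> insert N F" for N'
  proof (cases "N' = N")
    case True
    have "r \<otimes> n \<in> N" using rmod_smult[OF spec_rmod[OF maxspec_spec[OF Nmax(1)]] rD n(1)] .
    then show ?thesis using True m_comm[OF subsetD[OF Dc rD] subsetD[OF Dc nD]] by simp
  next
    case False
    then have "N' \<in> F" using that by blast
    then have "N' \<in> maxspec R D" "r \<in> N'" using insert.prems r(2) by auto
    then show ?thesis using rmod_smult[OF spec_rmod[OF maxspec_spec] nD] by blast
  qed
  then show ?case using rJ rM by blast
qed

text \<open>
  Avoidance of finitely many maximal ideals; one more is avoided by adding an element that lies in all
  the previous ones.
\<close>

lemma maximal_avoidance:
  assumes "finite F" "F \<subseteq> maxspec R D" "rmod R D J" "J \<subseteq> D" "\<And>M. M \<in> F \<Longrightarrow> \<not> J \<subseteq> M"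
  shows "\<exists>s\<in>J. \<forall>M\<in>F. s \<notin> M"
  using assms(1,2,5)
proof (induction F)
  case empty
  then show ?case using rmod_zero[OF assms(3)] by blast
next
  case (insert M F)
  then obtain s where s: "s \<in> J" "\<forall>N\<in>F. s \<notin> N" by blast
  have Mm: "M \<in> maxspec R D" "F \<subseteq> maxspec R D" using insert.prems(1) by auto
  show ?case
  proof (cases "s \<in> M")
    case False
    then show ?thesis using s by blast
  next
    case True
    have "\<not> J \<subseteq> M" using insert.prems(2) by blast
    then obtain r where r: "r \<in> J - M" "\<forall>N\<in>F. r \<in> N"
      using maximal_separation[OF insert.hyps(1) Mm(2,1) insert.hyps(2) assms(3,4)] by blast
    have c: "s \<in> carrier R" "r \<in> carrier R" using s(1) r(1) assms(4) Dc by auto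
    have diff: "a \<in> N" if N: "N \<in> maxspec R D" and "a \<oplus> b \<in> N" "b \<in> N" "a \<in> carrier R" for N a b
    proof -
      have bc: "b \<in> carrier R" using that(3) spec_le[OF maxspec_spec[OF N]] Dc by blast
      have "(a \<oplus> b) \<oplus> \<ominus> b \<in> N"
        using rmod_add[OF spec_rmod[OF maxspec_spec[OF N]] that(2)]
          rmod_minus[OF D spec_rmod[OF maxspec_spec[OF N]] that(3)] by blast
      then show ?thesis using that(4) bc by (simp add: a_assoc r_neg)
    qed
    have "s \<oplus> r \<in> J" using rmod_add[OF assms(3) s(1)] r(1) by blast
    moreover have "s \<oplus> r \<notin> N" if N: "N \<in> insert M F" for N
    proof (cases "N = M")
      case eq: True
      show ?thesis using diff[OF Mm(1), of r s] True r(1) c a_comm[OF c] unfolding eq by auto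
    next
      case False
      then have NF: "N \<in> F" "N \<in> maxspec R D" using N Mm(2) by auto
      show ?thesis using diff[OF NF(2), of s r] s(2) r(2) NF(1) c by auto
    qed
    ultimately show ?thesis by blast
  qed
qed

text \<open>
  The elements that are divisible by \<open>u j\<close> in all the \<open>T j\<close> with \<open>j \<noteq> C\<close> form an ideal \<open>J\<close> of \<open>D\<close>. For
  each maximal ideal \<open>M\<close> above \<open>C\<close>, a product of local approximations lies in \<open>J\<close> but not in \<open>M\<close>, and
  an element of \<open>J\<close> outside all these \<open>M\<close> is a unit of \<open>T C\<close>.
\<close>

lemma child_approx:
  assumes P: "P \<in> H" and C: "C \<in> children P" and u: "\<And>j. j \<in> children P \<Longrightarrow> u j \<in> runits R (L P)"
  shows "\<exists>s\<in>runits R (T C). \<forall>j\<in>children P - {C}. s \<in> T j \<and> inv (u j) \<otimes> s \<in> T j"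
proof -
  let ?Q = "{(j, N). j \<in> children P - {C} \<and> N \<in> maxspec R D \<and> j \<subseteq> N}"
  have "?Q \<subseteq> children P \<times> maxspec R D" by blast
  then have finQ: "finite ?Q" using finite_cartesian_product[OF finite_children finite_max] by (rule finite_subset)
  have ium: "inv (u j) \<in> carrier R" if "j \<in> children P" for j
    using runits_mem(5)[OF loc_subring[OF H_spec[OF P]] u[OF that]] .
  define J where "J = {s \<in> D. \<forall>(j, N)\<in>?Q. inv (u j) \<otimes> s \<in> L N}"
  have JD: "J \<subseteq> D" unfolding J_def by blast
  have JI: "s \<in> J" if "s \<in> D" "\<And>j N. (j, N) \<in> ?Q \<Longrightarrow> inv (u j) \<otimes> s \<in> L N" for s
    using that unfolding J_def by auto
  have NL: "subring (L N) R" "D \<subseteq> L N" if "N \<in> maxspec R D" for N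
    using loc_subring[OF maxspec_spec[OF that]] D_le_loc[OF maxspec_spec[OF that]] .
  have Jrm: "rmod R D J"
    unfolding rmod_def
  proof (intro conjI ballI)
    show "J \<subseteq> carrier R" using JD Dc by blast
    have "inv (u j) \<otimes> \<zero> \<in> L N" if "(j, N) \<in> ?Q" for j N
    proof -
      have "inv (u j) \<otimes> \<zero> = \<zero>" using ium[of j] that by simp
      then show ?thesis using subringE(2)[OF NL(1)] that by simp
    qed
    then show "\<zero> \<in> J" by (rule JI[OF subringE(2)[OF D]])
    fix x assume x: "x \<in> J"
    then have xc: "x \<in> carrier R" using JD Dc by blast
    show "x \<oplus> y \<in> J" if y: "y \<in> J" for y
    proof -
      have yc: "y \<in> carrier R" using y JD Dc by blast
      have "inv (u j) \<otimes> (x \<oplus> y) \<in> L N" if q: "(j, N) \<in> ?Q" for j N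
      proof -
        have "inv (u j) \<otimes> x \<in> L N" "inv (u j) \<otimes> y \<in> L N" using x y q unfolding J_def by auto
        then have "inv (u j) \<otimes> x \<oplus> inv (u j) \<otimes> y \<in> L N" using subringE(7)[OF NL(1)] q by blast
        then show ?thesis using ium[of j] q xc yc by (simp add: r_distr)
      qed
      then show ?thesis by (rule JI[OF subringE(7)[OF D subsetD[OF JD x] subsetD[OF JD y]]])
    qed
    show "r \<otimes> x \<in> J" if r: "r \<in> D" for r
    proof -
      have "inv (u j) \<otimes> (r \<otimes> x) \<in> L N" if q: "(j, N) \<in> ?Q" for j N
      proof -
        have 1: "inv (u j) \<otimes> x \<in> L N" using x q unfolding J_def by auto
        have Nm: "N \<in> maxspec R D" using q by blast
        have "r \<otimes> (inv (u j) \<otimes> x) \<in> L N" using subringE(6)[OF NL(1)[OF Nm] subsetD[OF NL(2)[OF Nm] r] 1] .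
        then show ?thesis using ium[of j] q xc subsetD[OF Dc r] by (simp add: m_lcomm)
      qed
      then show ?thesis by (rule JI[OF subringE(6)[OF D r subsetD[OF JD x]]])
    qed
  qed
  let ?F = "{M \<in> maxspec R D. C \<subseteq> M}"
  have "\<not> J \<subseteq> M" if M: "M \<in> ?F" for M
  proof -
    note Ms = maxspec_spec[of M]
    have MM: "M \<in> maxspec R D" "C \<subseteq> M" using M by auto
    have "\<exists>t\<in>D - M. \<forall>(j, N)\<in>Q. inv (u j) \<otimes> t \<in> L N" if "finite Q" "Q \<subseteq> ?Q" for Q
      using that
    proof (induction Q)
      case empty
      then show ?case using subringE(3)[OF D] spec_one[OF Ms[OF MM(1)]] by blast
    next
      case (insert q Q)
      then obtain t where t: "t \<in> D - M" "\<forall>(j, N)\<in>Q. inv (u j) \<otimes> t \<in> L N" by blast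
      obtain j0 N0 where q: "q = (j0, N0)" by (cases q)
      have j0: "j0 \<in> children P" "C \<noteq> j0" and N0: "N0 \<in> maxspec R D" "j0 \<subseteq> N0" using insert.prems q by auto
      obtain s where s: "s \<in> D - M" "inv (u j0) \<otimes> s \<in> L N0"
        using local_approx[OF P C j0 MM N0 u[OF j0(1)]] by blast
      have c: "s \<in> carrier R" "t \<in> carrier R" using s t Dc by auto
      have "inv (u j) \<otimes> (s \<otimes> t) \<in> L N" if jN: "(j, N) \<in> insert q Q" for j N
      proof (cases "(j, N) = q")
        case True
        then have jn: "j = j0" "N = N0" using q by auto
        have "t \<in> L N0" using NL(2)[OF N0(1)] t by blast
        then have "(inv (u j0) \<otimes> s) \<otimes> t \<in> L N0" using subringE(6)[OF NL(1)[OF N0(1)] s(2)] by blast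
        then show ?thesis unfolding jn using ium[OF j0(1)] c by (simp add: m_assoc)
      next
        case False
        then have jq: "(j, N) \<in> Q" using jN by blast
        then have Nm: "N \<in> maxspec R D" and jm: "j \<in> children P" using insert.prems by auto
        have "s \<in> L N" using NL(2)[OF Nm] s by blast
        moreover have "inv (u j) \<otimes> t \<in> L N" using t(2) jq by auto
        ultimately have "s \<otimes> (inv (u j) \<otimes> t) \<in> L N" using subringE(6)[OF NL(1)[OF Nm]] by blast
        then show ?thesis using ium[OF jm] c by (simp add: m_lcomm)
      qed
      then show ?case using den_mult[OF Ms[OF MM(1)] s(1) t(1)] by blast
    qed
    from this[OF finQ subset_refl] obtain t where t: "t \<in> D - M" "\<forall>(j, N)\<in>?Q. inv (u j) \<otimes> t \<in> L N" by blast
    from t have "t \<in> J" "t \<notin> M" by (auto intro!: JI)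
    then show ?thesis by blast
  qed
  moreover have "finite ?F" using finite_max by simp
  ultimately obtain s where s: "s \<in> J" "\<forall>M\<in>?F. s \<notin> M"
    using maximal_avoidance[of ?F J] Jrm JD by blast
  have sD: "s \<in> D" using s(1) JD by blast
  have "s \<in> runits R (T C)"
  proof -
    obtain M where M: "M \<in> ?F" using ex_maxspec_above[OF child_spec[OF C]] by blast
    have "s \<noteq> \<zero>" using den(2)[OF maxspec_spec, of M s] M s(2) sD by blast
    moreover have "inv s \<in> L M" if "M \<in> ?F" for M
      using inv_in_loc[OF maxspec_spec, of M s] that s(2) sD by blast
    ultimately show ?thesis unfolding runits_def T_ring_def using D_le_T[of C] sD unfolding T_ring_def by blast
  qed
  moreover have "s \<in> T j \<and> inv (u j) \<otimes> s \<in> T j" if j: "j \<in> children P - {C}" for j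
  proof
    show "s \<in> T j" using D_le_T sD by blast
    have "inv (u j) \<otimes> s \<in> L N" if "N \<in> maxspec R D" "j \<subseteq> N" for N
      using s(1) that j unfolding J_def by auto
    then show "inv (u j) \<otimes> s \<in> T j" unfolding T_ring_def by blast
  qed
  ultimately show ?thesis by blast
qed

lemma fork_children:
  assumes P: "P \<in> H"
  shows "fork_rings R (L P) (children P) L T"
proof (intro fork_rings.intro fork_rings_axioms.intro field_axioms)
  show "valuation_ring R (L P)" using loc_valuation[OF H_spec[OF P]] .
  show "finite (children P)" by (rule finite_children)
  show "trunk R (L P) (L C) (T C)" if "C \<in> children P" for C using trunk_child[OF P that] .
  show "\<exists>s\<in>runits R (T C). \<forall>j\<in>children P - {C}. s \<in> T j \<and> inv (u j) \<otimes> s \<in> T j"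
    if "C \<in> children P" "\<And>j. j \<in> children P \<Longrightarrow> u j \<in> runits R (L P)" for C u
    using child_approx[OF P that(1), of u] that(2) by simp
qed

lemma TT_children:
  assumes P: "P \<in> H"
  shows "fork_rings.TT (L P) (children P) T = T P"
  using fork_rings.TT_def[OF fork_children[OF P]] T_eq[OF P] by simp

text \<open>
  This identifies the ideal that is divided out in the definition of \<open>Zring\<close> with the maximal ideal of
  the localization at the node below.
\<close>

lemma nonunits_child:
  assumes P: "P \<in> H" and C: "C \<in> children P"
  shows "genideal (subrg R (L C)) P = nonunits R (L P)"
proof -
  note Cs = child_spec[OF C] and Ps = H_spec[OF P]
  have PC: "P \<subseteq> C" using child_above[OF C] by blast
  interpret LC: domain_in_field R "L C"
  proof (intro domain_in_field.intro domain_in_field_axioms.intro field_axioms)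
    show "subring (L C) R" using loc_subring[OF Cs] .
    show "\<exists>a\<in>L C. \<exists>b\<in>L C - {\<zero>}. x = a \<otimes> inv b" if "x \<in> carrier R" for x
      using quot[OF that] D_le_loc[OF Cs] by blast
  qed
  interpret LCd: domain "subrg R (L C)" by (rule LC.D_dom)
  note V = loc_valuation[OF Ps]
  have NP: "nonunits R (L P) \<subseteq> L C" using nonunits_le_T[OF Ps] T_le_loc[OF Cs] unfolding T_ring_def using PC
    nonunits_antimono[OF V loc_valuation[OF Cs] loc_antimono[OF PC]] nonunits_le[of "L C"] by blast
  have PN: "P \<subseteq> nonunits R (L P)" using nonunits_loc[OF Ps] spec_le[OF Ps] by blast
  have ideal: "ideal (nonunits R (L P)) (subrg R (L C))"
    unfolding LC.ideal_iff using NP rmod_le[OF nonunits_rmod[OF V] loc_antimono[OF PC]] by blast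
  show ?thesis
  proof
    show "genideal (subrg R (L C)) P \<subseteq> nonunits R (L P)"
      using LCd.genideal_minimal[OF ideal PN] .
    show "nonunits R (L P) \<subseteq> genideal (subrg R (L C)) P"
    proof
      fix x assume x: "x \<in> nonunits R (L P)"
      have Pc: "P \<subseteq> carrier (subrg R (L C))" using PN NP by auto
      have id: "ideal (genideal (subrg R (L C)) P) (subrg R (L C))" using LCd.genideal_ideal[OF Pc] .
      have PI: "P \<subseteq> genideal (subrg R (L C)) P" using LCd.genideal_self[OF Pc] .
      have "x \<in> L C" using x NP by blast
      then obtain a s where a: "a \<in> D" "s \<in> D - C" "x = a \<otimes> inv s" by (rule locE)
      note sm = den[OF Cs a(2)]
      have ac: "a \<in> carrier R" using a Dc by blast
      have "s \<in> L P" using D_le_loc[OF Ps] a(2) by blast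
      then have "s \<otimes> x \<in> nonunits R (L P)" using rmod_smult[OF nonunits_rmod[OF V] _ x] by blast
      then have "a \<in> nonunits R (L P)" unfolding a(3) using nz_cancel(5)[OF sm(1,2) ac] by simp
      then have "a \<in> P" using nonunits_loc[OF Ps a(1)] by blast
      then have aI: "a \<in> genideal (subrg R (L C)) P" using PI by blast
      have "inv s \<in> L C" using inv_in_loc[OF Cs a(2)] .
      then have "inv s \<otimes> a \<in> genideal (subrg R (L C)) P"
        using rmod_smult[of "L C"] id aI unfolding LC.ideal_iff by blast
      then show "x \<in> genideal (subrg R (L C)) P" unfolding a(3) using m_comm[OF sm(3) ac] by simp
    qed
  qed
qed

lemma Zring_child:
  assumes P: "P \<in> H" and C: "C \<in> children P"
  shows "Zring R D C = subrg R (L C) Quot nonunits R (L P)"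
  unfolding Zring_def hi_below_child[OF P C] nonunits_child[OF P C] ..

lemma order_iso_Zring:
  assumes P: "P \<in> H" and C: "C \<in> children P"
  shows "\<exists>h. order_iso (Clos R (L C) (L P) - {const_on (mods R (L C) (L P)) (L P)}) (cl_le (mods R (L C) (L P)))
     (FStar_ring (Zring R D C)) (FStar_ring_le (Zring R D C)) h"
  unfolding Zring_child[OF P C]
  using order_iso_quotient[OF loc_valuation[OF H_spec[OF P]] loc_valuation[OF child_spec[OF C]]
      loc_strict[OF H_spec[OF P] child_spec[OF C] child_above[OF C]]] .

section \<open>The standard decomposition\<close>

lemma hi_minimal_eq: "hi_minimal R D = children {\<zero>}"
proof -
  have "P \<in> H - {{\<zero>}} \<longleftrightarrow> P \<in> H \<and> {\<zero>} \<subset> P" for P using zero_least[OF H_spec] by blast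
  then show ?thesis unfolding hi_minimal_def children_def by blast
qed

lemma field_iff: "D = carrier R \<longleftrightarrow> {\<zero>} \<in> maxspec R D"
proof
  assume z: "{\<zero>} \<in> maxspec R D"
  have "M = {\<zero>}" if "M \<in> maxspec R D" for M
    using maxspec_incomparable[OF z maxspec_spec[OF that] zero_least[OF maxspec_spec[OF that]]] by simp
  then show "D = carrier R" using D_eq_Inter_loc loc_zero by auto
next
  assume DK: "D = carrier R"
  obtain M where M: "M \<in> maxspec R D" using ex_maxspec_above[OF zero_spec] by blast
  have "x = \<zero>" if x: "x \<in> M" for x
  proof (rule ccontr)
    assume x0: "x \<noteq> \<zero>"
    have xc: "x \<in> carrier R" using x spec_le[OF maxspec_spec[OF M]] Dc by blast
    have "inv x \<otimes> x \<in> M" using rmod_smult[OF spec_rmod[OF maxspec_spec[OF M]] _ x] nz_inv(1)[OF xc x0] DK by blast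
    then show False using nz_inv(4)[OF xc x0] spec_one[OF maxspec_spec[OF M]] by simp
  qed
  then have "M = {\<zero>}" using zero_least[OF maxspec_spec[OF M]] by blast
  then show "{\<zero>} \<in> maxspec R D" using M by simp
qed

lemma children_field:
  assumes "D = carrier R"
  shows "children {\<zero>} = {}"
proof -
  have z: "{\<zero>} \<in> maxspec R D" using assms field_iff by blast
  have "\<not> {\<zero>} \<subset> P" if "P \<in> spec R D" for P using maxspec_incomparable[OF z that] by blast
  then show ?thesis using child_above child_spec by blast
qed

text \<open>
  Two maximal ideals are dependent exactly when they lie above the same child of \<open>(0)\<close>.
\<close>

lemma std_decomp_eq: "std_decomp R D = T ` children {\<zero>}"
proof (cases "D = carrier R")
  case True
  then show ?thesis unfolding std_decomp_def using children_field by simp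
next
  case False
  have cls: "dep_rel R D `` {M} = {M' \<in> maxspec R D. C \<subseteq> M'}"
    if M: "M \<in> maxspec R D" and C: "C \<in> children {\<zero>}" "C \<subseteq> M" for M C
  proof
    have C0: "C \<noteq> {\<zero>}" using child_above[OF C(1)] by blast
    show "{M' \<in> maxspec R D. C \<subseteq> M'} \<subseteq> dep_rel R D `` {M}"
      unfolding dep_rel_def using M C child_spec[OF C(1)] C0 by blast
    show "dep_rel R D `` {M} \<subseteq> {M' \<in> maxspec R D. C \<subseteq> M'}"
    proof
      fix M' assume "M' \<in> dep_rel R D `` {M}"
      then obtain Q where Q: "M' \<in> maxspec R D" "Q \<in> spec R D" "Q \<noteq> {\<zero>}" "Q \<subseteq> M" "Q \<subseteq> M'"
        unfolding dep_rel_def by blast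
      have "{\<zero>} \<subset> M'" using zero_least[OF Q(2)] Q(3,5) by blast
      then obtain C' where C': "C' \<in> children {\<zero>}" "C' \<subseteq> M'" using ex_child[OF max_H[OF Q(1)]] by blast
      have "C' = C"
      proof (rule ccontr)
        assume "C' \<noteq> C"
        then have "Q \<subseteq> {\<zero>}" using distinct_children[OF zero_H C(1) C'(1) _ M C(2) Q(1) C'(2) Q(2,4,5)] by blast
        then show False using zero_least[OF Q(2)] Q(3) by blast
      qed
      then show "M' \<in> {M' \<in> maxspec R D. C \<subseteq> M'}" using C'(2) Q(1) by blast
    qed
  qed
  have quo: "maxspec R D // dep_rel R D = (\<lambda>C. {M \<in> maxspec R D. C \<subseteq> M}) ` children {\<zero>}"
  proof
    show "maxspec R D // dep_rel R D \<subseteq> (\<lambda>C. {M \<in> maxspec R D. C \<subseteq> M}) ` children {\<zero>}"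
    proof
      fix X assume "X \<in> maxspec R D // dep_rel R D"
      then obtain M where M: "M \<in> maxspec R D" "X = dep_rel R D `` {M}" by (rule quotientE)
      have "M \<noteq> {\<zero>}" using M(1) False field_iff by blast
      then have "{\<zero>} \<subset> M" using zero_least[OF maxspec_spec[OF M(1)]] by blast
      then obtain C where C: "C \<in> children {\<zero>}" "C \<subseteq> M" using ex_child[OF max_H[OF M(1)]] by blast
      then show "X \<in> (\<lambda>C. {M \<in> maxspec R D. C \<subseteq> M}) ` children {\<zero>}" using cls[OF M(1) C] M(2) by blast
    qed
    show "(\<lambda>C. {M \<in> maxspec R D. C \<subseteq> M}) ` children {\<zero>} \<subseteq> maxspec R D // dep_rel R D"
    proof
      fix X assume "X \<in> (\<lambda>C. {M \<in> maxspec R D. C \<subseteq> M}) ` children {\<zero>}"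
      then obtain C where C: "C \<in> children {\<zero>}" "X = {M \<in> maxspec R D. C \<subseteq> M}" by blast
      obtain M where M: "M \<in> maxspec R D" "C \<subseteq> M" using ex_maxspec_above[OF child_spec[OF C(1)]] by blast
      have "X = dep_rel R D `` {M}" using cls[OF M(1) C(1) M(2)] C(2) by simp
      then show "X \<in> maxspec R D // dep_rel R D" using quotientI[OF M(1)] by simp
    qed
  qed
  have "std_decomp R D = (\<lambda>\<Delta>. \<Inter>M\<in>\<Delta>. L M) ` (maxspec R D // dep_rel R D)"
    unfolding std_decomp_def using False by auto
  also have "\<dots> = T ` children {\<zero>}" unfolding quo image_image T_ring_def ..
  finally show ?thesis .
qed

definition sk_ring :: "'a set set \<Rightarrow> 'a set" where
  "sk_ring S = carrier R \<inter> (\<Inter>P\<in>S. T P)"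

lemma SkOver_eq: "SkOver R D = sk_ring ` Pow (children {\<zero>})"
proof -
  have "{S. S \<subseteq> T ` children {\<zero>}} = (`) T ` Pow (children {\<zero>})"
    using image_Pow_surj[of T "children {\<zero>}" "T ` children {\<zero>}"] unfolding Pow_def by simp
  then have "SkOver R D = (\<lambda>S. carrier R \<inter> \<Inter>S) ` ((`) T ` Pow (children {\<zero>}))"
    unfolding SkOver_def std_decomp_eq setcompr_eq_image by (rule arg_cong)
  then show ?thesis unfolding image_image sk_ring_def by simp
qed

end

section \<open>Supports and fractional ideals\<close>

lemma (in field) is_top_Clos:
  assumes "valuation_ring R V" "subring B R" "B \<subseteq> V"
  shows "is_top (Clos R B V) (cl_le (mods R B V)) (const_on (mods R B V) V)"
  unfolding Clos_def
  using mods_V[OF assms] mods_le runits_scale_V[OF assms(1)] runits_scale_mods[OF assms(1,3)]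
  by (intro is_top_const_on)

context fork_rings
begin

definition sub_glue :: "'i set \<Rightarrow> 'a set" where
  "sub_glue S = V \<inter> (\<Inter>i\<in>S. T i)"

lemma sub_glue:
  assumes "S \<subseteq> N"
  shows sub_glue_in: "sub_glue S \<in> mods R TT V" and dom_sub_glue: "fork.dom (sub_glue S) = S"
proof -
  let ?F = "\<lambda>i. if i \<in> S then T i else V"
  have F: "?F i \<in> mods R (T i) V" if "i \<in> N" for i using fork.T_in[OF that] fork.V_in[OF that] by simp
  have eq: "sub_glue S = V \<inter> (\<Inter>i\<in>N. ?F i)" unfolding sub_glue_def using assms by (auto split: if_splits)
  show "sub_glue S \<in> mods R TT V" unfolding eq using glue_mods[of ?F, OF F] .
  have "EE i (sub_glue S) = ?F i" if "i \<in> N" for i unfolding eq using EE_glue[of ?F, OF F that] .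
  then show "fork.dom (sub_glue S) = S" unfolding fork.dom_def using fork.T_ne assms by auto
qed

text \<open>
  Boundedness of \<open>I\<close> over the intersection of the \<open>T i\<close> with \<open>i \<in> S\<close> is local. The common denominator
  is a unit of \<open>V\<close> in the intersection of the \<open>u i <# T i\<close>, which exists because this intersection is
  again a module of the family.
\<close>

lemma bounded_iff_dom:
  assumes S: "S \<subseteq> N" and I: "I \<in> mods R TT V"
  shows "(\<exists>x\<in>runits R V. x <# I \<subseteq> sub_glue S) \<longleftrightarrow> S \<subseteq> fork.dom I"
proof
  assume "\<exists>x\<in>runits R V. x <# I \<subseteq> sub_glue S"
  then obtain x where x: "x \<in> runits R V" "x <# I \<subseteq> sub_glue S" by blast
  show "S \<subseteq> fork.dom I"
  proof
    fix i assume i: "i \<in> S"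
    then have iN: "i \<in> N" using S by blast
    have "EE i I \<noteq> V"
    proof
      assume "EE i I = V"
      then have "EE i (x <# I) = V" using EE_act[OF x(1) mods_carrier[OF I]] runits_scale_V[OF V x(1)] by simp
      moreover have "x <# I \<subseteq> T i" using x(2) i unfolding sub_glue_def by blast
      then have "EE i (x <# I) \<subseteq> T i" using EE_mono EE_T_mod[OF iN rmod_subring[OF T_sub[OF iN]]] by blast
      ultimately show False using T_le[OF iN] fork.T_ne[OF iN] by blast
    qed
    then show "i \<in> fork.dom I" using iN unfolding fork.dom_def by blast
  qed
next
  assume dom: "S \<subseteq> fork.dom I"
  have "\<forall>i\<in>N. \<exists>u\<in>runits R V. i \<in> S \<longrightarrow> u <# EE i I \<subseteq> T i"
  proof
    fix i assume i: "i \<in> N"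
    show "\<exists>u\<in>runits R V. i \<in> S \<longrightarrow> u <# EE i I \<subseteq> T i"
    proof (cases "i \<in> S")
      case True
      then have "EE i I \<noteq> V" using dom unfolding fork.dom_def by blast
      then show ?thesis using trunk.bounded[OF branch[OF i] EE_in[OF i I] _ fork.T_in[OF i]] by blast
    next
      case False
      then show ?thesis using runits_one[OF VS] by blast
    qed
  qed
  then obtain u where u: "\<And>i. i \<in> N \<Longrightarrow> u i \<in> runits R V" "\<And>i. i \<in> N \<Longrightarrow> i \<in> S \<Longrightarrow> u i <# EE i I \<subseteq> T i"
    by metis
  let ?F = "\<lambda>i. u i <# T i"
  have F: "?F i \<in> mods R (T i) V" if "i \<in> N" for i
    using runits_scale_mods[OF V T_le[OF that] u(1)[OF that] fork.T_in[OF that]] .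
  obtain x where x: "x \<in> V \<inter> (\<Inter>i\<in>N. ?F i)" "x \<in> runits R V" using mods_unit[OF glue_mods[of ?F, OF F]] by blast
  note xm = runits_mem[OF VS x(2)]
  have "x <# I \<subseteq> T i" if i: "i \<in> S" for i
  proof
    have iN: "i \<in> N" using i S by blast
    fix y assume "y \<in> x <# I"
    then obtain z where z: "z \<in> I" "y = x \<otimes> z" unfolding l_coset_def by blast
    have "x \<in> ?F i" using x(1) iN by blast
    then obtain t where t: "t \<in> T i" "x = u i \<otimes> t" unfolding l_coset_def by blast
    have "z \<in> EE i I" using EE_ge[OF mods_carrier[OF I] iN] z(1) by blast
    then have "u i \<otimes> z \<in> T i" using u(2)[OF iN i] l_coset_memI by blast
    then have "t \<otimes> (u i \<otimes> z) \<in> T i" using subringE(6)[OF T_sub[OF iN] t(1)] by blast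
    moreover have "t \<otimes> (u i \<otimes> z) = y"
      unfolding z(2) t(2) using subsetD[OF subringE(1)[OF T_sub[OF iN]] t(1)] runits_mem(3)[OF VS u(1)[OF iN]]
        subsetD[OF mods_carrier[OF I] z(1)] by (simp add: m_ac)
    ultimately show "y \<in> T i" by simp
  qed
  moreover have "x <# I \<subseteq> V" using l_coset_mono[OF mods_le[OF I], of x] runits_scale_V[OF V x(2)] by simp
  ultimately show "\<exists>x\<in>runits R V. x <# I \<subseteq> sub_glue S" using x(2) unfolding sub_glue_def by blast
qed

end

context pruefer_domain
begin

lemma fork_root: "fork_rings R (carrier R) (children {\<zero>}) L T"
  using fork_children[OF zero_H] unfolding loc_zero .

lemma TT_root: "fork_rings.TT (carrier R) (children {\<zero>}) T = D"
  using TT_children[OF zero_H] unfolding loc_zero T_zero .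

lemma runits_root: "runits R (carrier R) = carrier R - {\<zero>}"
  unfolding runits_def using nz_inv(1) by auto

lemma mods_root: "mods R D (carrier R) = submods R D - {{\<zero>}}"
proof -
  have n: "nonunits R (carrier R) = {\<zero>}" unfolding nonunits_def runits_root by auto
  have "nonunits R (carrier R) \<subset> I \<and> I \<subseteq> carrier R \<longleftrightarrow> I \<noteq> {\<zero>}" if "rmod R D I" for I
    unfolding n using rmod_zero[OF that] rmod_carrier[OF that] by auto
  then show ?thesis
    unfolding mods_def submods_eq[OF D] by auto
qed

lemma sk_ring_eq: "sk_ring S = fork_rings.sub_glue (carrier R) T S"
  unfolding sk_ring_def fork_rings.sub_glue_def[OF fork_root] ..

definition local_dom :: "'a set \<Rightarrow> 'a set set" where
  "local_dom I = fork_product.dom (carrier R) (children {\<zero>}) (fork_rings.EE R (carrier R) (children {\<zero>}) T) I"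

lemma sk_ring:
  assumes S: "S \<subseteq> children {\<zero>}"
  shows sk_ring_in: "sk_ring S \<in> submods R D - {{\<zero>}}" and local_dom_sk_ring: "local_dom (sk_ring S) = S"
    and sk_ring_sub: "subring (sk_ring S) R"
proof -
  interpret root: fork_rings R "carrier R" "children {\<zero>}" L T by (rule fork_root)
  show "sk_ring S \<in> submods R D - {{\<zero>}}"
    using root.sub_glue_in[OF S] unfolding sk_ring_eq TT_root mods_root .
  show "local_dom (sk_ring S) = S"
    using root.dom_sub_glue[OF S] unfolding sk_ring_eq local_dom_def .
  have "subring (\<Inter>(insert (carrier R) (T ` S))) R"
    using carrier_is_subring T_sub[OF child_spec] S by (intro subring_Inter) auto
  then show "subring (sk_ring S) R" unfolding sk_ring_def by simp
qed

lemma sk_ring_children: "sk_ring (children {\<zero>}) = D"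
  using TT_root unfolding sk_ring_def fork_rings.TT_def[OF fork_root] .

lemma frac_iff:
  assumes S: "S \<subseteq> children {\<zero>}" and I: "I \<in> submods R D - {{\<zero>}}"
  shows "(\<exists>x\<in>carrier R - {\<zero>}. x <# I \<subseteq> sk_ring S) \<longleftrightarrow> S \<subseteq> local_dom I"
proof -
  interpret root: fork_rings R "carrier R" "children {\<zero>}" L T by (rule fork_root)
  show ?thesis
    using root.bounded_iff_dom[OF S, of I] I
    unfolding sk_ring_eq local_dom_def TT_root mods_root runits_root by simp
qed

text \<open>
  The case of \<open>frac_iff\<close> in which the ring is \<open>D\<close> itself.
\<close>

lemma frac_ideals_root:
  "frac_ideals R D - {{\<zero>}} = {I \<in> submods R D - {{\<zero>}}. local_dom I \<in> {children {\<zero>}}}"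
proof -
  interpret root: fork_rings R "carrier R" "children {\<zero>}" L T by (rule fork_root)
  have "local_dom I \<subseteq> children {\<zero>}" for I unfolding local_dom_def using root.fork.dom_sub .
  moreover have "I \<in> frac_ideals R D - {{\<zero>}} \<longleftrightarrow> I \<in> submods R D - {{\<zero>}} \<and> children {\<zero>} \<subseteq> local_dom I" for I
    using frac_iff[OF subset_refl, of I] unfolding sk_ring_children frac_ideals_def by blast
  ultimately show ?thesis by blast
qed

text \<open>The closure of the ring \<open>sk_ring S\<close> is a module over that ring, so only its boundedness is at stake, and this is
  decided at the children in \<open>S\<close>.\<close>

lemma support_iff:
  assumes c: "c \<in> SStar R D" and S: "S \<subseteq> children {\<zero>}"
  shows "sk_ring S \<in> support R D c \<longleftrightarrow> S \<subseteq> local_dom (c (sk_ring S))"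
proof -
  let ?A = "sk_ring S"
  have AH: "?A \<in> SkOver R D" unfolding SkOver_eq using S by blast
  have cc: "c \<in> closure_ops (submods R D)" "prop_S R (submods R D) c" using c unfolding SStar_def by auto
  have A: "?A \<in> submods R D" "?A \<noteq> {\<zero>}" using sk_ring_in[OF S] by auto
  have cA: "c ?A \<in> submods R D" "?A \<subseteq> c ?A" using cc(1) A(1) unfolding closure_ops_def by auto
  have As: "subring ?A R" using sk_ring_sub[OF S] .
  have Ac: "?A \<subseteq> carrier R" using subringE(1)[OF As] .
  have cA0: "c ?A \<in> submods R D - {{\<zero>}}" using cA A(2) subringE(3)[OF As] one_not_zero by blast
  have "a \<otimes> x \<in> c ?A" if a: "a \<in> ?A" and x: "x \<in> c ?A" for a x
  proof -
    have aA: "a <# ?A \<subseteq> ?A" using subringE(6)[OF As a] unfolding l_coset_def by blast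
    have "a <# ?A \<in> submods R D"
      using rmod_scale[of D ?A a] A(1) Dc subsetD[OF Ac a] unfolding submods_eq[OF D] by blast
    then have "c (a <# ?A) \<subseteq> c ?A" using cc(1) A(1) aA unfolding closure_ops_def by blast
    moreover have "a <# c ?A = c (a <# ?A)" using cc(2) subsetD[OF Ac a] A(1) unfolding prop_S_def by blast
    ultimately show ?thesis using l_coset_memI[OF x, of a] by blast
  qed
  then have "rmod R ?A (c ?A)" using cA(1) unfolding submods_eq[OF D] rmod_def by blast
  then have "c ?A \<in> frac_ideals R ?A \<longleftrightarrow> (\<exists>x\<in>carrier R - {\<zero>}. x <# c ?A \<subseteq> ?A)"
    unfolding frac_ideals_eq[OF As] by blast
  then show ?thesis unfolding support_def using AH frac_iff[OF S cA0] by simp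
qed

end

section \<open>Transporting closure operations along the tree\<close>

text \<open>
  The second conclusion records where the closure of a tuple stays proper, which is what supports
  depend on.
\<close>

lemma fork_iso:
  assumes f1: "fork_rings K1 V1 N1 W1 T1" and f2: "fork_rings K2 V2 N2 W2 T2"
    and mu: "bij_betw \<mu> N1 N2" and SS: "SS \<subseteq> Pow N1"
    and g: "\<And>i. i \<in> N1 \<Longrightarrow> \<exists>g. order_iso (Clos K1 (T1 i) V1) (cl_le (mods K1 (T1 i) V1))
      (Clos K2 (T2 (\<mu> i)) V2) (cl_le (mods K2 (T2 (\<mu> i)) V2)) g"
  defines "dom1 \<equiv> fork_product.dom V1 N1 (fork_rings.EE K1 V1 N1 T1)"
    and "dom2 \<equiv> fork_product.dom V2 N2 (fork_rings.EE K2 V2 N2 T2)"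
  defines "X1 \<equiv> {I \<in> mods K1 (fork_rings.TT V1 N1 T1) V1. dom1 I \<in> SS}"
    and "X2 \<equiv> {I \<in> mods K2 (fork_rings.TT V2 N2 T2) V2. dom2 I \<in> (`) \<mu> ` SS}"
  shows "\<exists>f. order_iso (eq_clos (l_coset K1) (runits K1 V1) X1) (cl_le X1)
      (eq_clos (l_coset K2) (runits K2 V2) X2) (cl_le X2) f \<and>
    (\<forall>c\<in>eq_clos (l_coset K1) (runits K1 V1) X1. \<forall>I\<in>X1. \<forall>I'\<in>X2.
       dom2 I' = \<mu> ` dom1 I \<longrightarrow> dom2 (f c I') = \<mu> ` dom1 (c I))"
proof -
  interpret A: fork_rings K1 V1 N1 W1 T1 by (rule f1)
  interpret B: fork_rings K2 V2 N2 W2 T2 by (rule f2)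
  let ?SS = "(`) \<mu> ` SS"
  let ?C1 = "eq_clos (l_coset K1) (runits K1 V1) X1" and ?C2 = "eq_clos (l_coset K2) (runits K2 V2) X2"
  have X1: "X1 = A.fork.with_dom SS" unfolding X1_def dom1_def A.fork.with_dom_def ..
  have X2: "X2 = B.fork.with_dom ?SS" unfolding X2_def dom2_def B.fork.with_dom_def ..
  have muN: "\<mu> i \<in> N2" if "i \<in> N1" for i using mu that unfolding bij_betw_def by blast
  have SS2: "?SS \<subseteq> Pow N2" using SS muN by blast
  let ?k1 = "A.fork.component SS" and ?k2 = "B.fork.component ?SS"
  let ?A1 = "\<lambda>i. eq_clos (l_coset K1) (runits K1 V1) (mods K1 (T1 i) V1)"
  let ?A2 = "\<lambda>i. eq_clos (l_coset K2) (runits K2 V2) (mods K2 (T2 i) V2)"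
  let ?l1 = "\<lambda>i. cl_le (mods K1 (T1 i) V1)" and ?l2 = "\<lambda>i. cl_le (mods K2 (T2 i) V2)"
  let ?t1 = "\<lambda>i. const_on (mods K1 (T1 i) V1) V1" and ?t2 = "\<lambda>i. const_on (mods K2 (T2 i) V2) V2"
  note iso1 = A.fork.order_iso_component[OF SS, folded X1]
  note iso2 = B.fork.order_iso_component[OF SS2, folded X2]
  have "\<forall>i\<in>N1. \<exists>g. order_iso (?A1 i) (?l1 i) (?A2 (\<mu> i)) (?l2 (\<mu> i)) g"
    using g unfolding Clos_def by blast
  then obtain g where g: "\<And>i. i \<in> N1 \<Longrightarrow> order_iso (?A1 i) (?l1 i) (?A2 (\<mu> i)) (?l2 (\<mu> i)) (g i)"
    by metis
  have t1: "is_top (?A1 i) (?l1 i) (?t1 i)" if i: "i \<in> N1" for i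
    by (rule is_top_const_on)
      (use A.fork.V_in[OF i] A.fork.X_le[OF i] A.fork.act_V A.fork.act_X[OF i] in auto)
  have t2: "is_top (?A2 (\<mu> i)) (?l2 (\<mu> i)) (?t2 (\<mu> i))" if i: "i \<in> N1" for i
    by (rule is_top_const_on)
      (use B.fork.V_in[OF muN[OF i]] B.fork.X_le[OF muN[OF i]] B.fork.act_V B.fork.act_X[OF muN[OF i]] in auto)
  have "\<exists>h. order_iso (fam SS ?A1 ?l1 ?t1) (fam_le SS ?l1) (fam ?SS ?A2 ?l2 ?t2) (fam_le ?SS ?l2) h \<and>
    (\<forall>a\<in>fam SS ?A1 ?l1 ?t1. \<forall>S\<in>SS. \<forall>i\<in>S. h a (\<mu> ` S, \<mu> i) = ?t2 (\<mu> i) \<longleftrightarrow> a (S, i) = ?t1 i)"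
  proof (rule order_iso_fam[where A = ?A1 and leA = ?l1 and A' = ?A2 and leA' = ?l2 and t = ?t1 and t' = ?t2
        and g = g and N = N1 and N' = N2])
    show "c = d" if "c \<in> ?A1 i" "d \<in> ?A1 i" "?l1 i c d" "?l1 i d c" for i c d
      using cl_le_antisym[OF that] .
  qed (use mu SS g t1 t2 cl_le_refl in auto)
  then obtain h where h: "order_iso (fam SS ?A1 ?l1 ?t1) (fam_le SS ?l1) (fam ?SS ?A2 ?l2 ?t2) (fam_le ?SS ?l2) h"
    and h_top: "\<And>a S i. a \<in> fam SS ?A1 ?l1 ?t1 \<Longrightarrow> S \<in> SS \<Longrightarrow> i \<in> S \<Longrightarrow>
      h a (\<mu> ` S, \<mu> i) = ?t2 (\<mu> i) \<longleftrightarrow> a (S, i) = ?t1 i" by blast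
  let ?f = "inv_into ?C2 ?k2 \<circ> (h \<circ> ?k1)"
  have f: "order_iso ?C1 (cl_le X1) ?C2 (cl_le X2) ?f"
    using order_iso_trans[OF order_iso_trans[OF iso1 h] order_iso_sym[OF iso2]] .
  have "dom2 (?f c I') = \<mu> ` dom1 (c I)"
    if c: "c \<in> ?C1" and I: "I \<in> X1" and I': "I' \<in> X2" and dm: "dom2 I' = \<mu> ` dom1 I" for c I I'
  proof -
    have k1c: "?k1 c \<in> fam SS ?A1 ?l1 ?t1" using order_iso_closed[OF iso1 c] .
    have fc: "?f c \<in> ?C2" using order_iso_closed[OF f c] .
    have "?k2 ` ?C2 = fam ?SS ?A2 ?l2 ?t2" using iso2 unfolding order_iso_def bij_betw_def by blast
    then have k2f: "?k2 (?f c) = h (?k1 c)"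
      using f_inv_into_f[of "h (?k1 c)" ?k2 ?C2] order_iso_closed[OF h k1c] by simp
    have dS: "dom1 I \<in> SS" using I unfolding X1_def by blast
    have d1: "dom1 (c I) = {i \<in> dom1 I. ?k1 c (dom1 I, i) \<noteq> ?t1 i}"
      using A.fork.dom_closure[OF SS, folded X1 dom1_def, OF c I] .
    have d2: "dom2 (?f c I') = {j \<in> dom2 I'. ?k2 (?f c) (dom2 I', j) \<noteq> ?t2 j}"
      using B.fork.dom_closure[OF SS2, folded X2 dom2_def, OF fc I'] .
    have "?k2 (?f c) (dom2 I', \<mu> i) \<noteq> ?t2 (\<mu> i) \<longleftrightarrow> ?k1 c (dom1 I, i) \<noteq> ?t1 i" if "i \<in> dom1 I" for i
      unfolding k2f dm using h_top[OF k1c dS that] by simp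
    then show ?thesis unfolding d1 d2 unfolding dm by auto
  qed
  then show ?thesis using f by blast
qed

lemma trunk_iso:
  assumes t1: "trunk K1 V1 W1 B1" and t2: "trunk K2 V2 W2 B2"
    and f: "order_iso (Clos K1 B1 W1) (cl_le (mods K1 B1 W1)) (Clos K2 B2 W2) (cl_le (mods K2 B2 W2)) f"
    and g: "order_iso (Clos K1 W1 V1) (cl_le (mods K1 W1 V1)) (Clos K2 W2 V2) (cl_le (mods K2 W2 V2)) g"
  shows "\<exists>h. order_iso (Clos K1 B1 V1) (cl_le (mods K1 B1 V1)) (Clos K2 B2 V2) (cl_le (mods K2 B2 V2)) h"
proof -
  interpret A: trunk K1 V1 W1 B1 by (rule t1)
  interpret B: trunk K2 V2 W2 B2 by (rule t2)
  have "order_iso (Clos K1 B1 W1 - {const_on (mods K1 B1 W1) W1}) (cl_le (mods K1 B1 W1))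
      (Clos K2 B2 W2 - {const_on (mods K2 B2 W2) W2}) (cl_le (mods K2 B2 W2)) f"
    using order_iso_remove_top[OF f A.is_top_Clos[OF A.W A.B A.BW] B.is_top_Clos[OF B.W B.B B.BW]] .
  from order_iso_trans[OF order_iso_trans[OF A.order_iso_split_op order_iso_ord_sum[OF this g]]
      order_iso_sym[OF B.order_iso_split_op]]
  show ?thesis by blast
qed

locale pruefer_pair = A: pruefer_domain K1 D1 + B: pruefer_domain K2 D2
  for K1 :: "('a, 'm) ring_scheme" and D1 :: "'a set" and K2 :: "('b, 'n) ring_scheme" and D2 :: "'b set" +
  fixes \<nu> :: "'a set \<Rightarrow> 'b set"
  assumes \<nu>: "order_iso (spec_hi K1 D1) (\<subseteq>) (spec_hi K2 D2) (\<subseteq>) \<nu>"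
    and \<nu>_P: "P \<in> spec_hi K1 D1 \<Longrightarrow> P \<noteq> {\<zero>\<^bsub>K1\<^esub>} \<Longrightarrow> \<exists>g. order_iso
          (FStar_ring (Zring K1 D1 P)) (FStar_ring_le (Zring K1 D1 P))
          (FStar_ring (Zring K2 D2 (\<nu> P))) (FStar_ring_le (Zring K2 D2 (\<nu> P))) g"
begin

lemma \<nu>_less: "P \<in> spec_hi K1 D1 \<Longrightarrow> Q \<in> spec_hi K1 D1 \<Longrightarrow> \<nu> P \<subset> \<nu> Q \<longleftrightarrow> P \<subset> Q"
  using order_iso_le[OF \<nu>, of P Q] order_iso_inj[OF \<nu>, of P Q] by (simp add: psubset_eq)

lemma \<nu>_zero: "\<nu> {\<zero>\<^bsub>K1\<^esub>} = {\<zero>\<^bsub>K2\<^esub>}"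
proof -
  obtain P where P: "P \<in> spec_hi K1 D1" "\<nu> P = {\<zero>\<^bsub>K2\<^esub>}" using order_iso_surj[OF \<nu> B.zero_H] by blast
  have "\<nu> {\<zero>\<^bsub>K1\<^esub>} \<subseteq> \<nu> P"
    using order_iso_le[OF \<nu> A.zero_H P(1)] A.zero_least[OF A.H_spec[OF P(1)]] by blast
  then show ?thesis
    using P(2) B.zero_least[OF B.H_spec[OF order_iso_closed[OF \<nu> A.zero_H]]] by blast
qed

lemma \<nu>_children:
  assumes P: "P \<in> spec_hi K1 D1"
  shows "bij_betw \<nu> (A.children P) (B.children (\<nu> P))"
proof -
  have iff: "\<nu> C \<in> B.children (\<nu> P) \<longleftrightarrow> C \<in> A.children P" if C: "C \<in> spec_hi K1 D1" for C
  proof -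
    have "(\<exists>Q\<in>spec_hi K2 D2. \<nu> P \<subset> Q \<and> Q \<subset> \<nu> C) \<longleftrightarrow> (\<exists>Q\<in>spec_hi K1 D1. P \<subset> Q \<and> Q \<subset> C)"
    proof
      assume "\<exists>Q\<in>spec_hi K2 D2. \<nu> P \<subset> Q \<and> Q \<subset> \<nu> C"
      then obtain Q where Q: "Q \<in> spec_hi K2 D2" "\<nu> P \<subset> Q" "Q \<subset> \<nu> C" by blast
      obtain Q' where Q': "Q' \<in> spec_hi K1 D1" "\<nu> Q' = Q" using order_iso_surj[OF \<nu> Q(1)] by blast
      then have "P \<subset> Q'" "Q' \<subset> C" using \<nu>_less[OF P Q'(1)] \<nu>_less[OF Q'(1) C] Q by auto
      then show "\<exists>Q\<in>spec_hi K1 D1. P \<subset> Q \<and> Q \<subset> C" using Q'(1) by blast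
    next
      assume "\<exists>Q\<in>spec_hi K1 D1. P \<subset> Q \<and> Q \<subset> C"
      then obtain Q where Q: "Q \<in> spec_hi K1 D1" "P \<subset> Q" "Q \<subset> C" by blast
      then have "\<nu> P \<subset> \<nu> Q" "\<nu> Q \<subset> \<nu> C" using \<nu>_less[OF P Q(1)] \<nu>_less[OF Q(1) C] by auto
      then show "\<exists>Q\<in>spec_hi K2 D2. \<nu> P \<subset> Q \<and> Q \<subset> \<nu> C" using order_iso_closed[OF \<nu> Q(1)] by blast
    qed
    then show ?thesis
      unfolding A.children_def B.children_def using \<nu>_less[OF P C] C order_iso_closed[OF \<nu> C]
      by (simp only: mem_Collect_eq simp_thms)
  qed
  have sub: "A.children P \<subseteq> spec_hi K1 D1" using A.child_H by blast
  have "inj_on \<nu> (A.children P)"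
    using \<nu> sub unfolding order_iso_def bij_betw_def by (blast intro: inj_on_subset)
  moreover have "\<nu> ` A.children P = B.children (\<nu> P)"
  proof
    show "\<nu> ` A.children P \<subseteq> B.children (\<nu> P)" using iff sub by blast
    show "B.children (\<nu> P) \<subseteq> \<nu> ` A.children P"
    proof
      fix C' assume C': "C' \<in> B.children (\<nu> P)"
      obtain C where C: "C \<in> spec_hi K1 D1" "\<nu> C = C'" using order_iso_surj[OF \<nu> B.child_H[OF C']] by blast
      have "C \<in> A.children P" using iff[OF C(1)] C(2) C' by simp
      then show "C' \<in> \<nu> ` A.children P" using C(2) by blast
    qed
  qed
  ultimately show ?thesis unfolding bij_betw_def by blast
qed

lemma branch_iso:
  assumes P: "P \<in> spec_hi K1 D1" and C: "C \<in> A.children P"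
    and f: "order_iso (Clos K1 (T_ring K1 D1 C) (loc K1 D1 C)) (cl_le (mods K1 (T_ring K1 D1 C) (loc K1 D1 C)))
      (Clos K2 (T_ring K2 D2 (\<nu> C)) (loc K2 D2 (\<nu> C))) (cl_le (mods K2 (T_ring K2 D2 (\<nu> C)) (loc K2 D2 (\<nu> C)))) f"
  shows "\<exists>h. order_iso (Clos K1 (T_ring K1 D1 C) (loc K1 D1 P)) (cl_le (mods K1 (T_ring K1 D1 C) (loc K1 D1 P)))
      (Clos K2 (T_ring K2 D2 (\<nu> C)) (loc K2 D2 (\<nu> P))) (cl_le (mods K2 (T_ring K2 D2 (\<nu> C)) (loc K2 D2 (\<nu> P)))) h"
proof -
  have P': "\<nu> P \<in> spec_hi K2 D2" using order_iso_closed[OF \<nu> P] .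
  have C': "\<nu> C \<in> B.children (\<nu> P)" using \<nu>_children[OF P] C unfolding bij_betw_def by blast
  have C0: "C \<noteq> {\<zero>\<^bsub>K1\<^esub>}" using A.child_above[OF C] A.zero_least[OF A.H_spec[OF P]] by blast
  have lt1: "loc K1 D1 C \<subset> loc K1 D1 P"
    using A.loc_strict[OF A.H_spec[OF P] A.child_spec[OF C] A.child_above[OF C]] .
  have lt2: "loc K2 D2 (\<nu> C) \<subset> loc K2 D2 (\<nu> P)"
    using B.loc_strict[OF B.H_spec[OF P'] B.child_spec[OF C'] B.child_above[OF C']] .
  note V1 = A.loc_valuation[OF A.H_spec[OF P]] and W1 = A.loc_valuation[OF A.child_spec[OF C]]
  note V2 = B.loc_valuation[OF B.H_spec[OF P']] and W2 = B.loc_valuation[OF B.child_spec[OF C']]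
  obtain h1 where h1: "order_iso
      (Clos K1 (loc K1 D1 C) (loc K1 D1 P) - {const_on (mods K1 (loc K1 D1 C) (loc K1 D1 P)) (loc K1 D1 P)})
      (cl_le (mods K1 (loc K1 D1 C) (loc K1 D1 P)))
      (FStar_ring (Zring K1 D1 C)) (FStar_ring_le (Zring K1 D1 C)) h1"
    using A.order_iso_Zring[OF P C] by blast
  obtain h2 where h2: "order_iso
      (Clos K2 (loc K2 D2 (\<nu> C)) (loc K2 D2 (\<nu> P)) -
        {const_on (mods K2 (loc K2 D2 (\<nu> C)) (loc K2 D2 (\<nu> P))) (loc K2 D2 (\<nu> P))})
      (cl_le (mods K2 (loc K2 D2 (\<nu> C)) (loc K2 D2 (\<nu> P))))
      (FStar_ring (Zring K2 D2 (\<nu> C))) (FStar_ring_le (Zring K2 D2 (\<nu> C))) h2"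
    using B.order_iso_Zring[OF P' C'] by blast
  obtain g where g: "order_iso (FStar_ring (Zring K1 D1 C)) (FStar_ring_le (Zring K1 D1 C))
      (FStar_ring (Zring K2 D2 (\<nu> C))) (FStar_ring_le (Zring K2 D2 (\<nu> C))) g"
    using \<nu>_P[OF A.child_H[OF C] C0] by blast
  have "\<exists>g. order_iso (Clos K1 (loc K1 D1 C) (loc K1 D1 P)) (cl_le (mods K1 (loc K1 D1 C) (loc K1 D1 P)))
      (Clos K2 (loc K2 D2 (\<nu> C)) (loc K2 D2 (\<nu> P))) (cl_le (mods K2 (loc K2 D2 (\<nu> C)) (loc K2 D2 (\<nu> P)))) g"
    using order_iso_add_top[OF order_iso_trans[OF order_iso_trans[OF h1 g] order_iso_sym[OF h2]]]
      A.is_top_Clos[OF V1 A.valuation_subring[OF W1]] B.is_top_Clos[OF V2 B.valuation_subring[OF W2]] lt1 lt2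
    by blast
  then show ?thesis
    using trunk_iso[OF A.trunk_child[OF P C] B.trunk_child[OF P' C'] f] by blast
qed

text \<open>
  Induction from the maximal ideals down to \<open>(0)\<close>, on the number of nodes above \<open>P\<close>. At a maximal
  ideal there are no children, and both sides reduce to the single module \<open>V\<close>.
\<close>

lemma node_iso:
  assumes "P \<in> spec_hi K1 D1"
  shows "\<exists>f. order_iso (Clos K1 (T_ring K1 D1 P) (loc K1 D1 P)) (cl_le (mods K1 (T_ring K1 D1 P) (loc K1 D1 P)))
      (Clos K2 (T_ring K2 D2 (\<nu> P)) (loc K2 D2 (\<nu> P))) (cl_le (mods K2 (T_ring K2 D2 (\<nu> P)) (loc K2 D2 (\<nu> P)))) f"
  using assms
proof (induction "card {Q \<in> spec_hi K1 D1. P \<subset> Q}" arbitrary: P rule: less_induct)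
  case less
  note P = less.prems
  have P': "\<nu> P \<in> spec_hi K2 D2" using order_iso_closed[OF \<nu> P] .
  interpret FA: fork_rings K1 "loc K1 D1 P" "A.children P" "loc K1 D1" "T_ring K1 D1" by (rule A.fork_children[OF P])
  interpret FB: fork_rings K2 "loc K2 D2 (\<nu> P)" "B.children (\<nu> P)" "loc K2 D2" "T_ring K2 D2"
    by (rule B.fork_children[OF P'])
  have g: "\<exists>g. order_iso (Clos K1 (T_ring K1 D1 C) (loc K1 D1 P)) (cl_le (mods K1 (T_ring K1 D1 C) (loc K1 D1 P)))
      (Clos K2 (T_ring K2 D2 (\<nu> C)) (loc K2 D2 (\<nu> P))) (cl_le (mods K2 (T_ring K2 D2 (\<nu> C)) (loc K2 D2 (\<nu> P)))) g"
    if C: "C \<in> A.children P" for C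
  proof -
    have "{Q \<in> spec_hi K1 D1. C \<subset> Q} \<subset> {Q \<in> spec_hi K1 D1. P \<subset> Q}"
      using A.child_above[OF C] A.child_H[OF C] by auto
    moreover have "finite {Q \<in> spec_hi K1 D1. P \<subset> Q}" using A.finite_H by simp
    ultimately have "card {Q \<in> spec_hi K1 D1. C \<subset> Q} < card {Q \<in> spec_hi K1 D1. P \<subset> Q}"
      by (intro psubset_card_mono)
    then show ?thesis using less.hyps A.child_H[OF C] branch_iso[OF P C] by blast
  qed
  have Pow: "(`) \<nu> ` Pow (A.children P) = Pow (B.children (\<nu> P))"
    using \<nu>_children[OF P] by (intro image_Pow_surj) (simp add: bij_betw_def)
  have X1: "{I \<in> mods K1 (T_ring K1 D1 P) (loc K1 D1 P). FA.fork.dom I \<in> Pow (A.children P)}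
      = mods K1 (T_ring K1 D1 P) (loc K1 D1 P)"
    using FA.fork.dom_sub by blast
  have X2: "{I \<in> mods K2 (T_ring K2 D2 (\<nu> P)) (loc K2 D2 (\<nu> P)). FB.fork.dom I \<in> Pow (B.children (\<nu> P))}
      = mods K2 (T_ring K2 D2 (\<nu> P)) (loc K2 D2 (\<nu> P))"
    using FB.fork.dom_sub by blast
  show ?case
    using fork_iso[OF A.fork_children[OF P] B.fork_children[OF P'] \<nu>_children[OF P] subset_refl g]
    unfolding A.TT_children[OF P] B.TT_children[OF P'] Pow X1 X2 Clos_def by blast
qed

lemma root_iso:
  assumes SS: "SS \<subseteq> Pow (A.children {\<zero>\<^bsub>K1\<^esub>})"
  defines "X1 \<equiv> {I \<in> submods K1 D1 - {{\<zero>\<^bsub>K1\<^esub>}}. A.local_dom I \<in> SS}"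
    and "X2 \<equiv> {I \<in> submods K2 D2 - {{\<zero>\<^bsub>K2\<^esub>}}. B.local_dom I \<in> (`) \<nu> ` SS}"
  shows "\<exists>f. order_iso (eq_clos (l_coset K1) (carrier K1 - {\<zero>\<^bsub>K1\<^esub>}) X1) (cl_le X1)
      (eq_clos (l_coset K2) (carrier K2 - {\<zero>\<^bsub>K2\<^esub>}) X2) (cl_le X2) f \<and>
    (\<forall>c\<in>eq_clos (l_coset K1) (carrier K1 - {\<zero>\<^bsub>K1\<^esub>}) X1. \<forall>I\<in>X1. \<forall>I'\<in>X2.
       B.local_dom I' = \<nu> ` A.local_dom I \<longrightarrow> B.local_dom (f c I') = \<nu> ` A.local_dom (c I))"
proof -
  have g: "\<exists>g. order_iso (Clos K1 (T_ring K1 D1 C) (carrier K1)) (cl_le (mods K1 (T_ring K1 D1 C) (carrier K1)))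
      (Clos K2 (T_ring K2 D2 (\<nu> C)) (carrier K2)) (cl_le (mods K2 (T_ring K2 D2 (\<nu> C)) (carrier K2))) g"
    if C: "C \<in> A.children {\<zero>\<^bsub>K1\<^esub>}" for C
    using node_iso[OF A.child_H[OF C]] branch_iso[OF A.zero_H C] unfolding \<nu>_zero A.loc_zero B.loc_zero by blast
  have ch: "bij_betw \<nu> (A.children {\<zero>\<^bsub>K1\<^esub>}) (B.children {\<zero>\<^bsub>K2\<^esub>})" using \<nu>_children[OF A.zero_H] unfolding \<nu>_zero .
  show ?thesis
    using fork_iso[OF A.fork_root B.fork_root ch SS g]
    unfolding A.TT_root B.TT_root A.runits_root B.runits_root A.mods_root B.mods_root
      A.local_dom_def[symmetric] B.local_dom_def[symmetric] X1_def[symmetric] X2_def[symmetric] .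
qed

text \<open>
  The nonzero fractional ideals are the modules that are proper at all children of \<open>(0)\<close>, so
  \<open>root_iso\<close> is applied to the single index set of all children.
\<close>

lemma FStar_iso: "\<exists>f. order_iso (FStar K1 D1) (FStar_le K1 D1) (FStar K2 D2) (FStar_le K2 D2) f"
proof -
  let ?SS = "{A.children {\<zero>\<^bsub>K1\<^esub>}}"
  have "(`) \<nu> ` ?SS = {B.children {\<zero>\<^bsub>K2\<^esub>}}"
    using \<nu>_children[OF A.zero_H] unfolding \<nu>_zero bij_betw_def by simp
  then obtain f where f: "order_iso
      (eq_clos (l_coset K1) (carrier K1 - {\<zero>\<^bsub>K1\<^esub>}) (frac_ideals K1 D1 - {{\<zero>\<^bsub>K1\<^esub>}}))
      (cl_le (frac_ideals K1 D1 - {{\<zero>\<^bsub>K1\<^esub>}}))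
      (eq_clos (l_coset K2) (carrier K2 - {\<zero>\<^bsub>K2\<^esub>}) (frac_ideals K2 D2 - {{\<zero>\<^bsub>K2\<^esub>}}))
      (cl_le (frac_ideals K2 D2 - {{\<zero>\<^bsub>K2\<^esub>}})) f"
    using root_iso[of ?SS] unfolding A.frac_ideals_root B.frac_ideals_root by auto
  show ?thesis
    using order_iso_trans[OF order_iso_trans[OF A.order_iso_FStar[OF A.D] f]
        order_iso_sym[OF B.order_iso_FStar[OF B.D]]] by blast
qed

lemma induced_sk_ring:
  assumes S: "S \<subseteq> A.children {\<zero>\<^bsub>K1\<^esub>}"
  shows "induced_sk K1 D1 K2 D2 \<nu> (A.sk_ring S) = B.sk_ring (\<nu> ` S)"
  unfolding induced_sk_def A.hi_minimal_eq
proof (rule the_equality)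
  have B: "B.sk_ring (\<nu> ` S) = carrier K2 \<inter> (\<Inter>P\<in>S. T_ring K2 D2 (\<nu> P))" for S
    unfolding B.sk_ring_def by simp
  show "\<exists>S'\<subseteq>A.children {\<zero>\<^bsub>K1\<^esub>}. A.sk_ring S = carrier K1 \<inter> (\<Inter>P\<in>S'. T_ring K1 D1 P) \<and>
      B.sk_ring (\<nu> ` S) = carrier K2 \<inter> (\<Inter>P\<in>S'. T_ring K2 D2 (\<nu> P))"
    using S A.sk_ring_def[of S] B[of S] by blast
  fix X assume "\<exists>S'\<subseteq>A.children {\<zero>\<^bsub>K1\<^esub>}. A.sk_ring S = carrier K1 \<inter> (\<Inter>P\<in>S'. T_ring K1 D1 P) \<and>
      X = carrier K2 \<inter> (\<Inter>P\<in>S'. T_ring K2 D2 (\<nu> P))"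
  then obtain S' where S0: "S' \<subseteq> A.children {\<zero>\<^bsub>K1\<^esub>}"
    "A.sk_ring S = carrier K1 \<inter> (\<Inter>P\<in>S'. T_ring K1 D1 P)" "X = carrier K2 \<inter> (\<Inter>P\<in>S'. T_ring K2 D2 (\<nu> P))"
    by (elim exE conjE)
  have S': "A.sk_ring S = A.sk_ring S'" "X = B.sk_ring (\<nu> ` S')"
    by (rule trans[OF S0(2) A.sk_ring_def[of S', symmetric]], rule trans[OF S0(3) B[of S', symmetric]])
  have "S = S'"
    by (rule trans[OF A.local_dom_sk_ring[OF S, symmetric]
          trans[OF arg_cong[OF S'(1), of A.local_dom] A.local_dom_sk_ring[OF S0(1)]]])
  then show "X = B.sk_ring (\<nu> ` S)" using S'(2) by simp
qed

text \<open>
  The isomorphism preserves the sets of coordinates at which a closure is proper, and by \<open>support_iff\<close>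
  these sets determine the support.
\<close>

lemma SStar_iso: "\<exists>f. order_iso (SStar K1 D1) (SStar_le K1 D1) (SStar K2 D2) (SStar_le K2 D2) f \<and>
   (\<forall>\<Delta> \<subseteq> SkOver K1 D1. f ` SStar_supp K1 D1 \<Delta> = SStar_supp K2 D2 (induced_sk K1 D1 K2 D2 \<nu> ` \<Delta>))"
proof -
  let ?N1 = "A.children {\<zero>\<^bsub>K1\<^esub>}" and ?N2 = "B.children {\<zero>\<^bsub>K2\<^esub>}"
  let ?X1 = "submods K1 D1 - {{\<zero>\<^bsub>K1\<^esub>}}" and ?X2 = "submods K2 D2 - {{\<zero>\<^bsub>K2\<^esub>}}"
  let ?C1 = "eq_clos (l_coset K1) (carrier K1 - {\<zero>\<^bsub>K1\<^esub>}) ?X1"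
  let ?C2 = "eq_clos (l_coset K2) (carrier K2 - {\<zero>\<^bsub>K2\<^esub>}) ?X2"
  let ?r1 = "\<lambda>c. restrict c ?X1" and ?r2 = "\<lambda>c. restrict c ?X2"
  have ch: "inj_on \<nu> ?N1" "\<nu> ` ?N1 = ?N2" using \<nu>_children[OF A.zero_H] unfolding \<nu>_zero bij_betw_def by auto
  have Pow: "(`) \<nu> ` Pow ?N1 = Pow ?N2" using ch(2) by (rule image_Pow_surj)
  interpret RA: fork_rings K1 "carrier K1" ?N1 "loc K1 D1" "T_ring K1 D1" by (rule A.fork_root)
  interpret RB: fork_rings K2 "carrier K2" ?N2 "loc K2 D2" "T_ring K2 D2" by (rule B.fork_root)
  have dom1: "A.local_dom I \<subseteq> ?N1" for I unfolding A.local_dom_def using RA.fork.dom_sub .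
  have dom2: "B.local_dom I \<subseteq> ?N2" for I unfolding B.local_dom_def using RB.fork.dom_sub .
  have X1: "{I \<in> ?X1. A.local_dom I \<in> Pow ?N1} = ?X1" using dom1 by blast
  have X2: "{I \<in> ?X2. B.local_dom I \<in> Pow ?N2} = ?X2" using dom2 by blast
  obtain f where f: "order_iso ?C1 (cl_le ?X1) ?C2 (cl_le ?X2) f"
    and dom_all: "\<forall>c\<in>?C1. \<forall>I\<in>?X1. \<forall>I'\<in>?X2. B.local_dom I' = \<nu> ` A.local_dom I \<longrightarrow>
      B.local_dom (f c I') = \<nu> ` A.local_dom (c I)"
    using root_iso[OF subset_refl, unfolded Pow X1 X2] by (elim exE conjE)
  have f_dom: "B.local_dom (f c I') = \<nu> ` A.local_dom (c I)"
    if "c \<in> ?C1" "I \<in> ?X1" "I' \<in> ?X2" "B.local_dom I' = \<nu> ` A.local_dom I" for c I I'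
    using dom_all[THEN bspec, THEN bspec, THEN bspec, THEN mp, OF that] .
  note r1 = A.order_iso_SStar[OF A.D] and r2 = B.order_iso_SStar[OF B.D]
  let ?g = "inv_into (SStar K2 D2) ?r2 \<circ> (f \<circ> ?r1)"
  have g: "order_iso (SStar K1 D1) (SStar_le K1 D1) (SStar K2 D2) (SStar_le K2 D2) ?g"
    using order_iso_trans[OF order_iso_trans[OF r1 f] order_iso_sym[OF r2]] .
  have rg: "?r2 (?g c) = f (?r1 c)" if c: "c \<in> SStar K1 D1" for c
  proof -
    have "f (?r1 c) \<in> ?r2 ` SStar K2 D2"
      using order_iso_closed[OF f order_iso_closed[OF r1 c]] r2 unfolding order_iso_def bij_betw_def by simp
    then show ?thesis using f_inv_into_f[of "f (?r1 c)" ?r2 "SStar K2 D2"] by simp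
  qed
  let ?sk = "induced_sk K1 D1 K2 D2 \<nu>"
  have supp_iff: "B.sk_ring (\<nu> ` S) \<in> support K2 D2 (?g c) \<longleftrightarrow> A.sk_ring S \<in> support K1 D1 c"
    if c: "c \<in> SStar K1 D1" and S: "S \<subseteq> ?N1" for c S
  proof -
    have S2: "\<nu> ` S \<subseteq> ?N2" using S ch(2) by blast
    note A1 = A.sk_ring_in[OF S] and A2 = B.sk_ring_in[OF S2]
    have "B.local_dom (f (?r1 c) (B.sk_ring (\<nu> ` S))) = \<nu> ` A.local_dom (?r1 c (A.sk_ring S))"
      using f_dom[OF order_iso_closed[OF r1 c] A1 A2] A.local_dom_sk_ring[OF S] B.local_dom_sk_ring[OF S2] by simp
    moreover have "?r1 c (A.sk_ring S) = c (A.sk_ring S)" using A1 by simp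
    moreover have "f (?r1 c) (B.sk_ring (\<nu> ` S)) = ?g c (B.sk_ring (\<nu> ` S))"
      using fun_cong[OF rg[OF c], of "B.sk_ring (\<nu> ` S)"] A2 by simp
    ultimately have "B.local_dom (?g c (B.sk_ring (\<nu> ` S))) = \<nu> ` A.local_dom (c (A.sk_ring S))" by simp
    moreover have "\<nu> ` S \<subseteq> \<nu> ` A.local_dom (c (A.sk_ring S)) \<longleftrightarrow> S \<subseteq> A.local_dom (c (A.sk_ring S))"
      using inj_on_image_mem_iff[OF ch(1) _ dom1] S by blast
    ultimately show ?thesis
      using A.support_iff[OF c S] B.support_iff[OF order_iso_closed[OF g c] S2] by simp
  qed
  have sk_inj: "inj_on ?sk (SkOver K1 D1)"
  proof (rule inj_onI)
    fix X Y assume "X \<in> SkOver K1 D1" "Y \<in> SkOver K1 D1" and eq: "?sk X = ?sk Y"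
    then obtain S S' where S: "S \<subseteq> ?N1" "X = A.sk_ring S" "S' \<subseteq> ?N1" "Y = A.sk_ring S'"
      unfolding A.SkOver_eq by blast
    have S2: "\<nu> ` S \<subseteq> ?N2" "\<nu> ` S' \<subseteq> ?N2" using S(1,3) ch(2) by auto
    have "B.sk_ring (\<nu> ` S) = B.sk_ring (\<nu> ` S')"
      using eq unfolding S(2,4) induced_sk_ring[OF S(1)] induced_sk_ring[OF S(3)] .
    from trans[OF B.local_dom_sk_ring[OF S2(1), symmetric]
        trans[OF arg_cong[OF this, of B.local_dom] B.local_dom_sk_ring[OF S2(2)]]]
    have "\<nu> ` S = \<nu> ` S'" .
    then have "S = S'" using inj_on_image_eq_iff[OF ch(1) S(1,3)] by simp
    then show "X = Y" using S by simp
  qed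
  have supp: "support K2 D2 (?g c) = ?sk ` support K1 D1 c" if c: "c \<in> SStar K1 D1" for c
  proof
    show "?sk ` support K1 D1 c \<subseteq> support K2 D2 (?g c)"
    proof
      fix Y assume "Y \<in> ?sk ` support K1 D1 c"
      then obtain X where X: "X \<in> support K1 D1 c" "Y = ?sk X" by blast
      have "X \<in> SkOver K1 D1" using X(1) unfolding support_def by blast
      then obtain S where S: "S \<subseteq> ?N1" "X = A.sk_ring S" unfolding A.SkOver_eq by blast
      show "Y \<in> support K2 D2 (?g c)"
        using supp_iff[OF c S(1)] X unfolding S(2) induced_sk_ring[OF S(1)] by simp
    qed
    show "support K2 D2 (?g c) \<subseteq> ?sk ` support K1 D1 c"
    proof
      fix Y assume Y: "Y \<in> support K2 D2 (?g c)"
      then have "Y \<in> SkOver K2 D2" unfolding support_def by blast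
      then obtain S2 where S2: "S2 \<subseteq> ?N2" "Y = B.sk_ring S2" unfolding B.SkOver_eq by blast
      have "S2 \<in> (`) \<nu> ` Pow ?N1" using Pow S2(1) by simp
      then obtain S where S: "S \<subseteq> ?N1" "S2 = \<nu> ` S" by blast
      have "A.sk_ring S \<in> support K1 D1 c" using supp_iff[OF c S(1)] Y S2(2) S(2) by simp
      moreover have "Y = ?sk (A.sk_ring S)" using induced_sk_ring[OF S(1)] S2(2) S(2) by simp
      ultimately show "Y \<in> ?sk ` support K1 D1 c" by blast
    qed
  qed
  have "?g ` SStar_supp K1 D1 \<Delta> = SStar_supp K2 D2 (?sk ` \<Delta>)" if \<Delta>: "\<Delta> \<subseteq> SkOver K1 D1" for \<Delta>
  proof
    show "?g ` SStar_supp K1 D1 \<Delta> \<subseteq> SStar_supp K2 D2 (?sk ` \<Delta>)"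
    proof
      fix d assume "d \<in> ?g ` SStar_supp K1 D1 \<Delta>"
      then obtain c where c: "c \<in> SStar K1 D1" "support K1 D1 c = \<Delta>" "d = ?g c"
        unfolding SStar_supp_def by blast
      show "d \<in> SStar_supp K2 D2 (?sk ` \<Delta>)"
        unfolding SStar_supp_def c(3) using order_iso_closed[OF g c(1)] supp[OF c(1)] c(2) by simp
    qed
    show "SStar_supp K2 D2 (?sk ` \<Delta>) \<subseteq> ?g ` SStar_supp K1 D1 \<Delta>"
    proof
      fix d assume "d \<in> SStar_supp K2 D2 (?sk ` \<Delta>)"
      then have d: "d \<in> SStar K2 D2" "support K2 D2 d = ?sk ` \<Delta>" unfolding SStar_supp_def by auto
      obtain c where c: "c \<in> SStar K1 D1" "?g c = d" using order_iso_surj[OF g d(1)] by blast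
      have "?sk ` support K1 D1 c = ?sk ` \<Delta>" using supp[OF c(1)] d(2) c(2) by simp
      moreover have "support K1 D1 c \<subseteq> SkOver K1 D1" unfolding support_def by blast
      ultimately have "support K1 D1 c = \<Delta>" using inj_on_image_eq_iff[OF sk_inj _ \<Delta>] by blast
      then have "c \<in> SStar_supp K1 D1 \<Delta>" unfolding SStar_supp_def using c(1) by blast
      then show "d \<in> ?g ` SStar_supp K1 D1 \<Delta>" using c(2) by (intro image_eqI[of _ _ c]) auto
    qed
  qed
  then show ?thesis using g by blast
qed

end

theorem theorem4p3:
  fixes K1 :: "('a, 'm) ring_scheme" and D1 :: "'a set"
    and K2 :: "('b, 'n) ring_scheme" and D2 :: "'b set"
    and \<nu> :: "'a set \<Rightarrow> 'b set"
  assumes D1: "semilocal_pruefer K1 D1"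
    and D2: "semilocal_pruefer K2 D2"
    and \<nu>: "order_iso (spec_hi K1 D1) (\<subseteq>) (spec_hi K2 D2) (\<subseteq>) \<nu>"
    and \<nu>_zero: "\<exists>g. order_iso
          (FStar K1 (carrier K1)) (FStar_le K1 (carrier K1))
          (FStar K2 (carrier K2)) (FStar_le K2 (carrier K2)) g"
    and \<nu>_P: "\<forall>P \<in> spec_hi K1 D1 - {{\<zero>\<^bsub>K1\<^esub>}}. \<exists>g. order_iso
          (FStar_ring (Zring K1 D1 P)) (FStar_ring_le (Zring K1 D1 P))
          (FStar_ring (Zring K2 D2 (\<nu> P))) (FStar_ring_le (Zring K2 D2 (\<nu> P))) g"
  shows "\<exists>\<nu>S \<nu>F.
      order_iso (SStar K1 D1) (SStar_le K1 D1) (SStar K2 D2) (SStar_le K2 D2) \<nu>S \<and>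
      order_iso (FStar K1 D1) (FStar_le K1 D1) (FStar K2 D2) (FStar_le K2 D2) \<nu>F \<and>
      (\<forall>\<Delta> \<subseteq> SkOver K1 D1.
         \<nu>S ` SStar_supp K1 D1 \<Delta> = SStar_supp K2 D2 (induced_sk K1 D1 K2 D2 \<nu> ` \<Delta>))"
proof -
  interpret pruefer_pair K1 D1 K2 D2 \<nu>
    using semilocal_pruefer_imp_locale[OF D1] semilocal_pruefer_imp_locale[OF D2] \<nu> \<nu>_P
    by (intro pruefer_pair.intro pruefer_pair_axioms.intro) auto
  show ?thesis using SStar_iso FStar_iso by blast
qed

end
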